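(* Let $R$ and $S$ be rings, $C={}_SC_R$ a faithfully semidualizing $(S,R)$-bimodule, $n$ a positive integer and $k\ge 0$ an integer. Then there are inclusions of classes of left modules \[fp_nF(R)\subseteq fp_nF(R)_{\leq k}\subseteq \mathcal{A}_C(R),\qquad Cfp_nF(S)\subseteq Cfp_nF(S)_{\leq k}\subseteq \mathcal{B}_C(S),\] \[Cfp_nI(R)\subseteq Cfp_nI(R)_{\leq k}\subseteq \mathcal{A}_C(R),\qquad fp_nI(S)\subseteq fp_nI(S)_{\leq k}\subseteq \mathcal{B}_C(S),\] and the functors $C\otimes_R-$ (from left $R$-modules to left $S$-modules) and $\operatorname{Hom}_S(C,-)$ (from left $S$-modules to left $R$-modules) restrict to mutually quasi-inverse equivalences of categories (of full subcategories) between each of the following pairs: (1) $fp_nF(R)$ and $Cfp_nF(S)$; (2) $fp_nF(R)_{\leq k}$ and $Cfp_nF(S)_{\leq k}$; (3) $\mathcal{A}_C(R)$ and $\mathcal{B}_C(S)$; (4) $Cfp_nI(R)_{\leq k}$ and $fp_nI(S)_{\leq k}$; (5) $Cfp_nI(R)$ and $fp_nI(S)$.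
   Context: Rings are associative with unit; modules are unital left modules unless said otherwise, and right modules over a ring are identified with left modules over the opposite ring. A module $M$ is finitely $n$-presented if there is an exact sequence $F_n\to F_{n-1}\to\cdots\to F_0\to M\to 0$ with every $F_i$ finitely generated free. A left $R$-module $M$ is $fp_n$-injective (resp. $fp_n$-flat) if for every injective homomorphism $K\to L$ of finitely $n$-presented left (resp. right) $R$-modules, the induced map $\operatorname{Hom}_R(L,M)\to\operatorname{Hom}_R(K,M)$ is surjective (resp. $K\otimes_RM\to L\otimes_RM$ is injective). $fp_nI(R)$ and $fp_nF(R)$ denote the classes of $fp_n$-injective and $fp_n$-flat left $R$-modules (similarly for $S$). An $(S,R)$-bimodule $C={}_SC_R$ is semidualizing if: ${}_SC$ and $C_R$ each admit a projective resolution by finitely generated projective modules; the homothety maps $S\to\operatorname{Hom}_{R^{op}}(C,C)$ and $R\to\operatorname{Hom}_S(C,C)$ are isomorphisms; and $\operatorname{Ext}^i_S(C,C)=0=\operatorname{Ext}^i_{R^{op}}(C,C)$ for all $i\ge1$. It is faithfully semidualizing if moreover for all modules ${}_SN$ and $M_R$: $\operatorname{Hom}_S(C,N)=0$ implies $N=0$, and $\operatorname{Hom}_{R^{op}}(C,M)=0$ implies $M=0$. The Auslander class $\mathcal{A}_C(R)$ consists of all left $R$-modules $M$ with $\operatorname{Tor}_i^R(C,M)=0$ and $\operatorname{Ext}^i_S(C,C\otimes_RM)=0$ for all $i\ge1$ and such that the natural evaluation map $M\to\operatorname{Hom}_S(C,C\otimes_RM)$ is an isomorphism. The Bass class $\mathcal{B}_C(S)$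 consists of all left $S$-modules $N$ with $\operatorname{Ext}^i_S(C,N)=0$ and $\operatorname{Tor}^R_i(C,\operatorname{Hom}_S(C,N))=0$ for all $i\ge1$ and such that the natural evaluation map $C\otimes_R\operatorname{Hom}_S(C,N)\to N$ is an isomorphism. $Cfp_nI(R)$ is the class of left $R$-modules of the form $\operatorname{Hom}_S(C,X)$ with $X\in fp_nI(S)$; $Cfp_nF(S)$ is the class of left $S$-modules of the form $C\otimes_RY$ with $Y\in fp_nF(R)$ (both up to isomorphism). For $\mathcal{I}$ one of $fp_nI(S)$, $Cfp_nI(R)$, the class $\mathcal{I}_{\leq k}$ consists of all modules $M$ having an exact sequence $0\to M\to I_0\to I_1\to\cdots\to I_k\to0$ with all $I_i\in\mathcal{I}$. For $\mathcal{F}$ one of $fp_nF(R)$, $Cfp_nF(S)$, the class $\mathcal{F}_{\leq k}$ consists of all modules $N$ having an exact sequence $0\to F_k\to\cdots\to F_1\to F_0\to N\to0$ with all $F_i\in\mathcal{F}$. *)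

theory Defs
  imports "HOL-Algebra.Module" "HOL-Algebra.Elementary_Groups" "HOL-Algebra.Free_Abelian_Groups"
begin

text \<open>
  Universe convention. A class of modules is a set of records of type \<open>('r, 'u) module\<close> for a fixed
  type \<open>'u\<close>, and where a definition below speaks of all modules, or of the existence of modules or of
  resolutions, these are again carried by the type of the given module. In the theorem \<open>'u\<close> is an
  arbitrary infinite type into which the rings embed. Every set of modules is carried, up to
  isomorphism, by such a type. Moreover such a type is closed (up to isomorphism) under submodules,
  quotients, free modules on subsets of \<open>'u\<close>, \<open>C \<otimes> -\<close>, and \<open>Hom(C, -)\<close> for finitely generated \<open>C\<close>,
  so every module over \<open>'u\<close> has a projective resolution over \<open>'u\<close>, and every finitely generated
  module has a copy over \<open>'u\<close>.
\<close>

section \<open>Modules over noncommutative rings\<close>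

text \<open>The library locale \<^locale>\<open>module\<close> has the same axioms but requires a commutative ring.\<close>

locale left_module = R?: ring R + M?: abelian_group M for R (structure) and M (structure) +
  assumes smult_closed: "\<lbrakk>a \<in> carrier R; x \<in> carrier M\<rbrakk> \<Longrightarrow> a \<odot>\<^bsub>M\<^esub> x \<in> carrier M"
    and smult_l_distr: "\<lbrakk>a \<in> carrier R; b \<in> carrier R; x \<in> carrier M\<rbrakk> \<Longrightarrow>
      (a \<oplus> b) \<odot>\<^bsub>M\<^esub> x = a \<odot>\<^bsub>M\<^esub> x \<oplus>\<^bsub>M\<^esub> b \<odot>\<^bsub>M\<^esub> x"
    and smult_r_distr: "\<lbrakk>a \<in> carrier R; x \<in> carrier M; y \<in> carrier M\<rbrakk> \<Longrightarrow>
      a \<odot>\<^bsub>M\<^esub> (x \<oplus>\<^bsub>M\<^esub> y) = a \<odot>\<^bsub>M\<^esub> x \<oplus>\<^bsub>M\<^esub> a \<odot>\<^bsub>M\<^esub> y"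
    and smult_assoc1: "\<lbrakk>a \<in> carrier R; b \<in> carrier R; x \<in> carrier M\<rbrakk> \<Longrightarrow>
      (a \<otimes> b) \<odot>\<^bsub>M\<^esub> x = a \<odot>\<^bsub>M\<^esub> (b \<odot>\<^bsub>M\<^esub> x)"
    and smult_one: "x \<in> carrier M \<Longrightarrow> \<one> \<odot>\<^bsub>M\<^esub> x = x"

text \<open>Right \<open>R\<close>-modules are left modules over \<open>op_ring R\<close>.\<close>

definition op_ring :: "'r ring \<Rightarrow> 'r ring" where
  "op_ring R = R\<lparr>monoid.mult := (\<lambda>x y. y \<otimes>\<^bsub>R\<^esub> x)\<rparr>"

text \<open>Homomorphisms are extensional functions (\<^const>\<open>undefined\<close> off the carrier), so that equality
  of homomorphisms is equality of functions.\<close>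

definition lhom :: "'r ring \<Rightarrow> ('r, 'm) module \<Rightarrow> ('r, 'n) module \<Rightarrow> ('m \<Rightarrow> 'n) set" where
  "lhom R M N = {f \<in> carrier M \<rightarrow>\<^sub>E carrier N.
     (\<forall>x \<in> carrier M. \<forall>y \<in> carrier M. f (x \<oplus>\<^bsub>M\<^esub> y) = f x \<oplus>\<^bsub>N\<^esub> f y) \<and>
     (\<forall>r \<in> carrier R. \<forall>x \<in> carrier M. f (r \<odot>\<^bsub>M\<^esub> x) = r \<odot>\<^bsub>N\<^esub> f x)}"

definition lisos :: "'r ring \<Rightarrow> ('r, 'm) module \<Rightarrow> ('r, 'n) module \<Rightarrow> ('m \<Rightarrow> 'n) set" where
  "lisos R M N = {f \<in> lhom R M N. bij_betw f (carrier M) (carrier N)}"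

definition isomorphic :: "'r ring \<Rightarrow> ('r, 'm) module \<Rightarrow> ('r, 'n) module \<Rightarrow> bool" where
  "isomorphic R M N \<longleftrightarrow> lisos R M N \<noteq> {}"

definition lker :: "('r, 'm) module \<Rightarrow> ('r, 'n) module \<Rightarrow> ('m \<Rightarrow> 'n) \<Rightarrow> 'm set" where
  "lker M N f = {x \<in> carrier M. f x = \<zero>\<^bsub>N\<^esub>}"

definition hom_group :: "'r ring \<Rightarrow> ('r, 'm) module \<Rightarrow> ('r, 'n) module \<Rightarrow> ('m \<Rightarrow> 'n) monoid" where
  "hom_group R M N = \<lparr>carrier = lhom R M N,
     monoid.mult = (\<lambda>f g. \<lambda>x \<in> carrier M. f x \<oplus>\<^bsub>N\<^esub> g x), one = (\<lambda>x \<in> carrier M. \<zero>\<^bsub>N\<^esub>)\<rparr>"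

text \<open>The fields \<^const>\<open>monoid.mult\<close> and \<^const>\<open>one\<close> of a module record carry no information.\<close>

definition free_mod :: "'r ring \<Rightarrow> 'x set \<Rightarrow> ('r, 'x \<Rightarrow> 'r) module" where
  "free_mod R X = \<lparr>carrier = {f \<in> X \<rightarrow>\<^sub>E carrier R. finite {x \<in> X. f x \<noteq> \<zero>\<^bsub>R\<^esub>}},
     monoid.mult = undefined, one = undefined, ring.zero = (\<lambda>x \<in> X. \<zero>\<^bsub>R\<^esub>),
     add = (\<lambda>f g. \<lambda>x \<in> X. f x \<oplus>\<^bsub>R\<^esub> g x),
     smult = (\<lambda>r f. \<lambda>x \<in> X. r \<otimes>\<^bsub>R\<^esub> f x)\<rparr>"

definition fg_free :: "'r ring \<Rightarrow> ('r, 'm) module \<Rightarrow> bool" where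
  "fg_free R F \<longleftrightarrow> left_module R F \<and> (\<exists>m::nat. isomorphic R F (free_mod R {..<m}))"

definition fin_gen :: "'r ring \<Rightarrow> ('r, 'm) module \<Rightarrow> bool" where
  "fin_gen R M \<longleftrightarrow> left_module R M \<and>
     (\<exists>(m::nat) f. f \<in> lhom R (free_mod R {..<m}) M \<and> f ` carrier (free_mod R {..<m}) = carrier M)"

text \<open>Projective: a direct summand of a free module. Index sets inside the type of \<open>P\<close> suffice, since
  a projective \<open>P\<close> is a summand of the free module on its own carrier.\<close>

definition projective :: "'r ring \<Rightarrow> ('r, 'm) module \<Rightarrow> bool" where
  "projective R P \<longleftrightarrow> left_module R P \<and>
     (\<exists>(X::'m set) i p. i \<in> lhom R P (free_mod R X) \<and> p \<in> lhom R (free_mod R X) P \<and>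
        (\<forall>x \<in> carrier P. p (i x) = x))"

section \<open>Exact sequences and resolutions\<close>

text \<open>\<open>X\<^sub>l \<rightarrow> \<dots> \<rightarrow> X\<^sub>1 \<rightarrow> X\<^sub>0 \<rightarrow> 0\<close> is exact, where \<open>d i : X\<^sub>i\<^sub>+\<^sub>1 \<rightarrow> X\<^sub>i\<close> and \<open>l \<ge> 1\<close> (no condition at \<open>X\<^sub>l\<close>).
  In all uses \<open>X\<^sub>0\<close> is the resolved module and \<open>X\<^sub>i\<^sub>+\<^sub>1\<close> is the resolving module in degree \<open>i\<close>.\<close>

definition exact_onto ::
    "'r ring \<Rightarrow> nat \<Rightarrow> (nat \<Rightarrow> ('r, 'm) module) \<Rightarrow> (nat \<Rightarrow> 'm \<Rightarrow> 'm) \<Rightarrow> bool" where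
  "exact_onto R l X d \<longleftrightarrow>
     (\<forall>i \<le> l. left_module R (X i)) \<and>
     (\<forall>i < l. d i \<in> lhom R (X (Suc i)) (X i)) \<and>
     d 0 ` carrier (X 1) = carrier (X 0) \<and>
     (\<forall>i. Suc i < l \<longrightarrow> d (Suc i) ` carrier (X (Suc (Suc i))) = lker (X (Suc i)) (X i) (d i))"

definition fin_presented :: "'r ring \<Rightarrow> nat \<Rightarrow> ('r, 'm) module \<Rightarrow> bool" where
  "fin_presented R n M \<longleftrightarrow>
     (\<exists>X d. X 0 = M \<and> exact_onto R (Suc n) X d \<and> (\<forall>i \<le> n. fg_free R (X (Suc i))))"

definition proj_resolution ::
    "'r ring \<Rightarrow> ('r, 'm) module \<Rightarrow> (nat \<Rightarrow> ('r, 'm) module) \<Rightarrow> (nat \<Rightarrow> 'm \<Rightarrow> 'm) \<Rightarrow> bool" where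
  "proj_resolution R M X d \<longleftrightarrow>
     X 0 = M \<and> (\<forall>l \<ge> 1. exact_onto R l X d) \<and> (\<forall>i. projective R (X (Suc i)))"

definition chosen_resolution ::
    "'r ring \<Rightarrow> ('r, 'm) module \<Rightarrow> (nat \<Rightarrow> ('r, 'm) module) \<times> (nat \<Rightarrow> 'm \<Rightarrow> 'm)" where
  "chosen_resolution R M = (SOME (X, d). proj_resolution R M X d)"

text \<open>\<open>\<F>\<^sub>\<le>\<^sub>k\<close>: modules \<open>N\<close> with an exact \<open>0 \<rightarrow> F\<^sub>k \<rightarrow> \<dots> \<rightarrow> F\<^sub>0 \<rightarrow> N \<rightarrow> 0\<close>, all \<open>F\<^sub>i \<in> \<F>\<close>.\<close>

definition resolved_le :: "'r ring \<Rightarrow> ('r, 'm) module set \<Rightarrow> nat \<Rightarrow> ('r, 'm) module set" where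
  "resolved_le R \<F> k = {N. \<exists>X d. X 0 = N \<and> exact_onto R (Suc k) X d \<and>
     inj_on (d k) (carrier (X (Suc k))) \<and> (\<forall>i \<le> k. X (Suc i) \<in> \<F>)}"

text \<open>\<open>\<I>\<^sub>\<le>\<^sub>k\<close>: modules \<open>M\<close> with an exact \<open>0 \<rightarrow> M \<rightarrow> I\<^sub>0 \<rightarrow> \<dots> \<rightarrow> I\<^sub>k \<rightarrow> 0\<close>, all \<open>I\<^sub>i \<in> \<I>\<close>; here
  \<open>X\<^sub>0 = M\<close>, \<open>X\<^sub>i\<^sub>+\<^sub>1 = I\<^sub>i\<close> and \<open>d i : X\<^sub>i \<rightarrow> X\<^sub>i\<^sub>+\<^sub>1\<close>.\<close>

definition coresolved_le :: "'r ring \<Rightarrow> ('r, 'm) module set \<Rightarrow> nat \<Rightarrow> ('r, 'm) module set" where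
  "coresolved_le R \<I> k = {M. \<exists>X d. X 0 = M \<and>
     (\<forall>i \<le> Suc k. left_module R (X i)) \<and>
     (\<forall>i \<le> k. d i \<in> lhom R (X i) (X (Suc i))) \<and>
     inj_on (d 0) (carrier (X 0)) \<and>
     (\<forall>i < k. d i ` carrier (X i) = lker (X (Suc i)) (X (Suc (Suc i))) (d (Suc i))) \<and>
     d k ` carrier (X k) = carrier (X (Suc k)) \<and>
     (\<forall>i \<le> k. X (Suc i) \<in> \<I>)}"

section \<open>Tensor products\<close>

text \<open>\<open>A\<close> is a right \<open>R\<close>-module given as an \<open>op_ring R\<close>-module, so \<open>r \<odot>\<^bsub>A\<^esub> a\<close> stands for \<open>a r\<close>. The
  tensor product is the free abelian group on pairs modulo the usual relations; its elements are
  cosets.\<close>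

definition tensor_rel ::
    "'r ring \<Rightarrow> ('r, 'a) module \<Rightarrow> ('r, 'm) module \<Rightarrow> ('a \<times> 'm \<Rightarrow>\<^sub>0 int) set" where
  "tensor_rel R A M = generate (free_Abelian_group (carrier A \<times> carrier M))
     ({frag_of (a \<oplus>\<^bsub>A\<^esub> a', m) - frag_of (a, m) - frag_of (a', m) | a a' m.
         a \<in> carrier A \<and> a' \<in> carrier A \<and> m \<in> carrier M} \<union>
      {frag_of (a, m \<oplus>\<^bsub>M\<^esub> m') - frag_of (a, m) - frag_of (a, m') | a m m'.
         a \<in> carrier A \<and> m \<in> carrier M \<and> m' \<in> carrier M} \<union>
      {frag_of (r \<odot>\<^bsub>A\<^esub> a, m) - frag_of (a, r \<odot>\<^bsub>M\<^esub> m) | r a m.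
         r \<in> carrier R \<and> a \<in> carrier A \<and> m \<in> carrier M})"

definition tensor_group ::
    "'r ring \<Rightarrow> ('r, 'a) module \<Rightarrow> ('r, 'm) module \<Rightarrow> ('a \<times> 'm \<Rightarrow>\<^sub>0 int) set monoid" where
  "tensor_group R A M = free_Abelian_group (carrier A \<times> carrier M) Mod tensor_rel R A M"

definition coset_of ::
    "'r ring \<Rightarrow> ('r, 'a) module \<Rightarrow> ('r, 'm) module \<Rightarrow> ('a \<times> 'm \<Rightarrow>\<^sub>0 int) \<Rightarrow> ('a \<times> 'm \<Rightarrow>\<^sub>0 int) set"
  where
  "coset_of R A M x = tensor_rel R A M #>\<^bsub>free_Abelian_group (carrier A \<times> carrier M)\<^esub> x"

definition pure_tensor ::
    "'r ring \<Rightarrow> ('r, 'a) module \<Rightarrow> ('r, 'm) module \<Rightarrow> 'a \<Rightarrow> 'm \<Rightarrow> ('a \<times> 'm \<Rightarrow>\<^sub>0 int) set" where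
  "pure_tensor R A M a m = coset_of R A M (frag_of (a, m))"

text \<open>\<open>f \<otimes> g\<close> into \<open>B \<otimes> N\<close>; all representatives \<open>x\<close> of the coset \<open>t\<close> yield the same coset, so the
  union is that coset.\<close>

definition tensor_map :: "'r ring \<Rightarrow> ('r, 'b) module \<Rightarrow> ('r, 'n) module \<Rightarrow> ('a \<Rightarrow> 'b) \<Rightarrow> ('m \<Rightarrow> 'n) \<Rightarrow>
    ('a \<times> 'm \<Rightarrow>\<^sub>0 int) set \<Rightarrow> ('b \<times> 'n \<Rightarrow>\<^sub>0 int) set" where
  "tensor_map R B N f g t =
     (\<Union>x \<in> t. coset_of R B N (frag_extend (\<lambda>(a, m). frag_of (f a, g m)) x))"

section \<open>Tor and Ext\<close>

text \<open>Both are computed from the chosen projective resolution \<open>\<dots> \<rightarrow> P\<^sub>1 \<rightarrow> P\<^sub>0\<close>, \<open>P\<^sub>j = X\<^sub>j\<^sub>+\<^sub>1\<close>, of the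
  first argument, as (co)homology of the deleted complexes \<open>P \<otimes> M\<close> and \<open>Hom(P, N)\<close>.\<close>

definition Tor ::
    "'r ring \<Rightarrow> nat \<Rightarrow> ('r, 'a) module \<Rightarrow> ('r, 'm) module \<Rightarrow> ('a \<times> 'm \<Rightarrow>\<^sub>0 int) set set monoid" where
  "Tor R i A M =
     (let (X, d) = chosen_resolution (op_ring R) A;
          T = (\<lambda>j. tensor_group R (X (Suc j)) M);
          cycles = (if i = 0 then carrier (T 0)
                    else kernel (T i) (T (i - 1)) (tensor_map R (X i) M (d i) (\<lambda>m. m)));
          boundaries = tensor_map R (X (Suc i)) M (d (Suc i)) (\<lambda>m. m) ` carrier (T (Suc i))
      in (T i)\<lparr>carrier := cycles\<rparr> Mod boundaries)"

definition Ext ::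
    "'s ring \<Rightarrow> nat \<Rightarrow> ('s, 'a) module \<Rightarrow> ('s, 'n) module \<Rightarrow> ('a \<Rightarrow> 'n) set monoid" where
  "Ext S i A N =
     (let (X, d) = chosen_resolution S A;
          H = (\<lambda>j. hom_group S (X (Suc j)) N);
          \<delta> = (\<lambda>j g. compose (carrier (X (Suc (Suc j)))) g (d (Suc j)));
          cocycles = kernel (H i) (H (Suc i)) (\<delta> i);
          coboundaries = (if i = 0 then {\<one>\<^bsub>H 0\<^esub>} else \<delta> (i - 1) ` carrier (H (i - 1)))
      in (H i)\<lparr>carrier := cocycles\<rparr> Mod coboundaries)"

section \<open>Bimodules and semidualizing bimodules\<close>

record ('s, 'r, 'c) bimodule = "('s, 'c) module" +
  rsmult :: "'c \<Rightarrow> 'r \<Rightarrow> 'c"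

definition left_mod :: "('s, 'r, 'c) bimodule \<Rightarrow> ('s, 'c) module" where
  "left_mod C = module.truncate C"

definition right_mod :: "('s, 'r, 'c) bimodule \<Rightarrow> ('r, 'c) module" where
  "right_mod C = \<lparr>carrier = carrier C, monoid.mult = monoid.mult C, one = one C,
     ring.zero = ring.zero C, add = add C,
     smult = (\<lambda>r c. rsmult C c r)\<rparr>"

definition is_bimodule :: "'s ring \<Rightarrow> 'r ring \<Rightarrow> ('s, 'r, 'c) bimodule \<Rightarrow> bool" where
  "is_bimodule S R C \<longleftrightarrow> left_module S (left_mod C) \<and> left_module (op_ring R) (right_mod C) \<and>
     (\<forall>s \<in> carrier S. \<forall>c \<in> carrier C. \<forall>r \<in> carrier R.
        rsmult C (s \<odot>\<^bsub>C\<^esub> c) r = s \<odot>\<^bsub>C\<^esub> rsmult C c r)"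

definition degreewise_fg :: "'r ring \<Rightarrow> ('r, 'm) module \<Rightarrow> bool" where
  "degreewise_fg R M \<longleftrightarrow> (\<exists>X d. proj_resolution R M X d \<and> (\<forall>i. fin_gen R (X (Suc i))))"

definition semidualizing :: "'s ring \<Rightarrow> 'r ring \<Rightarrow> ('s, 'r, 'c) bimodule \<Rightarrow> bool" where
  "semidualizing S R C \<longleftrightarrow> is_bimodule S R C \<and>
     degreewise_fg S (left_mod C) \<and> degreewise_fg (op_ring R) (right_mod C) \<and>
     bij_betw (\<lambda>s. \<lambda>c \<in> carrier C. s \<odot>\<^bsub>C\<^esub> c)
       (carrier S) (lhom (op_ring R) (right_mod C) (right_mod C)) \<and>
     bij_betw (\<lambda>r. \<lambda>c \<in> carrier C. rsmult C c r)
       (carrier R) (lhom S (left_mod C) (left_mod C)) \<and>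
     (\<forall>i \<ge> 1. trivial_group (Ext S i (left_mod C) (left_mod C))) \<and>
     (\<forall>i \<ge> 1. trivial_group (Ext (op_ring R) i (right_mod C) (right_mod C)))"

definition faithfully_semidualizing :: "'s ring \<Rightarrow> 'r ring \<Rightarrow> ('s, 'r, 'c) bimodule \<Rightarrow> bool" where
  "faithfully_semidualizing S R C \<longleftrightarrow> semidualizing S R C \<and>
     (\<forall>N :: ('s, 'c) module. left_module S N \<longrightarrow>
        trivial_group (hom_group S (left_mod C) N) \<longrightarrow> carrier N = {\<zero>\<^bsub>N\<^esub>}) \<and>
     (\<forall>M :: ('r, 'c) module. left_module (op_ring R) M \<longrightarrow>
        trivial_group (hom_group (op_ring R) (right_mod C) M) \<longrightarrow> carrier M = {\<zero>\<^bsub>M\<^esub>})"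

text \<open>\<open>C \<otimes>\<^sub>R M\<close> as a left \<open>S\<close>-module, and \<open>Hom\<^sub>S(C, N)\<close> as a left \<open>R\<close>-module via \<open>(r f)(c) = f(c r)\<close>.\<close>

definition tensor_mod :: "'r ring \<Rightarrow> ('s, 'r, 'c) bimodule \<Rightarrow> ('r, 'm) module \<Rightarrow>
    ('s, ('c \<times> 'm \<Rightarrow>\<^sub>0 int) set) module" where
  "tensor_mod R C M = (let T = tensor_group R (right_mod C) M in
     \<lparr>carrier = carrier T, monoid.mult = undefined, one = undefined, ring.zero = one T, add = monoid.mult T,
      smult = (\<lambda>s. tensor_map R (right_mod C) M (\<lambda>c. s \<odot>\<^bsub>C\<^esub> c) (\<lambda>m. m))\<rparr>)"

definition hom_mod :: "'s ring \<Rightarrow> ('s, 'r, 'c) bimodule \<Rightarrow> ('s, 'n) module \<Rightarrow>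
    ('r, 'c \<Rightarrow> 'n) module" where
  "hom_mod S C N = (let H = hom_group S (left_mod C) N in
     \<lparr>carrier = carrier H, monoid.mult = undefined, one = undefined, ring.zero = one H, add = monoid.mult H,
      smult = (\<lambda>r f. \<lambda>c \<in> carrier C. f (rsmult C c r))\<rparr>)"

section \<open>Auslander and Bass classes\<close>

definition unit_map :: "'r ring \<Rightarrow> ('s, 'r, 'c) bimodule \<Rightarrow> ('r, 'm) module \<Rightarrow>
    'm \<Rightarrow> 'c \<Rightarrow> ('c \<times> 'm \<Rightarrow>\<^sub>0 int) set" where
  "unit_map R C M = (\<lambda>m \<in> carrier M. \<lambda>c \<in> carrier C. pure_tensor R (right_mod C) M c m)"

definition counit_map :: "'s ring \<Rightarrow> 'r ring \<Rightarrow> ('s, 'r, 'c) bimodule \<Rightarrow> ('s, 'n) module \<Rightarrow>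
    ('c \<times> ('c \<Rightarrow> 'n) \<Rightarrow>\<^sub>0 int) set \<Rightarrow> 'n" where
  "counit_map S R C N = (THE \<nu>. \<nu> \<in> lhom S (tensor_mod R C (hom_mod S C N)) N \<and>
     (\<forall>c \<in> carrier C. \<forall>f \<in> lhom S (left_mod C) N.
        \<nu> (pure_tensor R (right_mod C) (hom_mod S C N) c f) = f c))"

definition Auslander :: "'s ring \<Rightarrow> 'r ring \<Rightarrow> ('s, 'r, 'c) bimodule \<Rightarrow> ('r, 'm) module set" where
  "Auslander S R C = {M. left_module R M \<and>
     (\<forall>i \<ge> 1. trivial_group (Tor R i (right_mod C) M)) \<and>
     (\<forall>i \<ge> 1. trivial_group (Ext S i (left_mod C) (tensor_mod R C M))) \<and>
     unit_map R C M \<in> lisos R M (hom_mod S C (tensor_mod R C M))}"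

definition Bass :: "'s ring \<Rightarrow> 'r ring \<Rightarrow> ('s, 'r, 'c) bimodule \<Rightarrow> ('s, 'n) module set" where
  "Bass S R C = {N. left_module S N \<and>
     (\<forall>i \<ge> 1. trivial_group (Ext S i (left_mod C) N)) \<and>
     (\<forall>i \<ge> 1. trivial_group (Tor R i (right_mod C) (hom_mod S C N))) \<and>
     counit_map S R C N \<in> lisos S (tensor_mod R C (hom_mod S C N)) N}"

section \<open>Classes of \<open>fp\<^sub>n\<close>-injective and \<open>fp\<^sub>n\<close>-flat modules\<close>

definition fpI :: "'r ring \<Rightarrow> nat \<Rightarrow> ('r, 'u) module set" where
  "fpI R n = {M. left_module R M \<and>
     (\<forall>(K :: ('r, 'u) module) (L :: ('r, 'u) module) f.
        fin_presented R n K \<longrightarrow> fin_presented R n L \<longrightarrow>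
        f \<in> lhom R K L \<longrightarrow> inj_on f (carrier K) \<longrightarrow>
        (\<lambda>h. compose (carrier K) h f) ` lhom R L M = lhom R K M)}"

definition fpF :: "'r ring \<Rightarrow> nat \<Rightarrow> ('r, 'u) module set" where
  "fpF R n = {M. left_module R M \<and>
     (\<forall>(K :: ('r, 'u) module) (L :: ('r, 'u) module) f.
        fin_presented (op_ring R) n K \<longrightarrow> fin_presented (op_ring R) n L \<longrightarrow>
        f \<in> lhom (op_ring R) K L \<longrightarrow> inj_on f (carrier K) \<longrightarrow>
        inj_on (tensor_map R L M f (\<lambda>m. m)) (carrier (tensor_group R K M)))}"

definition CfpI :: "'s ring \<Rightarrow> 'r ring \<Rightarrow> ('s, 'r, 'u) bimodule \<Rightarrow> nat \<Rightarrow> ('r, 'u) module set" where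
  "CfpI S R C n = {M. left_module R M \<and>
     (\<exists>X :: ('s, 'u) module. X \<in> fpI S n \<and> isomorphic R M (hom_mod S C X))}"

definition CfpF :: "'s ring \<Rightarrow> 'r ring \<Rightarrow> ('s, 'r, 'u) bimodule \<Rightarrow> nat \<Rightarrow> ('s, 'u) module set" where
  "CfpF S R C n = {N. left_module S N \<and>
     (\<exists>Y :: ('r, 'u) module. Y \<in> fpF R n \<and> isomorphic S N (tensor_mod R C Y))}"

section \<open>Categories, functors, equivalences\<close>

text \<open>Arrows need not determine their endpoints, hence the object arguments of \<open>Comp\<close> (the source of
  the composite) and of the arrow part of a functor.\<close>

record ('o, 'a) category =
  Obj :: "'o set"
  Arr :: "'o \<Rightarrow> 'o \<Rightarrow> 'a set"
  Comp :: "'o \<Rightarrow> 'a \<Rightarrow> 'a \<Rightarrow> 'a"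
  Ident :: "'o \<Rightarrow> 'a"

type_synonym ('o, 'a, 'p, 'b) functor_data = "('o \<Rightarrow> 'p) \<times> ('o \<Rightarrow> 'o \<Rightarrow> 'a \<Rightarrow> 'b)"

definition is_functor ::
    "('o, 'a) category \<Rightarrow> ('p, 'b) category \<Rightarrow> ('o, 'a, 'p, 'b) functor_data \<Rightarrow> bool" where
  "is_functor A B F \<longleftrightarrow>
     (\<forall>X \<in> Obj A. fst F X \<in> Obj B) \<and>
     (\<forall>X \<in> Obj A. \<forall>Y \<in> Obj A. \<forall>f \<in> Arr A X Y. snd F X Y f \<in> Arr B (fst F X) (fst F Y)) \<and>
     (\<forall>X \<in> Obj A. snd F X X (Ident A X) = Ident B (fst F X)) \<and>
     (\<forall>X \<in> Obj A. \<forall>Y \<in> Obj A. \<forall>Z \<in> Obj A. \<forall>f \<in> Arr A X Y. \<forall>g \<in> Arr A Y Z.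
        snd F X Z (Comp A X g f) = Comp B (fst F X) (snd F Y Z g) (snd F X Y f))"

definition id_functor :: "('o, 'a, 'o, 'a) functor_data" where
  "id_functor = (\<lambda>X. X, \<lambda>X Y f. f)"

definition comp_functor :: "('p, 'b, 'q, 'c) functor_data \<Rightarrow> ('o, 'a, 'p, 'b) functor_data \<Rightarrow>
    ('o, 'a, 'q, 'c) functor_data" where
  "comp_functor G F =
     (\<lambda>X. fst G (fst F X), \<lambda>X Y f. snd G (fst F X) (fst F Y) (snd F X Y f))"

definition cat_isos :: "('o, 'a) category \<Rightarrow> 'o \<Rightarrow> 'o \<Rightarrow> 'a set" where
  "cat_isos A X Y = {f \<in> Arr A X Y.
     \<exists>g \<in> Arr A Y X. Comp A X g f = Ident A X \<and> Comp A Y f g = Ident A Y}"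

definition naturally_isomorphic :: "('o, 'a) category \<Rightarrow> ('p, 'b) category \<Rightarrow>
    ('o, 'a, 'p, 'b) functor_data \<Rightarrow> ('o, 'a, 'p, 'b) functor_data \<Rightarrow> bool" where
  "naturally_isomorphic A B F G \<longleftrightarrow> (\<exists>\<eta>.
     (\<forall>X \<in> Obj A. \<eta> X \<in> cat_isos B (fst F X) (fst G X)) \<and>
     (\<forall>X \<in> Obj A. \<forall>Y \<in> Obj A. \<forall>f \<in> Arr A X Y.
        Comp B (fst F X) (\<eta> Y) (snd F X Y f) = Comp B (fst F X) (snd G X Y f) (\<eta> X)))"

definition quasi_inverse_equivalences :: "('o, 'a) category \<Rightarrow> ('p, 'b) category \<Rightarrow>
    ('o, 'a, 'p, 'b) functor_data \<Rightarrow> ('p, 'b, 'o, 'a) functor_data \<Rightarrow> bool" where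
  "quasi_inverse_equivalences A B F G \<longleftrightarrow> is_functor A B F \<and> is_functor B A G \<and>
     naturally_isomorphic A A id_functor (comp_functor G F) \<and>
     naturally_isomorphic B B (comp_functor F G) id_functor"

definition full_subcat :: "'r ring \<Rightarrow> ('r, 'm) module set \<Rightarrow>
    (('r, 'm) module, 'm \<Rightarrow> 'm) category" where
  "full_subcat R \<M> = \<lparr>Obj = \<M>, Arr = lhom R, Comp = (\<lambda>X g f. compose (carrier X) g f),
     Ident = (\<lambda>X. \<lambda>x \<in> carrier X. x)\<rparr>"

section \<open>The functors \<open>C \<otimes>\<^sub>R -\<close> and \<open>Hom\<^sub>S(C, -)\<close>\<close>

text \<open>The concrete \<^const>\<open>tensor_mod\<close> and \<^const>\<open>hom_mod\<close> live over larger types. To obtain functors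
  between categories of modules over \<open>'u\<close>, they are replaced by isomorphic copies over \<open>'u\<close>, along a
  chosen injection of the carrier.\<close>

definition code :: "('r, 'm) module \<Rightarrow> 'm \<Rightarrow> 'u" where
  "code M = (SOME e. inj_on e (carrier M))"

definition decode :: "('r, 'm) module \<Rightarrow> 'u \<Rightarrow> 'm" where
  "decode M = inv_into (carrier M) (code M)"

definition copy :: "('r, 'm) module \<Rightarrow> ('r, 'u) module" where
  "copy M = \<lparr>carrier = code M ` carrier M, monoid.mult = undefined, one = undefined,
     ring.zero = code M \<zero>\<^bsub>M\<^esub>,
     add = (\<lambda>x y. code M (decode M x \<oplus>\<^bsub>M\<^esub> decode M y)),
     smult = (\<lambda>r x. code M (r \<odot>\<^bsub>M\<^esub> decode M x))\<rparr>"

definition copy_map :: "('r, 'm) module \<Rightarrow> ('r, 'n) module \<Rightarrow> ('m \<Rightarrow> 'n) \<Rightarrow> 'u \<Rightarrow> 'u" where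
  "copy_map M N f = (\<lambda>x \<in> code M ` carrier M. code N (f (decode M x)))"

definition tensor_functor :: "'r ring \<Rightarrow> ('s, 'r, 'u) bimodule \<Rightarrow>
    (('r, 'u) module, 'u \<Rightarrow> 'u, ('s, 'u) module, 'u \<Rightarrow> 'u) functor_data" where
  "tensor_functor R C =
     (\<lambda>M. copy (tensor_mod R C M),
      \<lambda>M M' f. copy_map (tensor_mod R C M) (tensor_mod R C M')
        (tensor_map R (right_mod C) M' (\<lambda>c. c) f))"

definition hom_functor :: "'s ring \<Rightarrow> ('s, 'r, 'u) bimodule \<Rightarrow>
    (('s, 'u) module, 'u \<Rightarrow> 'u, ('r, 'u) module, 'u \<Rightarrow> 'u) functor_data" where
  "hom_functor S C =
     (\<lambda>N. copy (hom_mod S C N),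
      \<lambda>N N' f. copy_map (hom_mod S C N :: ('r, _) module) (hom_mod S C N' :: ('r, _) module)
        (\<lambda>g. compose (carrier C) f g))"

definition restrict_to_equivalence :: "'s ring \<Rightarrow> 'r ring \<Rightarrow> ('s, 'r, 'u) bimodule \<Rightarrow>
    ('r, 'u) module set \<Rightarrow> ('s, 'u) module set \<Rightarrow> bool" where
  "restrict_to_equivalence S R C \<M> \<N> \<longleftrightarrow>
     quasi_inverse_equivalences (full_subcat R \<M>) (full_subcat S \<N>)
       (tensor_functor R C) (hom_functor S C)"

end

theory Submission imports Defs begin

text \<open>Since \<open>C\<close> has resolutions by finitely generated free modules on both sides, comparison of resolutions
  turns \<open>Ext\<close> and \<open>Tor\<close> of \<open>C\<close> into homology of explicit complexes of matrices acting on powers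
  \<open>M\<^sup>l\<close> and \<open>N\<^sup>m\<close>. Call a map \<open>C \<otimes> M \<rightarrow> N\<close>, seen as a pairing, good if \<open>M\<close> and \<open>N\<close> correspond to each
  other under the two functors and the higher \<open>Tor\<close> and \<open>Ext\<close> vanish. The Auslander class consists of the \<open>M\<close>
  with a good pairing into \<open>C \<otimes> M\<close>, the Bass class of the \<open>N\<close> with a good evaluation pairing on
  \<open>Hom(C, N)\<close>, so \<open>C \<otimes> -\<close> and \<open>Hom(C, -)\<close> exchange the two classes, with unit and counit as the natural
  isomorphisms.

  Dualising the free resolution of \<open>\<^sub>SC\<close> into \<open>C\<close> gives an exact sequence
  \<open>0 \<rightarrow> R \<rightarrow> C\<^bsup>m 0\<^esup> \<rightarrow> C\<^bsup>m 1\<^esup> \<rightarrow> \<dots>\<close> all of whose kernels are finitely \<open>n\<close>-presented. Tensoring it with an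
  \<open>fp\<^sub>n\<close>-flat module keeps it exact, which says that the module is in the Auslander class; dually,
  \<open>fp\<^sub>n\<close>-injective modules are in the Bass class. Faithfulness of \<open>C\<close> makes both classes closed under cokernels
  of monomorphisms and kernels of epimorphisms, and the functors exact on them, so that finite resolutions
  by the smaller classes are transported back and forth.\<close>

text \<open>Goodness of a pairing is exactness of two complexes: \<open>M\<close> followed by the
  cochains in powers of \<open>N\<close>, and the chains in powers of \<open>M\<close> ending in
  \<open>N\<close>. A short exact sequence of modules together with its image under a functor gives
  short exact sequences of such complexes, so two good pairings make the third good. What remains is
  that the functor keeps the given sequence exact. Vanishing of Ext ensures this when the submodule
  is in the Bass class, vanishing of Tor when the quotient is in the Auslander class; in the other
  two cases the missing injectivity or surjectivity is where faithfulness enters. The kernels in the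
  dualised resolution are finitely n-presented because each is the quotient of a power of
  \<open>C\<close> by the one before it, starting from a free module of rank one. A second obstacle
  is one of types: the concrete functors leave the type of the given modules, while faithfulness and
  the fp_n classes test only modules over that type. Hence the cardinality bounds and the transport
  along copies.\<close>

abbreviation "car \<equiv> carrier"
abbreviation "tmapl R B N f \<equiv> tensor_map R B N f (\<lambda>m. m)"

\<comment> \<open>Notation, finite sums and additive maps in abelian groups\<close>
syntax "_index" :: "logic \<Rightarrow> index" ("\<^sub>_" [1000] 1000)

text \<open>A recursion instead of \<open>finsum\<close>: the index sets of all matrices are initial
  segments, and commuting with additive maps or scalars is then a plain induction.\<close>

primrec nsum :: "('b, 'c) ring_scheme \<Rightarrow> (nat \<Rightarrow> 'b) \<Rightarrow> nat \<Rightarrow> 'b" where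
 "nsum G f 0 = \<zero>\<^sub>G"
| "nsum G f (Suc m) = nsum G f m \<oplus>\<^sub>G f m"

lemma nsum_cong: "(\<And>k. k < m \<Longrightarrow> f k = g k) \<Longrightarrow> nsum G f m = nsum G g m"
 by (induction m) auto

text \<open>A thin layer over the library locale with one fixed simp set. Many groups, often whole
  families of them, are interpreted side by side below, and this keeps their facts few and
  uniform.\<close>

locale abg =
 fixes G (structure)
 assumes abelian_group: "abelian_group G"
begin

interpretation abelian_group G by (rule abelian_group)

lemma zero_closed [simp]: "\<zero> \<in> car G" by simp
lemma add_closed [simp]: "x \<in> car G \<Longrightarrow> y \<in> car G \<Longrightarrow> x \<oplus> y \<in> car G" by simp
lemma neg_closed [simp]: "x \<in> car G \<Longrightarrow> \<ominus> x \<in> car G" by simp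
lemma diff_closed [simp]: "x \<in> car G \<Longrightarrow> y \<in> car G \<Longrightarrow> x \<ominus> y \<in> car G" by simp
lemma zero_add [simp]: "x \<in> car G \<Longrightarrow> \<zero> \<oplus> x = x" by simp
lemma add_zero [simp]: "x \<in> car G \<Longrightarrow> x \<oplus> \<zero> = x" by simp
lemma add_neg [simp]: "x \<in> car G \<Longrightarrow> x \<oplus> (\<ominus> x) = \<zero>" by (simp add: r_neg)
lemma neg_add [simp]: "x \<in> car G \<Longrightarrow> (\<ominus> x) \<oplus> x = \<zero>" by (simp add: l_neg)
lemma neg_neg [simp]: "x \<in> car G \<Longrightarrow> \<ominus> (\<ominus> x) = x" by simp
lemma neg_zero [simp]: "\<ominus> \<zero> = \<zero>" by (simp add: minus_equality)
lemma diff_self [simp]: "x \<in> car G \<Longrightarrow> x \<ominus> x = \<zero>" by (simp add: a_minus_def r_neg)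
lemma diff_zero [simp]: "x \<in> car G \<Longrightarrow> x \<ominus> \<zero> = x" by (simp add: a_minus_def)
lemma assoc: "\<lbrakk>x \<in> car G; y \<in> car G; z \<in> car G\<rbrakk> \<Longrightarrow> x \<oplus> y \<oplus> z = x \<oplus> (y \<oplus> z)"
 by (rule a_assoc)
lemma comm: "\<lbrakk>x \<in> car G; y \<in> car G\<rbrakk> \<Longrightarrow> x \<oplus> y = y \<oplus> x"
 by (rule a_comm)
lemma lcomm: "\<lbrakk>x \<in> car G; y \<in> car G; z \<in> car G\<rbrakk> \<Longrightarrow> x \<oplus> (y \<oplus> z) = y \<oplus> (x \<oplus> z)"
 by (rule a_lcomm)
lemmas ac = assoc comm lcomm
lemma neg_add_distrib: "\<lbrakk>x \<in> car G; y \<in> car G\<rbrakk> \<Longrightarrow> \<ominus> (x \<oplus> y) = (\<ominus> x) \<oplus> (\<ominus> y)"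
 by (rule minus_add)
lemma add_neg_cancel [simp]: "\<lbrakk>x \<in> car G; y \<in> car G\<rbrakk> \<Longrightarrow> x \<oplus> ((\<ominus> x) \<oplus> y) = y"
 by (rule r_neg2)
lemma neg_add_cancel [simp]: "\<lbrakk>x \<in> car G; y \<in> car G\<rbrakk> \<Longrightarrow> (\<ominus> x) \<oplus> (x \<oplus> y) = y"
 by (rule r_neg1)
lemma diff_add_cancel [simp]: "\<lbrakk>x \<in> car G; y \<in> car G\<rbrakk> \<Longrightarrow> x \<ominus> y \<oplus> y = x"
 by (simp add: a_minus_def assoc)
lemma add_diff_cancel [simp]: "\<lbrakk>x \<in> car G; y \<in> car G\<rbrakk> \<Longrightarrow> x \<oplus> y \<ominus> y = x"
 by (simp add: a_minus_def assoc)
lemma add_diff_cancel2 [simp]: "\<lbrakk>x \<in> car G; y \<in> car G\<rbrakk> \<Longrightarrow> x \<oplus> y \<ominus> x = y"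
 by (simp add: comm[of x y])
lemma add_diff_cancel_left [simp]: "\<lbrakk>x \<in> car G; y \<in> car G\<rbrakk> \<Longrightarrow> x \<oplus> (y \<ominus> x) = y"
 by (metis comm diff_add_cancel diff_closed)
lemma diff_eq_zero: "\<lbrakk>x \<in> car G; y \<in> car G\<rbrakk> \<Longrightarrow> x \<ominus> y = \<zero> \<longleftrightarrow> x = y"
 by (metis add_diff_cancel_left add_zero diff_self)
lemma left_cancel: "\<lbrakk>x \<in> car G; y \<in> car G; z \<in> car G\<rbrakk> \<Longrightarrow> x \<oplus> y = x \<oplus> z \<longleftrightarrow> y = z"
 by (metis neg_add_cancel)
lemma add_self_zero: "\<lbrakk>x \<in> car G; x \<oplus> x = x\<rbrakk> \<Longrightarrow> x = \<zero>"
 by (metis add_diff_cancel diff_self)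
lemma add_eq_zeroD: "\<lbrakk>x \<in> car G; y \<in> car G; x \<oplus> y = \<zero>\<rbrakk> \<Longrightarrow> y = \<ominus> x"
 by (metis add_neg left_cancel neg_closed)
lemma add_add_swap:
 "\<lbrakk>x \<in> car G; y \<in> car G; z \<in> car G; w \<in> car G\<rbrakk> \<Longrightarrow>
  (x \<oplus> y) \<oplus> (z \<oplus> w) = (x \<oplus> z) \<oplus> (y \<oplus> w)"
 by (simp add: ac)

lemma nsum_closed [simp]: "(\<And>k. k < m \<Longrightarrow> f k \<in> car G) \<Longrightarrow> nsum G f m \<in> car G"
 by (induction m) auto
lemma nsum_zero [simp]: "nsum G (\<lambda>k. \<zero>) m = \<zero>"
 by (induction m) auto
lemma nsum_add: "(\<And>k. k < m \<Longrightarrow> f k \<in> car G) \<Longrightarrow> (\<And>k. k < m \<Longrightarrow> g k \<in> car G) \<Longrightarrow>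
 nsum G (\<lambda>k. f k \<oplus> g k) m = nsum G f m \<oplus> nsum G g m"
 by (induction m) (auto simp: add_add_swap)
lemma nsum_delta: "j < m \<Longrightarrow> f j \<in> car G \<Longrightarrow> nsum G (\<lambda>k. if k = j then f k else \<zero>) m = f j"
proof (induction m)
 case (Suc m)
 show ?case
 proof (cases "j = m")
  case True
  have "nsum G (\<lambda>k. if k = j then f k else \<zero>) m = nsum G (\<lambda>k. \<zero>) m"
   by (rule nsum_cong) (use True in auto)
  then show ?thesis using Suc True by simp
 qed (use Suc in auto)
qed simp
lemma nsum_swap: "(\<And>i j. i < m \<Longrightarrow> j < n \<Longrightarrow> f i j \<in> car G) \<Longrightarrow>
 nsum G (\<lambda>i. nsum G (f i) n) m = nsum G (\<lambda>j. nsum G (\<lambda>i. f i j) m) n"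
 by (induction m) (auto simp: nsum_add)

end

text \<open>Unlike for \<open>lhom\<close>, no value outside the carrier is prescribed, so
  \<open>tensor_map\<close>, entrywise maps and plain abstractions belong to it as they
  stand.\<close>

definition ahom :: "('a, 'x) ring_scheme \<Rightarrow> ('b, 'y) ring_scheme \<Rightarrow> ('a \<Rightarrow> 'b) set" where
 "ahom G H = {h. (\<forall>x \<in> car G. h x \<in> car H) \<and>
   (\<forall>x \<in> car G. \<forall>y \<in> car G. h (x \<oplus>\<^sub>G y) = h x \<oplus>\<^sub>H h y)}"

locale ahm = A?: abg A + B?: abg B for A (structure) and B (structure) +
 fixes h
 assumes ahom: "h \<in> ahom A B"
begin

lemma closed [simp]: "x \<in> car A \<Longrightarrow> h x \<in> car B"
 using ahom by (simp add: ahom_def)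
lemma add [simp]: "x \<in> car A \<Longrightarrow> y \<in> car A \<Longrightarrow> h (x \<oplus>\<^sub>A y) = h x \<oplus>\<^sub>B h y"
 using ahom by (simp add: ahom_def)
lemma zero [simp]: "h \<zero>\<^sub>A = \<zero>\<^sub>B"
 by (metis A.add_zero A.zero_closed B.add_self_zero add closed)
lemma neg [simp]: "x \<in> car A \<Longrightarrow> h (\<ominus>\<^sub>A x) = \<ominus>\<^sub>B h x"
 by (metis A.add_neg A.neg_closed B.add_eq_zeroD add closed zero)
lemma diff [simp]: "x \<in> car A \<Longrightarrow> y \<in> car A \<Longrightarrow> h (x \<ominus>\<^sub>A y) = h x \<ominus>\<^sub>B h y"
 by (simp add: a_minus_def)
lemma nsum: "(\<And>k. k < m \<Longrightarrow> f k \<in> car A) \<Longrightarrow> h (nsum A f m) = nsum B (\<lambda>k. h (f k)) m"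
 by (induction m) auto
lemma inj_onI0: "(\<And>x. x \<in> car A \<Longrightarrow> h x = \<zero>\<^sub>B \<Longrightarrow> x = \<zero>\<^sub>A) \<Longrightarrow> inj_on h (car A)"
 by (rule inj_onI) (metis A.diff_closed A.diff_eq_zero B.diff_self closed diff)
lemma inj_on_zeroD: "inj_on h (car A) \<Longrightarrow> x \<in> car A \<Longrightarrow> h x = \<zero>\<^sub>B \<Longrightarrow> x = \<zero>\<^sub>A"
 by (metis A.zero_closed inj_on_def zero)

end

section \<open>Left modules, their homomorphisms and submodules\<close>

locale lmod =
 fixes R :: "'r ring" (structure) and M :: "('r, 'm) module" (structure)
 assumes left_module: "left_module R M"
begin

interpretation left_module R M by (rule left_module)

sublocale abg M by unfold_locales

lemma ring: "ring R" ..
lemma smult_closed [simp]: "a \<in> car R \<Longrightarrow> x \<in> car M \<Longrightarrow> a \<odot>\<^sub>M x \<in> car M"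
 by (rule smult_closed)
lemma smult_l_distr: "\<lbrakk>a \<in> car R; b \<in> car R; x \<in> car M\<rbrakk> \<Longrightarrow>
 (a \<oplus>\<^sub>R b) \<odot>\<^sub>M x = a \<odot>\<^sub>M x \<oplus>\<^sub>M b \<odot>\<^sub>M x"
 by (rule smult_l_distr)
lemma smult_r_distr: "\<lbrakk>a \<in> car R; x \<in> car M; y \<in> car M\<rbrakk> \<Longrightarrow>
 a \<odot>\<^sub>M (x \<oplus>\<^sub>M y) = a \<odot>\<^sub>M x \<oplus>\<^sub>M a \<odot>\<^sub>M y"
 by (rule smult_r_distr)
lemma smult_assoc: "\<lbrakk>a \<in> car R; b \<in> car R; x \<in> car M\<rbrakk> \<Longrightarrow>
 (a \<otimes>\<^sub>R b) \<odot>\<^sub>M x = a \<odot>\<^sub>M (b \<odot>\<^sub>M x)"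
 by (rule smult_assoc1)
lemma smult_one [simp]: "x \<in> car M \<Longrightarrow> \<one>\<^sub>R \<odot>\<^sub>M x = x"
 by (rule smult_one)
lemma smult_zero_r [simp]: "a \<in> car R \<Longrightarrow> a \<odot>\<^sub>M \<zero>\<^sub>M = \<zero>\<^sub>M"
 by (metis add_self_zero add_zero smult_closed smult_r_distr zero_closed)
lemma smult_zero_l [simp]: "x \<in> car M \<Longrightarrow> \<zero>\<^sub>R \<odot>\<^sub>M x = \<zero>\<^sub>M"
 by (metis add_self_zero R.add.r_one smult_closed smult_l_distr R.zero_closed)
lemma smult_nsum: "a \<in> car R \<Longrightarrow> (\<And>k. k < m \<Longrightarrow> f k \<in> car M) \<Longrightarrow>
 a \<odot>\<^sub>M nsum M f m = nsum M (\<lambda>k. a \<odot>\<^sub>M f k) m"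
 by (induction m) (auto simp: smult_r_distr)
lemma nsum_smult: "x \<in> car M \<Longrightarrow> (\<And>k. k < m \<Longrightarrow> f k \<in> car R) \<Longrightarrow>
 nsum R f m \<odot>\<^sub>M x = nsum M (\<lambda>k. f k \<odot>\<^sub>M x) m"
proof (induction m)
 case (Suc m)
 interpret R: abg R by unfold_locales
 show ?case using Suc by (simp add: smult_l_distr)
qed auto
lemma smult_neg: "x \<in> car M \<Longrightarrow> (\<ominus>\<^sub>R \<one>\<^sub>R) \<odot>\<^sub>M x = \<ominus>\<^sub>M x"
 by (metis add_eq_zeroD R.add.inv_closed R.add.r_inv R.one_closed smult_closed smult_l_distr smult_one smult_zero_l)

end

lemma lmod_iff: "lmod R M \<longleftrightarrow> left_module R M"
 by (simp add: lmod_def)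

lemma left_moduleI:
 assumes "ring R"
  and "\<And>x y. \<lbrakk>x \<in> car M; y \<in> car M\<rbrakk> \<Longrightarrow> x \<oplus>\<^sub>M y \<in> car M"
  and "\<zero>\<^sub>M \<in> car M"
  and "\<And>x y z. \<lbrakk>x \<in> car M; y \<in> car M; z \<in> car M\<rbrakk> \<Longrightarrow>
   (x \<oplus>\<^sub>M y) \<oplus>\<^sub>M z = x \<oplus>\<^sub>M (y \<oplus>\<^sub>M z)"
  and "\<And>x y. \<lbrakk>x \<in> car M; y \<in> car M\<rbrakk> \<Longrightarrow> x \<oplus>\<^sub>M y = y \<oplus>\<^sub>M x"
  and "\<And>x. x \<in> car M \<Longrightarrow> \<zero>\<^sub>M \<oplus>\<^sub>M x = x"
  and "\<And>x. x \<in> car M \<Longrightarrow> \<exists>y \<in> car M. y \<oplus>\<^sub>M x = \<zero>\<^sub>M"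
  and "\<And>a x. \<lbrakk>a \<in> car R; x \<in> car M\<rbrakk> \<Longrightarrow> a \<odot>\<^sub>M x \<in> car M"
  and "\<And>a b x. \<lbrakk>a \<in> car R; b \<in> car R; x \<in> car M\<rbrakk> \<Longrightarrow>
   (a \<oplus>\<^sub>R b) \<odot>\<^sub>M x = a \<odot>\<^sub>M x \<oplus>\<^sub>M b \<odot>\<^sub>M x"
  and "\<And>a x y. \<lbrakk>a \<in> car R; x \<in> car M; y \<in> car M\<rbrakk> \<Longrightarrow>
   a \<odot>\<^sub>M (x \<oplus>\<^sub>M y) = a \<odot>\<^sub>M x \<oplus>\<^sub>M a \<odot>\<^sub>M y"
  and "\<And>a b x. \<lbrakk>a \<in> car R; b \<in> car R; x \<in> car M\<rbrakk> \<Longrightarrow>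
   (a \<otimes>\<^sub>R b) \<odot>\<^sub>M x = a \<odot>\<^sub>M (b \<odot>\<^sub>M x)"
  and "\<And>x. x \<in> car M \<Longrightarrow> \<one>\<^sub>R \<odot>\<^sub>M x = x"
 shows "left_module R M"
 unfolding left_module_def left_module_axioms_def
 using assms by (auto intro!: abelian_groupI)

lemma op_ring_simps [simp]:
 "car (op_ring R) = car R" "\<zero>\<^bsub>op_ring R\<^esub> = \<zero>\<^sub>R" "\<one>\<^bsub>op_ring R\<^esub> = \<one>\<^sub>R"
 "x \<oplus>\<^bsub>op_ring R\<^esub> y = x \<oplus>\<^sub>R y" "x \<otimes>\<^bsub>op_ring R\<^esub> y = y \<otimes>\<^sub>R x"
 by (simp_all add: op_ring_def)

lemma op_op [simp]: "op_ring (op_ring R) = R"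
 by (simp add: op_ring_def)

lemma nsum_op [simp]: "nsum (op_ring R) f m = nsum R f m"
 by (induction m) auto

lemma ring_op [simp]: "ring (op_ring R) \<longleftrightarrow> ring R"
proof -
 have "ring (op_ring R)" if "ring R" for R :: "'r ring"
 proof -
  interpret ring R by fact
  show ?thesis
   by (rule ringI, rule abelian_groupI)
    (auto simp: a_ac m_assoc l_distr r_distr intro!: monoidI bexI[of _ "\<ominus>\<^sub>R _"] l_neg)
 qed
 from this[of R] this[of "op_ring R"] show ?thesis by auto
qed

locale lhm = A?: lmod R A + B?: lmod R B for R :: "'r ring" (structure) and A :: "('r, 'a) module" (structure) and B :: "('r, 'b) module" (structure) +
 fixes f
 assumes lhom: "f \<in> lhom R A B"
begin

sublocale ahm A B f
 using lhom by unfold_locales (auto simp: ahom_def lhom_def)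

lemma smult [simp]: "a \<in> car R \<Longrightarrow> x \<in> car A \<Longrightarrow> f (a \<odot>\<^sub>A x) = a \<odot>\<^sub>B f x"
 using lhom by (simp add: lhom_def)
lemma ext: "f \<in> extensional (car A)"
 using lhom by (simp add: lhom_def PiE_def)

end

lemma lhmI: "left_module R A \<Longrightarrow> left_module R B \<Longrightarrow> f \<in> lhom R A B \<Longrightarrow> lhm R A B f"
 by (simp add: lhm_def lhm_axioms_def lmod_iff)

lemma lhomI:
 assumes "\<And>x. x \<in> car A \<Longrightarrow> f x \<in> car B"
  and "\<And>x y. x \<in> car A \<Longrightarrow> y \<in> car A \<Longrightarrow> f (x \<oplus>\<^sub>A y) = f x \<oplus>\<^sub>B f y"
  and "\<And>a x. a \<in> car R \<Longrightarrow> x \<in> car A \<Longrightarrow> f (a \<odot>\<^sub>A x) = a \<odot>\<^sub>B f x"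
  and "\<And>x. x \<notin> car A \<Longrightarrow> f x = undefined"
 shows "f \<in> lhom R A B"
 using assms by (auto simp: lhom_def PiE_def extensional_def)

lemma restrict_lhomI:
 assumes "left_module R A"
  and "\<And>x. x \<in> car A \<Longrightarrow> f x \<in> car B"
  and "\<And>x y. x \<in> car A \<Longrightarrow> y \<in> car A \<Longrightarrow> f (x \<oplus>\<^sub>A y) = f x \<oplus>\<^sub>B f y"
  and "\<And>a x. a \<in> car R \<Longrightarrow> x \<in> car A \<Longrightarrow> f (a \<odot>\<^sub>A x) = a \<odot>\<^sub>B f x"
 shows "restrict f (car A) \<in> lhom R A B"
proof -
 interpret lmod R A using assms(1) by (simp add: lmod_iff)
 show ?thesis using assms by (intro lhomI) auto
qed

lemma lhom_eqI:
 assumes "f \<in> lhom R A B" "g \<in> lhom R A B'" "\<And>x. x \<in> car A \<Longrightarrow> f x = g x"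
 shows "f = g"
 by (rule extensionalityI[of f "car A" g]) (use assms in \<open>simp_all add: lhom_def PiE_def\<close>)

lemma lhom_closed: "f \<in> lhom R A B \<Longrightarrow> x \<in> car A \<Longrightarrow> f x \<in> car B"
 by (auto simp: lhom_def)

lemma lhom_ahom: "f \<in> lhom R A B \<Longrightarrow> f \<in> ahom A B"
 by (auto simp: lhom_def ahom_def)

lemma lhom_compose:
 assumes "left_module R A" "f \<in> lhom R A B" "g \<in> lhom R B C"
 shows "compose (car A) g f \<in> lhom R A C"
 unfolding compose_def using assms
 by (intro restrict_lhomI) (auto simp: lhom_def PiE_def Pi_def)

lemma lhom_id: "left_module R A \<Longrightarrow> (\<lambda>x \<in> car A. x) \<in> lhom R A A"
 by (rule restrict_lhomI) auto

lemma lhom_zero: "left_module R A \<Longrightarrow> left_module R B \<Longrightarrow> (\<lambda>x \<in> car A. \<zero>\<^sub>B) \<in> lhom R A B"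
proof -
 assume "left_module R A" "left_module R B"
 then interpret B: lmod R B by (simp add: lmod_iff)
 show ?thesis by (rule restrict_lhomI) (auto simp: \<open>left_module R A\<close>)
qed

lemma lhom_diff:
 assumes "left_module R A" "left_module R B" "f \<in> lhom R A B" "g \<in> lhom R A B"
 shows "(\<lambda>x \<in> car A. f x \<ominus>\<^sub>B g x) \<in> lhom R A B"
proof -
 interpret f: lhm R A B f using assms by (simp add: lhmI)
 interpret g: lhm R A B g using assms by (simp add: lhmI)
 have neg: "\<ominus>\<^sub>B (a \<odot>\<^sub>B x) = a \<odot>\<^sub>B (\<ominus>\<^sub>B x)" if "a \<in> car R" "x \<in> car B" for a x
  by (rule f.B.add_eq_zeroD[symmetric]) (use that in \<open>auto simp flip: f.B.smult_r_distr\<close>)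
 show ?thesis
  using assms(1) by (rule restrict_lhomI)
   (auto simp: a_minus_def f.B.neg_add_distrib f.B.add_add_swap f.B.smult_r_distr neg)
qed

lemma lhom_add:
 assumes "left_module R A" "left_module R B" "f \<in> lhom R A B" "g \<in> lhom R A B"
 shows "(\<lambda>x \<in> car A. f x \<oplus>\<^sub>B g x) \<in> lhom R A B"
proof -
 interpret f: lhm R A B f using assms by (simp add: lhmI)
 interpret g: lhm R A B g using assms by (simp add: lhmI)
 show ?thesis
  using assms(1) by (rule restrict_lhomI) (auto simp: f.B.add_add_swap f.B.smult_r_distr)
qed

lemma lhom_inv:
 assumes "left_module R A" "left_module R B" "f \<in> lisos R A B"
 shows "restrict (inv_into (car A) f) (car B) \<in> lisos R B A"
proof -
 interpret f: lhm R A B f using assms by (simp add: lhmI lisos_def)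
 have bij: "bij_betw f (car A) (car B)" using assms by (simp add: lisos_def)
 have inj: "inj_on f (car A)" using bij by (rule bij_betw_imp_inj_on)
 let ?g = "inv_into (car A) f"
 have g: "?g y \<in> car A" "f (?g y) = y" if "y \<in> car B" for y
  using that bij by (auto simp: bij_betw_def intro: inv_into_into f_inv_into_f)
 have "restrict ?g (car B) \<in> lhom R B A"
  by (rule restrict_lhomI[OF assms(2)]) (auto simp: g intro!: inj_onD[OF inj])
 then show ?thesis
  using bij_betw_inv_into[OF bij] by (simp add: lisos_def bij_betw_def inj_on_def)
qed

lemma isomorphic_sym: "left_module R A \<Longrightarrow> left_module R B \<Longrightarrow> isomorphic R A B \<Longrightarrow> isomorphic R B A"
 unfolding isomorphic_def using lhom_inv[of R A B] by blast

lemma lisos_compose: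
 assumes "left_module R A" "f \<in> lisos R A B" "g \<in> lisos R B C"
 shows "compose (car A) g f \<in> lisos R A C"
 using assms lhom_compose[of R A f B g C] by (auto simp: lisos_def intro: bij_betw_compose)

lemma isomorphic_trans: "left_module R A \<Longrightarrow> isomorphic R A B \<Longrightarrow> isomorphic R B C \<Longrightarrow> isomorphic R A C"
 unfolding isomorphic_def using lisos_compose[of R A _ B _ C] by blast

text \<open>The point is a parameter so that a zero module is available over every type.\<close>

definition zero_mod :: "'a \<Rightarrow> ('r, 'a) module" where
 "zero_mod z = \<lparr>carrier = {z}, monoid.mult = undefined, one = undefined, ring.zero = z,
   add = (\<lambda>x y. z), smult = (\<lambda>r x. z)\<rparr>"

lemma zero_mod_simps [simp]:
 "car (zero_mod z) = {z}" "ring.zero (zero_mod z) = z"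
 "x \<oplus>\<^bsub>zero_mod z\<^esub> y = z" "r \<odot>\<^bsub>zero_mod z\<^esub> x = z"
 by (simp_all add: zero_mod_def)

lemma lm_zero_mod: "ring R \<Longrightarrow> left_module R (zero_mod z)"
 by (rule left_moduleI) auto

lemma submodule:
 fixes R :: "'r ring" and M :: "('r, 'm) module"
 assumes "left_module R M" "U \<subseteq> car M" "\<zero>\<^sub>M \<in> U"
  and "\<And>x y. x \<in> U \<Longrightarrow> y \<in> U \<Longrightarrow> x \<oplus>\<^sub>M y \<in> U"
  and "\<And>a x. a \<in> car R \<Longrightarrow> x \<in> U \<Longrightarrow> a \<odot>\<^sub>M x \<in> U"
 shows "left_module R (M\<lparr>carrier := U\<rparr>)"
proof -
 interpret M: lmod R M using assms by (simp add: lmod_iff)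
 interpret R: ring R by (rule M.ring)
 have [simp]: "x \<in> car M" if "x \<in> U" for x using that assms by auto
 \<comment> \<open>A negative is the multiple by \<open>\<ominus> \<one>\<close>, so closure under
   scalars covers it.\<close>
 have neg: "\<ominus>\<^sub>M x \<in> U" if "x \<in> U" for x
  using assms(5)[OF _ that, of "\<ominus>\<^sub>R \<one>\<^sub>R"] that by (simp add: M.smult_neg)
 show ?thesis
 proof (rule left_moduleI)
  show "\<exists>y \<in> car (M\<lparr>carrier := U\<rparr>). y \<oplus>\<^bsub>M\<lparr>carrier := U\<rparr>\<^esub> x = \<zero>\<^bsub>M\<lparr>carrier := U\<rparr>\<^esub>"
   if "x \<in> car (M\<lparr>carrier := U\<rparr>)" for x
   by (rule bexI[of _ "\<ominus>\<^sub>M x"]) (use that neg in auto)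
 qed (use assms in \<open>auto simp: M.ring M.ac M.smult_l_distr M.smult_r_distr M.smult_assoc\<close>)
qed

abbreviation ker_mod :: "('r, 'm) module \<Rightarrow> ('r, 'n) module \<Rightarrow> ('m \<Rightarrow> 'n) \<Rightarrow> ('r, 'm) module" where
 "ker_mod M N f \<equiv> M\<lparr>carrier := lker M N f\<rparr>"

abbreviation im_mod :: "('r, 'm) module \<Rightarrow> ('r, 'n) module \<Rightarrow> ('m \<Rightarrow> 'n) \<Rightarrow> ('r, 'n) module" where
 "im_mod M N f \<equiv> N\<lparr>carrier := f ` car M\<rparr>"

lemma (in lhm) lm_ker: "left_module R (ker_mod A B f)"
 by (rule submodule) (auto simp: lker_def A.left_module)

lemma (in lhm) lm_im: "left_module R (im_mod A B f)"
proof (rule submodule[OF B.left_module])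
 show "\<zero>\<^sub>B \<in> f ` car A" by (metis A.zero_closed imageI zero)
 show "x \<oplus>\<^sub>B y \<in> f ` car A" if "x \<in> f ` car A" "y \<in> f ` car A" for x y
  using that by clarify (metis A.add_closed add imageI)
 show "a \<odot>\<^sub>B x \<in> f ` car A" if "a \<in> car R" "x \<in> f ` car A" for a x
  using that by clarify (metis A.smult_closed smult imageI)
qed auto

lemma isomorphic_zero:
 assumes A: "left_module R A" "car A = {\<zero>\<^sub>A}" and B: "left_module R B" "car B = {\<zero>\<^sub>B}"
 shows "isomorphic R A B"
proof -
 have "bij_betw (\<lambda>x \<in> car A. \<zero>\<^sub>B) (car A) (car B)" unfolding A(2) B(2) by (simp add: bij_betw_def)
 then show ?thesis using lhom_zero[OF A(1) B(1)] by (auto simp: isomorphic_def lisos_def)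
qed

lemma lhom_update: "f \<in> lhom R A B \<Longrightarrow> f ` car A \<subseteq> U \<Longrightarrow> f \<in> lhom R A (B\<lparr>carrier := U\<rparr>)"
 by (auto simp: lhom_def PiE_def)

lemma lhom_im_mod: "f \<in> lhom R A B \<Longrightarrow> f \<in> lhom R A (im_mod A B f)"
 by (simp add: lhom_update)

section \<open>Finite powers of a module\<close>

definition mpow :: "nat \<Rightarrow> ('r, 'm) module \<Rightarrow> ('r, nat \<Rightarrow> 'm) module" where
 "mpow m M = \<lparr>carrier = {..<m} \<rightarrow>\<^sub>E car M, monoid.mult = undefined, one = undefined,
   ring.zero = (\<lambda>i \<in> {..<m}. \<zero>\<^sub>M), add = (\<lambda>x y. \<lambda>i \<in> {..<m}. x i \<oplus>\<^sub>M y i),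
   smult = (\<lambda>r x. \<lambda>i \<in> {..<m}. r \<odot>\<^sub>M x i)\<rparr>"

lemma carrier_pow: "car (mpow m M) = {..<m} \<rightarrow>\<^sub>E car M"
 and zero_pow: "\<zero>\<^bsub>mpow m M\<^esub> = (\<lambda>i \<in> {..<m}. \<zero>\<^sub>M)"
 and add_pow: "x \<oplus>\<^bsub>mpow m M\<^esub> y = (\<lambda>i \<in> {..<m}. x i \<oplus>\<^sub>M y i)"
 and smult_pow: "r \<odot>\<^bsub>mpow m M\<^esub> x = (\<lambda>i \<in> {..<m}. r \<odot>\<^sub>M x i)"
 by (simp_all add: mpow_def)
lemmas pow_defs = carrier_pow zero_pow add_pow smult_pow

lemma pow_closed [simp]: "x \<in> car (mpow m M) \<Longrightarrow> i < m \<Longrightarrow> x i \<in> car M"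
 by (auto simp: carrier_pow)

lemma pow_nth [simp]:
 "i < m \<Longrightarrow> \<zero>\<^bsub>mpow m M\<^esub> i = \<zero>\<^sub>M" "i < m \<Longrightarrow> (x \<oplus>\<^bsub>mpow m M\<^esub> y) i = x i \<oplus>\<^sub>M y i"
 "i < m \<Longrightarrow> (r \<odot>\<^bsub>mpow m M\<^esub> x) i = r \<odot>\<^sub>M x i"
 by (simp_all add: pow_defs)

lemma pow_eqI: "x \<in> car (mpow m M) \<Longrightarrow> y \<in> car (mpow m M) \<Longrightarrow>
  (\<And>i. i < m \<Longrightarrow> x i = y i) \<Longrightarrow> x = y"
 by (auto simp: carrier_pow intro: PiE_ext)

lemma restrict_pow [simp]: "(\<lambda>i \<in> {..<m}. x i) \<in> car (mpow m M) \<longleftrightarrow> (\<forall>i<m. x i \<in> car M)"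
 by (auto simp: carrier_pow)

lemma neg_pow_exists:
 assumes "abg M" "x \<in> car (mpow m M)"
 shows "\<exists>y \<in> car (mpow m M). y \<oplus>\<^bsub>mpow m M\<^esub> x = \<zero>\<^bsub>mpow m M\<^esub>"
proof -
 interpret M: abg M by fact
 show ?thesis
  by (rule bexI[of _ "\<lambda>i \<in> {..<m}. \<ominus>\<^sub>M (x i)"])
   (use assms in \<open>auto simp: add_pow zero_pow intro!: restrict_ext\<close>)
qed

lemma abg_pow:
 assumes "abg M" shows "abg (mpow m M)"
proof -
 interpret M: abg M by fact
 show ?thesis
 proof (rule abg.intro, rule abelian_groupI)
  show "\<exists>y \<in> car (mpow m M). y \<oplus>\<^bsub>mpow m M\<^esub> x = \<zero>\<^bsub>mpow m M\<^esub>"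
   if "x \<in> car (mpow m M)" for x using neg_pow_exists[OF assms that] .
  show "\<zero>\<^bsub>mpow m M\<^esub> \<oplus>\<^bsub>mpow m M\<^esub> x = x" if "x \<in> car (mpow m M)" for x
   by (rule pow_eqI[of _ m M]) (use that in \<open>auto simp: add_pow\<close>)
 qed (auto simp: zero_pow add_pow M.ac intro!: restrict_ext)
qed

lemma lm_pow:
 fixes R :: "'r ring" and M :: "('r, 'm) module"
 assumes "left_module R M" shows "left_module R (mpow m M)"
proof -
 interpret M: lmod R M using assms by (simp add: lmod_iff)
 interpret P: abg "mpow m M" by (rule abg_pow) unfold_locales
 show ?thesis
 proof (rule left_moduleI)
  show "\<one>\<^sub>R \<odot>\<^bsub>mpow m M\<^esub> x = x" if "x \<in> car (mpow m M)" for x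
   by (rule pow_eqI[of _ m M]) (use that in \<open>auto simp: smult_pow\<close>)
  show "\<exists>y \<in> car (mpow m M). y \<oplus>\<^bsub>mpow m M\<^esub> x = \<zero>\<^bsub>mpow m M\<^esub>"
   if "x \<in> car (mpow m M)" for x using neg_pow_exists[OF M.abg_axioms that] .
 qed (auto simp: P.ac M.ring, auto simp: smult_pow add_pow M.smult_l_distr M.smult_r_distr M.smult_assoc
    intro!: restrict_ext)
qed

lemma nsum_pow: "i < m \<Longrightarrow> nsum (mpow m M) f n i = nsum M (\<lambda>k. f k i) n"
 by (induction n) auto

section \<open>Free modules, linear combinations and projective modules\<close>

definition uvec :: "'r ring \<Rightarrow> 'x set \<Rightarrow> 'x \<Rightarrow> 'x \<Rightarrow> 'r" where
 "uvec R X j = (\<lambda>x \<in> X. if x = j then \<one>\<^sub>R else \<zero>\<^sub>R)"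

lemma uvec_nth [simp]: "x \<in> X \<Longrightarrow> uvec R X j x = (if x = j then \<one>\<^sub>R else \<zero>\<^sub>R)"
 by (simp add: uvec_def)

lemma carrier_free: "car (free_mod R X) = {f \<in> X \<rightarrow>\<^sub>E car R. finite {x \<in> X. f x \<noteq> \<zero>\<^sub>R}}"
 and zero_free: "\<zero>\<^bsub>free_mod R X\<^esub> = (\<lambda>x \<in> X. \<zero>\<^sub>R)"
 and add_free: "f \<oplus>\<^bsub>free_mod R X\<^esub> g = (\<lambda>x \<in> X. f x \<oplus>\<^sub>R g x)"
 and smult_free: "r \<odot>\<^bsub>free_mod R X\<^esub> f = (\<lambda>x \<in> X. r \<otimes>\<^sub>R f x)"
 by (simp_all add: free_mod_def)

lemma free_nth [simp]:
 "x \<in> X \<Longrightarrow> \<zero>\<^bsub>free_mod R X\<^esub> x = \<zero>\<^sub>R" "x \<in> X \<Longrightarrow> (f \<oplus>\<^bsub>free_mod R X\<^esub> g) x = f x \<oplus>\<^sub>R g x"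
 "x \<in> X \<Longrightarrow> (r \<odot>\<^bsub>free_mod R X\<^esub> f) x = r \<otimes>\<^sub>R f x"
 by (simp_all add: free_mod_def)

lemma free_closed [simp]: "f \<in> car (free_mod R X) \<Longrightarrow> x \<in> X \<Longrightarrow> f x \<in> car R"
 by (auto simp: carrier_free)

lemma free_eqI: "f \<in> car (free_mod R X) \<Longrightarrow> g \<in> car (free_mod R X) \<Longrightarrow>
  (\<And>x. x \<in> X \<Longrightarrow> f x = g x) \<Longrightarrow> f = g"
 by (auto simp: carrier_free intro: PiE_ext)

lemma lm_free:
 assumes "ring R" shows "left_module R (free_mod R X)"
proof -
 interpret R: ring R by fact
 let ?F = "free_mod R X"
 have add: "f \<oplus>\<^sub>?F g \<in> car ?F" if "f \<in> car ?F" "g \<in> car ?F" for f g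
 proof -
  have "finite ({x \<in> X. f x \<noteq> \<zero>\<^sub>R} \<union> {x \<in> X. g x \<noteq> \<zero>\<^sub>R})"
   using that by (auto simp: carrier_free)
  then have "finite {x \<in> X. f x \<oplus>\<^sub>R g x \<noteq> \<zero>\<^sub>R}"
   by (rule rev_finite_subset) auto
  then show ?thesis using that by (auto simp: carrier_free add_free PiE_mem cong: conj_cong)
 qed
 have smult: "a \<odot>\<^sub>?F f \<in> car ?F" if "a \<in> car R" "f \<in> car ?F" for a f
 proof -
  have "finite {x \<in> X. f x \<noteq> \<zero>\<^sub>R}"
   using that by (auto simp: carrier_free)
  then have "finite {x \<in> X. a \<otimes>\<^sub>R f x \<noteq> \<zero>\<^sub>R}"
   by (rule rev_finite_subset) (use that in auto)
  then show ?thesis using that by (auto simp: carrier_free smult_free PiE_mem cong: conj_cong)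
 qed
 have zero: "\<zero>\<^sub>?F \<in> car ?F" by (auto simp: carrier_free zero_free)
 note cl = add smult zero
 show ?thesis
 proof (rule left_moduleI)
  show "\<exists>g \<in> car ?F. g \<oplus>\<^sub>?F f = \<zero>\<^sub>?F" if "f \<in> car ?F" for f
  proof (rule bexI[of _ "(\<ominus>\<^sub>R \<one>\<^sub>R) \<odot>\<^sub>?F f"])
   show "(\<ominus>\<^sub>R \<one>\<^sub>R) \<odot>\<^sub>?F f \<oplus>\<^sub>?F f = \<zero>\<^sub>?F"
    by (rule free_eqI) (use that cl in \<open>auto simp: R.l_minus R.l_neg\<close>)
  qed (use cl that in auto)
 qed (auto simp: cl assms R.a_ac R.l_distr R.r_distr R.m_assoc intro!: free_eqI[of _ R X])
qed

lemma uvec_closed [simp]: "ring R \<Longrightarrow> uvec R X j \<in> car (free_mod R X)"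
proof -
 assume "ring R"
 then interpret R: ring R .
 have "finite {x \<in> X. uvec R X j x \<noteq> \<zero>\<^sub>R}"
  by (rule finite_subset[of _ "{j}"]) (auto split: if_splits)
 then show ?thesis by (auto simp: carrier_free uvec_def)
qed

lemma free_lhom_eqI:
 assumes M: "left_module R M" and f: "f \<in> lhom R (free_mod R X) M" and g: "g \<in> lhom R (free_mod R X) M"
  and eq: "\<And>x. x \<in> X \<Longrightarrow> f (uvec R X x) = g (uvec R X x)"
 shows "f = g"
proof (rule lhom_eqI[OF f g])
 interpret M: lmod R M using M by (simp add: lmod_iff)
 interpret R: ring R by (rule M.ring)
 let ?F = "free_mod R X"
 interpret f: lhm R ?F M f using f M by (simp add: lhmI lm_free M.ring)
 interpret g: lhm R ?F M g using g M by (simp add: lhmI lm_free M.ring)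
 \<comment> \<open>Induction on a finite set that contains the support: \<open>r'\<close> is
   \<open>r\<close> with the entry at the new index erased, and \<open>r\<close> is recovered by
   adding a multiple of one unit vector.\<close>
 have *: "finite S \<Longrightarrow> S \<subseteq> X \<Longrightarrow> r \<in> car ?F \<Longrightarrow> {x \<in> X. r x \<noteq> \<zero>\<^sub>R} \<subseteq> S \<Longrightarrow> f r = g r" for S r
 proof (induction S arbitrary: r rule: finite_induct)
  case empty
  then have "r = \<zero>\<^sub>?F" by (intro free_eqI[of _ R X]) auto
  then show ?case by simp
 next
  case (insert x S)
  define r' where "r' = (\<lambda>y \<in> X. if y = x then \<zero>\<^sub>R else r y)"
  have supp: "{y \<in> X. r' y \<noteq> \<zero>\<^sub>R} \<subseteq> S" using insert by (auto simp: r'_def split: if_splits)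
  have x: "x \<in> X" using insert by auto
  have r': "r' \<in> car ?F"
   using insert.prems finite_subset[OF supp \<open>finite S\<close>] by (auto simp: carrier_free r'_def)
  have r: "r = r' \<oplus>\<^sub>?F r x \<odot>\<^sub>?F uvec R X x"
   by (rule free_eqI[of _ R X]) (use r' insert.prems x M.ring in \<open>auto simp: r'_def\<close>)
  have "f r' = g r'" using insert r' supp by auto
  then show ?case
   using r' insert.prems x M.ring eq[OF x] by (subst (1 2) r) auto
 qed
 show "f r = g r" if "r \<in> car ?F" for r
  by (rule *[of "{x \<in> X. r x \<noteq> \<zero>\<^sub>R}"]) (use that in \<open>auto simp: carrier_free\<close>)
qed

lemma free_lhom_exists:
 assumes M: "left_module R M" and v: "\<And>x. x \<in> X \<Longrightarrow> v x \<in> car M"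
 shows "\<exists>h \<in> lhom R (free_mod R X) M. \<forall>x \<in> X. h (uvec R X x) = v x"
proof -
 interpret M: lmod R M using M by (simp add: lmod_iff)
 interpret R: ring R by (rule M.ring)
 interpret AM: abelian_group M by (rule M.abelian_group)
 let ?F = "free_mod R X"
 interpret F: lmod R ?F by (simp add: lmod_iff lm_free M.ring)
 let ?s = "\<lambda>r. {x \<in> X. r x \<noteq> \<zero>\<^sub>R}"
 define h where "h r = finsum M (\<lambda>x. r x \<odot>\<^sub>M v x) (?s r)" for r
 have cl: "(\<lambda>x. r x \<odot>\<^sub>M v x) \<in> X \<rightarrow> car M" if "r \<in> car ?F" for r
  using that v by auto
 \<comment> \<open>The sum may be taken over any finite set containing the support, which lets two
   vectors and their sum be compared over one common set.\<close>
 have h: "h r = finsum M (\<lambda>x. r x \<odot>\<^sub>M v x) S"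
  if "r \<in> car ?F" "finite S" "S \<subseteq> X" "?s r \<subseteq> S" for r S
  unfolding h_def using that cl[OF that(1)] v
  by (intro AM.add.finprod_mono_neutral_cong_left) auto
 have fin: "finite (?s r)" if "r \<in> car ?F" for r
  using that by (simp add: carrier_free)
 have closed: "h r \<in> car M" if "r \<in> car ?F" for r
  unfolding h_def using cl[OF that] by (intro AM.finsum_closed) auto
 have "restrict h (car ?F) \<in> lhom R ?F M"
 proof (rule restrict_lhomI[OF F.left_module])
  fix r s assume rs: "r \<in> car ?F" "s \<in> car ?F"
  let ?S = "?s r \<union> ?s s"
  have S: "finite ?S" "?S \<subseteq> X" "?s (r \<oplus>\<^sub>?F s) \<subseteq> ?S" using rs fin by auto
  have "h (r \<oplus>\<^sub>?F s) = finsum M (\<lambda>x. (r \<oplus>\<^sub>?F s) x \<odot>\<^sub>M v x) ?S"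
   using rs S by (intro h) auto
  also have "\<dots> = finsum M (\<lambda>x. r x \<odot>\<^sub>M v x \<oplus>\<^sub>M s x \<odot>\<^sub>M v x) ?S"
   using rs v by (intro AM.finsum_cong') (auto simp: M.smult_l_distr)
  also have "\<dots> = finsum M (\<lambda>x. r x \<odot>\<^sub>M v x) ?S \<oplus>\<^sub>M finsum M (\<lambda>x. s x \<odot>\<^sub>M v x) ?S"
   using cl rs S by (intro AM.finsum_addf) auto
  also have "\<dots> = h r \<oplus>\<^sub>M h s"
   using rs S h[of r ?S] h[of s ?S] by simp
  finally show "h (r \<oplus>\<^sub>?F s) = h r \<oplus>\<^sub>M h s" .
 next
  fix a r assume a: "a \<in> car R" and r: "r \<in> car ?F"
  have *: "finsum M (\<lambda>x. a \<odot>\<^sub>M (r x \<odot>\<^sub>M v x)) T = a \<odot>\<^sub>M finsum M (\<lambda>x. r x \<odot>\<^sub>M v x) T"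
   if "finite T" "T \<subseteq> X" for T
   using that
  proof (induction T rule: finite_induct)
   case (insert x T)
   have i: "(\<lambda>x. r x \<odot>\<^sub>M v x) \<in> T \<rightarrow> car M" "r x \<odot>\<^sub>M v x \<in> car M"
    "(\<lambda>x. a \<odot>\<^sub>M (r x \<odot>\<^sub>M v x)) \<in> T \<rightarrow> car M"
    using cl[OF r] insert.prems r a v by (auto simp: Pi_def)
   then show ?case
    using insert a AM.finsum_closed[OF i(1)] by (simp add: M.smult_r_distr)
  qed (use a in auto)
  have "h (a \<odot>\<^sub>?F r) = finsum M (\<lambda>x. (a \<odot>\<^sub>?F r) x \<odot>\<^sub>M v x) (?s r)"
   using a r fin by (intro h) auto
  also have "\<dots> = finsum M (\<lambda>x. a \<odot>\<^sub>M (r x \<odot>\<^sub>M v x)) (?s r)"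
   using a r v by (intro AM.finsum_cong') (auto simp: M.smult_assoc)
  also have "\<dots> = a \<odot>\<^sub>M h r" using *[OF fin[OF r]] by (simp add: h_def)
  finally show "h (a \<odot>\<^sub>?F r) = a \<odot>\<^sub>M h r" .
 qed (use closed in auto)
 moreover have "h (uvec R X x) = v x" if x: "x \<in> X" for x
 proof -
  have "{y \<in> X. uvec R X x y \<noteq> \<zero>\<^sub>R} \<subseteq> {x}" by (auto split: if_splits)
  then show ?thesis
   using h[of "uvec R X x" "{x}"] x v M.ring by (simp add: AM.finsum_insert)
 qed
 ultimately show ?thesis using M.ring by (intro bexI[of _ "restrict h (car ?F)"]) auto
qed

abbreviation fr :: "'r ring \<Rightarrow> nat \<Rightarrow> ('r, nat \<Rightarrow> 'r) module" where
 "fr R m \<equiv> free_mod R {..<m}"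

lemma carrier_fr: "car (fr R m) = {..<m} \<rightarrow>\<^sub>E car R"
 by (auto simp: carrier_free)

lemma restrict_fr [simp]: "(\<lambda>i \<in> {..<m}. x i) \<in> car (fr R m) \<longleftrightarrow> (\<forall>i<m. x i \<in> car R)"
 by (auto simp: carrier_fr)

definition lincomb :: "('r, 'm) module \<Rightarrow> nat \<Rightarrow> (nat \<Rightarrow> 'm) \<Rightarrow> (nat \<Rightarrow> 'r) \<Rightarrow> 'm" where
 "lincomb M m v r = nsum M (\<lambda>k. r k \<odot>\<^sub>M v k) m"

context lmod begin

lemma lincomb_closed [simp]:
 "(\<And>k. k < m \<Longrightarrow> v k \<in> car M) \<Longrightarrow> r \<in> car (fr R m) \<Longrightarrow> lincomb M m v r \<in> car M"
 by (auto simp: lincomb_def)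

lemma lincomb_lhom:
 assumes v: "\<And>k. k < m \<Longrightarrow> v k \<in> car M"
 shows "restrict (lincomb M m v) (car (fr R m)) \<in> lhom R (fr R m) M"
proof (rule restrict_lhomI)
 fix r s assume "r \<in> car (fr R m)" "s \<in> car (fr R m)"
 then show "lincomb M m v (r \<oplus>\<^bsub>fr R m\<^esub> s) = lincomb M m v r \<oplus>\<^sub>M lincomb M m v s"
  unfolding lincomb_def using v
  by (subst nsum_add[symmetric]) (auto simp: smult_l_distr intro!: nsum_cong)
next
 fix a r assume "a \<in> car R" "r \<in> car (fr R m)"
 then show "lincomb M m v (a \<odot>\<^bsub>fr R m\<^esub> r) = a \<odot>\<^sub>M lincomb M m v r"
  unfolding lincomb_def using v
  by (subst smult_nsum) (auto simp: smult_assoc intro!: nsum_cong)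
qed (use v in \<open>auto simp: lm_free ring\<close>)

lemma lincomb_uvec [simp]: 
 assumes "j < m" "\<And>k. k < m \<Longrightarrow> v k \<in> car M"
 shows "lincomb M m v (uvec R {..<m} j) = v j"
proof -
 have "lincomb M m v (uvec R {..<m} j) = nsum M (\<lambda>k. if k = j then v k else \<zero>\<^sub>M) m"
  unfolding lincomb_def by (rule nsum_cong) (use assms in auto)
 then show ?thesis using assms by (simp add: nsum_delta)
qed

lemma lhom_fr_eq_lincomb:
 assumes h: "h \<in> lhom R (fr R m) M" and r: "r \<in> car (fr R m)"
 shows "h r = lincomb M m (\<lambda>k. h (uvec R {..<m} k)) r"
proof -
 have v: "h (uvec R {..<m} k) \<in> car M" for k
  by (rule lhom_closed[OF h uvec_closed[OF ring]])
 have "h = restrict (lincomb M m (\<lambda>k. h (uvec R {..<m} k))) (car (fr R m))"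
  by (rule free_lhom_eqI[OF left_module h lincomb_lhom]) (use v ring in auto)
 then show ?thesis using r by (metis restrict_apply)
qed

end

lemma (in lhm) lincomb:
 assumes "\<And>k. k < m \<Longrightarrow> v k \<in> car A" "r \<in> car (fr R m)"
 shows "f (lincomb A m v r) = lincomb B m (\<lambda>k. f (v k)) r"
 using assms unfolding lincomb_def by (subst nsum) (auto intro!: nsum_cong)

text \<open>The index set may have any type. This covers the modules \<open>fr R m\<close>, indexed
  by numbers, together with the projectives of a chosen resolution, indexed by the type of the
  module itself.\<close>

definition proj_via :: "'r ring \<Rightarrow> ('r, 'm) module \<Rightarrow> 'x set \<Rightarrow> bool" where
 "proj_via R P X \<longleftrightarrow> (\<exists>i p. i \<in> lhom R P (free_mod R X) \<and> p \<in> lhom R (free_mod R X) P \<and>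
    (\<forall>x \<in> car P. p (i x) = x))"

lemma projective_iff: "projective R P \<longleftrightarrow> left_module R P \<and> (\<exists>X :: 'm set. proj_via R P X)"
 for P :: "('r, 'm) module"
 by (auto simp: projective_def proj_via_def)

lemma proj_via_free: "ring R \<Longrightarrow> proj_via R (free_mod R X) X"
 unfolding proj_via_def using lhom_id[OF lm_free] by fastforce

text \<open>The values at the basis of the free module are lifted one by one, and the resulting map
  is precomposed with the section \<open>i\<close>. Requiring only that the image of
  \<open>f\<close> lies in that of \<open>g\<close> avoids cutting down codomains when lifting
  against a differential.\<close>

lemma proj_lift:
 assumes P: "left_module R P" "proj_via R P X" and L: "left_module R L" and N: "left_module R N"
  and f: "f \<in> lhom R P N" and g: "g \<in> lhom R L N" and sub: "f ` car P \<subseteq> g ` car L"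
 obtains h where "h \<in> lhom R P L" "\<And>x. x \<in> car P \<Longrightarrow> g (h x) = f x"
proof -
 let ?F = "free_mod R X"
 interpret P: lmod R P using P by (simp add: lmod_iff)
 note ring = P.ring
 obtain i p where i: "i \<in> lhom R P ?F" and p: "p \<in> lhom R ?F P" and pi: "\<And>x. x \<in> car P \<Longrightarrow> p (i x) = x"
  using P(2) by (auto simp: proj_via_def)
 have "\<exists>v. v \<in> car L \<and> g v = f (p (uvec R X x))" for x
 proof -
  have "f (p (uvec R X x)) \<in> g ` car L"
   using sub lhom_closed[OF p uvec_closed[OF ring]] by blast
  then show ?thesis by force
 qed
 then obtain v where v: "\<And>x. v x \<in> car L" "\<And>x. g (v x) = f (p (uvec R X x))"
  by metis
 obtain h where h: "h \<in> lhom R ?F L" "\<And>x. x \<in> X \<Longrightarrow> h (uvec R X x) = v x"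
  using free_lhom_exists[OF L, of X v] v by auto
 have F: "left_module R ?F" by (rule lm_free[OF ring])
 have "compose (car ?F) g h = compose (car ?F) f p"
  by (rule free_lhom_eqI[OF N]) (use lhom_compose[OF F h(1) g] lhom_compose[OF F p f] h v ring in
   \<open>auto simp: compose_def\<close>)
 then have gh: "g (h r) = f (p r)" if "r \<in> car ?F" for r
  using that by (metis compose_eq)
 show thesis
 proof
  show "compose (car P) h i \<in> lhom R P L" by (rule lhom_compose[OF P(1) i h(1)])
  show "g (compose (car P) h i x) = f x" if "x \<in> car P" for x
   using that gh[of "i x"] pi[of x] lhom_closed[OF i] by (simp add: compose_def)
 qed
qed

section \<open>Short exact sequences of modules\<close>

definition ses :: "'r ring \<Rightarrow> ('r, 'a) module \<Rightarrow> ('r, 'b) module \<Rightarrow> ('r, 'z) module \<Rightarrow>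
  ('a \<Rightarrow> 'b) \<Rightarrow> ('b \<Rightarrow> 'z) \<Rightarrow> bool" where
 "ses R A B Z f g \<longleftrightarrow> left_module R A \<and> left_module R B \<and> left_module R Z \<and>
   f \<in> lhom R A B \<and> g \<in> lhom R B Z \<and> inj_on f (car A) \<and> g ` car B = car Z \<and>
   f ` car A = lker B Z g"

locale sesm = f: lhm R A B f + g: lhm R B Z g
 for R (structure) and A (structure) and B (structure) and Z (structure) and f g +
 assumes inj: "inj_on f (car A)" and surj: "g ` car B = car Z"
  and exact: "f ` car A = lker B Z g"
begin

lemma gf [simp]: "x \<in> car A \<Longrightarrow> g (f x) = \<zero>\<^sub>Z"
 using exact by (auto simp: lker_def)

lemma exactE: 
 assumes "y \<in> car B" "g y = \<zero>\<^sub>Z"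
 obtains x where "x \<in> car A" "f x = y"
proof -
 have "y \<in> f ` car A" using assms exact by (simp add: lker_def)
 then show thesis using that by auto
qed

lemma surjE: 
 assumes "z \<in> car Z"
 obtains y where "y \<in> car B" "g y = z"
proof -
 have "z \<in> g ` car B" using assms surj by simp
 then show thesis using that by auto
qed

lemma f_eq_iff [simp]: "x \<in> car A \<Longrightarrow> y \<in> car A \<Longrightarrow> f x = f y \<longleftrightarrow> x = y"
 using inj by (auto simp: inj_on_def)

lemma f_zero_iff: "x \<in> car A \<Longrightarrow> f x = \<zero>\<^sub>B \<longleftrightarrow> x = \<zero>\<^sub>A"
 using f.inj_on_zeroD[OF inj] by auto

end

lemma ses_iff: "ses R A B Z f g \<longleftrightarrow> sesm R A B Z f g"
 by (auto simp: ses_def sesm_def sesm_axioms_def lhm_def lhm_axioms_def lmod_iff)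

lemma (in lhm) ses_ker: 
 assumes "f ` car A = car B"
 shows "ses R (ker_mod A B f) A B (\<lambda>x \<in> lker A B f. x) f"
proof -
 have "(\<lambda>x \<in> lker A B f. x) \<in> lhom R (ker_mod A B f) A"
  using restrict_lhomI[OF lm_ker, of "\<lambda>x. x" A] by (auto simp: lker_def)
 moreover have "(\<lambda>x \<in> lker A B f. x) ` lker A B f = lker A B f" by simp
 ultimately show ?thesis
  using assms lm_ker A.left_module B.left_module lhom
  by (simp add: ses_def)
qed

lemma lhom_lift_inj:
 assumes P: "left_module R P" and A: "left_module R A" and B: "left_module R B"
  and f: "f \<in> lhom R A B" "inj_on f (car A)" and h: "h \<in> lhom R P B"
  and sub: "\<And>x. x \<in> car P \<Longrightarrow> h x \<in> f ` car A"
 obtains h' where "h' \<in> lhom R P A" "\<And>x. x \<in> car P \<Longrightarrow> f (h' x) = h x"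
proof -
 interpret f: lhm R A B f by (intro lhmI A B f)
 interpret h: lhm R P B h by (intro lhmI P B h)
 let ?w = "\<lambda>x. the_inv_into (car A) f (h x)"
 have w: "?w x \<in> car A" "f (?w x) = h x" if "x \<in> car P" for x
  using sub[OF that] f(2) by (auto simp: f_the_inv_into_f intro: the_inv_into_into)
 have w': "?w x = a" if "a \<in> car A" "f a = h x" for a x
  using that f(2) by (metis the_inv_into_f_f)
 have "restrict ?w (car P) \<in> lhom R P A"
 proof (rule restrict_lhomI[OF P])
  show "?w (x \<oplus>\<^sub>P y) = ?w x \<oplus>\<^sub>A ?w y" if "x \<in> car P" "y \<in> car P" for x y
   by (rule w') (use that w in auto)
  show "?w (a \<odot>\<^sub>P x) = a \<odot>\<^sub>A ?w x" if "a \<in> car R" "x \<in> car P" for a x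
   by (rule w') (use that w in auto)
 qed (rule w)
 then show thesis using that w(2) by simp
qed

section \<open>Copies of modules over another type\<close>

lemma inj_code:
 assumes "car M \<lesssim> (UNIV :: 'u set)"
 shows "inj_on (code M :: 'm \<Rightarrow> 'u) (car M)"
proof -
 obtain e :: "'m \<Rightarrow> 'u" where "inj_on e (car M)" using assms by (auto simp: lepoll_def)
 then show ?thesis unfolding code_def by (rule someI[of "\<lambda>e. inj_on e (car M)"])
qed

lemma decode_code [simp]:
 assumes "car M \<lesssim> (UNIV :: 'u set)" "x \<in> car M"
 shows "decode M (code M x :: 'u) = x"
 using inj_code[OF assms(1)] assms(2) by (simp add: decode_def)

lemma copy_simps [simp]:
 "car (copy M) = code M ` car M" "\<zero>\<^bsub>copy M\<^esub> = code M \<zero>\<^sub>M"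
 "x \<oplus>\<^bsub>copy M\<^esub> y = code M (decode M x \<oplus>\<^sub>M decode M y)"
 "r \<odot>\<^bsub>copy M\<^esub> x = code M (r \<odot>\<^sub>M decode M x)"
 by (simp_all add: copy_def)

lemma lm_copy:
 fixes R :: "'r ring" and M :: "('r, 'm) module"
 assumes "left_module R M" "car M \<lesssim> (UNIV :: 'u set)"
 shows "left_module R (copy M :: ('r, 'u) module)"
proof -
 interpret M: lmod R M using assms by (simp add: lmod_iff)
 interpret R: ring R by (rule M.ring)
 note [simp] = decode_code[OF assms(2)]
 show ?thesis
 proof (rule left_moduleI)
  show "\<exists>y \<in> car (copy M). y \<oplus>\<^bsub>copy M\<^esub> x = \<zero>\<^bsub>copy M :: ('r, 'u) module\<^esub>"
   if "x \<in> car (copy M)" for x :: 'u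
   using that by (auto intro!: bexI[of _ "\<ominus>\<^sub>M decode M x"])
 qed (auto simp: M.ac M.ring M.smult_l_distr M.smult_r_distr M.smult_assoc)
qed

lemma code_lisos:
 fixes R :: "'r ring" and M :: "('r, 'm) module"
 assumes "left_module R M" "car M \<lesssim> (UNIV :: 'u set)"
 shows "restrict (code M) (car M) \<in> lisos R M (copy M :: ('r, 'u) module)"
proof -
 interpret M: lmod R M using assms by (simp add: lmod_iff)
 note [simp] = decode_code[OF assms(2)]
 have "restrict (code M) (car M) \<in> lhom R M (copy M :: ('r, 'u) module)"
  by (rule restrict_lhomI[OF assms(1)]) auto
 then show ?thesis
  using inj_code[OF assms(2)] by (simp add: lisos_def bij_betw_def inj_on_restrict_eq)
qed

lemma decode_lisos:
 fixes R :: "'r ring" and M :: "('r, 'm) module"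
 assumes M: "left_module R M" and small: "car M \<lesssim> (UNIV :: 'u set)"
 shows "restrict (decode M) (car (copy M)) \<in> lisos R (copy M :: ('r, 'u) module) M"
proof -
 interpret M: lmod R M using M by (simp add: lmod_iff)
 have dc: "decode M (code M x :: 'u) = x" if "x \<in> car M" for x by (rule decode_code[OF small that])
 have "restrict (decode M) (car (copy M)) \<in> lhom R (copy M :: ('r, 'u) module) M"
  by (rule restrict_lhomI[OF lm_copy[OF M small]]) (auto simp: dc)
 moreover have "bij_betw (restrict (decode M) (car (copy M))) (car (copy M :: ('r, 'u) module)) (car M)"
  by (rule bij_betw_imageI) (auto simp: inj_on_def dc image_image cong: image_cong)
 ultimately show ?thesis by (simp add: lisos_def)
qed

lemma isomorphic_copy:
 fixes R :: "'r ring" and M :: "('r, 'm) module"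
 assumes "left_module R M" "car M \<lesssim> (UNIV :: 'u set)"
 shows "isomorphic R M (copy M :: ('r, 'u) module)"
 using code_lisos[OF assms] by (auto simp: isomorphic_def)

section \<open>Finitely presented modules\<close>

primrec FPk :: "nat \<Rightarrow> 'r ring \<Rightarrow> ('r, nat \<Rightarrow> 'r) module \<Rightarrow> bool" where
 "FPk 0 R K \<longleftrightarrow> fin_gen R K"
| "FPk (Suc n) R K \<longleftrightarrow> left_module R K \<and> (\<exists>m f. f \<in> lhom R (fr R m) K \<and>
   f ` car (fr R m) = car K \<and> FPk n R (ker_mod (fr R m) K f))"

text \<open>The kernels of presentations live in one fixed type, so that \<^const>\<open>FPk\<close> can be defined by
 recursion; the following predicate is its extension to modules over arbitrary types.\<close>

definition FP :: "nat \<Rightarrow> 'r ring \<Rightarrow> ('r, 'm) module \<Rightarrow> bool" where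
 "FP n R M \<longleftrightarrow> left_module R M \<and> (\<exists>m f. f \<in> lhom R (fr R m) M \<and>
   f ` car (fr R m) = car M \<and> (\<forall>n'. n = Suc n' \<longrightarrow> FPk n' R (ker_mod (fr R m) M f)))"

lemma FPk_eq_FP: "FPk n R K \<longleftrightarrow> FP n R K"
 by (cases n) (auto simp: FP_def fin_gen_def)

lemma FP_0: "FP 0 R M \<longleftrightarrow> fin_gen R M"
 by (auto simp: FP_def fin_gen_def)

lemma FP_Suc: "FP (Suc n) R M \<longleftrightarrow> left_module R M \<and> (\<exists>m f. f \<in> lhom R (fr R m) M \<and>
   f ` car (fr R m) = car M \<and> FP n R (ker_mod (fr R m) M f))"
 by (auto simp: FP_def[of "Suc n"] FPk_eq_FP)

lemma FP_0I: "left_module R M \<Longrightarrow> f \<in> lhom R (fr R m) M \<Longrightarrow> f ` car (fr R m) = car M \<Longrightarrow> FP 0 R M"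
 by (auto simp: FP_0 fin_gen_def)

lemma FP_SucI: "left_module R M \<Longrightarrow> f \<in> lhom R (fr R m) M \<Longrightarrow> f ` car (fr R m) = car M \<Longrightarrow>
  FP n R (ker_mod (fr R m) M f) \<Longrightarrow> FP (Suc n) R M"
 unfolding FP_Suc by blast

lemma FP_left_module: "FP n R M \<Longrightarrow> left_module R M"
 by (simp add: FP_def)

lemma FP_SucD_fin_gen: "FP n R M \<Longrightarrow> fin_gen R M"
 by (auto simp: FP_def fin_gen_def)

lemma FP_Suc_imp_FP: "FP (Suc n) R M \<Longrightarrow> FP n R M"
proof -
 \<comment> \<open>The induction runs over modules in the type of the kernels, since the first
   syzygy leaves the type of \<open>M\<close>; the case distinction below adds that first
   step.\<close>
 have K: "FP (Suc n) R K \<Longrightarrow> FP n R K" for K :: "('r, nat \<Rightarrow> 'r) module" and n and R :: "'r ring"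
 proof (induction n arbitrary: K)
  case 0
  then show ?case using FP_SucD_fin_gen FP_0 by blast
 next
  case (Suc n)
  then show ?case by (subst FP_Suc, subst (asm) FP_Suc) blast
 qed
 assume "FP (Suc n) R M"
 then show ?thesis
 proof (cases n)
  case 0
  then show ?thesis using \<open>FP (Suc n) R M\<close> FP_SucD_fin_gen FP_0 by blast
 next
  case (Suc k)
  then show ?thesis using \<open>FP (Suc n) R M\<close> K by (subst Suc, subst FP_Suc, subst (asm) FP_Suc) blast
 qed
qed

lemma FP_iso:
 assumes "FP n R A" "left_module R B" "isomorphic R A B"
 shows "FP n R B"
proof -
 obtain e where e: "e \<in> lhom R A B" "bij_betw e (car A) (car B)"
  using assms by (auto simp: isomorphic_def lisos_def)
 obtain m f where f: "f \<in> lhom R (fr R m) A" "f ` car (fr R m) = car A"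
  "\<And>n'. n = Suc n' \<Longrightarrow> FPk n' R (ker_mod (fr R m) A f)"
  using assms by (auto simp: FP_def)
 interpret e: lhm R A B e using e assms by (intro lhmI) (auto simp: FP_def)
 have F: "left_module R (fr R m)" by (rule lm_free[OF e.A.ring])
 interpret f: lhm R "fr R m" A f using f F e.A.left_module by (intro lhmI)
 let ?g = "compose (car (fr R m)) e f"
 have "lker (fr R m) B ?g = lker (fr R m) A f"
  using e.inj_on_zeroD[OF bij_betw_imp_inj_on[OF e(2)]] by (auto simp: lker_def compose_def)
 moreover have "?g ` car (fr R m) = car B"
  using e(2) f(2) by (auto simp: bij_betw_def surj_compose)
 ultimately show ?thesis
  using f lhom_compose[OF F f(1) e(1)] assms(2) unfolding FP_def by metis
qed

lemma carrier_fr_0 [simp]: "car (free_mod R {}) = {\<lambda>x. undefined}"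
 by (auto simp: carrier_free)

lemma FP_zero:
 assumes M: "left_module R M" "car M = {\<zero>\<^sub>M}"
 shows "FP n R M"
proof -
 interpret M: lmod R M using M by (simp add: lmod_iff)
 let ?F = "fr R 0"
 have F: "left_module R ?F" by (rule lm_free[OF M.ring])
 have z: "car ?F = {\<zero>\<^sub>?F}" by (simp add: carrier_fr_0 zero_free restrict_def)
 have "FP n R ?F"
 proof (induction n)
  case 0
  show ?case by (rule FP_0I[OF F lhom_id[OF F]]) simp
 next
  case (Suc n)
  have "ker_mod ?F ?F (\<lambda>x \<in> car ?F. x) = ?F" unfolding lker_def using z by auto
  then show ?case using Suc by (intro FP_SucI[OF F lhom_id[OF F]]) simp_all
 qed
 then show ?thesis by (rule FP_iso[OF _ M(1) isomorphic_zero[OF F z M]])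
qed

lemma FP_fr: 
 assumes R: "ring R" shows "FP n R (fr R m)"
proof -
 let ?F = "fr R m" and ?i = "\<lambda>x \<in> car (fr R m). x"
 have F: "left_module R ?F" by (rule lm_free[OF R])
 interpret i: lhm R ?F ?F ?i by (intro lhmI F lhom_id)
 have "car (ker_mod ?F ?F ?i) = {\<zero>\<^bsub>ker_mod ?F ?F ?i\<^esub>}" by (auto simp: lker_def)
 then have "FP k R (ker_mod ?F ?F ?i)" for k by (rule FP_zero[OF i.lm_ker])
 then show ?thesis by (cases n) (simp_all add: FP_0I[OF F i.lhom] FP_SucI[OF F i.lhom])
qed

text \<open>\<open>pi1\<close>, \<open>pi2\<close> and \<open>join\<close> identify
  \<open>fr R (a + b)\<close> with the product of \<open>fr R a\<close> and
  \<open>fr R b\<close>.\<close>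

definition pi1 :: "nat \<Rightarrow> (nat \<Rightarrow> 'r) \<Rightarrow> nat \<Rightarrow> 'r" where
 "pi1 a r = (\<lambda>i \<in> {..<a}. r i)"
definition pi2 :: "nat \<Rightarrow> nat \<Rightarrow> (nat \<Rightarrow> 'r) \<Rightarrow> nat \<Rightarrow> 'r" where
 "pi2 a b r = (\<lambda>i \<in> {..<b}. r (a + i))"
definition join :: "nat \<Rightarrow> nat \<Rightarrow> (nat \<Rightarrow> 'r) \<Rightarrow> (nat \<Rightarrow> 'r) \<Rightarrow> nat \<Rightarrow> 'r" where
 "join a b u v = (\<lambda>i \<in> {..<a + b}. if i < a then u i else v (i - a))"

lemma pi_join_closed [simp]:
 "r \<in> car (fr R (a + b)) \<Longrightarrow> pi1 a r \<in> car (fr R a)"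
 "r \<in> car (fr R (a + b)) \<Longrightarrow> pi2 a b r \<in> car (fr R b)"
 "u \<in> car (fr R a) \<Longrightarrow> v \<in> car (fr R b) \<Longrightarrow> join a b u v \<in> car (fr R (a + b))"
 by (auto simp: pi1_def pi2_def join_def)

lemma pi_linear [simp]:
 "pi1 a \<zero>\<^bsub>fr R (a + b)\<^esub> = \<zero>\<^bsub>fr R a\<^esub>"
 "pi1 a (r \<oplus>\<^bsub>fr R (a + b)\<^esub> s) = pi1 a r \<oplus>\<^bsub>fr R a\<^esub> pi1 a s"
 "pi1 a (x \<odot>\<^bsub>fr R (a + b)\<^esub> r) = x \<odot>\<^bsub>fr R a\<^esub> pi1 a r"
 "pi2 a b \<zero>\<^bsub>fr R (a + b)\<^esub> = \<zero>\<^bsub>fr R b\<^esub>"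
 "pi2 a b (r \<oplus>\<^bsub>fr R (a + b)\<^esub> s) = pi2 a b r \<oplus>\<^bsub>fr R b\<^esub> pi2 a b s"
 "pi2 a b (x \<odot>\<^bsub>fr R (a + b)\<^esub> r) = x \<odot>\<^bsub>fr R b\<^esub> pi2 a b r"
 by (simp_all add: pi1_def pi2_def free_mod_def cong: restrict_cong)

lemma pi_join [simp]:
 "u \<in> car (fr R a) \<Longrightarrow> pi1 a (join a b u v) = u"
 "v \<in> car (fr R b) \<Longrightarrow> pi2 a b (join a b u v) = v"
 "r \<in> car (fr R (a + b)) \<Longrightarrow> join a b (pi1 a r) (pi2 a b r) = r"
proof -
 show "pi1 a (join a b u v) = u" if "u \<in> car (fr R a)"
  by (rule extensionalityI[of _ "{..<a}"]) (use that in \<open>auto simp: pi1_def join_def carrier_fr PiE_def\<close>)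
 show "pi2 a b (join a b u v) = v" if "v \<in> car (fr R b)"
  by (rule extensionalityI[of _ "{..<b}"]) (use that in \<open>auto simp: pi2_def join_def carrier_fr PiE_def\<close>)
 show "join a b (pi1 a r) (pi2 a b r) = r" if "r \<in> car (fr R (a + b))"
  by (rule extensionalityI[of _ "{..<a+b}"])
   (use that in \<open>auto simp: pi1_def pi2_def join_def carrier_fr PiE_def\<close>)
qed

lemma join_add: "join a b (u \<oplus>\<^bsub>fr R a\<^esub> u') (v \<oplus>\<^bsub>fr R b\<^esub> v') =
  join a b u v \<oplus>\<^bsub>fr R (a + b)\<^esub> join a b u' v'"
 and join_smult: "join a b (x \<odot>\<^bsub>fr R a\<^esub> u) (x \<odot>\<^bsub>fr R b\<^esub> v) = x \<odot>\<^bsub>fr R (a + b)\<^esub> join a b u v"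
 by (auto simp: join_def free_mod_def intro!: restrict_ext)

lemma sesI:
 assumes "left_module R A" "left_module R B" "left_module R Z"
  and "f \<in> lhom R A B" "g \<in> lhom R B Z" "inj_on f (car A)"
  and "\<And>z. z \<in> car Z \<Longrightarrow> \<exists>y \<in> car B. g y = z"
  and "\<And>x. x \<in> car A \<Longrightarrow> g (f x) = \<zero>\<^sub>Z"
  and "\<And>y. y \<in> car B \<Longrightarrow> g y = \<zero>\<^sub>Z \<Longrightarrow> \<exists>x \<in> car A. f x = y"
 shows "ses R A B Z f g"
 unfolding ses_def
proof (intro conjI)
 show "g ` car B = car Z" using assms(5,7) by (auto simp: image_iff dest: lhom_closed)
 show "f ` car A = lker B Z g"
 proof (intro Set.set_eqI iffI)
  fix y assume "y \<in> lker B Z g"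
  then have "\<exists>x \<in> car A. f x = y" by (intro assms(9)) (auto simp: lker_def)
  then show "y \<in> f ` car A" by auto
 qed (use assms(8) lhom_closed[OF assms(4)] in \<open>auto simp: lker_def\<close>)
qed (use assms in auto)

lemma FP_obtain:
 assumes "FP n R A"
 obtains m p where "p \<in> lhom R (fr R m) A" "p ` car (fr R m) = car A"
  "\<forall>n'. n = Suc n' \<longrightarrow> FP n' R (ker_mod (fr R m) A p)"
 using assms unfolding FPk_eq_FP[symmetric] FP_def by blast

lemma FP_fg_obtain:
 assumes "FP n R A"
 obtains m p where "p \<in> lhom R (fr R m) A" "p ` car (fr R m) = car A"
 using assms by (auto simp: FP_def)

text \<open>One step of the horseshoe lemma: the cover of \<open>Z\<close> lifts through
  \<open>g\<close>, so the covers of \<open>A\<close> and \<open>Z\<close> combine to a cover of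
  \<open>B\<close>, and the three kernels form a short exact sequence again, which feeds the
  induction.\<close>

lemma FP_ext_step:
 fixes A :: "('r, 'a) module" and B :: "('r, 'b) module" and Z :: "('r, 'z) module"
 assumes S: "ses R A B Z f g" and A: "FP n R A" and Z: "FP n R Z"
 obtains m h mA pA mZ pZ u v where "h \<in> lhom R (fr R m) B" "h ` car (fr R m) = car B"
  "\<And>n'. n = Suc n' \<Longrightarrow> FP n' R (ker_mod (fr R mA) A pA)"
  "\<And>n'. n = Suc n' \<Longrightarrow> FP n' R (ker_mod (fr R mZ) Z pZ)"
  "ses R (ker_mod (fr R mA) A pA) (ker_mod (fr R m) B h) (ker_mod (fr R mZ) Z pZ) u v"
proof -
 interpret sesm R A B Z f g using S by (simp add: ses_iff)
 note ring = f.A.ring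
 obtain mA pA where pA: "pA \<in> lhom R (fr R mA) A" "pA ` car (fr R mA) = car A"
  "\<forall>n'. n = Suc n' \<longrightarrow> FP n' R (ker_mod (fr R mA) A pA)"
  by (rule FP_obtain[OF A])
 obtain mZ pZ where pZ: "pZ \<in> lhom R (fr R mZ) Z" "pZ ` car (fr R mZ) = car Z"
  "\<forall>n'. n = Suc n' \<longrightarrow> FP n' R (ker_mod (fr R mZ) Z pZ)"
  by (rule FP_obtain[OF Z])
 have F: "left_module R (fr R k)" for k by (rule lm_free[OF ring])
 obtain q where q: "q \<in> lhom R (fr R mZ) B" "\<And>x. x \<in> car (fr R mZ) \<Longrightarrow> g (q x) = pZ x"
  using proj_lift[OF F proj_via_free[OF ring] f.B.left_module g.B.left_module pZ(1) g.lhom] pZ(2) surj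
  by (metis subset_refl)
 let ?m = "mA + mZ"
 let ?A = "fr R mA" let ?Z = "fr R mZ" let ?B = "fr R (mA + mZ)"
 interpret pA: lhm R ?A A pA using pA F f.A.left_module by (intro lhmI)
 interpret pZ: lhm R ?Z Z pZ using pZ F g.B.left_module by (intro lhmI)
 interpret q: lhm R ?Z B q using q F f.B.left_module by (intro lhmI)
 interpret FB: lmod R ?B using F by (simp add: lmod_iff)
 define h where "h = (\<lambda>r \<in> car ?B. f (pA (pi1 mA r)) \<oplus>\<^sub>B q (pi2 mA mZ r))"
 have h: "h \<in> lhom R ?B B"
  unfolding h_def by (rule restrict_lhomI[OF F]) (auto simp: f.B.add_add_swap f.B.smult_r_distr)
 interpret h: lhm R ?B B h using h F f.B.left_module by (intro lhmI)
 have h_join: "h (join mA mZ u v) = f (pA u) \<oplus>\<^sub>B q v" if "u \<in> car ?A" "v \<in> car ?Z" for u v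
  using that by (simp add: h_def)
 have corr: "\<exists>u \<in> car ?A. f (pA u) = y" if "y \<in> car B" "g y = \<zero>\<^sub>Z" for y
  using exactE[OF that] pA(2) by (metis imageE)
 have onto: "\<exists>r \<in> car ?B. h r = y" if y: "y \<in> car B" for y
 proof -
  obtain v where v: "v \<in> car ?Z" "pZ v = g y" using pZ(2) y by (metis g.closed imageE)
  obtain u where u: "u \<in> car ?A" "f (pA u) = y \<ominus>\<^sub>B q v"
   using corr[of "y \<ominus>\<^sub>B q v"] y v q by auto
  show ?thesis
   by (rule bexI[of _ "join mA mZ u v"]) (use u v y in \<open>auto simp: h_join\<close>)
 qed
 let ?u = "\<lambda>u \<in> lker ?A A pA. join mA mZ u \<zero>\<^sub>?Z"
 let ?v = "\<lambda>r \<in> lker ?B B h. pi2 mA mZ r"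
 have gh: "pZ (pi2 mA mZ r) = g (h r)" if "r \<in> car ?B" for r
  using that q(2) by (simp add: h_def)
 have "ses R (ker_mod ?A A pA) (ker_mod ?B B h) (ker_mod ?Z Z pZ) ?u ?v"
 proof (rule sesI)
  have smult: "join mA mZ (x \<odot>\<^sub>?A u) \<zero>\<^sub>?Z = x \<odot>\<^sub>?B join mA mZ u \<zero>\<^sub>?Z"
   if "x \<in> car R" for x u
   using join_smult[of mA mZ R x u "\<zero>\<^sub>?Z"] pZ.A.smult_zero_r[OF that] by simp
  show "?u \<in> lhom R (ker_mod ?A A pA) (ker_mod ?B B h)"
   using restrict_lhomI[OF pA.lm_ker, of "\<lambda>u. join mA mZ u \<zero>\<^sub>?Z" "ker_mod ?B B h"]
    join_add[where R = R and a = mA and b = mZ and v = "\<zero>\<^sub>?Z" and v' = "\<zero>\<^sub>?Z"]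
   by (simp add: lker_def h_join smult)
  show "?v \<in> lhom R (ker_mod ?B B h) (ker_mod ?Z Z pZ)"
   using restrict_lhomI[OF h.lm_ker, of "pi2 mA mZ" "ker_mod ?Z Z pZ"]
   by (simp add: lker_def gh)
  show "inj_on ?u (car (ker_mod ?A A pA))"
   by (auto simp: inj_on_def lker_def) (metis pi_join(1))
  show "\<exists>y \<in> car (ker_mod ?B B h). ?v y = z" if z: "z \<in> car (ker_mod ?Z Z pZ)" for z
  proof -
   have z': "z \<in> car ?Z" "pZ z = \<zero>\<^sub>Z" using z by (auto simp: lker_def)
   obtain u where u: "u \<in> car ?A" "f (pA u) = q z" using corr[of "q z"] z' q by auto
   have "h (join mA mZ (\<ominus>\<^sub>?A u) z) = \<zero>\<^sub>B" using u z' by (simp add: h_join)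
   then show ?thesis
    using u z' by (intro bexI[of _ "join mA mZ (\<ominus>\<^sub>?A u) z"]) (auto simp: lker_def)
  qed
  show "\<exists>x \<in> car (ker_mod ?A A pA). ?u x = y"
   if "y \<in> car (ker_mod ?B B h)" "?v y = \<zero>\<^bsub>ker_mod ?Z Z pZ\<^esub>" for y
  proof -
   have y: "y \<in> car ?B" "h y = \<zero>\<^sub>B" "pi2 mA mZ y = \<zero>\<^sub>?Z" using that by (auto simp: lker_def)
   then have "f (pA (pi1 mA y)) = \<zero>\<^sub>B" by (simp add: h_def)
   then have "pA (pi1 mA y) = \<zero>\<^sub>A" using y by (simp add: f_zero_iff)
   then show ?thesis
    using y pi_join(3)[OF y(1)] by (intro bexI[of _ "pi1 mA y"]) (auto simp: lker_def)
  qed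
 qed (simp_all add: pA.lm_ker h.lm_ker pZ.lm_ker,
   simp add: lker_def h_join pi_join(2)[OF pZ.A.zero_closed])
 moreover have "h ` car ?B = car B" using onto by (auto simp: image_iff)
 ultimately show thesis by (intro that[OF h _ pA(3)[rule_format] pZ(3)[rule_format]])
qed

text \<open>The hypothesis \<open>IH\<close> speaks of the type of kernels because the kernels of
  the horseshoe live there whatever the types of \<open>A\<close>, \<open>B\<close>,
  \<open>Z\<close> are. The general statement thus follows from its instance at that type.\<close>

lemma FP_ext_Suc:
 assumes "ses R A B Z f g" "FP (Suc n) R A" "FP (Suc n) R Z"
  and IH: "\<And>(A :: ('r, nat \<Rightarrow> 'r) module) (B :: ('r, nat \<Rightarrow> 'r) module) (Z :: ('r, nat \<Rightarrow> 'r) module) f g.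
   ses R A B Z f g \<Longrightarrow> FP n R A \<Longrightarrow> FP n R Z \<Longrightarrow> FP n R B"
 shows "FP (Suc n) R B"
proof (rule FP_ext_step[OF assms(1-3)])
 fix m h mA pA mZ pZ u v
 assume h: "h \<in> lhom R (fr R m) B" "h ` car (fr R m) = car B"
  and A: "\<And>n'. Suc n = Suc n' \<Longrightarrow> FP n' R (ker_mod (fr R mA) A pA)"
  and Z: "\<And>n'. Suc n = Suc n' \<Longrightarrow> FP n' R (ker_mod (fr R mZ) Z pZ)"
  and S: "ses R (ker_mod (fr R mA) A pA) (ker_mod (fr R m) B h) (ker_mod (fr R mZ) Z pZ) u v"
 have "left_module R B" using assms by (simp add: ses_def)
 then show ?thesis by (rule FP_SucI[OF _ h]) (rule IH[OF S A[OF refl] Z[OF refl]])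
qed

lemma FP_ext_0:
 assumes "ses R A B Z f g" "FP 0 R A" "FP 0 R Z"
 shows "FP 0 R B"
proof (rule FP_ext_step[OF assms])
 fix m h assume h: "h \<in> lhom R (fr R m) B" "h ` car (fr R m) = car B"
 have "left_module R B" using assms by (simp add: ses_def)
 then show ?thesis by (rule FP_0I[OF _ h])
qed

lemma FP_ext:
 assumes "ses R A B Z f g" "FP n R A" "FP n R Z"
 shows "FP n R B"
proof -
 have K: "ses R A B Z f g \<Longrightarrow> FP n R A \<Longrightarrow> FP n R Z \<Longrightarrow> FP n R B"
  for A B Z :: "('r, nat \<Rightarrow> 'r) module" and f g n and R :: "'r ring"
 proof (induction n arbitrary: A B Z f g)
  case (Suc n)
  then show ?case by (intro FP_ext_Suc[OF Suc.prems])
 qed (rule FP_ext_0)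
 show ?thesis
 proof (cases n)
  case 0
  then show ?thesis using FP_ext_0 assms by blast
 next
  case (Suc k)
  then show ?thesis using assms by (auto intro: FP_ext_Suc K)
 qed
qed

lemma FP_quot_0:
 assumes S: "ses R A B Z f g" and B: "FP 0 R B"
 shows "FP 0 R Z"
proof -
 interpret sesm R A B Z f g using S by (simp add: ses_iff)
 have F: "left_module R (fr R k)" for k by (rule lm_free[OF f.A.ring])
 obtain m p where p: "p \<in> lhom R (fr R m) B" "p ` car (fr R m) = car B"
  using B by (auto simp: FP_0 fin_gen_def)
 have "compose (car (fr R m)) g p ` car (fr R m) = car Z"
  using p(2) surj by (simp add: surj_compose)
 then show ?thesis using lhom_compose[OF F p(1) g.lhom] g.B.left_module by (auto simp: FP_0 fin_gen_def)
qed

text \<open>Let \<open>F \<rightarrow> B\<close> be a free cover with kernel \<open>K\<close>. The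
  kernel of the composite \<open>F \<rightarrow> Z\<close> is an extension of \<open>A\<close> by
  \<open>K\<close>, so \<open>FP_ext\<close> applies to it.\<close>

lemma FP_quot_Suc:
 assumes S: "ses R A B Z f g" and A: "FP n R A" and B: "FP (Suc n) R B"
 shows "FP (Suc n) R Z"
proof -
 interpret sesm R A B Z f g using S by (simp add: ses_iff)
 have F: "left_module R (fr R k)" for k by (rule lm_free[OF f.A.ring])
 obtain m p where p: "p \<in> lhom R (fr R m) B" "p ` car (fr R m) = car B"
  and K: "FP n R (ker_mod (fr R m) B p)"
  using B by (auto simp: FP_Suc)
 interpret p: lhm R "fr R m" B p using p F f.B.left_module by (intro lhmI)
 let ?gp = "compose (car (fr R m)) g p"
 interpret gp: lhm R "fr R m" Z ?gp
  using lhom_compose[OF F p(1) g.lhom] F g.B.left_module by (intro lhmI)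
 have onto: "?gp ` car (fr R m) = car Z"
  using p(2) surj by (simp add: surj_compose)
 let ?L = "ker_mod (fr R m) Z ?gp"
 have L: "x \<in> car ?L \<longleftrightarrow> x \<in> car (fr R m) \<and> g (p x) = \<zero>\<^sub>Z" for x by (auto simp: lker_def compose_def)
 have pL: "restrict p (car ?L) \<in> lhom R ?L B" by (rule restrict_lhomI[OF gp.lm_ker]) (auto simp: lker_def)
 obtain w where w: "w \<in> lhom R ?L A" "\<And>x. x \<in> car ?L \<Longrightarrow> f (w x) = p x"
 proof (rule lhom_lift_inj[OF gp.lm_ker f.A.left_module f.B.left_module f.lhom inj pL])
  show "restrict p (car ?L) x \<in> f ` car A" if "x \<in> car ?L" for x
   using that L p.closed unfolding exact by (auto simp: lker_def)
 qed (use that in simp)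
 have "ses R (ker_mod (fr R m) B p) ?L A (\<lambda>x \<in> lker (fr R m) B p. x) w"
 proof (rule sesI)
  show "(\<lambda>x \<in> lker (fr R m) B p. x) \<in> lhom R (ker_mod (fr R m) B p) ?L"
   using restrict_lhomI[OF p.lm_ker, of "\<lambda>x. x" ?L] by (simp add: lker_def compose_def)
  show "\<exists>y \<in> car ?L. w y = z" if z: "z \<in> car A" for z
  proof -
   obtain r where r: "r \<in> car (fr R m)" "p r = f z" using p(2) z by (metis f.closed imageE)
   then have rL: "r \<in> car ?L" using z by (simp only: L) simp
   then have "w r = z" using inj_onD[OF inj _ lhom_closed[OF w(1) rL] z] w(2)[OF rL] r by simp
   then show ?thesis using rL by blast
  qed
  show "\<exists>x \<in> car (ker_mod (fr R m) B p). (\<lambda>x \<in> lker (fr R m) B p. x) x = y"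
   if y: "y \<in> car ?L" "w y = \<zero>\<^sub>A" for y
   using y w(2)[OF y(1)] by (intro bexI[of _ y]) (auto simp: lker_def)
  show "w ((\<lambda>x \<in> lker (fr R m) B p. x) x) = \<zero>\<^sub>A" if x: "x \<in> car (ker_mod (fr R m) B p)" for x
  proof -
   have xL: "x \<in> car ?L" using x by (simp add: lker_def compose_def)
   then show ?thesis using x w(2)[OF xL] lhom_closed[OF w(1) xL] f_zero_iff by (simp add: lker_def)
  qed
 qed (auto simp: p.lm_ker gp.lm_ker f.A.left_module w(1) inj_on_def)
 from FP_ext[OF this K A] show ?thesis
  using onto gp.lhom g.B.left_module by (subst FP_Suc) blast
qed

lemma FP_quot:
 assumes "ses R A B Z f g" "FP n R A" "FP n R B"
 shows "FP n R Z"
 using assms by (cases n) (auto intro: FP_quot_0 FP_quot_Suc FP_Suc_imp_FP)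

text \<open>The summand \<open>P\<close> of \<open>fr R m\<close> and its complement, the kernel of
  \<open>p\<close>, are each the quotient of \<open>fr R m\<close> by the other. In a simultaneous
  induction both therefore gain one step of presentation at a time.\<close>

lemma FP_retract:
 assumes P: "left_module R P" and i: "i \<in> lhom R P (fr R m)" and p: "p \<in> lhom R (fr R m) P"
  and pi: "\<And>x. x \<in> car P \<Longrightarrow> p (i x) = x"
 shows "FP n R P"
proof -
 interpret P: lmod R P using P by (simp add: lmod_iff)
 let ?F = "fr R m"
 have F: "left_module R ?F" by (rule lm_free[OF P.ring])
 interpret p: lhm R ?F P p by (intro lhmI F P p)
 interpret i: lhm R P ?F i by (intro lhmI F P i)
 let ?K = "ker_mod ?F P p"
 define r where "r = (\<lambda>x \<in> car ?F. (\<lambda>x \<in> car ?F. x) x \<ominus>\<^sub>?F compose (car ?F) i p x)"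
 have r: "r \<in> lhom R ?F ?F" unfolding r_def by (intro lhom_diff F lhom_id lhom_compose[OF F p i])
 have rx: "r x = x \<ominus>\<^sub>?F i (p x)" if "x \<in> car ?F" for x using that by (simp add: r_def compose_def)
 have s1: "ses R ?K ?F P (\<lambda>x \<in> lker ?F P p. x) p"
  by (rule p.ses_ker, rule equalityI) (use pi i.closed p.closed in \<open>auto simp: image_iff, metis\<close>)
 have s2: "ses R P ?F ?K i r"
 proof (rule sesI[OF P F p.lm_ker i])
  show "r \<in> lhom R ?F ?K" by (rule lhom_update[OF r]) (auto simp: lker_def rx pi)
  show "inj_on i (car P)" by (rule inj_onI) (metis pi)
  show "\<exists>y \<in> car ?F. r y = z" if "z \<in> car ?K" for z
   by (rule bexI[of _ z]) (use that in \<open>auto simp: lker_def rx\<close>)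
  show "\<exists>x \<in> car P. i x = y" if y: "y \<in> car ?F" "r y = \<zero>\<^sub>?K" for y
   by (rule bexI[of _ "p y"]) (use y p.A.diff_eq_zero[of y "i (p y)"] in \<open>simp_all add: rx\<close>)
 qed (simp add: rx pi)
 have "FP n R P \<and> FP n R ?K"
  by (induction n) (use FP_quot_0[OF s1] FP_quot_0[OF s2] FP_quot_Suc[OF s1] FP_quot_Suc[OF s2] FP_fr[OF P.ring] in blast)+
 then show ?thesis ..
qed

lemma FP_projective:
 fixes P :: "('r, 'm) module"
 assumes P: "projective R P" and fg: "fin_gen R P"
 shows "FP n R P"
proof -
 obtain X :: "'m set" where X: "left_module R P" "proj_via R P X"
  using P by (auto simp: projective_iff)
 interpret P: lmod R P using X by (simp add: lmod_iff)
 obtain m p where p: "p \<in> lhom R (fr R m) P" "p ` car (fr R m) = car P"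
  using fg by (auto simp: fin_gen_def)
 obtain i where "i \<in> lhom R P (fr R m)" "\<And>x. x \<in> car P \<Longrightarrow> p (i x) = (\<lambda>x \<in> car P. x) x"
  by (rule proj_lift[OF X lm_free[OF P.ring] X(1) lhom_id[OF X(1)] p(1)]) (use p(2) in auto)
 then show ?thesis by (intro FP_retract[OF X(1) _ p(1)]) auto
qed

definition pullback :: "('r, 'a) module \<Rightarrow> ('r, 'b) module \<Rightarrow> ('a \<Rightarrow> 'z) \<Rightarrow> ('b \<Rightarrow> 'z) \<Rightarrow> ('r, 'a \<times> 'b) module" where
 "pullback A B p q = \<lparr>carrier = {x. fst x \<in> car A \<and> snd x \<in> car B \<and> p (fst x) = q (snd x)}, monoid.mult = undefined,
   one = undefined, ring.zero = (\<zero>\<^sub>A, \<zero>\<^sub>B), add = (\<lambda>x y. (fst x \<oplus>\<^sub>A fst y, snd x \<oplus>\<^sub>B snd y)),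
   smult = (\<lambda>r x. (r \<odot>\<^sub>A fst x, r \<odot>\<^sub>B snd x))\<rparr>"

lemma pullback_simps [simp]:
 "x \<in> car (pullback A B p q) \<longleftrightarrow> fst x \<in> car A \<and> snd x \<in> car B \<and> p (fst x) = q (snd x)"
 "\<zero>\<^bsub>pullback A B p q\<^esub> = (\<zero>\<^sub>A, \<zero>\<^sub>B)" "x \<oplus>\<^bsub>pullback A B p q\<^esub> y = (fst x \<oplus>\<^sub>A fst y, snd x \<oplus>\<^sub>B snd y)"
 "r \<odot>\<^bsub>pullback A B p q\<^esub> x = (r \<odot>\<^sub>A fst x, r \<odot>\<^sub>B snd x)"
 by (simp_all add: pullback_def)

lemma pullback:
 assumes A: "left_module R A" and B: "left_module R B" and Z: "left_module R Z"
  and p: "p \<in> lhom R A Z" and q: "q \<in> lhom R B Z" "q ` car B = car Z"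
 shows lm_pullback: "left_module R (pullback A B p q)"
  and ses_pullback: "ses R (ker_mod B Z q) (pullback A B p q) A (\<lambda>b \<in> lker B Z q. (\<zero>\<^sub>A, b)) (restrict fst (car (pullback A B p q)))"
proof -
 interpret p: lhm R A Z p by (intro lhmI A Z p)
 interpret q: lhm R B Z q by (intro lhmI B Z q)
 show X: "left_module R (pullback A B p q)"
 proof (rule left_moduleI)
  show "\<exists>y \<in> car (pullback A B p q). y \<oplus>\<^bsub>pullback A B p q\<^esub> x = \<zero>\<^bsub>pullback A B p q\<^esub>"
   if "x \<in> car (pullback A B p q)" for x
   by (rule bexI[of _ "(\<ominus>\<^sub>A fst x, \<ominus>\<^sub>B snd x)"]) (use that in simp_all)
 qed (auto simp: p.A.ring p.A.ac q.A.ac p.A.smult_l_distr p.A.smult_r_distr p.A.smult_assoc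
   q.A.smult_l_distr q.A.smult_r_distr q.A.smult_assoc)
 show "ses R (ker_mod B Z q) (pullback A B p q) A (\<lambda>b \<in> lker B Z q. (\<zero>\<^sub>A, b)) (restrict fst (car (pullback A B p q)))"
 proof (rule sesI[OF q.lm_ker X A])
  show "(\<lambda>b \<in> lker B Z q. (\<zero>\<^sub>A, b)) \<in> lhom R (ker_mod B Z q) (pullback A B p q)"
   using restrict_lhomI[OF q.lm_ker, of "\<lambda>b. (\<zero>\<^sub>A, b)" "pullback A B p q"] by (simp add: lker_def)
  show "restrict fst (car (pullback A B p q)) \<in> lhom R (pullback A B p q) A" by (rule restrict_lhomI[OF X]) auto
  show "\<exists>y \<in> car (pullback A B p q). restrict fst (car (pullback A B p q)) y = z" if z: "z \<in> car A" for z
  proof -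
   have "p z \<in> q ` car B" using q(2) z by simp
   then obtain b where "p z = q b" "b \<in> car B" by (rule imageE)
   then show ?thesis using z by (intro bexI[of _ "(z, b)"]) simp_all
  qed
  show "\<exists>x \<in> car (ker_mod B Z q). (\<lambda>b \<in> lker B Z q. (\<zero>\<^sub>A, b)) x = y"
   if y: "y \<in> car (pullback A B p q)" "restrict fst (car (pullback A B p q)) y = \<zero>\<^sub>A" for y
   by (rule bexI[of _ "snd y"]) (use y in \<open>auto simp: lker_def prod_eq_iff\<close>)
 qed (auto simp: inj_on_def lker_def)
qed

text \<open>The sequence splits because its last term is free, and the splitting exhibits
  \<open>A\<close> as the quotient of \<open>X\<close> by that free module.\<close>

lemma FP_split:
 assumes S: "ses R A X (fr R k) f g" and X: "FP n R X"
 shows "FP n R A"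
proof -
 interpret sesm R A X "fr R k" f g using S by (simp add: ses_iff)
 note mA = f.A.left_module and mX = f.B.left_module and mF = g.B.left_module and ring = f.A.ring
 obtain s where s: "s \<in> lhom R (fr R k) X" "\<And>y. y \<in> car (fr R k) \<Longrightarrow> g (s y) = (\<lambda>y \<in> car (fr R k). y) y"
  by (rule proj_lift[OF mF proj_via_free[OF ring] mX mF lhom_id[OF mF] g.lhom]) (use surj in auto)
 interpret s: lhm R "fr R k" X s by (intro lhmI mF mX s)
 define h where "h = (\<lambda>x \<in> car X. (\<lambda>x \<in> car X. x) x \<ominus>\<^sub>X compose (car X) s g x)"
 have h: "h \<in> lhom R X X" unfolding h_def by (intro lhom_diff mX lhom_id lhom_compose[OF mX g.lhom s(1)])
 have hx: "h x = x \<ominus>\<^sub>X s (g x)" if "x \<in> car X" for x using that by (simp add: h_def compose_eq)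
 obtain r where r: "r \<in> lhom R X A" "\<And>x. x \<in> car X \<Longrightarrow> f (r x) = h x"
  by (rule lhom_lift_inj[OF mX mA mX f.lhom inj h]) (use s in \<open>auto simp: exact lker_def hx\<close>)
 have rc: "r x \<in> car A" if "x \<in> car X" for x by (rule lhom_closed[OF r(1) that])
 have "ses R (fr R k) X A s r"
 proof (rule sesI[OF mF mX mA s(1) r(1)])
  show "inj_on s (car (fr R k))" by (rule inj_onI) (metis s(2) restrict_apply')
  show "\<exists>y \<in> car X. r y = z" if z: "z \<in> car A" for z
   by (rule bexI[of _ "f z"]) (use z r(2)[of "f z"] rc[of "f z"] f_eq_iff[of "r (f z)" z] in \<open>simp_all add: hx\<close>)
  show "r (s x) = \<zero>\<^sub>A" if x: "x \<in> car (fr R k)" for x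
   using f_zero_iff[of "r (s x)"] r(2)[of "s x"] s(2)[OF x] rc[of "s x"] x by (simp add: hx)
  show "\<exists>x \<in> car (fr R k). s x = y" if y: "y \<in> car X" "r y = \<zero>\<^sub>A" for y
   by (rule bexI[of _ "g y"]) (use y r(2)[OF y(1)] f.B.diff_eq_zero[of y "s (g y)"] in \<open>simp_all add: hx\<close>)
 qed
 then show ?thesis by (rule FP_quot[OF _ FP_fr[OF ring] X])
qed

text \<open>Schanuel's argument: the pullback of \<open>p\<close> and a free presentation
  \<open>q\<close> of \<open>Z\<close> is an extension of \<open>B\<close> by the kernel of
  \<open>q\<close>, and after swapping the factors an extension of a free module by the kernel of
  \<open>p\<close>.\<close>

lemma FP_ker:
 assumes Z: "FP (Suc n) R Z" and B: "FP n R B" and p: "p \<in> lhom R B Z" "p ` car B = car Z"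
 shows "FP n R (ker_mod B Z p)"
proof -
 obtain k q where q: "q \<in> lhom R (fr R k) Z" "q ` car (fr R k) = car Z" and K: "FP n R (ker_mod (fr R k) Z q)"
  using Z by (auto simp: FP_Suc)
 note mZ = FP_left_module[OF Z] and mB = FP_left_module[OF B]
 interpret Z: lmod R Z using mZ by (simp add: lmod_iff)
 have F: "left_module R (fr R k)" by (rule lm_free[OF Z.ring])
 let ?X = "pullback B (fr R k) p q" and ?Y = "pullback (fr R k) B q p"
 note X = pullback[OF mB F mZ p(1) q] and Y = pullback[OF F mB mZ q(1) p]
 have "FP n R ?X" by (rule FP_ext[OF X(2) K B])
 moreover have "restrict prod.swap (car ?X) \<in> lhom R ?X ?Y" by (rule restrict_lhomI[OF X(1)]) auto
 moreover have "bij_betw (restrict prod.swap (car ?X)) (car ?X) (car ?Y)"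
  by (rule bij_betwI[where g = prod.swap]) auto
 ultimately have "FP n R ?Y" by (intro FP_iso[OF _ Y(1)]) (auto simp: isomorphic_def lisos_def)
 then show ?thesis by (rule FP_split[OF Y(2)])
qed

lemma exact_onto_tail:
 assumes ex: "exact_onto R (Suc l) X d" and l: "1 \<le> l"
 shows "ses R (ker_mod (X 1) (X 0) (d 0)) (X 1) (X 0) (\<lambda>x \<in> lker (X 1) (X 0) (d 0). x) (d 0)"
  and "exact_onto R l (\<lambda>i. if i = 0 then ker_mod (X 1) (X 0) (d 0) else X (Suc i)) (\<lambda>i. d (Suc i))"
proof -
 have m: "left_module R (X 0)" "left_module R (X 1)" "d 0 \<in> lhom R (X 1) (X 0)"
  "d 0 ` car (X 1) = car (X 0)"
  using ex by (auto simp: exact_onto_def)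
 interpret lhm R "X 1" "X 0" "d 0" using m by (intro lhmI)
 show "ses R (ker_mod (X 1) (X 0) (d 0)) (X 1) (X 0) (\<lambda>x \<in> lker (X 1) (X 0) (d 0). x) (d 0)"
  by (rule ses_ker[OF m(4)])
 have im: "d (Suc 0) ` car (X (Suc (Suc 0))) = lker (X (Suc 0)) (X 0) (d 0)"
  using ex l by (auto simp: exact_onto_def)
 have "d (Suc 0) \<in> lhom R (X (Suc (Suc 0))) (X 1)" using ex l by (auto simp: exact_onto_def)
 then have d1: "d (Suc 0) \<in> lhom R (X (Suc (Suc 0))) (ker_mod (X 1) (X 0) (d 0))"
  using im by (auto simp: lhom_def)
 show "exact_onto R l (\<lambda>i. if i = 0 then ker_mod (X 1) (X 0) (d 0) else X (Suc i)) (\<lambda>i. d (Suc i))"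
  using ex l d1 im lm_ker unfolding exact_onto_def
  by (auto simp: lker_def)
qed

text \<open>Dimension shifting: the tail of the resolution resolves the kernel of the first map, and
  \<open>M\<close> is the quotient of a finitely generated projective module by that kernel.\<close>

lemma degreewise_fg_FP:
 assumes "degreewise_fg R M"
 shows "FP n R M"
proof -
 obtain X d where "proj_resolution R M X d" "\<And>i. fin_gen R (X (Suc i))"
  using assms by (auto simp: degreewise_fg_def)
 then show ?thesis
 proof (induction n arbitrary: M X d)
  case (0 M X d)
  have ex: "exact_onto R (Suc 1) X d" and X0: "X 0 = M" using 0(1) by (auto simp: proj_resolution_def)
  have "FP 0 R (X 1)" using 0(2)[of 0] by (simp add: FP_0)
  then show ?case using FP_quot_0[OF exact_onto_tail(1)[OF ex]] X0 by simp
 next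
  case (Suc n M X d)
  have ex: "exact_onto R (Suc l) X d" for l using Suc.prems(1) by (auto simp: proj_resolution_def)
  have X0: "X 0 = M" using Suc.prems(1) by (auto simp: proj_resolution_def)
  have proj: "projective R (X (Suc i))" for i using Suc.prems(1) by (auto simp: proj_resolution_def)
  let ?X = "\<lambda>i. if i = 0 then ker_mod (X 1) (X 0) (d 0) else X (Suc i)"
  have "proj_resolution R (ker_mod (X 1) (X 0) (d 0)) ?X (\<lambda>i. d (Suc i))"
   using exact_onto_tail(2)[OF ex] proj by (auto simp: proj_resolution_def)
  then have "FP n R (ker_mod (X 1) (X 0) (d 0))"
   by (rule Suc.IH) (use Suc.prems(2) in auto)
  moreover have "FP (Suc n) R (X 1)" using proj[of 0] Suc.prems(2)[of 0] by (auto intro: FP_projective)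
  ultimately show ?case using FP_quot_Suc[OF exact_onto_tail(1)[OF ex[of 1]]] X0 by auto
 qed
qed

section \<open>Resolutions by free modules of finite rank, and presentations over a given
  type\<close>

definition free_res :: "'r ring \<Rightarrow> ('r, 'm) module \<Rightarrow> (nat \<Rightarrow> nat) \<Rightarrow> ((nat \<Rightarrow> 'r) \<Rightarrow> 'm) \<Rightarrow>
  (nat \<Rightarrow> (nat \<Rightarrow> 'r) \<Rightarrow> nat \<Rightarrow> 'r) \<Rightarrow> bool" where
 "free_res R M l p d \<longleftrightarrow> left_module R M \<and> p \<in> lhom R (fr R (l 0)) M \<and>
   p ` car (fr R (l 0)) = car M \<and>
   (\<forall>i. d i \<in> lhom R (fr R (l (Suc i))) (fr R (l i))) \<and>
   d 0 ` car (fr R (l 1)) = lker (fr R (l 0)) M p \<and>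
   (\<forall>i. d (Suc i) ` car (fr R (l (Suc (Suc i)))) = lker (fr R (l (Suc i))) (fr R (l i)) (d i))"

lemma FP_free_res:
 assumes M: "\<And>n. FP n R M"
 shows "\<exists>l p d. free_res R M l p d"
proof -
 have Mm: "left_module R M" using M[of 0] by (rule FP_left_module)
 then have R: "ring R" by (metis lmod.ring lmod_iff)
 obtain l0 p where p: "p \<in> lhom R (fr R l0) M" "p ` car (fr R l0) = car M"
  by (rule FP_fg_obtain[OF M[of 0]])
 \<comment> \<open>A state is a rank together with a submodule of the free module of that rank: the
   syzygy that is still to be covered. By \<open>FP_ker\<close> it stays finitely n-presented for
   every n. The clause for \<open>i = 0\<close> in \<open>?P\<close> pins the start of the dependent
   choice to the kernel of \<open>p\<close>.\<close>
 let ?K = "\<lambda>s. (fr R (fst s))\<lparr>carrier := snd s\<rparr>"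
 let ?P = "\<lambda>(i :: nat) s. snd s \<subseteq> car (fr R (fst s)) \<and> (\<forall>n. FP n R (?K s)) \<and>
  (i = 0 \<longrightarrow> s = (l0, lker (fr R l0) M p))"
 let ?Q = "\<lambda>(i :: nat) s s'. \<exists>f \<in> lhom R (fr R (fst s')) (fr R (fst s)). f ` car (fr R (fst s')) = snd s \<and>
  snd s' = lker (fr R (fst s')) (fr R (fst s)) f"
 have "\<exists>s. \<forall>i. ?P i (s i) \<and> ?Q i (s i) (s (Suc i))"
 proof (rule dependent_nat_choice)
  show "\<exists>s. ?P 0 s"
   using FP_ker[OF M FP_fr[OF R] p] by (intro exI[of _ "(l0, lker (fr R l0) M p)"]) (auto simp: lker_def)
 next
  fix s and i :: nat assume s: "?P i s"
  then have FPs: "FP n R (?K s)" for n by blast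
  obtain m f where f: "f \<in> lhom R (fr R m) (?K s)" "f ` car (fr R m) = snd s"
   by (rule FP_fg_obtain[OF FPs[of 0]]) auto
  have "f \<in> lhom R (fr R m) (fr R (fst s))" using f s by (auto simp: lhom_def)
  moreover have "lker (fr R m) (?K s) f = lker (fr R m) (fr R (fst s)) f" by (simp add: lker_def)
  moreover have "FP n R (ker_mod (fr R m) (?K s) f)" for n using f by (intro FP_ker[OF FPs FP_fr[OF R]]) auto
  ultimately show "\<exists>s'. ?P (Suc i) s' \<and> ?Q i s s'"
   using f by (intro exI[of _ "(m, lker (fr R m) (?K s) f)"]) (auto simp: lker_def)
 qed
 then obtain s where s: "\<forall>i. ?P i (s i) \<and> ?Q i (s i) (s (Suc i))" by (rule exE)
 have "\<forall>i. \<exists>f. f \<in> lhom R (fr R (fst (s (Suc i)))) (fr R (fst (s i))) \<and>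
   f ` car (fr R (fst (s (Suc i)))) = snd (s i) \<and>
   snd (s (Suc i)) = lker (fr R (fst (s (Suc i)))) (fr R (fst (s i))) f"
 proof
  fix i
  have "?Q i (s i) (s (Suc i))" using s by simp
  then show "\<exists>f. f \<in> lhom R (fr R (fst (s (Suc i)))) (fr R (fst (s i))) \<and>
   f ` car (fr R (fst (s (Suc i)))) = snd (s i) \<and>
   snd (s (Suc i)) = lker (fr R (fst (s (Suc i)))) (fr R (fst (s i))) f" by (simp add: Bex_def)
 qed
 from choice[OF this] obtain d where "\<forall>i. d i \<in> lhom R (fr R (fst (s (Suc i)))) (fr R (fst (s i))) \<and>
   d i ` car (fr R (fst (s (Suc i)))) = snd (s i) \<and>
   snd (s (Suc i)) = lker (fr R (fst (s (Suc i)))) (fr R (fst (s i))) (d i)" by (rule exE)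
 then have d: "d i \<in> lhom R (fr R (fst (s (Suc i)))) (fr R (fst (s i)))"
  "d i ` car (fr R (fst (s (Suc i)))) = snd (s i)"
  "snd (s (Suc i)) = lker (fr R (fst (s (Suc i)))) (fr R (fst (s i))) (d i)" for i
  by simp_all
 have "s 0 = (l0, lker (fr R l0) M p)" using s by simp
 then have "free_res R M (\<lambda>i. fst (s i)) p d"
  using d p Mm d(2)[of 0] unfolding free_res_def by auto
 then show ?thesis by blast
qed

text \<open>A finite power embeds into the lists over the set, and an infinite type has as many
  lists as elements.\<close>

lemma PiE_lessThan_lepoll:
 fixes m :: nat
 assumes "infinite (UNIV :: 'u set)" "A \<lesssim> (UNIV :: 'u set)"
 shows "({..<m} \<rightarrow>\<^sub>E A) \<lesssim> (UNIV :: 'u set)"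
proof -
 have "inj_on (\<lambda>f. map f [0..<m]) ({..<m} \<rightarrow>\<^sub>E A)"
 proof (rule inj_onI)
  fix f g assume f: "f \<in> {..<m} \<rightarrow>\<^sub>E A" and g: "g \<in> {..<m} \<rightarrow>\<^sub>E A" and eq: "map f [0..<m] = map g [0..<m]"
  show "f = g"
  proof (rule PiE_ext[OF f g])
   show "f i = g i" if "i \<in> {..<m}" for i using arg_cong[OF eq, of "\<lambda>l. l ! i"] that by simp
  qed
 qed
 moreover have "(\<lambda>f. map f [0..<m]) ` ({..<m} \<rightarrow>\<^sub>E A) \<subseteq> lists A"
 proof (rule image_subsetI)
  fix f assume f: "f \<in> {..<m} \<rightarrow>\<^sub>E A"
  show "map f [0..<m] \<in> lists A" by (simp add: in_lists_conv_set PiE_mem[OF f])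
 qed
 ultimately have "({..<m} \<rightarrow>\<^sub>E A) \<lesssim> lists A" unfolding lepoll_def by blast
 also have "lists A \<lesssim> lists (UNIV :: 'u set)" by (rule lists_lepoll_mono[OF assms(2)])
 also have "lists (UNIV :: 'u set) \<approx> (UNIV :: 'u set)"
  using card_of_lists_infinite[OF assms(1)] by (simp add: eqpoll_iff_card_of_ordIso)
 finally show ?thesis .
qed

lemma lhom_submodule_mono:
 "f \<in> lhom R A (N\<lparr>carrier := U\<rparr>) \<Longrightarrow> U \<subseteq> car N \<Longrightarrow> f \<in> lhom R A N"
 unfolding lhom_def by (simp add: PiE_def Pi_def subset_iff)

text \<open>A presentation of the kernel is spliced onto the cover \<open>F\<close>. Its last map
  serves unchanged as a map into \<open>F\<close>, because the kernel carries the operations of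
  \<open>F\<close>.\<close>

lemma fin_presented_SucI:
 fixes M F :: "('r, 'u) module"
 assumes M: "left_module R M" and F: "fg_free R F" and f: "f \<in> lhom R F M" "f ` car F = car M"
  and K: "fin_presented R n (ker_mod F M f)"
 shows "fin_presented R (Suc n) M"
proof -
 obtain X d where X: "X 0 = ker_mod F M f" "exact_onto R (Suc n) X d" "\<And>i. i \<le> n \<Longrightarrow> fg_free R (X (Suc i))"
  using K by (auto simp: fin_presented_def)
 define X' where "X' i = (case i of 0 \<Rightarrow> M | Suc i \<Rightarrow> (case i of 0 \<Rightarrow> F | Suc j \<Rightarrow> X (Suc j)))" for i
 define d' where "d' i = (case i of 0 \<Rightarrow> f | Suc i \<Rightarrow> d i)" for i
 have X's: "X' 0 = M" "X' (Suc 0) = F" "X' (Suc (Suc j)) = X (Suc j)" for j by (auto simp: X'_def)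
 have d's: "d' 0 = f" "d' (Suc j) = d j" for j by (auto simp: d'_def)
 have Fm: "left_module R F" using F by (simp add: fg_free_def)
 have d0': "d 0 \<in> lhom R (X (Suc 0)) (X 0)" "d 0 ` car (X (Suc 0)) = car (X 0)"
  using X(2) by (simp_all add: exact_onto_def)
 have "lker F M f \<subseteq> car F" by (auto simp: lker_def)
 then have d0: "d 0 \<in> lhom R (X (Suc 0)) F" "d 0 ` car (X (Suc 0)) = lker F M f"
  using d0' unfolding X(1) by (auto intro: lhom_submodule_mono)
 have e: "left_module R (X j)" "j < Suc n \<Longrightarrow> d j \<in> lhom R (X (Suc j)) (X j)"
  "Suc j < Suc n \<Longrightarrow> d (Suc j) ` car (X (Suc (Suc j))) = lker (X (Suc j)) (X j) (d j)"
  if "j \<le> Suc n" for j using X(2) that by (auto simp: exact_onto_def)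
 have "exact_onto R (Suc (Suc n)) X' d'"
  unfolding exact_onto_def
 proof (intro conjI allI impI)
  show "left_module R (X' i)" if "i \<le> Suc (Suc n)" for i
   using that e(1)[of "i - 1"] M Fm by (auto simp: X'_def split: nat.split)
  show "d' i \<in> lhom R (X' (Suc i)) (X' i)" if "i < Suc (Suc n)" for i
  proof (cases i)
   case (Suc j)
   then show ?thesis using d0 e(2)[of j] that by (cases j) (auto simp: X's d's)
  qed (auto simp: X's d's f)
  show "d' 0 ` car (X' 1) = car (X' 0)" using f by (simp add: X's d's)
  show "d' (Suc i) ` car (X' (Suc (Suc i))) = lker (X' (Suc i)) (X' i) (d' i)"
   if "Suc i < Suc (Suc n)" for i
  proof (cases i)
   case (Suc j)
   have "d (Suc j) ` car (X (Suc (Suc j))) = lker (X (Suc j)) (X j) (d j)"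
    using e(3)[of j] that Suc by simp
   then show ?thesis unfolding Suc X's d's using X(1) X's by (cases j) (auto simp: lker_def)
  qed (simp add: X's d's d0)
 qed
 moreover have "fg_free R (X' (Suc i))" if "i \<le> Suc n" for i
  using F X(3)[of "i - 1"] that by (cases i) (auto simp: X's)
 ultimately show ?thesis using X's(1) unfolding fin_presented_def by blast
qed

text \<open>\<open>fin_presented\<close> wants all terms in the type of \<open>M\<close>. The bound
  on \<open>R\<close> provides copies of the modules \<open>fr R m\<close> there, and the kernel of
  a cover by such a copy is again in that type, which keeps the induction going.\<close>

lemma FP_fin_presented:
 fixes R :: "'r ring" and M :: "('r, 'u) module"
 assumes inf: "infinite (UNIV :: 'u set)" and R: "car R \<lesssim> (UNIV :: 'u set)"
 shows "FP n R M \<Longrightarrow> fin_presented R n M"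
proof (induction n arbitrary: M)
 have cover: "\<exists>(F :: ('r, 'u) module) f. fg_free R F \<and> (\<forall>k. FP k R F) \<and> f \<in> lhom R F M \<and> f ` car F = car M"
  if M: "FP n R M" for M :: "('r, 'u) module" and n
 proof -
  note mM = FP_left_module[OF M]
  interpret M: lmod R M using mM by (simp add: lmod_iff)
  obtain m f where f: "f \<in> lhom R (fr R m) M" "f ` car (fr R m) = car M" by (rule FP_fg_obtain[OF M])
  let ?F = "copy (fr R m) :: ('r, 'u) module"
  have F: "left_module R (fr R m)" by (rule lm_free[OF M.ring])
  have le: "car (fr R m) \<lesssim> (UNIV :: 'u set)" unfolding carrier_fr by (rule PiE_lessThan_lepoll[OF inf R])
  have cF: "left_module R ?F" by (rule lm_copy[OF F le])
  note iso = isomorphic_copy[OF F le]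
  obtain e where e: "e \<in> lhom R ?F (fr R m)" "e ` car ?F = car (fr R m)"
   using decode_lisos[OF F le] by (auto simp: lisos_def bij_betw_def)
  have "fg_free R ?F" unfolding fg_free_def using cF isomorphic_sym[OF F cF iso] by blast
  moreover have "FP k R ?F" for k by (rule FP_iso[OF FP_fr[OF M.ring] cF iso])
  ultimately show ?thesis
   using lhom_compose[OF cF e(1) f(1)] surj_compose[OF e(2) f(2)] by blast
 qed
 {
  case (0 M)
  obtain F :: "('r, 'u) module" and f where F: "fg_free R F" "f \<in> lhom R F M" "f ` car F = car M"
   using cover[OF 0] by blast
  have "exact_onto R (Suc 0) (\<lambda>i. if i = 0 then M else F) (\<lambda>i. f)"
   using F FP_left_module[OF 0] by (auto simp: exact_onto_def fg_free_def)
  then show ?case using F unfolding fin_presented_def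
   by (intro exI[of _ "\<lambda>i. if i = 0 then M else F"] exI[of _ "\<lambda>i. f"]) auto
 next
  case (Suc n M)
  obtain F :: "('r, 'u) module" and f where F: "fg_free R F" "f \<in> lhom R F M" "f ` car F = car M" "FP n R F"
   using cover[OF Suc.prems] by blast
  show ?case
   by (rule fin_presented_SucI[OF FP_left_module[OF Suc.prems] F(1-3)]) (rule Suc.IH[OF FP_ker[OF Suc.prems F(4,2,3)]])
 }
qed

section \<open>Tensor products\<close>

text \<open>Abelian groups are regarded as additive groups of module records whose scalar multiplication
 carries no information.\<close>

definition grp_mod :: "'a monoid \<Rightarrow> (unit, 'a) module" where
 "grp_mod T = \<lparr>carrier = car T, monoid.mult = undefined, one = undefined, ring.zero = \<one>\<^sub>T,
   add = monoid.mult T, smult = (\<lambda>r x. x)\<rparr>"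

lemma grp_mod_simps [simp]:
 "car (grp_mod T) = car T" "\<zero>\<^bsub>grp_mod T\<^esub> = \<one>\<^sub>T" "x \<oplus>\<^bsub>grp_mod T\<^esub> y = x \<otimes>\<^sub>T y"
 by (simp_all add: grp_mod_def)

lemma abg_grp_mod:
 assumes "comm_group T" shows "abg (grp_mod T)"
proof -
 interpret T: comm_group T by (rule assms)
 show ?thesis by (intro abg.intro abelian_groupI) (auto simp: T.m_ac)
qed

lemma (in abg) comm_group_add: "comm_group (add_monoid G)"
proof -
 interpret abelian_group G by (rule abelian_group)
 show ?thesis by (rule a_comm_group)
qed

definition quot :: "('a, 'x) ring_scheme \<Rightarrow> 'a set \<Rightarrow> (unit, 'a set) module" where
 "quot G H = grp_mod (add_monoid G Mod H)"

text \<open>Membership in an image becomes vanishing under an additive map. It can then be shown by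
  comparing additive maps on pure tensors.\<close>

lemma quot_projection:
 assumes G: "abg G" and E: "abg E" and h: "h \<in> ahom E G"
 obtains \<pi> where "abg (quot G (h ` car E))" "\<pi> \<in> ahom G (quot G (h ` car E))"
  "\<And>x. x \<in> car G \<Longrightarrow> \<pi> x = \<zero>\<^bsub>quot G (h ` car E)\<^esub> \<longleftrightarrow> x \<in> h ` car E"
proof -
 interpret ahm E G h using G E h by (simp add: ahm_def ahm_axioms_def)
 interpret G: comm_group "add_monoid G" by (rule B.comm_group_add)
 let ?H = "h ` car E"
 have "subgroup ?H (add_monoid G)"
 proof (rule G.subgroupI)
  show "inv\<^bsub>add_monoid G\<^esub> a \<in> ?H" if "a \<in> ?H" for a
   using that by (auto simp flip: a_inv_def neg)
  show "a \<otimes>\<^bsub>add_monoid G\<^esub> b \<in> ?H" if "a \<in> ?H" "b \<in> ?H" for a b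
   using that by (auto simp flip: add)
  show "?H \<noteq> {}" by (metis A.zero_closed empty_iff image_is_empty)
 qed auto
 then interpret H: normal ?H "add_monoid G" by (rule G.subgroup_imp_normal)
 have "comm_group (add_monoid G Mod ?H)" by (rule G.abelian_FactGroup) (rule H.is_subgroup)
 then have 1: "abg (quot G ?H)" by (simp add: quot_def abg_grp_mod)
 have 2: "(\<lambda>a. ?H #>\<^bsub>add_monoid G\<^esub> a) \<in> ahom G (quot G ?H)"
  using H.r_coset_hom_Mod by (auto simp: ahom_def quot_def hom_def Pi_def)
 have "?H #>\<^bsub>add_monoid G\<^esub> x = ?H \<longleftrightarrow> x \<in> ?H" if "x \<in> car G" for x
  using that G.coset_join1[OF _ _ H.is_subgroup, of x] G.coset_join2[OF _ H.is_subgroup, of x]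
   H.subset by auto
 then have 3: "?H #>\<^bsub>add_monoid G\<^esub> x = \<zero>\<^bsub>quot G ?H\<^esub> \<longleftrightarrow> x \<in> ?H" if "x \<in> car G" for x
  using that by (simp add: quot_def FactGroup_def)
 show thesis by (rule that[OF 1 2 3])
qed

text \<open>Linear maps without the extensionality of \<open>lhom\<close>: coordinate maps, scalar
  multiplications and \<open>tensor_map\<close> are not cut off outside the carrier.\<close>

definition linear :: "'r ring \<Rightarrow> ('r, 'a) module \<Rightarrow> ('r, 'b) module \<Rightarrow> ('a \<Rightarrow> 'b) set" where
 "linear R A B = {f \<in> ahom A B. \<forall>r \<in> car R. \<forall>x \<in> car A. f (r \<odot>\<^sub>A x) = r \<odot>\<^sub>B f x}"

lemma lhom_linear: "f \<in> lhom R A B \<Longrightarrow> f \<in> linear R A B"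
 by (simp add: linear_def ahom_def lhom_def PiE_def Pi_def)

lemma linear_id: "(\<lambda>x. x) \<in> linear R A A"
 by (simp add: linear_def ahom_def)

lemma linearD: 
 assumes "f \<in> linear R A B"
 shows "x \<in> car A \<Longrightarrow> f x \<in> car B"
  and "x \<in> car A \<Longrightarrow> y \<in> car A \<Longrightarrow> f (x \<oplus>\<^sub>A y) = f x \<oplus>\<^sub>B f y"
  and "r \<in> car R \<Longrightarrow> x \<in> car A \<Longrightarrow> f (r \<odot>\<^sub>A x) = r \<odot>\<^sub>B f x"
 using assms by (auto simp: linear_def ahom_def)

lemma linear_comp: "f \<in> linear R A B \<Longrightarrow> g \<in> linear R B C \<Longrightarrow> (\<lambda>x. g (f x)) \<in> linear R A C"
 by (simp add: linear_def ahom_def)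

lemma ahom_comp: "f \<in> ahom A B \<Longrightarrow> g \<in> ahom B C \<Longrightarrow> (\<lambda>x. g (f x)) \<in> ahom A C"
 by (simp add: ahom_def)

lemma ahom_add: "abg B \<Longrightarrow> f \<in> ahom A B \<Longrightarrow> g \<in> ahom A B \<Longrightarrow> (\<lambda>x. f x \<oplus>\<^sub>B g x) \<in> ahom A B"
 by (simp add: ahom_def abg.add_closed abg.add_add_swap)

lemma ahom_zero: "abg B \<Longrightarrow> (\<lambda>x. \<zero>\<^sub>B) \<in> ahom A B"
 by (simp add: ahom_def abg.zero_closed abg.zero_add)

lemma ahom_nsum:
 assumes "abg B" "\<And>k. k < n \<Longrightarrow> f k \<in> ahom A B" shows "(\<lambda>x. nsum B (\<lambda>k. f k x) n) \<in> ahom A B"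
 using assms(2) by (induction n) (auto intro!: ahom_zero ahom_add assms(1))

definition tens :: "'r ring \<Rightarrow> ('r, 'a) module \<Rightarrow> ('r, 'm) module \<Rightarrow> (unit, ('a \<times> 'm \<Rightarrow>\<^sub>0 int) set) module" where
 "tens R A M = grp_mod (tensor_group R A M)"

abbreviation "pt \<equiv> pure_tensor"

locale tens_ctx = A: lmod "op_ring R" A + M: lmod R M
 for R :: "'r ring" and A :: "('r, 'a) module" and M :: "('r, 'm) module"
begin

abbreviation "FG \<equiv> free_Abelian_group (car A \<times> car M)"

definition gens :: "('a \<times> 'm \<Rightarrow>\<^sub>0 int) set" where
 "gens = {frag_of (a \<oplus>\<^sub>A a', m) - frag_of (a, m) - frag_of (a', m) | a a' m.
     a \<in> car A \<and> a' \<in> car A \<and> m \<in> car M} \<union>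
   {frag_of (a, m \<oplus>\<^sub>M m') - frag_of (a, m) - frag_of (a, m') | a m m'.
     a \<in> car A \<and> m \<in> car M \<and> m' \<in> car M} \<union>
   {frag_of (r \<odot>\<^sub>A a, m) - frag_of (a, r \<odot>\<^sub>M m) | r a m.
     r \<in> car R \<and> a \<in> car A \<and> m \<in> car M}"

lemma tensor_rel: "tensor_rel R A M = generate FG gens"
 by (simp add: tensor_rel_def gens_def)

interpretation FG: comm_group FG by (rule abelian_free_Abelian_group)

lemma diff_in_FG: "x \<in> car FG \<Longrightarrow> y \<in> car FG \<Longrightarrow> x - y \<in> car FG"
 using keys_diff[of x y] by auto

lemma frag_in_FG: "a \<in> car A \<Longrightarrow> m \<in> car M \<Longrightarrow> frag_of (a, m) \<in> car FG"
 by simp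

lemma gens_subset: "gens \<subseteq> car FG"
 unfolding gens_def by (auto intro!: diff_in_FG frag_in_FG simp del: carrier_free_Abelian_group_iff)

lemma gensI:
 "a \<in> car A \<Longrightarrow> a' \<in> car A \<Longrightarrow> m \<in> car M \<Longrightarrow>
  frag_of (a \<oplus>\<^sub>A a', m) - frag_of (a, m) - frag_of (a', m) \<in> gens"
 "a \<in> car A \<Longrightarrow> m \<in> car M \<Longrightarrow> m' \<in> car M \<Longrightarrow>
  frag_of (a, m \<oplus>\<^sub>M m') - frag_of (a, m) - frag_of (a, m') \<in> gens"
 "r \<in> car R \<Longrightarrow> a \<in> car A \<Longrightarrow> m \<in> car M \<Longrightarrow>
  frag_of (r \<odot>\<^sub>A a, m) - frag_of (a, r \<odot>\<^sub>M m) \<in> gens"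
 unfolding gens_def by blast+

lemma gens_in_rel: "x \<in> gens \<Longrightarrow> x \<in> car FG \<and> x \<in> tensor_rel R A M"
 using gens_subset by (auto simp: tensor_rel intro: generate.incl simp del: carrier_free_Abelian_group_iff)

lemma subgroup_rel: "subgroup (tensor_rel R A M) FG"
 unfolding tensor_rel by (rule FG.generate_is_subgroup[OF gens_subset])

interpretation rel: normal "tensor_rel R A M" FG
 by (rule FG.subgroup_imp_normal[OF subgroup_rel])

lemma comm_group_tensor: "comm_group (tensor_group R A M)"
 unfolding tensor_group_def by (rule FG.abelian_FactGroup[OF subgroup_rel])

lemma abg_tens: "abg (tens R A M)"
 unfolding tens_def by (rule abg_grp_mod[OF comm_group_tensor])

interpretation T: abg "tens R A M" by (rule abg_tens)

lemma carrier_tens: "car (tens R A M) = coset_of R A M ` car FG"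
 by (auto simp: tens_def tensor_group_def carrier_FactGroup coset_of_def)

lemma coset_add: "x \<in> car FG \<Longrightarrow> y \<in> car FG \<Longrightarrow>
  coset_of R A M (x + y) = coset_of R A M x \<oplus>\<^bsub>tens R A M\<^esub> coset_of R A M y"
 using rel.rcos_sum[of x y] by (simp add: tens_def tensor_group_def coset_of_def)

lemma coset_closed: "x \<in> car FG \<Longrightarrow> coset_of R A M x \<in> car (tens R A M)"
 using carrier_tens by blast

lemma coset_ahm: "coset_of R A M \<in> ahom (grp_mod FG) (tens R A M)"
 using coset_closed coset_add by (simp add: ahom_def)

lemma coset_zero_iff: "x \<in> car FG \<Longrightarrow> coset_of R A M x = \<zero>\<^bsub>tens R A M\<^esub> \<longleftrightarrow> x \<in> tensor_rel R A M"
 using FG.coset_join1[OF _ _ subgroup_rel, of x] FG.coset_join2[OF _ subgroup_rel, of x] rel.subset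
 by (auto simp: tens_def tensor_group_def coset_of_def)

interpretation co: ahm "grp_mod FG" "tens R A M" "coset_of R A M"
 using coset_ahm abg_grp_mod[OF abelian_free_Abelian_group] abg_tens by (simp add: ahm_def ahm_axioms_def)

lemma coset_zero: "coset_of R A M 0 = \<zero>\<^bsub>tens R A M\<^esub>"
 using co.zero by simp

lemma coset_diff: 
 assumes "x \<in> car FG" "y \<in> car FG"
 shows "coset_of R A M (x - y) = coset_of R A M x \<ominus>\<^bsub>tens R A M\<^esub> coset_of R A M y"
proof -
 have "coset_of R A M (x - y) \<oplus>\<^bsub>tens R A M\<^esub> coset_of R A M y = coset_of R A M x"
  using assms coset_add[OF diff_in_FG[OF assms] assms(2)] by simp
 then show ?thesis using assms coset_closed diff_in_FG by (metis T.add_diff_cancel)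
qed

lemma coset_gens:
 assumes "x - y - z \<in> gens" "x \<in> car FG" "y \<in> car FG" "z \<in> car FG"
 shows "coset_of R A M x = coset_of R A M y \<oplus>\<^bsub>tens R A M\<^esub> coset_of R A M z"
proof -
 have "coset_of R A M (x - y - z) = \<zero>\<^bsub>tens R A M\<^esub>"
  using gens_in_rel[OF assms(1)] by (subst coset_zero_iff) auto
 then have "coset_of R A M x \<ominus>\<^bsub>tens R A M\<^esub> coset_of R A M y = coset_of R A M z"
  using assms diff_in_FG coset_diff coset_closed T.diff_eq_zero by (metis T.diff_closed)
 then show ?thesis using assms coset_closed by (metis T.add_diff_cancel_left)
qed

lemma pt_closed [simp]: "a \<in> car A \<Longrightarrow> m \<in> car M \<Longrightarrow> pt R A M a m \<in> car (tens R A M)"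
 unfolding pure_tensor_def by (rule coset_closed) simp

lemma pt_add_l: "a \<in> car A \<Longrightarrow> a' \<in> car A \<Longrightarrow> m \<in> car M \<Longrightarrow>
  pt R A M (a \<oplus>\<^sub>A a') m = pt R A M a m \<oplus>\<^bsub>tens R A M\<^esub> pt R A M a' m"
 unfolding pure_tensor_def by (rule coset_gens[OF gensI(1)]) auto

lemma pt_add_r: "a \<in> car A \<Longrightarrow> m \<in> car M \<Longrightarrow> m' \<in> car M \<Longrightarrow>
  pt R A M a (m \<oplus>\<^sub>M m') = pt R A M a m \<oplus>\<^bsub>tens R A M\<^esub> pt R A M a m'"
 unfolding pure_tensor_def by (rule coset_gens[OF gensI(2)]) auto

lemma pt_balanced:
 assumes "r \<in> car R" "a \<in> car A" "m \<in> car M"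
 shows "pt R A M (r \<odot>\<^sub>A a) m = pt R A M a (r \<odot>\<^sub>M m)"
proof -
 have "coset_of R A M (frag_of (r \<odot>\<^sub>A a, m) - frag_of (a, r \<odot>\<^sub>M m)) = \<zero>\<^bsub>tens R A M\<^esub>"
  using gens_in_rel[OF gensI(3)[OF assms]] by (subst coset_zero_iff) auto
 then show ?thesis
  using assms unfolding pure_tensor_def
  by (subst (asm) coset_diff) (auto simp: T.diff_eq_zero coset_closed)
qed

lemma pt_l_ahom: "m \<in> car M \<Longrightarrow> (\<lambda>a. pt R A M a m) \<in> ahom A (tens R A M)"
 by (simp add: ahom_def pt_add_l)

lemma pt_r_ahom: "a \<in> car A \<Longrightarrow> pt R A M a \<in> ahom M (tens R A M)"
 by (simp add: ahom_def pt_add_r)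

lemma pt_l_ahm: "m \<in> car M \<Longrightarrow> ahm A (tens R A M) (\<lambda>a. pt R A M a m)"
 by (simp add: ahm_def ahm_axioms_def abg_tens A.abg_axioms pt_l_ahom)

lemma pt_r_ahm: "a \<in> car A \<Longrightarrow> ahm M (tens R A M) (pt R A M a)"
 by (simp add: ahm_def ahm_axioms_def abg_tens M.abg_axioms pt_r_ahom)

text \<open>The inductive step is a difference, as in the induction principle for free abelian
  groups from which it comes; it covers negatives too.\<close>

lemma tens_induct [consumes 1, case_names zero diff pure]:
 assumes "t \<in> car (tens R A M)" "P \<zero>\<^bsub>tens R A M\<^esub>"
  and "\<And>x y. \<lbrakk>x \<in> car (tens R A M); y \<in> car (tens R A M); P x; P y\<rbrakk> \<Longrightarrow> P (x \<ominus>\<^bsub>tens R A M\<^esub> y)"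
  and "\<And>a m. \<lbrakk>a \<in> car A; m \<in> car M\<rbrakk> \<Longrightarrow> P (pt R A M a m)"
 shows "P t"
proof -
 obtain x where x: "x \<in> car FG" "t = coset_of R A M x" using assms(1) carrier_tens by auto
 have "P (coset_of R A M x)"
 proof (rule free_Abelian_group_induct[of x "car A \<times> car M" "\<lambda>x. P (coset_of R A M x)"])
  show "P (coset_of R A M 0)" using assms(2) co.zero by simp
  show "P (coset_of R A M (x - y))" if "Poly_Mapping.keys x \<subseteq> car A \<times> car M"
   "Poly_Mapping.keys y \<subseteq> car A \<times> car M" "P (coset_of R A M x)" "P (coset_of R A M y)" for x y
   using that assms(3) by (subst coset_diff) (auto simp: coset_closed)
  show "P (coset_of R A M (frag_of am))" if "am \<in> car A \<times> car M" for am
   using that assms(4) by (cases am) (auto simp: pure_tensor_def)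
 qed (use x in simp)
 then show ?thesis using x by simp
qed

lemma tens_eqI:
 assumes "abg G" "h \<in> ahom (tens R A M) G" "h' \<in> ahom (tens R A M) G"
  and "\<And>a m. a \<in> car A \<Longrightarrow> m \<in> car M \<Longrightarrow> h (pt R A M a m) = h' (pt R A M a m)"
  and "t \<in> car (tens R A M)"
 shows "h t = h' t"
proof -
 interpret h: ahm "tens R A M" G h using assms abg_tens by (simp add: ahm_def ahm_axioms_def)
 interpret h': ahm "tens R A M" G h' using assms abg_tens by (simp add: ahm_def ahm_axioms_def)
 show ?thesis using assms(5) by (induction rule: tens_induct) (auto simp: assms(4))
qed

text \<open>The free abelian group on pairs maps to \<open>G\<close> by \<open>\<beta>\<close>, and
  biadditivity and balance put the defining relations into the kernel.\<close>

lemma tens_universal: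
 assumes G: "abg G"
  and cl: "\<And>a m. a \<in> car A \<Longrightarrow> m \<in> car M \<Longrightarrow> \<beta> a m \<in> car G"
  and l: "\<And>a a' m. a \<in> car A \<Longrightarrow> a' \<in> car A \<Longrightarrow> m \<in> car M \<Longrightarrow>
   \<beta> (a \<oplus>\<^sub>A a') m = \<beta> a m \<oplus>\<^sub>G \<beta> a' m"
  and r: "\<And>a m m'. a \<in> car A \<Longrightarrow> m \<in> car M \<Longrightarrow> m' \<in> car M \<Longrightarrow>
   \<beta> a (m \<oplus>\<^sub>M m') = \<beta> a m \<oplus>\<^sub>G \<beta> a m'"
  and bal: "\<And>r a m. r \<in> car R \<Longrightarrow> a \<in> car A \<Longrightarrow> m \<in> car M \<Longrightarrow>
   \<beta> (r \<odot>\<^sub>A a) m = \<beta> a (r \<odot>\<^sub>M m)"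
 obtains h where "h \<in> ahom (tens R A M) G"
  "\<And>a m. a \<in> car A \<Longrightarrow> m \<in> car M \<Longrightarrow> h (pt R A M a m) = \<beta> a m"
proof -
 interpret G: abg G by (rule G)
 interpret GG: comm_group "add_monoid G" by (rule G.comm_group_add)
 obtain h where h: "h \<in> hom FG (add_monoid G)"
  "\<And>x. x \<in> car A \<times> car M \<Longrightarrow> h (frag_of x) = case_prod \<beta> x"
  by (rule GG.free_Abelian_group_universal[of "case_prod \<beta>" "car A \<times> car M"]) (use cl in auto)
 interpret h: group_hom FG "add_monoid G" h by unfold_locales (rule h(1))
 have h_ahom: "h \<in> ahom (grp_mod FG) G" using h(1) by (auto simp: ahom_def hom_def)
 interpret ha: ahm "grp_mod FG" G h
  using h_ahom abg_grp_mod[OF abelian_free_Abelian_group] G by (simp add: ahm_def ahm_axioms_def)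
 have hd: "h (x - y) = h x \<ominus>\<^sub>G h y" if "x \<in> car FG" "y \<in> car FG" for x y
 proof -
  have "h (x - y) \<oplus>\<^sub>G h y = h x" using ha.add[of "x - y" y] that diff_in_FG[OF that] by simp
  then show ?thesis using that ha.closed diff_in_FG[OF that] by (metis G.add_diff_cancel grp_mod_simps(1))
 qed
 have "gens \<subseteq> kernel FG (add_monoid G) h"
 proof
  fix x assume x: "x \<in> gens"
  have "h x = \<zero>\<^sub>G"
   using x unfolding gens_def
   by (auto simp: hd diff_in_FG frag_in_FG h(2) l r bal cl simp del: carrier_free_Abelian_group_iff)
  then show "x \<in> kernel FG (add_monoid G) h" using gens_in_rel[OF x] by (simp add: kernel_def del: carrier_free_Abelian_group_iff)
 qed
 then have "tensor_rel R A M \<subseteq> kernel FG (add_monoid G) h"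
  unfolding tensor_rel by (rule FG.generate_subgroup_incl[OF _ h.subgroup_kernel])
 then obtain g where g: "g \<in> hom (FG Mod tensor_rel R A M) (add_monoid G)"
  "\<And>x. x \<in> car FG \<Longrightarrow> g (tensor_rel R A M #>\<^sub>FG x) = h x"
  using h.FactGroup_universal_kernel[OF rel.normal_axioms] by metis
 show thesis
 proof
  show "g \<in> ahom (tens R A M) G"
   using g(1) by (auto simp: ahom_def hom_def tens_def tensor_group_def)
  show "g (pt R A M a m) = \<beta> a m" if "a \<in> car A" "m \<in> car M" for a m
   using that g(2)[of "frag_of (a, m)"] h(2) by (simp add: pure_tensor_def coset_of_def)
 qed
qed

end

lemma tens_ctxI: "left_module (op_ring R) A \<Longrightarrow> left_module R M \<Longrightarrow> tens_ctx R A M"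
 by (simp add: tens_ctx_def lmod_iff)

lemma
 assumes A: "left_module (op_ring R) A" "left_module (op_ring R) B" and M: "left_module R M" "left_module R N"
  and f: "f \<in> linear (op_ring R) A B" and g: "g \<in> linear R M N"
 shows tmap_ahom: "tensor_map R B N f g \<in> ahom (tens R A M) (tens R B N)"
  and tmap_pure: "a \<in> car A \<Longrightarrow> m \<in> car M \<Longrightarrow>
   tensor_map R B N f g (pt R A M a m) = pt R B N (f a) (g m)"
proof -
 interpret X: tens_ctx R A M using A M by (intro tens_ctxI)
 interpret Y: tens_ctx R B N using A M by (intro tens_ctxI)
 note lf = linearD[OF f] and lg = linearD[OF g]
 let ?F = "frag_extend (\<lambda>(a, m). frag_of (f a, g m))"
 obtain h where h: "h \<in> ahom (tens R A M) (tens R B N)"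
  "\<And>a m. a \<in> car A \<Longrightarrow> m \<in> car M \<Longrightarrow> h (pt R A M a m) = pt R B N (f a) (g m)"
  by (rule X.tens_universal[OF Y.abg_tens, of "\<lambda>a m. pt R B N (f a) (g m)"])
   (use lf lg in \<open>auto simp: Y.pt_add_l Y.pt_add_r Y.pt_balanced\<close>)
 interpret h: ahm "tens R A M" "tens R B N" h
  using h X.abg_tens Y.abg_tens by (simp add: ahm_def ahm_axioms_def)
 have F: "?F x \<in> car Y.FG \<and> coset_of R B N (?F x) = h (coset_of R A M x)" if "x \<in> car X.FG" for x
 proof -
  show ?thesis
  proof (rule free_Abelian_group_induct[of x "car A \<times> car M"
     "\<lambda>x. ?F x \<in> car Y.FG \<and> coset_of R B N (?F x) = h (coset_of R A M x)"])
   show "?F 0 \<in> car Y.FG \<and> coset_of R B N (?F 0) = h (coset_of R A M 0)"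
    using X.coset_zero Y.coset_zero h.zero by simp
  next
   fix x y assume 2: "Poly_Mapping.keys x \<subseteq> car A \<times> car M" "Poly_Mapping.keys y \<subseteq> car A \<times> car M"
    "?F x \<in> car Y.FG \<and> coset_of R B N (?F x) = h (coset_of R A M x)"
    "?F y \<in> car Y.FG \<and> coset_of R B N (?F y) = h (coset_of R A M y)"
   have xy: "x \<in> car X.FG" "y \<in> car X.FG" using 2 by auto
   have "?F (x - y) = ?F x - ?F y" by (rule frag_extend_diff)
   then show "?F (x - y) \<in> car Y.FG \<and> coset_of R B N (?F (x - y)) = h (coset_of R A M (x - y))"
    using 2 X.coset_diff[OF xy] Y.coset_diff[of "?F x" "?F y"] Y.diff_in_FG[of "?F x" "?F y"]
     h.diff[OF X.coset_closed[OF xy(1)] X.coset_closed[OF xy(2)]]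
    by (simp del: carrier_free_Abelian_group_iff)
  next
   fix am assume "am \<in> car A \<times> car M"
   then show "?F (frag_of am) \<in> car Y.FG \<and> coset_of R B N (?F (frag_of am)) = h (coset_of R A M (frag_of am))"
    using h(2) lf(1) lg(1) by (cases am) (auto simp: pure_tensor_def)
  qed (use that in simp)
 qed
 \<comment> \<open>\<open>tensor_map\<close> is a union over all representatives of the coset. Every
   representative yields \<open>h t\<close>, and there is at least one, so the union is
   \<open>h t\<close>.\<close>
 have eq: "tensor_map R B N f g t = h t" if t: "t \<in> car (tens R A M)" for t
 proof -
  obtain x0 where x0: "x0 \<in> car X.FG" "t = coset_of R A M x0" using t X.carrier_tens by auto
  interpret FGm: comm_group X.FG by (rule abelian_free_Abelian_group)
  have x0t: "x0 \<in> t" unfolding x0(2) coset_of_def by (rule FGm.rcos_self[OF x0(1) X.subgroup_rel])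
  have "coset_of R B N (?F x) = h t" if "x \<in> t" for x
  proof -
   have x: "x \<in> car X.FG"
    using that FGm.r_coset_subset_G[OF subgroup.subset[OF X.subgroup_rel] x0(1)]
    unfolding x0(2) coset_of_def by (rule subsetD[rotated])
   have "coset_of R A M x = t"
    using that FGm.repr_independence[OF _ x0(1) X.subgroup_rel, of x] x0(2) by (simp add: coset_of_def)
   then show ?thesis using F[OF x] by simp
  qed
  then show ?thesis unfolding tensor_map_def using x0t by blast
 qed
 show "tensor_map R B N f g \<in> ahom (tens R A M) (tens R B N)"
  using h(1) eq X.abg_tens by (simp add: ahom_def abg.add_closed)
 show "tensor_map R B N f g (pt R A M a m) = pt R B N (f a) (g m)" if "a \<in> car A" "m \<in> car M"
  using that eq h(2) by simp
qed

lemma ahmI: "abg A \<Longrightarrow> abg B \<Longrightarrow> h \<in> ahom A B \<Longrightarrow> ahm A B h"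
 by (simp add: ahm_def ahm_axioms_def)

text \<open>Let \<open>Q\<close> be the quotient of \<open>V \<otimes> M\<close> by the image of
  \<open>U \<otimes> M\<close>. A set-theoretic section of \<open>w\<close> defines a map from
  \<open>A \<otimes> M\<close> to \<open>Q\<close> through which the projection of
  \<open>V \<otimes> M\<close> factors, so an element that dies in \<open>A \<otimes> M\<close> also
  dies in \<open>Q\<close>.\<close>

lemma tens_right_exact:
 assumes U: "left_module (op_ring R) U" and V: "left_module (op_ring R) V" and A: "left_module (op_ring R) A"
  and M: "left_module R M" and u: "u \<in> linear (op_ring R) U V" and w: "w \<in> linear (op_ring R) V A"
  and onto: "w ` car V = car A" and ex: "\<And>v. v \<in> car V \<Longrightarrow> w v = \<zero>\<^sub>A \<Longrightarrow> v \<in> u ` car U"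
  and t: "t \<in> car (tens R V M)" "tmapl R A M w t = \<zero>\<^bsub>tens R A M\<^esub>"
 shows "t \<in> tmapl R V M u ` car (tens R U M)"
proof -
 interpret U: tens_ctx R U M using U M by (rule tens_ctxI)
 interpret V: tens_ctx R V M using V M by (rule tens_ctxI)
 interpret A: tens_ctx R A M using A M by (rule tens_ctxI)
 let ?u = "tmapl R V M u" and ?w = "tmapl R A M w"
 have uh: "?u \<in> ahom (tens R U M) (tens R V M)" by (rule tmap_ahom[OF U V M M u linear_id])
 have wh: "?w \<in> ahom (tens R V M) (tens R A M)" by (rule tmap_ahom[OF V A M M w linear_id])
 note up = tmap_pure[OF U V M M u linear_id] and wp = tmap_pure[OF V A M M w linear_id]
 let ?Q = "quot (tens R V M) (?u ` car (tens R U M))"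
 obtain \<pi> where Q: "abg ?Q" and \<pi>: "\<pi> \<in> ahom (tens R V M) ?Q"
  and \<pi>0: "\<And>x. x \<in> car (tens R V M) \<Longrightarrow> \<pi> x = \<zero>\<^sub>?Q \<longleftrightarrow> x \<in> ?u ` car (tens R U M)"
  using quot_projection[OF V.abg_tens U.abg_tens uh] by blast
 interpret Q: abg ?Q by (rule Q)
 interpret \<pi>: ahm "tens R V M" ?Q \<pi> by (rule ahmI[OF V.abg_tens Q \<pi>])
 interpret w: ahm V A w using w V.A.abg_axioms A.A.abg_axioms by (intro ahmI) (auto simp: linear_def)
 interpret wh: ahm "tens R V M" "tens R A M" ?w by (rule ahmI[OF V.abg_tens A.abg_tens wh])
 define s where "s a = (SOME v. v \<in> car V \<and> w v = a)" for a
 have s: "s a \<in> car V \<and> w (s a) = a" if "a \<in> car A" for a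
 proof -
  have "a \<in> w ` car V" using that onto by simp
  then show ?thesis unfolding s_def by (intro someI_ex[of "\<lambda>v. v \<in> car V \<and> w v = a"]) auto
 qed
 \<comment> \<open>Modulo the image of \<open>U \<otimes> M\<close> the choice of a preimage under
   \<open>w\<close> does not matter. This makes the arbitrary section \<open>s\<close> additive and
   balanced there.\<close>
 have \<pi>_eq: "\<pi> (pt R V M v m) = \<pi> (pt R V M v' m)"
  if v: "v \<in> car V" "v' \<in> car V" "w v = w v'" and m: "m \<in> car M" for v v' m
 proof -
  interpret l: ahm V "tens R V M" "\<lambda>a. pt R V M a m" by (rule V.pt_l_ahm[OF m])
  have "w (v \<ominus>\<^sub>V v') = \<zero>\<^sub>A" using v by simp
  then obtain z where z: "z \<in> car U" "v \<ominus>\<^sub>V v' = u z" using ex[of "v \<ominus>\<^sub>V v'"] v by auto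
  have "\<pi> (pt R V M (v \<ominus>\<^sub>V v') m) = \<zero>\<^sub>?Q"
   using z m v up[OF z(1) m] U.pt_closed[OF z(1) m] linearD(1)[OF u z(1)] by (subst \<pi>0) (auto simp: image_iff)
  then show ?thesis using v m by (simp add: Q.diff_eq_zero)
 qed
 have lin: "w (s a \<oplus>\<^sub>V s a') = a \<oplus>\<^sub>A a'" if "a \<in> car A" "a' \<in> car A" for a a'
  using s[OF that(1)] s[OF that(2)] by simp
 obtain g where g: "g \<in> ahom (tens R A M) ?Q"
  "\<And>a m. a \<in> car A \<Longrightarrow> m \<in> car M \<Longrightarrow> g (pt R A M a m) = \<pi> (pt R V M (s a) m)"
 proof (rule A.tens_universal[OF Q, of "\<lambda>a m. \<pi> (pt R V M (s a) m)"])
  show "\<pi> (pt R V M (s (a \<oplus>\<^sub>A a')) m) = \<pi> (pt R V M (s a) m) \<oplus>\<^sub>?Q \<pi> (pt R V M (s a') m)"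
   if "a \<in> car A" "a' \<in> car A" "m \<in> car M" for a a' m
  proof -
   have "\<pi> (pt R V M (s (a \<oplus>\<^sub>A a')) m) = \<pi> (pt R V M (s a \<oplus>\<^sub>V s a') m)"
    by (rule \<pi>_eq) (use that s s[of "a \<oplus>\<^sub>A a'"] lin in auto)
   then show ?thesis using that s by (simp add: V.pt_add_l)
  qed
  show "\<pi> (pt R V M (s (r \<odot>\<^sub>A a)) m) = \<pi> (pt R V M (s a) (r \<odot>\<^sub>M m))"
   if "r \<in> car R" "a \<in> car A" "m \<in> car M" for r a m
  proof -
   have "\<pi> (pt R V M (s (r \<odot>\<^sub>A a)) m) = \<pi> (pt R V M (r \<odot>\<^sub>V s a) m)"
    by (rule \<pi>_eq) (use that s[of a] s[of "r \<odot>\<^sub>A a"] linearD(3)[OF w] in auto)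
   then show ?thesis using that s by (simp add: V.pt_balanced)
  qed
 qed (use s in \<open>auto simp: V.pt_add_r\<close>)
 have "g (?w t) = \<pi> t"
 proof (rule V.tens_eqI[OF Q ahom_comp[OF wh g(1)] \<pi> _ t(1)])
  fix v m assume "v \<in> car V" "m \<in> car M"
  then show "g (?w (pt R V M v m)) = \<pi> (pt R V M v m)"
   using wp g(2)[of "w v" m] s[of "w v"] \<pi>_eq[of "s (w v)" v m] by simp
 qed
 interpret g: ahm "tens R A M" ?Q g by (rule ahmI[OF A.abg_tens Q g(1)])
 from \<open>g (?w t) = \<pi> t\<close> have "\<pi> t = \<zero>\<^sub>?Q" using t(2) by simp
 then show ?thesis using \<pi>0[OF t(1)] by simp
qed

section \<open>Matrices acting on powers of a module\<close>

definition mv :: "('r, 'm) module \<Rightarrow> nat \<Rightarrow> nat \<Rightarrow> (nat \<Rightarrow> nat \<Rightarrow> 'r) \<Rightarrow> (nat \<Rightarrow> 'm) \<Rightarrow> nat \<Rightarrow> 'm" where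
 "mv M a b D x = (\<lambda>j \<in> {..<b}. nsum M (\<lambda>k. D j k \<odot>\<^sub>M x k) a)"

definition pm :: "nat \<Rightarrow> ('m \<Rightarrow> 'n) \<Rightarrow> (nat \<Rightarrow> 'm) \<Rightarrow> nat \<Rightarrow> 'n" where
 "pm b f x = (\<lambda>k \<in> {..<b}. f (x k))"

lemma mv_nth [simp]: "j < b \<Longrightarrow> mv M a b D x j = nsum M (\<lambda>k. D j k \<odot>\<^sub>M x k) a"
 by (simp add: mv_def)

lemma pm_nth [simp]: "k < b \<Longrightarrow> pm b f x k = f (x k)"
 by (simp add: pm_def)

lemma (in lmod) mv_closed:
 assumes "\<And>j k. j < b \<Longrightarrow> k < a \<Longrightarrow> D j k \<in> car R" "x \<in> car (mpow a M)"
 shows "mv M a b D x \<in> car (mpow b M)"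
 using assms by (auto simp: mv_def intro!: nsum_closed)

lemma (in lmod) mv_ahom:
 assumes "\<And>j k. j < b \<Longrightarrow> k < a \<Longrightarrow> D j k \<in> car R"
 shows "mv M a b D \<in> ahom (mpow a M) (mpow b M)"
proof -
 interpret P: abg "mpow a M" by (rule abg_pow) unfold_locales
 interpret Q: abg "mpow b M" by (rule abg_pow) unfold_locales
 have "mv M a b D (x \<oplus>\<^bsub>mpow a M\<^esub> y) = mv M a b D x \<oplus>\<^bsub>mpow b M\<^esub> mv M a b D y"
  if "x \<in> car (mpow a M)" "y \<in> car (mpow a M)" for x y
 proof (rule pow_eqI[of _ b M])
  fix j assume j: "j < b"
  have "nsum M (\<lambda>k. D j k \<odot>\<^sub>M (x \<oplus>\<^bsub>mpow a M\<^esub> y) k) a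
    = nsum M (\<lambda>k. D j k \<odot>\<^sub>M x k \<oplus>\<^sub>M D j k \<odot>\<^sub>M y k) a"
   by (rule nsum_cong) (use that j assms in \<open>auto simp: smult_r_distr\<close>)
  also have "\<dots> = nsum M (\<lambda>k. D j k \<odot>\<^sub>M x k) a \<oplus>\<^sub>M nsum M (\<lambda>k. D j k \<odot>\<^sub>M y k) a"
   by (rule nsum_add) (use that j assms in auto)
  finally show "mv M a b D (x \<oplus>\<^bsub>mpow a M\<^esub> y) j = (mv M a b D x \<oplus>\<^bsub>mpow b M\<^esub> mv M a b D y) j"
   using j by simp
 qed (use that assms mv_closed in auto)
 then show ?thesis using mv_closed assms by (simp add: ahom_def)
qed

lemma pm_closed: "f \<in> ahom M N \<Longrightarrow> x \<in> car (mpow b M) \<Longrightarrow> pm b f x \<in> car (mpow b N)"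
 by (auto simp: pm_def ahom_def)

lemma pm_ahom: "f \<in> ahom M N \<Longrightarrow> pm b f \<in> ahom (mpow b M) (mpow b N)"
 by (simp add: ahom_def pm_def add_pow cong: restrict_cong)

lemma pm_mv:
 assumes M: "left_module R M" and N: "left_module R N" and f: "f \<in> linear R M N"
  and D: "\<And>j k. j < b \<Longrightarrow> k < a \<Longrightarrow> D j k \<in> car R" and x: "x \<in> car (mpow a M)"
 shows "pm b f (mv M a b D x) = mv N a b D (pm a f x)"
proof -
 interpret M: lmod R M using M by (simp add: lmod_iff)
 interpret N: lmod R N using N by (simp add: lmod_iff)
 interpret f: ahm M N f using f M.abg_axioms N.abg_axioms by (intro ahmI) (auto simp: linear_def)
 show ?thesis
 proof (rule pow_eqI[of _ b N])
  show "pm b f (mv M a b D x) \<in> car (mpow b N)"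
   by (rule pm_closed[OF f.ahom M.mv_closed[OF D x]])
  show "mv N a b D (pm a f x) \<in> car (mpow b N)"
   by (rule N.mv_closed[OF D pm_closed[OF f.ahom x]])
  show "pm b f (mv M a b D x) j = mv N a b D (pm a f x) j" if "j < b" for j
   using that x D linearD(3)[OF f] by (simp add: f.nsum cong: nsum_cong)
 qed
qed

abbreviation uv :: "'r ring \<Rightarrow> nat \<Rightarrow> nat \<Rightarrow> nat \<Rightarrow> 'r" where
 "uv R m \<equiv> uvec R {..<m}"

lemma uvec_op [simp]: "uvec (op_ring R) X = uvec R X"
 by (simp add: uvec_def fun_eq_iff)

section \<open>Tensor products with free modules and with finitely presented modules\<close>

locale free_tens = M: lmod R M for R :: "'r ring" and M :: "('r, 'm) module"
begin

abbreviation "F l \<equiv> fr (op_ring R) l"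

lemma F: "left_module (op_ring R) (F l)"
 by (rule lm_free) (simp add: M.ring)

sublocale Ft: tens_ctx R "F l" M for l
 by (rule tens_ctxI[OF F M.left_module])

lemma uv_closed [simp]: "uv R l k \<in> car (F l)"
 using uvec_closed[of "op_ring R" "{..<l}" k] M.ring by simp

text \<open>\<open>tau\<close> and \<open>sigma\<close> are the two directions of the isomorphism
  between \<open>R^l \<otimes> M\<close> and \<open>M^l\<close>. \<open>sigma\<close> comes from the
  universal property, which gives existence only; hence its definition by
  \<open>SOME\<close>.\<close>

definition tau :: "nat \<Rightarrow> (nat \<Rightarrow> 'm) \<Rightarrow> ((nat \<Rightarrow> 'r) \<times> 'm \<Rightarrow>\<^sub>0 int) set" where
 "tau l x = nsum (tens R (F l) M) (\<lambda>k. pt R (F l) M (uv R l k) (x k)) l"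

lemma tau_closed: "x \<in> car (mpow l M) \<Longrightarrow> tau l x \<in> car (tens R (F l) M)"
proof -
 interpret T: abg "tens R (F l) M" by (rule Ft.abg_tens)
 show "x \<in> car (mpow l M) \<Longrightarrow> tau l x \<in> car (tens R (F l) M)"
  unfolding tau_def by (rule T.nsum_closed) auto
qed

lemma sigma_exists:
 "\<exists>\<sigma> \<in> ahom (tens R (F l) M) (mpow l M). \<forall>r \<in> car (F l). \<forall>m \<in> car M.
   \<sigma> (pt R (F l) M r m) = (\<lambda>k \<in> {..<l}. r k \<odot>\<^sub>M m)"
proof -
 interpret P: abg "mpow l M" by (rule abg_pow[OF M.abg_axioms])
 have cl: "r k \<in> car R" if "r \<in> car (F l)" "k < l" for r k
  using free_closed[of r "op_ring R" "{..<l}" k] that by simp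
 obtain \<sigma> where "\<sigma> \<in> ahom (tens R (F l) M) (mpow l M)"
  "\<And>r m. r \<in> car (F l) \<Longrightarrow> m \<in> car M \<Longrightarrow> \<sigma> (pt R (F l) M r m) = (\<lambda>k \<in> {..<l}. r k \<odot>\<^sub>M m)"
  by (rule Ft.tens_universal[OF P.abg_axioms, of l "\<lambda>r m. \<lambda>k \<in> {..<l}. r k \<odot>\<^sub>M m"])
   (auto simp: cl add_pow M.smult_l_distr M.smult_r_distr M.smult_assoc intro!: restrict_ext)
 then show ?thesis by blast
qed

definition sigma where
 "sigma l = (SOME \<sigma>. \<sigma> \<in> ahom (tens R (F l) M) (mpow l M) \<and> (\<forall>r \<in> car (F l). \<forall>m \<in> car M.
   \<sigma> (pt R (F l) M r m) = (\<lambda>k \<in> {..<l}. r k \<odot>\<^sub>M m)))"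

lemma sigma: "sigma l \<in> ahom (tens R (F l) M) (mpow l M)"
 and sigma_pure: "r \<in> car (F l) \<Longrightarrow> m \<in> car M \<Longrightarrow>
  sigma l (pt R (F l) M r m) = (\<lambda>k \<in> {..<l}. r k \<odot>\<^sub>M m)"
 using someI_ex[OF sigma_exists[of l, unfolded Bex_def]] unfolding sigma_def by blast+

lemma sigma_tau:
 assumes x: "x \<in> car (mpow l M)" shows "sigma l (tau l x) = x"
proof -
 interpret s: ahm "tens R (F l) M" "mpow l M" "sigma l"
  by (rule ahmI[OF Ft.abg_tens abg_pow[OF M.abg_axioms] sigma])
 show ?thesis
 proof (rule pow_eqI[OF s.closed[OF tau_closed[OF x]] x])
  fix i assume i: "i < l"
  have "sigma l (tau l x) = nsum (mpow l M) (\<lambda>k. sigma l (pt R (F l) M (uv R l k) (x k))) l"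
   unfolding tau_def by (rule s.nsum) (use x in auto)
  then have "sigma l (tau l x) i = nsum M (\<lambda>k. sigma l (pt R (F l) M (uv R l k) (x k)) i) l"
   using i by (simp add: nsum_pow)
  also have "\<dots> = nsum M (\<lambda>k. if k = i then x k else \<zero>\<^sub>M) l"
   by (rule nsum_cong) (use x i in \<open>auto simp: sigma_pure\<close>)
  also have "\<dots> = x i" by (rule M.nsum_delta) (use x i in auto)
  finally show "sigma l (tau l x) i = x i" .
 qed
qed

lemma tau_ahom: "tau l \<in> ahom (mpow l M) (tens R (F l) M)"
proof -
 interpret T: abg "tens R (F l) M" by (rule Ft.abg_tens)
 have "tau l (x \<oplus>\<^bsub>mpow l M\<^esub> y) = tau l x \<oplus>\<^bsub>tens R (F l) M\<^esub> tau l y"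
  if "x \<in> car (mpow l M)" "y \<in> car (mpow l M)" for x y
  unfolding tau_def using that
  by (subst T.nsum_add[symmetric]) (auto simp: Ft.pt_add_r intro!: nsum_cong)
 then show ?thesis by (simp add: ahom_def tau_closed)
qed

lemma tau_sigma:
 assumes t: "t \<in> car (tens R (F l) M)" shows "tau l (sigma l t) = t"
proof (rule Ft.tens_eqI[OF Ft.abg_tens ahom_comp[OF sigma tau_ahom] _ _ t, where h' = "\<lambda>t. t"])
 show "(\<lambda>t. t) \<in> ahom (tens R (F l) M) (tens R (F l) M)" by (simp add: ahom_def)
 fix r m assume r: "r \<in> car (F l)" and m: "m \<in> car M"
 interpret p: ahm "F l" "tens R (F l) M" "\<lambda>a. pt R (F l) M a m" by (rule Ft.pt_l_ahm[OF m])
 have rk: "r k \<in> car R" if "k < l" for k using free_closed[OF r] that by simp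
 have "r = lincomb (F l) l (uv R l) r"
  using Ft.A.lhom_fr_eq_lincomb[OF lhom_id[OF F] r] r by (simp add: lincomb_def)
 then have "pt R (F l) M r m = pt R (F l) M (nsum (F l) (\<lambda>k. r k \<odot>\<^bsub>F l\<^esub> uv R l k) l) m"
  by (simp add: lincomb_def)
 also have "\<dots> = nsum (tens R (F l) M) (\<lambda>k. pt R (F l) M (r k \<odot>\<^bsub>F l\<^esub> uv R l k) m) l"
  by (rule p.nsum) (use Ft.A.smult_closed rk in auto)
 also have "\<dots> = tau l (sigma l (pt R (F l) M r m))"
  unfolding tau_def sigma_pure[OF r m] by (rule nsum_cong) (use m rk in \<open>auto simp: Ft.pt_balanced\<close>)
 finally show "tau l (sigma l (pt R (F l) M r m)) = pt R (F l) M r m" by simp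
qed

lemma mat_closed: "d \<in> lhom (op_ring R) (F b) (F a) \<Longrightarrow> k < a \<Longrightarrow> d (uv R b j) k \<in> car R"
 using lhom_closed[of d "op_ring R" "F b" "F a" "uv R b j"] free_closed[of "d (uv R b j)" "op_ring R" "{..<a}" k] by simp

text \<open>Column \<open>j\<close> of the matrix is the image of unit vector \<open>j\<close>. The
  free module is one over \<open>op_ring R\<close>, so the scalars of \<open>r\<close> end up to the
  right of the matrix entries, as the action on the left module \<open>M\<close> requires.\<close>

lemma sigma_map:
 assumes d: "d \<in> lhom (op_ring R) (F b) (F a)" and t: "t \<in> car (tens R (F b) M)"
 shows "sigma a (tmapl R (F a) M d t) = mv M b a (\<lambda>k j. d (uv R b j) k) (sigma b t)"
proof (rule Ft.tens_eqI[OF abg_pow[OF M.abg_axioms] _ _ _ t])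
 note lin = lhom_linear[OF d]
 show "(\<lambda>t. sigma a (tmapl R (F a) M d t)) \<in> ahom (tens R (F b) M) (mpow a M)"
  by (rule ahom_comp[OF tmap_ahom[OF F F M.left_module M.left_module lin linear_id] sigma])
 show "(\<lambda>t. mv M b a (\<lambda>k j. d (uv R b j) k) (sigma b t)) \<in> ahom (tens R (F b) M) (mpow a M)"
  by (rule ahom_comp[OF sigma M.mv_ahom]) (use mat_closed[OF d] in auto)
 fix r m assume r: "r \<in> car (F b)" and m: "m \<in> car M"
 have rk: "r k \<in> car R" if "k < b" for k using free_closed[OF r] that by simp
 have dr: "d r \<in> car (F a)" by (rule lhom_closed[OF d r])
 have dk: "d r k = nsum R (\<lambda>j. d (uv R b j) k \<otimes>\<^sub>R r j) b" if k: "k < a" for k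
 proof -
  have "d r = lincomb (F a) b (\<lambda>j. d (uv R b j)) r"
   using Ft.A.lhom_fr_eq_lincomb[OF d r] by simp
  moreover have "nsum (F a) f n k = nsum R (\<lambda>j. f j k) n" for f n
   using k by (induction n) auto
  ultimately show ?thesis using k by (simp add: lincomb_def)
 qed
 have "tmapl R (F a) M d (pt R (F b) M r m) = pt R (F a) M (d r) m"
  by (rule tmap_pure[OF F F M.left_module M.left_module lin linear_id r m])
 moreover have "(\<lambda>k \<in> {..<a}. d r k \<odot>\<^sub>M m) = mv M b a (\<lambda>k j. d (uv R b j) k) (\<lambda>k \<in> {..<b}. r k \<odot>\<^sub>M m)"
  unfolding mv_def
 proof (rule restrict_ext)
  fix k assume k: "k \<in> {..<a}"
  interpret R: ring R by (rule M.ring)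
  have "d r k \<odot>\<^sub>M m = nsum M (\<lambda>j. (d (uv R b j) k \<otimes>\<^sub>R r j) \<odot>\<^sub>M m) b"
   using k m mat_closed[OF d] rk by (simp add: dk M.nsum_smult)
  also have "\<dots> = nsum M (\<lambda>j. d (uv R b j) k \<odot>\<^sub>M (\<lambda>k \<in> {..<b}. r k \<odot>\<^sub>M m) j) b"
   by (rule nsum_cong) (use k m mat_closed[OF d] rk in \<open>auto simp: M.smult_assoc\<close>)
  finally show "d r k \<odot>\<^sub>M m = nsum M (\<lambda>j. d (uv R b j) k \<odot>\<^sub>M (\<lambda>k \<in> {..<b}. r k \<odot>\<^sub>M m) j) b" .
 qed
 ultimately show "sigma a (tmapl R (F a) M d (pt R (F b) M r m)) =
   mv M b a (\<lambda>k j. d (uv R b j) k) (sigma b (pt R (F b) M r m))"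
  using r m dr by (simp add: sigma_pure)
qed

end

text \<open>A presentation of \<open>A\<close> by free right modules of ranks \<open>l'\<close> and
  \<open>l\<close>. Tensoring it with \<open>M\<close> makes \<open>A \<otimes> M\<close> the
  cokernel of a matrix from \<open>M^l'\<close> to \<open>M^l\<close>, with \<open>gam\<close> as
  the projection.\<close>

locale presented_tens = free_tens R M for R :: "'r ring" and M :: "('r, 'm) module" +
 fixes A :: "('r, 'a) module" and l l' :: nat and p d
 assumes A: "left_module (op_ring R) A"
  and p: "p \<in> lhom (op_ring R) (F l) A" "p ` car (F l) = car A"
  and d: "d \<in> lhom (op_ring R) (F l') (F l)" "d ` car (F l') = lker (F l) A p"
begin

sublocale At: tens_ctx R A M by (rule tens_ctxI[OF A M.left_module])

definition gam :: "(nat \<Rightarrow> 'm) \<Rightarrow> ('a \<times> 'm \<Rightarrow>\<^sub>0 int) set" where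
 "gam x = nsum (tens R A M) (\<lambda>k. pt R A M (p (uv R l k)) (x k)) l"

lemma c_closed [simp]: "p (uv R l k) \<in> car A"
 by (rule lhom_closed[OF p(1)]) simp

lemma gam_ahom: "gam \<in> ahom (mpow l M) (tens R A M)"
proof -
 interpret T: abg "tens R A M" by (rule At.abg_tens)
 have "gam (x \<oplus>\<^bsub>mpow l M\<^esub> y) = gam x \<oplus>\<^bsub>tens R A M\<^esub> gam y"
  if "x \<in> car (mpow l M)" "y \<in> car (mpow l M)" for x y
  unfolding gam_def using that
  by (subst T.nsum_add[symmetric]) (auto simp: At.pt_add_r intro!: nsum_cong)
 then show ?thesis by (auto simp: ahom_def gam_def intro!: T.nsum_closed)
qed

abbreviation "pp \<equiv> tmapl R A M p"

lemma pp: "pp \<in> ahom (tens R (F l) M) (tens R A M)"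
 by (rule tmap_ahom[OF F A M.left_module M.left_module lhom_linear[OF p(1)] linear_id])

lemma gam_pp:
 assumes x: "x \<in> car (mpow l M)" shows "pp (tau l x) = gam x"
proof -
 interpret pp: ahm "tens R (F l) M" "tens R A M" pp by (rule ahmI[OF Ft.abg_tens At.abg_tens pp])
 have "pp (tau l x) = nsum (tens R A M) (\<lambda>k. pp (pt R (F l) M (uv R l k) (x k))) l"
  unfolding tau_def by (rule pp.nsum) (use x in auto)
 also have "\<dots> = gam x"
  unfolding gam_def
  by (rule nsum_cong, rule tmap_pure[OF F A M.left_module M.left_module lhom_linear[OF p(1)] linear_id])
   (use x in auto)
 finally show ?thesis .
qed

lemma gam_surj:
 assumes t: "t \<in> car (tens R A M)" shows "\<exists>x \<in> car (mpow l M). gam x = t"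
proof -
 interpret g: ahm "mpow l M" "tens R A M" gam
  by (rule ahmI[OF abg_pow[OF M.abg_axioms] At.abg_tens gam_ahom])
 show ?thesis using t
 proof (induction rule: At.tens_induct)
  case zero
  then show ?case by (intro bexI[of _ "\<zero>\<^bsub>mpow l M\<^esub>"]) auto
 next
  case (diff x y)
  then obtain u v where "u \<in> car (mpow l M)" "gam u = x" "v \<in> car (mpow l M)" "gam v = y" by blast
  then show ?case by (intro bexI[of _ "u \<ominus>\<^bsub>mpow l M\<^esub> v"]) auto
 next
  case (pure a m)
  then obtain r where r: "r \<in> car (F l)" "p r = a" using p(2) by (metis imageE)
  have "sigma l (pt R (F l) M r m) \<in> car (mpow l M)"
   using sigma[of l] r pure by (simp add: ahom_def)
  moreover have "gam (sigma l (pt R (F l) M r m)) = pt R A M a m"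
   using gam_pp[OF calculation] r pure
    tmap_pure[OF F A M.left_module M.left_module lhom_linear[OF p(1)] linear_id, of r m]
   by (simp add: tau_sigma)
  ultimately show ?case by blast
 qed
qed

lemma gam_zero_iff:
 assumes x: "x \<in> car (mpow l M)"
 shows "gam x = \<zero>\<^bsub>tens R A M\<^esub> \<longleftrightarrow>
  (\<exists>y \<in> car (mpow l' M). x = mv M l' l (\<lambda>k j. d (uv R l' j) k) y)"
proof
 let ?d = "tmapl R (F l) M d"
 assume "gam x = \<zero>\<^bsub>tens R A M\<^esub>"
 then have "pp (tau l x) = \<zero>\<^bsub>tens R A M\<^esub>" using gam_pp[OF x] by simp
 then have "tau l x \<in> ?d ` car (tens R (F l') M)"
  by (intro tens_right_exact[OF F F A M.left_module lhom_linear[OF d(1)] lhom_linear[OF p(1)] p(2) _ tau_closed[OF x]])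
   (auto simp: d(2) lker_def)
 then obtain t where t: "t \<in> car (tens R (F l') M)" "tau l x = ?d t" by auto
 have "x = mv M l' l (\<lambda>k j. d (uv R l' j) k) (sigma l' t)"
  using sigma_map[OF d(1) t(1)] t(2) sigma_tau[OF x] by simp
 then show "\<exists>y \<in> car (mpow l' M). x = mv M l' l (\<lambda>k j. d (uv R l' j) k) y"
  using sigma[of l'] t(1) by (auto simp: ahom_def)
next
 let ?d = "tmapl R (F l) M d"
 assume "\<exists>y \<in> car (mpow l' M). x = mv M l' l (\<lambda>k j. d (uv R l' j) k) y"
 then obtain y where y: "y \<in> car (mpow l' M)" "x = mv M l' l (\<lambda>k j. d (uv R l' j) k) y" by blast
 have dh: "?d \<in> ahom (tens R (F l') M) (tens R (F l) M)"
  by (rule tmap_ahom[OF F F M.left_module M.left_module lhom_linear[OF d(1)] linear_id])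
 interpret z: ahm "mpow l' M" "tens R A M" "\<lambda>y. pp (?d (tau l' y))"
  by (rule ahmI[OF abg_pow[OF M.abg_axioms] At.abg_tens ahom_comp[OF ahom_comp[OF tau_ahom dh] pp]])
 \<comment> \<open>The composite of \<open>d\<close> and \<open>p\<close> is zero, which is visible
   on pure tensors.\<close>
 have zero: "pp (?d t) = \<zero>\<^bsub>tens R A M\<^esub>" if "t \<in> car (tens R (F l') M)" for t
 proof (rule Ft.tens_eqI[OF At.abg_tens ahom_comp[OF dh pp] ahom_zero[OF At.abg_tens] _ that])
  fix r m assume rm: "r \<in> car (F l')" "m \<in> car M"
  have "d r \<in> lker (F l) A p" using d(2) rm by blast
  then have dr: "d r \<in> car (F l)" "p (d r) = \<zero>\<^sub>A" by (auto simp: lker_def)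
  interpret q: ahm A "tens R A M" "\<lambda>a. pt R A M a m" by (rule At.pt_l_ahm[OF rm(2)])
  show "pp (?d (pt R (F l') M r m)) = \<zero>\<^bsub>tens R A M\<^esub>"
   using tmap_pure[OF F F M.left_module M.left_module lhom_linear[OF d(1)] linear_id rm]
    tmap_pure[OF F A M.left_module M.left_module lhom_linear[OF p(1)] linear_id dr(1) rm(2)] dr(2)
   by simp
 qed
 have "?d (tau l' y) = tau l x"
 proof -
  have "sigma l (?d (tau l' y)) = x"
   using sigma_map[OF d(1) tau_closed[OF y(1)]] sigma_tau[OF y(1)] y(2) by simp
  then show ?thesis using tau_sigma[of "?d (tau l' y)" l] dh tau_closed[OF y(1)] by (auto simp: ahom_def)
 qed
 then show "gam x = \<zero>\<^bsub>tens R A M\<^esub>" using zero[OF tau_closed[OF y(1)]] gam_pp[OF x] by simp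
qed

end

section \<open>Comparison of projective resolutions\<close>

text \<open>A projective resolution with its augmentation, in which the resolving modules and the
  index sets have types of their own. Both the chosen resolutions behind \<open>Ext\<close> and
  \<open>Tor\<close> and the resolutions by \<open>fr R m\<close> are instances.\<close>

definition aug_res :: "'r ring \<Rightarrow> ('r, 'm) module \<Rightarrow> (nat \<Rightarrow> ('r, 'y) module) \<Rightarrow> ('y \<Rightarrow> 'm) \<Rightarrow>
  (nat \<Rightarrow> 'y \<Rightarrow> 'y) \<Rightarrow> (nat \<Rightarrow> 'i set) \<Rightarrow> bool" where
 "aug_res R M Y p d I \<longleftrightarrow> left_module R M \<and> (\<forall>i. left_module R (Y i)) \<and> p \<in> lhom R (Y 0) M \<and>
   p ` car (Y 0) = car M \<and> (\<forall>i. d i \<in> lhom R (Y (Suc i)) (Y i)) \<and>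
   d 0 ` car (Y 1) = lker (Y 0) M p \<and>
   (\<forall>i. d (Suc i) ` car (Y (Suc (Suc i))) = lker (Y (Suc i)) (Y i) (d i)) \<and>
   (\<forall>i. proj_via R (Y i) (I i))"

locale aug =
 fixes R :: "'r ring" and M :: "('r, 'm) module" and Y :: "nat \<Rightarrow> ('r, 'y) module" and p d
  and I :: "nat \<Rightarrow> 'i set"
 assumes aug: "aug_res R M Y p d I"
begin

lemma M: "left_module R M" and Y: "left_module R (Y i)" and p: "p \<in> lhom R (Y 0) M"
 and p_onto: "p ` car (Y 0) = car M" and d: "d i \<in> lhom R (Y (Suc i)) (Y i)"
 and d0: "d 0 ` car (Y 1) = lker (Y 0) M p"
 and dS: "d (Suc i) ` car (Y (Suc (Suc i))) = lker (Y (Suc i)) (Y i) (d i)"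
 and proj: "proj_via R (Y i) (I i)"
 using aug by (auto simp: aug_res_def)

sublocale M: lmod R M using M by (simp add: lmod_iff)
sublocale d: lhm R "Y (Suc i)" "Y i" "d i" for i by (intro lhmI Y d)
sublocale p: lhm R "Y 0" M p by (intro lhmI Y M p)

lemma pd [simp]: "x \<in> car (Y (Suc 0)) \<Longrightarrow> p (d 0 x) = \<zero>\<^sub>M"
 using d0 by (auto simp: lker_def)

lemma dd [simp]: "x \<in> car (Y (Suc (Suc i))) \<Longrightarrow> d i (d (Suc i) x) = \<zero>\<^bsub>Y i\<^esub>"
 using dS[of i] by (auto simp: lker_def)

lemma exact0: "x \<in> car (Y 0) \<Longrightarrow> p x = \<zero>\<^sub>M \<Longrightarrow> x \<in> d 0 ` car (Y (Suc 0))"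
 using d0 by (simp add: lker_def)

lemma exactS: "x \<in> car (Y (Suc i)) \<Longrightarrow> d i x = \<zero>\<^bsub>Y i\<^esub> \<Longrightarrow> x \<in> d (Suc i) ` car (Y (Suc (Suc i)))"
 using dS[of i] by (simp add: lker_def)

end

lemma chain_map:
 assumes "aug_res R M Y p d I" and "aug_res R M Y' p' d' I'"
 obtains \<phi> where "\<And>i. \<phi> i \<in> lhom R (Y i) (Y' i)"
  "\<And>x. x \<in> car (Y 0) \<Longrightarrow> p' (\<phi> 0 x) = p x"
  "\<And>i x. x \<in> car (Y (Suc i)) \<Longrightarrow> d' i (\<phi> (Suc i) x) = \<phi> i (d i x)"
proof -
 interpret A: aug R M Y p d I by (rule aug.intro) fact
 interpret B: aug R M Y' p' d' I' by (rule aug.intro) fact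
 \<comment> \<open>The middle clause is the invariant that lets the dependent choice continue: it
   says that the next lift exists.\<close>
 let ?P = "\<lambda>i f. f \<in> lhom R (Y i) (Y' i) \<and> (\<forall>x \<in> car (Y (Suc i)). f (d i x) \<in> d' i ` car (Y' (Suc i))) \<and>
  (i = 0 \<longrightarrow> (\<forall>x \<in> car (Y 0). p' (f x) = p x))"
 let ?Q = "\<lambda>i f f'. \<forall>x \<in> car (Y (Suc i)). d' i (f' x) = f (d i x)"
 have "\<exists>\<phi>. \<forall>i. ?P i (\<phi> i) \<and> ?Q i (\<phi> i) (\<phi> (Suc i))"
 proof (rule dependent_nat_choice)
  obtain f where f: "f \<in> lhom R (Y 0) (Y' 0)" "\<And>x. x \<in> car (Y 0) \<Longrightarrow> p' (f x) = p x"
   by (rule proj_lift[OF A.Y A.proj B.Y A.M A.p B.p]) (use A.p_onto B.p_onto in auto)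
  have "f (d 0 x) \<in> d' 0 ` car (Y' (Suc 0))" if "x \<in> car (Y (Suc 0))" for x
   using that f lhom_closed[OF f(1)] by (intro B.exact0) auto
  then show "\<exists>f. ?P 0 f" using f by blast
 next
  fix f i assume f: "?P i f"
  then have fd: "compose (car (Y (Suc i))) f (d i) \<in> lhom R (Y (Suc i)) (Y' i)"
   by (intro lhom_compose[OF A.Y A.d]) auto
  have sub: "compose (car (Y (Suc i))) f (d i) ` car (Y (Suc i)) \<subseteq> d' i ` car (Y' (Suc i))"
   using f by (auto simp: compose_eq)
  obtain f' where f': "f' \<in> lhom R (Y (Suc i)) (Y' (Suc i))"
   "\<And>x. x \<in> car (Y (Suc i)) \<Longrightarrow> d' i (f' x) = compose (car (Y (Suc i))) f (d i) x"
   by (rule proj_lift[OF A.Y A.proj B.Y B.Y fd B.d sub]) blast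
  interpret f: lhm R "Y i" "Y' i" f using f by (intro lhmI A.Y B.Y) auto
  have "f' (d (Suc i) x) \<in> d' (Suc i) ` car (Y' (Suc (Suc i)))" if "x \<in> car (Y (Suc (Suc i)))" for x
   using that f'(2)[of "d (Suc i) x"] lhom_closed[OF f'(1)] by (intro B.exactS) (auto simp: compose_eq)
  then show "\<exists>f'. ?P (Suc i) f' \<and> ?Q i f f'" using f' by (intro exI[of _ f']) (auto simp: compose_eq)
 qed
 then obtain \<phi> where "\<forall>i. ?P i (\<phi> i) \<and> ?Q i (\<phi> i) (\<phi> (Suc i))" by (rule exE)
 then show thesis by (intro that[of \<phi>]) auto
qed

text \<open>The formula concerns positive degrees, where the augmentation does not interfere; only
  homology in degrees at least one is compared.\<close>

lemma chain_homotopy: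
 assumes "aug_res R M Y p d I"
  and \<phi>: "\<And>i. \<phi> i \<in> lhom R (Y i) (Y i)" "\<And>x. x \<in> car (Y 0) \<Longrightarrow> p (\<phi> 0 x) = p x"
  "\<And>i x. x \<in> car (Y (Suc i)) \<Longrightarrow> d i (\<phi> (Suc i) x) = \<phi> i (d i x)"
 obtains h where "\<And>i. h i \<in> lhom R (Y i) (Y (Suc i))"
  "\<And>i x. x \<in> car (Y (Suc i)) \<Longrightarrow>
   \<phi> (Suc i) x = x \<oplus>\<^bsub>Y (Suc i)\<^esub> (d (Suc i) (h (Suc i) x) \<oplus>\<^bsub>Y (Suc i)\<^esub> h i (d i x))"
proof -
 interpret A: aug R M Y p d I by (rule aug.intro) fact
 interpret \<phi>: lhm R "Y i" "Y i" "\<phi> i" for i by (intro lhmI A.Y \<phi>(1))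
 define g where "g i = (\<lambda>x \<in> car (Y i). \<phi> i x \<ominus>\<^bsub>Y i\<^esub> (\<lambda>x \<in> car (Y i). x) x)" for i
 have g: "g i \<in> lhom R (Y i) (Y i)" for i
  unfolding g_def by (intro lhom_diff A.Y \<phi>(1) lhom_id)
 interpret g: lhm R "Y i" "Y i" "g i" for i by (intro lhmI A.Y g)
 have gx: "g i x = \<phi> i x \<ominus>\<^bsub>Y i\<^esub> x" if "x \<in> car (Y i)" for i x using that by (simp add: g_def)
 have dg: "d i (g (Suc i) x) = g i (d i x)" if "x \<in> car (Y (Suc i))" for i x
  using that by (simp add: gx \<phi>(3))
 let ?P = "\<lambda>i h. h \<in> lhom R (Y i) (Y (Suc i)) \<and>
  (\<forall>x \<in> car (Y (Suc i)). d i (g (Suc i) x \<ominus>\<^bsub>Y (Suc i)\<^esub> h (d i x)) = \<zero>\<^bsub>Y i\<^esub>)"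
 let ?Q = "\<lambda>i h h'. \<forall>x \<in> car (Y (Suc i)). d (Suc i) (h' x) = g (Suc i) x \<ominus>\<^bsub>Y (Suc i)\<^esub> h (d i x)"
 have "\<exists>h. \<forall>i. ?P i (h i) \<and> ?Q i (h i) (h (Suc i))"
 proof (rule dependent_nat_choice)
  have "g 0 ` car (Y 0) \<subseteq> d 0 ` car (Y (Suc 0))"
   by (rule image_subsetI, rule A.exact0) (auto simp: gx \<phi>(2))
  then obtain h where h: "h \<in> lhom R (Y 0) (Y (Suc 0))" "\<And>x. x \<in> car (Y 0) \<Longrightarrow> d 0 (h x) = g 0 x"
   by (rule proj_lift[OF A.Y A.proj A.Y A.Y g A.d]) blast
  have "d 0 (g (Suc 0) x \<ominus>\<^bsub>Y (Suc 0)\<^esub> h (d 0 x)) = \<zero>\<^bsub>Y 0\<^esub>" if "x \<in> car (Y (Suc 0))" for x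
   using that lhom_closed[OF h(1)] by (simp add: dg h(2))
  then show "\<exists>h. ?P 0 h" using h by blast
 next
  fix h i assume h: "?P i h"
  let ?f = "\<lambda>x \<in> car (Y (Suc i)). g (Suc i) x \<ominus>\<^bsub>Y (Suc i)\<^esub> compose (car (Y (Suc i))) h (d i) x"
  have hd: "compose (car (Y (Suc i))) h (d i) \<in> lhom R (Y (Suc i)) (Y (Suc i))"
   using h by (intro lhom_compose[OF A.Y A.d]) auto
  have f: "?f \<in> lhom R (Y (Suc i)) (Y (Suc i))"
   by (intro lhom_diff A.Y g hd)
  have fx: "?f x = g (Suc i) x \<ominus>\<^bsub>Y (Suc i)\<^esub> h (d i x)" if "x \<in> car (Y (Suc i))" for x
   using that by (simp add: compose_eq)
  have "?f ` car (Y (Suc i)) \<subseteq> d (Suc i) ` car (Y (Suc (Suc i)))"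
  proof (rule image_subsetI, rule A.exactS)
   fix x assume x: "x \<in> car (Y (Suc i))"
   show "?f x \<in> car (Y (Suc i))" by (rule lhom_closed[OF f x])
   show "d i (?f x) = \<zero>\<^bsub>Y i\<^esub>" using h x unfolding fx[OF x] by blast
  qed
  then obtain h' where h': "h' \<in> lhom R (Y (Suc i)) (Y (Suc (Suc i)))"
   "\<And>x. x \<in> car (Y (Suc i)) \<Longrightarrow> d (Suc i) (h' x) = ?f x"
   by (rule proj_lift[OF A.Y A.proj A.Y A.Y f A.d]) blast
  interpret h: lhm R "Y i" "Y (Suc i)" h using h by (intro lhmI A.Y) auto
  have "d (Suc i) (g (Suc (Suc i)) x \<ominus>\<^bsub>Y (Suc (Suc i))\<^esub> h' (d (Suc i) x)) = \<zero>\<^bsub>Y (Suc i)\<^esub>"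
   if x: "x \<in> car (Y (Suc (Suc i)))" for x
  proof -
   have "d (Suc i) (h' (d (Suc i) x)) = g (Suc i) (d (Suc i) x)"
    using x h'(2)[of "d (Suc i) x"] fx[of "d (Suc i) x"] by simp
   then show ?thesis using x lhom_closed[OF h'(1)] by (simp add: dg)
  qed
  then show "\<exists>h'. ?P (Suc i) h' \<and> ?Q i h h'"
   using h' fx by (intro exI[of _ h']) simp
 qed
 then obtain h where h: "\<forall>i. ?P i (h i) \<and> ?Q i (h i) (h (Suc i))" by (rule exE)
 show thesis
 proof (rule that[of h])
  show hi: "h i \<in> lhom R (Y i) (Y (Suc i))" for i using h by blast
  fix i x assume x: "x \<in> car (Y (Suc i))"
  have hdx: "h i (d i x) \<in> car (Y (Suc i))" using lhom_closed[OF hi, of "d i x" i] x by simp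
  have "d (Suc i) (h (Suc i) x) \<oplus>\<^bsub>Y (Suc i)\<^esub> h i (d i x) = g (Suc i) x"
   using h x hdx by simp
  then show "\<phi> (Suc i) x = x \<oplus>\<^bsub>Y (Suc i)\<^esub> (d (Suc i) (h (Suc i) x) \<oplus>\<^bsub>Y (Suc i)\<^esub> h i (d i x))"
   using x by (simp add: gx)
 qed
qed

text \<open>One homotopy, for the composite of \<open>\<phi>\<close> and \<open>\<psi>\<close> on
  \<open>Y\<close>, moves acyclicity from \<open>Y'\<close> to \<open>Y\<close>; exchanging the two
  resolutions gives the other direction.\<close>

lemma homotopy_inverse:
 assumes Y: "aug_res R M Y p d I" and Y': "aug_res R M Y' p' d' I'"
 obtains \<phi> \<psi> h where "\<And>i. \<phi> i \<in> lhom R (Y i) (Y' i)"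
  "\<And>i x. x \<in> car (Y (Suc i)) \<Longrightarrow> d' i (\<phi> (Suc i) x) = \<phi> i (d i x)"
  "\<And>i. \<psi> i \<in> lhom R (Y' i) (Y i)"
  "\<And>i x. x \<in> car (Y' (Suc i)) \<Longrightarrow> d i (\<psi> (Suc i) x) = \<psi> i (d' i x)"
  "\<And>i. h i \<in> lhom R (Y i) (Y (Suc i))"
  "\<And>i x. x \<in> car (Y (Suc i)) \<Longrightarrow> \<psi> (Suc i) (\<phi> (Suc i) x) =
   x \<oplus>\<^bsub>Y (Suc i)\<^esub> (d (Suc i) (h (Suc i) x) \<oplus>\<^bsub>Y (Suc i)\<^esub> h i (d i x))"
proof -
 have A: "left_module R (Y i)" for i using Y by (simp add: aug_res_def)
 obtain \<phi> where \<phi>: "\<And>i. \<phi> i \<in> lhom R (Y i) (Y' i)" "\<And>x. x \<in> car (Y 0) \<Longrightarrow> p' (\<phi> 0 x) = p x"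
  "\<And>i x. x \<in> car (Y (Suc i)) \<Longrightarrow> d' i (\<phi> (Suc i) x) = \<phi> i (d i x)"
  using chain_map[OF Y Y'] by metis
 obtain \<psi> where \<psi>: "\<And>i. \<psi> i \<in> lhom R (Y' i) (Y i)" "\<And>x. x \<in> car (Y' 0) \<Longrightarrow> p (\<psi> 0 x) = p' x"
  "\<And>i x. x \<in> car (Y' (Suc i)) \<Longrightarrow> d i (\<psi> (Suc i) x) = \<psi> i (d' i x)"
  using chain_map[OF Y' Y] by metis
 let ?c = "\<lambda>i. compose (car (Y i)) (\<psi> i) (\<phi> i)"
 have c: "?c i \<in> lhom R (Y i) (Y i)" for i by (rule lhom_compose[OF A \<phi>(1) \<psi>(1)])
 have d: "d i x \<in> car (Y i)" if "x \<in> car (Y (Suc i))" for i x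
  using Y that lhom_closed[of "d i" R "Y (Suc i)" "Y i"] by (simp add: aug_res_def)
 obtain h where "\<And>i. h i \<in> lhom R (Y i) (Y (Suc i))" "\<And>i x. x \<in> car (Y (Suc i)) \<Longrightarrow>
   ?c (Suc i) x = x \<oplus>\<^bsub>Y (Suc i)\<^esub> (d (Suc i) (h (Suc i) x) \<oplus>\<^bsub>Y (Suc i)\<^esub> h i (d i x))"
  by (rule chain_homotopy[OF Y c]) (auto simp: compose_eq \<phi> \<psi> d lhom_closed[OF \<phi>(1)])
 with \<phi> \<psi> show thesis by (intro that[of \<phi> \<psi> h]) (auto simp: compose_eq)
qed

section \<open>Vanishing of Ext and Tor is independent of the resolution\<close>

definition Ext_acyclic :: "'r ring \<Rightarrow> (nat \<Rightarrow> ('r, 'y) module) \<Rightarrow> (nat \<Rightarrow> 'y \<Rightarrow> 'y) \<Rightarrow> ('r, 'n) module \<Rightarrow> bool" where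
 "Ext_acyclic R Y d N \<longleftrightarrow> (\<forall>i. \<forall>g \<in> lhom R (Y (Suc i)) N.
   (\<forall>x \<in> car (Y (Suc (Suc i))). g (d (Suc i) x) = \<zero>\<^sub>N) \<longrightarrow>
   (\<exists>u \<in> lhom R (Y i) N. \<forall>x \<in> car (Y (Suc i)). g x = u (d i x)))"

text \<open>A cocycle \<open>g\<close> on \<open>Y\<close> is pulled back along
  \<open>\<psi>\<close> to \<open>Y'\<close>, where it is the coboundary of some \<open>u\<close>.
  On \<open>Y\<close> it is then the coboundary of \<open>u\<close> after \<open>\<phi>\<close>
  minus \<open>g\<close> after the homotopy.\<close>

lemma Ext_acyclic_transfer:
 assumes Y: "aug_res R M Y p d I" and Y': "aug_res R M Y' p' d' I'" and N: "left_module R N"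
  and ac: "Ext_acyclic R Y' d' N"
 shows "Ext_acyclic R Y d N"
 unfolding Ext_acyclic_def
proof (intro allI ballI impI)
 interpret A: aug R M Y p d I by (rule aug.intro) fact
 interpret B: aug R M Y' p' d' I' by (rule aug.intro) fact
 interpret N: lmod R N using N by (simp add: lmod_iff)
 obtain \<phi> \<psi> h where \<phi>: "\<And>i. \<phi> i \<in> lhom R (Y i) (Y' i)"
   "\<And>i x. x \<in> car (Y (Suc i)) \<Longrightarrow> d' i (\<phi> (Suc i) x) = \<phi> i (d i x)"
  and \<psi>: "\<And>i. \<psi> i \<in> lhom R (Y' i) (Y i)"
   "\<And>i x. x \<in> car (Y' (Suc i)) \<Longrightarrow> d i (\<psi> (Suc i) x) = \<psi> i (d' i x)"
  and h: "\<And>i. h i \<in> lhom R (Y i) (Y (Suc i))"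
   "\<And>i x. x \<in> car (Y (Suc i)) \<Longrightarrow> \<psi> (Suc i) (\<phi> (Suc i) x) =
    x \<oplus>\<^bsub>Y (Suc i)\<^esub> (d (Suc i) (h (Suc i) x) \<oplus>\<^bsub>Y (Suc i)\<^esub> h i (d i x))"
  using homotopy_inverse[OF Y Y'] by metis
 fix i g assume g: "g \<in> lhom R (Y (Suc i)) N" "\<forall>x \<in> car (Y (Suc (Suc i))). g (d (Suc i) x) = \<zero>\<^sub>N"
 interpret g: lhm R "Y (Suc i)" N g by (intro lhmI A.Y N g)
 interpret h: lhm R "Y j" "Y (Suc j)" "h j" for j by (intro lhmI A.Y h)
 let ?g' = "compose (car (Y' (Suc i))) g (\<psi> (Suc i))"
 have g': "?g' \<in> lhom R (Y' (Suc i)) N" by (rule lhom_compose[OF B.Y \<psi>(1) g(1)])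
 have "?g' (d' (Suc i) x) = \<zero>\<^sub>N" if "x \<in> car (Y' (Suc (Suc i)))" for x
  using that g(2) lhom_closed[OF \<psi>(1)] by (simp add: compose_eq flip: \<psi>(2))
 then obtain u where u: "u \<in> lhom R (Y' i) N" "\<And>x. x \<in> car (Y' (Suc i)) \<Longrightarrow> ?g' x = u (d' i x)"
  using ac g' unfolding Ext_acyclic_def by blast
 interpret u: lhm R "Y' i" N u by (intro lhmI B.Y N u)
 let ?v = "\<lambda>x \<in> car (Y i). compose (car (Y i)) u (\<phi> i) x \<ominus>\<^sub>N compose (car (Y i)) g (h i) x"
 show "\<exists>v \<in> lhom R (Y i) N. \<forall>x \<in> car (Y (Suc i)). g x = v (d i x)"
 proof (intro bexI ballI)
  show "?v \<in> lhom R (Y i) N"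
   by (rule lhom_diff[OF A.Y N lhom_compose[OF A.Y \<phi>(1) u(1)] lhom_compose[OF A.Y h(1) g(1)]])
  fix x assume x: "x \<in> car (Y (Suc i))"
  have \<phi>x: "\<phi> (Suc i) x \<in> car (Y' (Suc i))" by (rule lhom_closed[OF \<phi>(1) x])
  have "u (\<phi> i (d i x)) = g (\<psi> (Suc i) (\<phi> (Suc i) x))"
   using u(2)[OF \<phi>x] \<phi>(2)[OF x] \<phi>x by (simp add: compose_eq)
  also have "\<dots> = g x \<oplus>\<^sub>N g (h i (d i x))"
   using h(2)[OF x] x g(2) by (simp add: compose_eq)
  finally show "g x = ?v (d i x)" using x by (simp add: compose_eq)
 qed
qed

definition Tor_acyclic :: "'r ring \<Rightarrow> (nat \<Rightarrow> ('r, 'y) module) \<Rightarrow> (nat \<Rightarrow> 'y \<Rightarrow> 'y) \<Rightarrow> ('r, 'n) module \<Rightarrow> bool" where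
 "Tor_acyclic R Y d N \<longleftrightarrow> (\<forall>i. \<forall>t \<in> car (tens R (Y (Suc i)) N).
   tmapl R (Y i) N (d i) t = \<zero>\<^bsub>tens R (Y i) N\<^esub> \<longrightarrow>
   (\<exists>t' \<in> car (tens R (Y (Suc (Suc i))) N). t = tmapl R (Y (Suc i)) N (d (Suc i)) t'))"

lemma tensor_map_comp:
 assumes "left_module (op_ring R) A" "left_module (op_ring R) B" "left_module (op_ring R) C"
  and "left_module R M" "left_module R M'" "left_module R M''"
  and f: "f \<in> linear (op_ring R) A B" "g \<in> linear (op_ring R) B C"
  and k: "k \<in> linear R M M'" "k' \<in> linear R M' M''"
  and t: "t \<in> car (tens R A M)"
 shows "tensor_map R C M'' g k' (tensor_map R B M' f k t) = tensor_map R C M'' (\<lambda>x. g (f x)) (\<lambda>x. k' (k x)) t"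
proof -
 interpret A: tens_ctx R A M using assms by (intro tens_ctxI)
 interpret C: tens_ctx R C M'' using assms by (intro tens_ctxI)
 show ?thesis
  by (rule A.tens_eqI[OF C.abg_tens ahom_comp[OF tmap_ahom tmap_ahom] tmap_ahom _ t])
   (use assms linearD(1)[OF f(1)] linearD(1)[OF k(1)] linear_comp[OF f] linear_comp[OF k] in
    \<open>simp_all add: tmap_pure\<close>)
qed

lemma tensor_map_id:
 assumes "left_module (op_ring R) A" "left_module R M" "t \<in> car (tens R A M)"
  and "\<And>a. a \<in> car A \<Longrightarrow> f a = a" "\<And>m. m \<in> car M \<Longrightarrow> g m = m"
 shows "tensor_map R A M f g t = t"
proof -
 interpret A: tens_ctx R A M using assms by (intro tens_ctxI)
 have f: "f \<in> linear (op_ring R) A A" and g: "g \<in> linear R M M"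
  using assms(4,5) by (auto simp: linear_def ahom_def)
 show ?thesis
  by (rule A.tens_eqI[OF A.abg_tens tmap_ahom _ _ assms(3), where h' = "\<lambda>t. t"])
   (use assms f g in \<open>auto simp: tmap_pure ahom_def\<close>)
qed

text \<open>The dual argument: the image of a cycle \<open>t\<close> in the complex of
  \<open>Y'\<close> is the boundary of some \<open>t'\<close>, and \<open>t\<close> itself is the
  boundary of the image of \<open>t'\<close> minus the homotopy applied to \<open>t\<close>. The
  chain map and homotopy identities pass to the tensor products by comparison on pure
  tensors.\<close>

lemma Tor_acyclic_transfer:
 fixes R :: "'r ring" and N :: "('r, 'n) module"
 assumes Y: "aug_res (op_ring R) M Y p d I" and Y': "aug_res (op_ring R) M Y' p' d' I'"
  and N: "left_module R N" and ac: "Tor_acyclic R Y' d' N"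
 shows "Tor_acyclic R Y d N"
 unfolding Tor_acyclic_def
proof (intro allI ballI impI)
 interpret A: aug "op_ring R" M Y p d I by (rule aug.intro) fact
 interpret B: aug "op_ring R" M Y' p' d' I' by (rule aug.intro) fact
 interpret N: lmod R N using N by (simp add: lmod_iff)
 obtain \<phi> \<psi> h where \<phi>: "\<And>i. \<phi> i \<in> lhom (op_ring R) (Y i) (Y' i)"
   "\<And>i x. x \<in> car (Y (Suc i)) \<Longrightarrow> d' i (\<phi> (Suc i) x) = \<phi> i (d i x)"
  and \<psi>: "\<And>i. \<psi> i \<in> lhom (op_ring R) (Y' i) (Y i)"
   "\<And>i x. x \<in> car (Y' (Suc i)) \<Longrightarrow> d i (\<psi> (Suc i) x) = \<psi> i (d' i x)"
  and h: "\<And>i. h i \<in> lhom (op_ring R) (Y i) (Y (Suc i))"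
   "\<And>i x. x \<in> car (Y (Suc i)) \<Longrightarrow> \<psi> (Suc i) (\<phi> (Suc i) x) =
    x \<oplus>\<^bsub>Y (Suc i)\<^esub> (d (Suc i) (h (Suc i) x) \<oplus>\<^bsub>Y (Suc i)\<^esub> h i (d i x))"
  using homotopy_inverse[OF Y Y'] by metis
 interpret T: tens_ctx R "Y i" N for i by (rule tens_ctxI[OF A.Y N])
 interpret T': tens_ctx R "Y' i" N for i by (rule tens_ctxI[OF B.Y N])
 interpret TT: abg "tens R (Y i) N" for i by (rule T.abg_tens)
 let ?D = "\<lambda>i. tmapl R (Y i) N (d i)"
 let ?D' = "\<lambda>i. tmapl R (Y' i) N (d' i)"
 let ?F = "\<lambda>i. tmapl R (Y' i) N (\<phi> i)"
 let ?G = "\<lambda>i. tmapl R (Y i) N (\<psi> i)"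
 let ?H = "\<lambda>i. tmapl R (Y (Suc i)) N (h i)"
 have D: "?D i \<in> ahom (tens R (Y (Suc i)) N) (tens R (Y i) N)" for i
  by (rule tmap_ahom[OF A.Y A.Y N N lhom_linear[OF A.d] linear_id])
 have D': "?D' i \<in> ahom (tens R (Y' (Suc i)) N) (tens R (Y' i) N)" for i
  by (rule tmap_ahom[OF B.Y B.Y N N lhom_linear[OF B.d] linear_id])
 have F: "?F i \<in> ahom (tens R (Y i) N) (tens R (Y' i) N)" for i
  by (rule tmap_ahom[OF A.Y B.Y N N lhom_linear[OF \<phi>(1)] linear_id])
 have G: "?G i \<in> ahom (tens R (Y' i) N) (tens R (Y i) N)" for i
  by (rule tmap_ahom[OF B.Y A.Y N N lhom_linear[OF \<psi>(1)] linear_id])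
 have H: "?H i \<in> ahom (tens R (Y i) N) (tens R (Y (Suc i)) N)" for i
  by (rule tmap_ahom[OF A.Y A.Y N N lhom_linear[OF h(1)] linear_id])
 interpret D: ahm "tens R (Y (Suc i)) N" "tens R (Y i) N" "?D i" for i by (rule ahmI[OF T.abg_tens T.abg_tens D])
 interpret F: ahm "tens R (Y i) N" "tens R (Y' i) N" "?F i" for i by (rule ahmI[OF T.abg_tens T'.abg_tens F])
 interpret G: ahm "tens R (Y' i) N" "tens R (Y i) N" "?G i" for i by (rule ahmI[OF T'.abg_tens T.abg_tens G])
 interpret H: ahm "tens R (Y i) N" "tens R (Y (Suc i)) N" "?H i" for i by (rule ahmI[OF T.abg_tens T.abg_tens H])
 note pure = tmap_pure[OF A.Y A.Y N N lhom_linear[OF A.d] linear_id]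
  tmap_pure[OF B.Y B.Y N N lhom_linear[OF B.d] linear_id]
  tmap_pure[OF A.Y B.Y N N lhom_linear[OF \<phi>(1)] linear_id]
  tmap_pure[OF B.Y A.Y N N lhom_linear[OF \<psi>(1)] linear_id]
  tmap_pure[OF A.Y A.Y N N lhom_linear[OF h(1)] linear_id]
 have FD: "?F i (?D i t) = ?D' i (?F (Suc i) t)" if "t \<in> car (tens R (Y (Suc i)) N)" for i t
  by (rule T.tens_eqI[OF T'.abg_tens ahom_comp[OF D F] ahom_comp[OF F D'] _ that])
   (simp add: pure lhom_closed[OF \<phi>(1)] \<phi>(2))
 have GD: "?G i (?D' i t) = ?D i (?G (Suc i) t)" if "t \<in> car (tens R (Y' (Suc i)) N)" for i t
  by (rule T'.tens_eqI[OF T.abg_tens ahom_comp[OF D' G] ahom_comp[OF G D] _ that])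
   (simp add: pure lhom_closed[OF \<psi>(1)] \<psi>(2))
 have GF: "?G (Suc i) (?F (Suc i) t) =
   t \<oplus>\<^bsub>tens R (Y (Suc i)) N\<^esub> (?D (Suc i) (?H (Suc i) t) \<oplus>\<^bsub>tens R (Y (Suc i)) N\<^esub> ?H i (?D i t))"
  if "t \<in> car (tens R (Y (Suc i)) N)" for i t
 proof (rule T.tens_eqI[OF T.abg_tens ahom_comp[OF F G] _ _ that])
  show "(\<lambda>t. t \<oplus>\<^bsub>tens R (Y (Suc i)) N\<^esub> (?D (Suc i) (?H (Suc i) t) \<oplus>\<^bsub>tens R (Y (Suc i)) N\<^esub> ?H i (?D i t)))
    \<in> ahom (tens R (Y (Suc i)) N) (tens R (Y (Suc i)) N)"
   by (rule ahom_add[OF T.abg_tens _ ahom_add[OF T.abg_tens ahom_comp[OF H D] ahom_comp[OF D H]]])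
    (simp add: ahom_def)
  fix x m assume x: "x \<in> car (Y (Suc i))" and m: "m \<in> car N"
  have "\<psi> (Suc i) (\<phi> (Suc i) x) =
    x \<oplus>\<^bsub>Y (Suc i)\<^esub> (d (Suc i) (h (Suc i) x) \<oplus>\<^bsub>Y (Suc i)\<^esub> h i (d i x))"
   using h(2)[OF x] x by (simp add: compose_eq)
  then show "?G (Suc i) (?F (Suc i) (pt R (Y (Suc i)) N x m)) =
   pt R (Y (Suc i)) N x m \<oplus>\<^bsub>tens R (Y (Suc i)) N\<^esub> (?D (Suc i) (?H (Suc i) (pt R (Y (Suc i)) N x m))
    \<oplus>\<^bsub>tens R (Y (Suc i)) N\<^esub> ?H i (?D i (pt R (Y (Suc i)) N x m)))"
   using x m by (simp add: pure lhom_closed[OF \<phi>(1)] lhom_closed[OF h(1)] T.pt_add_l)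
 qed
 fix i t assume t: "t \<in> car (tens R (Y (Suc i)) N)" "?D i t = \<zero>\<^bsub>tens R (Y i) N\<^esub>"
 have "?D' i (?F (Suc i) t) = \<zero>\<^bsub>tens R (Y' i) N\<^esub>" using FD[OF t(1)] t(2) by simp
 then obtain t' where t': "t' \<in> car (tens R (Y' (Suc (Suc i))) N)" "?F (Suc i) t = ?D' (Suc i) t'"
  using ac F.closed[OF t(1)] unfolding Tor_acyclic_def by blast
 have "?G (Suc i) (?F (Suc i) t) = t \<oplus>\<^bsub>tens R (Y (Suc i)) N\<^esub> ?D (Suc i) (?H (Suc i) t)"
  using GF[OF t(1)] t by simp
 then have "t \<oplus>\<^bsub>tens R (Y (Suc i)) N\<^esub> ?D (Suc i) (?H (Suc i) t) = ?D (Suc i) (?G (Suc (Suc i)) t')"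
  using GD[OF t'(1)] t'(2) by simp
 then have "t = ?D (Suc i) (?G (Suc (Suc i)) t' \<ominus>\<^bsub>tens R (Y (Suc (Suc i))) N\<^esub> ?H (Suc i) t)"
  using t t' TT.add_diff_cancel[of t "Suc i" "?D (Suc i) (?H (Suc i) t)"] by simp
 then show "\<exists>t' \<in> car (tens R (Y (Suc (Suc i))) N). t = ?D (Suc i) t'"
  by (rule bexI) (use t t' in simp)
qed

section \<open>Ext and Tor from a finitely generated free resolution\<close>

lemma trivial_Mod_iff:
 assumes G: "comm_group G" and K: "subgroup K G" and B: "subgroup B G" and BK: "B \<subseteq> K"
 shows "trivial_group (G\<lparr>carrier := K\<rparr> Mod B) \<longleftrightarrow> K \<subseteq> B"
proof -
 interpret G: comm_group G by (rule G)
 let ?G = "G\<lparr>carrier := K\<rparr>"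
 have "comm_group ?G"
 proof (rule group.group_comm_groupI[OF G.subgroup_imp_group[OF K]])
  show "x \<otimes>\<^sub>?G y = y \<otimes>\<^sub>?G x" if "x \<in> car ?G" "y \<in> car ?G" for x y
   using that subgroup.subset[OF K] by (simp add: G.m_comm subset_iff)
 qed
 then interpret K: comm_group ?G .
 have BG: "subgroup B ?G" by (rule G.subgroup_incl[OF B K BK])
 interpret B: normal B ?G by (rule K.subgroup_imp_normal[OF BG])
 have grp: "group (?G Mod B)" by (rule B.factorgroup_is_group)
 have coset: "B #>\<^sub>?G x = B \<longleftrightarrow> x \<in> B" if "x \<in> K" for x
  using that K.coset_join1[OF _ _ BG, of x] K.coset_join2[OF _ BG, of x] BK by auto
 have "car (?G Mod B) = (\<lambda>x. B #>\<^sub>?G x) ` K"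
  by (auto simp: carrier_FactGroup)
 moreover have "\<one>\<^bsub>?G Mod B\<^esub> = B" by (simp add: FactGroup_def)
 moreover have "B \<in> (\<lambda>x. B #>\<^sub>?G x) ` K"
  using coset[of "\<one>\<^sub>G"] subgroup.one_closed[OF B] BK by (metis image_eqI subsetD)
 moreover from this have "(\<lambda>x. B #>\<^sub>?G x) ` K = {B} \<longleftrightarrow> (\<forall>x \<in> K. B #>\<^sub>?G x = B)"
  by (simp add: set_eq_subset image_subset_iff)
 ultimately have "car (?G Mod B) = {\<one>\<^bsub>?G Mod B\<^esub>} \<longleftrightarrow> (\<forall>x \<in> K. B #>\<^sub>?G x = B)"
  by simp
 then show ?thesis using coset grp by (auto simp: trivial_group_def)
qed

lemma hom_group_simps [simp]:
 "car (hom_group R M N) = lhom R M N" "\<one>\<^bsub>hom_group R M N\<^esub> = (\<lambda>x \<in> car M. \<zero>\<^sub>N)"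
 "f \<otimes>\<^bsub>hom_group R M N\<^esub> g = (\<lambda>x \<in> car M. f x \<oplus>\<^sub>N g x)"
 by (simp_all add: hom_group_def)

lemma comm_group_hom_group:
 fixes R :: "'r ring" and M :: "('r, 'm) module" and N :: "('r, 'n) module"
 assumes M: "left_module R M" and N: "left_module R N"
 shows "comm_group (hom_group R M N)"
proof -
 interpret M: lmod R M using M by (simp add: lmod_iff)
 interpret N: lmod R N using N by (simp add: lmod_iff)
 note cl = lhom_closed[of _ R M N]
 show ?thesis
 proof (rule comm_groupI)
  fix f assume f: "f \<in> car (hom_group R M N)"
  interpret f: lhm R M N f using f by (intro lhmI M N) simp
  show "\<one>\<^bsub>hom_group R M N\<^esub> \<otimes>\<^bsub>hom_group R M N\<^esub> f = f"
   by (rule extensionalityI[of _ "car M"]) (auto simp: f.ext)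
  have "(\<lambda>x \<in> car M. (\<lambda>x \<in> car M. \<zero>\<^sub>N) x \<ominus>\<^sub>N f x) \<in> lhom R M N"
   by (intro lhom_diff M N lhom_zero f.lhom)
  then show "\<exists>g \<in> car (hom_group R M N). g \<otimes>\<^bsub>hom_group R M N\<^esub> f = \<one>\<^bsub>hom_group R M N\<^esub>"
   by (intro bexI[of _ "\<lambda>x \<in> car M. (\<lambda>x \<in> car M. \<zero>\<^sub>N) x \<ominus>\<^sub>N f x"]) (auto intro!: restrict_ext)
 qed (auto simp: lhom_add[OF M N] lhom_zero[OF M N] cl N.ac intro!: restrict_ext)
qed

lemma hom_image_subgroup:
 assumes "comm_group G" "comm_group H" "h \<in> hom G H" 
 shows "subgroup (h ` car G) H" "subgroup (kernel G H h) G"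
proof -
 interpret group_hom G H h
  using assms by (simp add: group_hom_def group_hom_axioms_def comm_group_def)
 show "subgroup (h ` car G) H" "subgroup (kernel G H h) G"
  by (rule img_is_subgroup, rule subgroup_kernel)
qed

lemma chosen_resolution:
 assumes "degreewise_fg R M" shows "case_prod (proj_resolution R M) (chosen_resolution R M)"
proof -
 obtain X d where "proj_resolution R M X d" using assms by (auto simp: degreewise_fg_def)
 then have "(\<lambda>(X, d). proj_resolution R M X d) (X, d)" by simp
 then show ?thesis unfolding chosen_resolution_def by (rule someI)
qed

lemma proj_resolution_aug_res:
 fixes M :: "('r, 'm) module"
 assumes "proj_resolution R M X d"
 shows "\<exists>I :: nat \<Rightarrow> 'm set. aug_res R M (\<lambda>i. X (Suc i)) (d 0) (\<lambda>i. d (Suc i)) I"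
proof -
 have ex: "\<And>l. 1 \<le> l \<Longrightarrow> exact_onto R l X d" and X0: "X 0 = M" and pr: "\<And>i. projective R (X (Suc i))"
  using assms by (auto simp: proj_resolution_def)
 have "\<forall>i. \<exists>I :: 'm set. proj_via R (X (Suc i)) I" using pr by (simp add: projective_iff)
 then obtain I :: "nat \<Rightarrow> 'm set" where I: "\<And>i. proj_via R (X (Suc i)) (I i)" by metis
 have "aug_res R M (\<lambda>i. X (Suc i)) (d 0) (\<lambda>i. d (Suc i)) I"
  unfolding aug_res_def
 proof (intro conjI allI)
  show "left_module R M" "d 0 \<in> lhom R (X (Suc 0)) M" "d 0 ` car (X (Suc 0)) = car M"
   using ex[of 1] X0 by (auto simp: exact_onto_def)
  show "left_module R (X (Suc i))" for i using ex[of "Suc i"] by (auto simp: exact_onto_def)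
  show "d (Suc i) \<in> lhom R (X (Suc (Suc i))) (X (Suc i))" for i
   using ex[of "Suc (Suc i)"] by (auto simp: exact_onto_def)
  show "d (Suc 0) ` car (X (Suc 1)) = lker (X (Suc 0)) M (d 0)"
   using ex[of 2] X0 by (auto simp: exact_onto_def)
  show "d (Suc (Suc i)) ` car (X (Suc (Suc (Suc i)))) = lker (X (Suc (Suc i))) (X (Suc i)) (d (Suc i))" for i
   using ex[of "Suc (Suc (Suc i))"] by (auto simp: exact_onto_def)
 qed (rule I)
 then show ?thesis by blast
qed

lemma free_res_aug_res:
 assumes "free_res R M l p d"
 shows "aug_res R M (\<lambda>i. fr R (l i)) p d (\<lambda>i. {..<l i})"
proof -
 interpret M: lmod R M using assms by (simp add: free_res_def lmod_iff)
 show ?thesis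
  using assms by (simp add: free_res_def aug_res_def lm_free[OF M.ring] proj_via_free[OF M.ring])
qed

lemma trivial_Ext_iff:
 fixes R :: "'r ring" and M :: "('r, 'm) module"
 assumes M: "degreewise_fg R M" and N: "left_module R N" and X: "chosen_resolution R M = (X, d)"
 shows "(\<forall>i \<ge> 1. trivial_group (Ext R i M N)) \<longleftrightarrow> Ext_acyclic R (\<lambda>i. X (Suc i)) (\<lambda>i. d (Suc i)) N"
proof -
 obtain I :: "nat \<Rightarrow> 'm set" where "aug_res R M (\<lambda>i. X (Suc i)) (d 0) (\<lambda>i. d (Suc i)) I"
  using proj_resolution_aug_res[of R M X d] chosen_resolution[OF M] X by auto
 then interpret A: aug R M "\<lambda>i. X (Suc i)" "d 0" "\<lambda>i. d (Suc i)" I by (rule aug.intro)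
 let ?H = "\<lambda>j. hom_group R (X (Suc j)) N"
 let ?\<delta> = "\<lambda>j g. compose (car (X (Suc (Suc j)))) g (d (Suc j))"
 have H: "comm_group (?H j)" for j by (rule comm_group_hom_group[OF A.Y N])
 have \<delta>: "?\<delta> j \<in> hom (?H j) (?H (Suc j))" for j
 proof (rule homI)
  show "?\<delta> j g \<in> car (?H (Suc j))" if "g \<in> car (?H j)" for g
   using that lhom_compose[OF A.Y A.d] by simp
  show "?\<delta> j (g \<otimes>\<^bsub>?H j\<^esub> g') = ?\<delta> j g \<otimes>\<^bsub>?H (Suc j)\<^esub> ?\<delta> j g'" for g g'
   by (auto simp: compose_def intro!: restrict_ext)
 qed
 have ker: "kernel (?H j) (?H (Suc j)) (?\<delta> j) =
   {g \<in> lhom R (X (Suc j)) N. \<forall>x \<in> car (X (Suc (Suc j))). g (d (Suc j) x) = \<zero>\<^sub>N}" for j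
  by (auto simp: kernel_def compose_def fun_eq_iff restrict_def)
 have *: "trivial_group (Ext R (Suc j) M N) \<longleftrightarrow>
   kernel (?H (Suc j)) (?H (Suc (Suc j))) (?\<delta> (Suc j)) \<subseteq> ?\<delta> j ` car (?H j)" for j
 proof -
  have "?\<delta> j ` car (?H j) \<subseteq> kernel (?H (Suc j)) (?H (Suc (Suc j))) (?\<delta> (Suc j))"
  proof (rule image_subsetI)
   fix g assume g: "g \<in> car (?H j)"
   interpret g: lhm R "X (Suc j)" N g using g by (intro lhmI A.Y N) simp
   show "?\<delta> j g \<in> kernel (?H (Suc j)) (?H (Suc (Suc j))) (?\<delta> (Suc j))"
    unfolding ker using g lhom_compose[OF A.Y A.d, of g j N] by (simp add: compose_eq)
  qed
  then show ?thesis
   unfolding Ext_def X Let_def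
   using trivial_Mod_iff[OF H hom_image_subgroup(2)[OF H H \<delta>] hom_image_subgroup(1)[OF H H \<delta>]]
   by simp
 qed
 have "(\<forall>i \<ge> 1. trivial_group (Ext R i M N)) \<longleftrightarrow> (\<forall>j. trivial_group (Ext R (Suc j) M N))"
  by (metis One_nat_def Suc_le_D Suc_le_mono le0)
 also have "\<dots> \<longleftrightarrow> Ext_acyclic R (\<lambda>i. X (Suc i)) (\<lambda>i. d (Suc i)) N"
  unfolding * ker Ext_acyclic_def
 proof (intro all_cong1 iffI ballI impI subsetI)
  fix i g
  assume sub: "{g \<in> lhom R (X (Suc (Suc i))) N. \<forall>x \<in> car (X (Suc (Suc (Suc i)))). g (d (Suc (Suc i)) x) = \<zero>\<^sub>N}
    \<subseteq> ?\<delta> i ` car (?H i)"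
   and g: "g \<in> lhom R (X (Suc (Suc i))) N" "\<forall>x \<in> car (X (Suc (Suc (Suc i)))). g (d (Suc (Suc i)) x) = \<zero>\<^sub>N"
  then obtain u where "u \<in> lhom R (X (Suc i)) N" "g = ?\<delta> i u" by auto
  then show "\<exists>u \<in> lhom R (X (Suc i)) N. \<forall>x \<in> car (X (Suc (Suc i))). g x = u (d (Suc i) x)"
   by (intro bexI[of _ u]) (auto simp: compose_eq)
 next
  fix i g
  assume ac: "\<forall>g \<in> lhom R (X (Suc (Suc i))) N. (\<forall>x \<in> car (X (Suc (Suc (Suc i)))). g (d (Suc (Suc i)) x) = \<zero>\<^sub>N) \<longrightarrow>
    (\<exists>u \<in> lhom R (X (Suc i)) N. \<forall>x \<in> car (X (Suc (Suc i))). g x = u (d (Suc i) x))"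
   and g: "g \<in> {g \<in> lhom R (X (Suc (Suc i))) N. \<forall>x \<in> car (X (Suc (Suc (Suc i)))). g (d (Suc (Suc i)) x) = \<zero>\<^sub>N}"
  obtain u where u: "u \<in> lhom R (X (Suc i)) N" "\<And>x. x \<in> car (X (Suc (Suc i))) \<Longrightarrow> g x = u (d (Suc i) x)"
   using ac g by blast
  have "g = ?\<delta> i u"
   by (rule lhom_eqI[where B = N]) (use g u lhom_compose[OF A.Y A.d u(1)] in \<open>auto simp: compose_eq\<close>)
  then show "g \<in> ?\<delta> i ` car (?H i)" using u(1) by auto
 qed
 finally show ?thesis .
qed

lemma trivial_Tor_iff:
 fixes R :: "'r ring" and A :: "('r, 'a) module" and M :: "('r, 'm) module"
 assumes A: "degreewise_fg (op_ring R) A" and M: "left_module R M" and X: "chosen_resolution (op_ring R) A = (X, d)"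
 shows "(\<forall>i \<ge> 1. trivial_group (Tor R i A M)) \<longleftrightarrow> Tor_acyclic R (\<lambda>i. X (Suc i)) (\<lambda>i. d (Suc i)) M"
proof -
 obtain I :: "nat \<Rightarrow> 'a set" where "aug_res (op_ring R) A (\<lambda>i. X (Suc i)) (d 0) (\<lambda>i. d (Suc i)) I"
  using proj_resolution_aug_res[of "op_ring R" A X d] chosen_resolution[OF A] X by auto
 then interpret A: aug "op_ring R" A "\<lambda>i. X (Suc i)" "d 0" "\<lambda>i. d (Suc i)" I by (rule aug.intro)
 interpret T: tens_ctx R "X (Suc j)" M for j by (rule tens_ctxI[OF A.Y M])
 let ?T = "\<lambda>j. tensor_group R (X (Suc j)) M"
 let ?D = "\<lambda>j. tmapl R (X j) M (d j)"
 have D: "?D (Suc j) \<in> ahom (tens R (X (Suc (Suc j))) M) (tens R (X (Suc j)) M)" for j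
  by (rule tmap_ahom[OF A.Y A.Y M M lhom_linear[OF A.d] linear_id])
 then have Dh: "?D (Suc j) \<in> hom (?T (Suc j)) (?T j)" for j
  by (auto simp: tens_def ahom_def hom_def)
 interpret D: ahm "tens R (X (Suc (Suc j))) M" "tens R (X (Suc j)) M" "?D (Suc j)" for j
  by (rule ahmI[OF T.abg_tens T.abg_tens D])
 note G = T.comm_group_tensor
 have DD: "?D (Suc j) (?D (Suc (Suc j)) t) = \<zero>\<^bsub>tens R (X (Suc j)) M\<^esub>"
  if "t \<in> car (tens R (X (Suc (Suc (Suc j)))) M)" for j t
 proof (rule T.tens_eqI[OF T.abg_tens ahom_comp[OF D D] ahom_zero[OF T.abg_tens] _ that])
  fix x m assume x: "x \<in> car (X (Suc (Suc (Suc j))))" and m: "m \<in> car M"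
  interpret l: ahm "X (Suc j)" "tens R (X (Suc j)) M" "\<lambda>a. pt R (X (Suc j)) M a m" by (rule T.pt_l_ahm[OF m])
  show "?D (Suc j) (?D (Suc (Suc j)) (pt R (X (Suc (Suc (Suc j)))) M x m)) = \<zero>\<^bsub>tens R (X (Suc j)) M\<^esub>"
   using x m by (simp add: tmap_pure[OF A.Y A.Y M M lhom_linear[OF A.d] linear_id])
 qed
 have *: "trivial_group (Tor R (Suc j) A M) \<longleftrightarrow>
   kernel (?T (Suc j)) (?T j) (?D (Suc j)) \<subseteq> ?D (Suc (Suc j)) ` car (?T (Suc (Suc j)))" for j
 proof -
  have "?D (Suc (Suc j)) ` car (?T (Suc (Suc j))) \<subseteq> kernel (?T (Suc j)) (?T j) (?D (Suc j))"
   using DD D.closed by (auto simp: kernel_def tens_def)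
  then show ?thesis
   unfolding Tor_def X Let_def
   using trivial_Mod_iff[OF G hom_image_subgroup(2)[OF G G Dh] hom_image_subgroup(1)[OF G G Dh]]
   by simp
 qed
 have "(\<forall>i \<ge> 1. trivial_group (Tor R i A M)) \<longleftrightarrow> (\<forall>j. trivial_group (Tor R (Suc j) A M))"
  by (metis One_nat_def Suc_le_D Suc_le_mono le0)
 also have "\<dots> \<longleftrightarrow> Tor_acyclic R (\<lambda>i. X (Suc i)) (\<lambda>i. d (Suc i)) M"
  unfolding * Tor_acyclic_def by (auto simp: kernel_def tens_def subset_iff image_iff)
 finally show ?thesis .
qed

lemma factor_lhom:
 assumes F: "left_module R F" and A: "left_module R A" and N: "left_module R N"
  and p: "p \<in> lhom R F A" "p ` car F = car A" and h: "h \<in> lhom R F N"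
  and ker: "\<And>x. x \<in> car F \<Longrightarrow> p x = \<zero>\<^sub>A \<Longrightarrow> h x = \<zero>\<^sub>N"
 obtains g where "g \<in> lhom R A N" "\<And>x. x \<in> car F \<Longrightarrow> g (p x) = h x"
proof -
 interpret p: lhm R F A p by (intro lhmI F A p)
 interpret h: lhm R F N h by (intro lhmI F N h)
 define s where "s a = (SOME x. x \<in> car F \<and> p x = a)" for a
 have s: "s a \<in> car F" "p (s a) = a" if "a \<in> car A" for a
 proof -
  have "a \<in> p ` car F" using that p(2) by simp
  then have "s a \<in> car F \<and> p (s a) = a"
   unfolding s_def by (intro someI_ex[of "\<lambda>x. x \<in> car F \<and> p x = a"]) auto
  then show "s a \<in> car F" "p (s a) = a" by auto
 qed
 have eq: "h x = h y" if "x \<in> car F" "y \<in> car F" "p x = p y" for x y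
  using ker[of "x \<ominus>\<^sub>F y"] that by (simp add: h.B.diff_eq_zero)
 show thesis
 proof (rule that[of "restrict (\<lambda>a. h (s a)) (car A)"])
  show "restrict (\<lambda>a. h (s a)) (car A) \<in> lhom R A N"
  proof (rule restrict_lhomI[OF A])
   show "h (s (a \<oplus>\<^sub>A b)) = h (s a) \<oplus>\<^sub>N h (s b)" if "a \<in> car A" "b \<in> car A" for a b
    using eq[of "s (a \<oplus>\<^sub>A b)" "s a \<oplus>\<^sub>F s b"] that s by simp
   show "h (s (r \<odot>\<^sub>A a)) = r \<odot>\<^sub>N h (s a)" if "r \<in> car R" "a \<in> car A" for r a
    using eq[of "s (r \<odot>\<^sub>A a)" "r \<odot>\<^sub>F s a"] that s by simp
  qed (use s in simp)
  show "restrict (\<lambda>a. h (s a)) (car A) (p x) = h x" if "x \<in> car F" for x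
   using that eq[of "s (p x)" x] s[of "p x"] by simp
 qed
qed

locale fres =
 fixes R :: "'r ring" and A :: "('r, 'a) module" and l :: "nat \<Rightarrow> nat" and p d
 assumes free_res: "free_res R A l p d"
begin

sublocale aug R A "\<lambda>i. fr R (l i)" p d "\<lambda>i. {..<l i}"
 by (rule aug.intro[OF free_res_aug_res[OF free_res]])

text \<open>Row \<open>j\<close> is the image of unit vector \<open>j\<close>. With this orientation
  the matrix acts on vectors of values as precomposition with \<open>d i\<close>; boundaries on
  tensor products use the transpose.\<close>

definition mat :: "nat \<Rightarrow> nat \<Rightarrow> nat \<Rightarrow> 'r" where
 "mat i j k = d i (uv R (l (Suc i)) j) k"

definition cvec :: "nat \<Rightarrow> 'a" where "cvec k = p (uv R (l 0) k)"

lemma mat_closed [simp]: "k < l i \<Longrightarrow> mat i j k \<in> car R"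
 unfolding mat_def by (rule free_closed[OF lhom_closed[OF d uvec_closed[OF M.ring]]]) simp

lemma cvec_closed [simp]: "cvec k \<in> car A"
 unfolding cvec_def by (rule p.closed[OF uvec_closed[OF M.ring]])

definition cob :: "('r, 'n) module \<Rightarrow> nat \<Rightarrow> (nat \<Rightarrow> 'n) \<Rightarrow> nat \<Rightarrow> 'n" where
 "cob N i = mv N (l i) (l (Suc i)) (mat i)"

lemma cob_ahom: "left_module R N \<Longrightarrow> cob N i \<in> ahom (mpow (l i) N) (mpow (l (Suc i)) N)"
 unfolding cob_def by (rule lmod.mv_ahom) (auto simp: lmod_iff)

lemma pm_cob:
 assumes "left_module R M'" "left_module R N" "f \<in> linear R M' N" "x \<in> car (mpow (l i) M')"
 shows "pm (l (Suc i)) f (cob M' i x) = cob N i (pm (l i) f x)"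
 unfolding cob_def by (rule pm_mv) (use assms in auto)

text \<open>A homomorphism on a free module as its vector of values on the basis: the isomorphism of
  \<open>Hom(fr R (l i), N)\<close> with a power of \<open>N\<close>.\<close>

definition ev :: "nat \<Rightarrow> ((nat \<Rightarrow> 'r) \<Rightarrow> 'n) \<Rightarrow> nat \<Rightarrow> 'n" where
 "ev i g = (\<lambda>k \<in> {..<l i}. g (uv R (l i) k))"

lemma ev_closed: "left_module R N \<Longrightarrow> g \<in> lhom R (fr R (l i)) N \<Longrightarrow> ev i g \<in> car (mpow (l i) N)"
 by (simp add: ev_def lhom_closed[OF _ uvec_closed[OF M.ring]])

lemma ev_lincomb:
 assumes N: "left_module R N" and x: "x \<in> car (mpow (l i) N)"
 shows "restrict (lincomb N (l i) x) (car (fr R (l i))) \<in> lhom R (fr R (l i)) N"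
  and "ev i (restrict (lincomb N (l i) x) (car (fr R (l i)))) = x"
proof -
 interpret N: lmod R N using N by (simp add: lmod_iff)
 show 1: "restrict (lincomb N (l i) x) (car (fr R (l i))) \<in> lhom R (fr R (l i)) N"
  by (rule N.lincomb_lhom) (use x in auto)
 show "ev i (restrict (lincomb N (l i) x) (car (fr R (l i)))) = x"
  by (rule pow_eqI[OF ev_closed[OF N 1] x]) (use x in \<open>auto simp: ev_def uvec_closed[OF M.ring]\<close>)
qed

lemma ev_inj:
 assumes N: "left_module R N" and g: "g \<in> lhom R (fr R (l i)) N" and g': "g' \<in> lhom R (fr R (l i)) N"
  and eq: "ev i g = ev i g'"
 shows "g = g'"
proof (rule free_lhom_eqI[OF N g g'])
 show "g (uv R (l i) x) = g' (uv R (l i) x)" if "x \<in> {..<l i}" for x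
  using fun_cong[OF eq, of x] that by (simp add: ev_def)
qed

lemma cob_ev:
 assumes N: "left_module R N" and g: "g \<in> lhom R (fr R (l i)) N"
 shows "cob N i (ev i g) = ev (Suc i) (compose (car (fr R (l (Suc i)))) g (d i))"
proof -
 interpret N: lmod R N using N by (simp add: lmod_iff)
 have "nsum N (\<lambda>k. mat i j k \<odot>\<^sub>N ev i g k) (l i) = g (d i (uv R (l (Suc i)) j))" for j
  using N.lhom_fr_eq_lincomb[OF g d.closed[OF uvec_closed[OF M.ring]], of j]
  unfolding lincomb_def mat_def by (auto simp: ev_def intro!: nsum_cong)
 then show ?thesis
  unfolding cob_def mv_def
  by (auto simp: ev_def compose_eq uvec_closed[OF M.ring] intro!: restrict_ext)
qed

lemma ev_zero_iff:
 assumes N: "left_module R N" and g: "g \<in> lhom R (fr R (l i)) N"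
 shows "ev i g = \<zero>\<^bsub>mpow (l i) N\<^esub> \<longleftrightarrow> (\<forall>x \<in> car (fr R (l i)). g x = \<zero>\<^sub>N)"
proof
 have z: "(\<lambda>x \<in> car (fr R (l i)). \<zero>\<^sub>N) \<in> lhom R (fr R (l i)) N" by (rule lhom_zero[OF Y N])
 assume "ev i g = \<zero>\<^bsub>mpow (l i) N\<^esub>"
 then have "g = (\<lambda>x \<in> car (fr R (l i)). \<zero>\<^sub>N)"
  by (intro ev_inj[OF N g z]) (auto simp: ev_def zero_pow uvec_closed[OF M.ring] intro!: restrict_ext)
 then show "\<forall>x \<in> car (fr R (l i)). g x = \<zero>\<^sub>N" by simp
qed (auto simp: ev_def zero_pow uvec_closed[OF M.ring] intro!: restrict_ext)

lemma cob_cob: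
 assumes N: "left_module R N" and x: "x \<in> car (mpow (l i) N)"
 shows "cob N (Suc i) (cob N i x) = \<zero>\<^bsub>mpow (l (Suc (Suc i))) N\<^esub>"
proof -
 let ?g = "restrict (lincomb N (l i) x) (car (fr R (l i)))"
 note g = ev_lincomb[OF N x]
 interpret g: lhm R "fr R (l i)" N ?g by (intro lhmI Y N g(1))
 have gd: "compose (car (fr R (l (Suc i)))) ?g (d i) \<in> lhom R (fr R (l (Suc i))) N"
  by (rule lhom_compose[OF Y d g(1)])
 have "cob N (Suc i) (cob N i (ev i ?g)) = \<zero>\<^bsub>mpow (l (Suc (Suc i))) N\<^esub>"
  unfolding cob_ev[OF N g(1)] cob_ev[OF N gd]
  by (subst ev_zero_iff[OF N lhom_compose[OF Y d gd]]) (auto simp: compose_eq g.zero simp del: restrict_apply)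
 then show ?thesis unfolding g(2) .
qed

definition coexact :: "('r, 'n) module \<Rightarrow> bool" where
 "coexact N \<longleftrightarrow> (\<forall>i. \<forall>x \<in> car (mpow (l (Suc i)) N). cob N (Suc i) x = \<zero>\<^bsub>mpow (l (Suc (Suc i))) N\<^esub> \<longrightarrow>
   (\<exists>y \<in> car (mpow (l i) N). cob N i y = x))"

lemma coexact_iff: 
 assumes N: "left_module R N"
 shows "coexact N \<longleftrightarrow> Ext_acyclic R (\<lambda>i. fr R (l i)) d N"
proof
 assume co: "coexact N"
 show "Ext_acyclic R (\<lambda>i. fr R (l i)) d N"
  unfolding Ext_acyclic_def
 proof (intro allI ballI impI)
  fix i g assume g: "g \<in> lhom R (fr R (l (Suc i))) N"
   and z: "\<forall>x \<in> car (fr R (l (Suc (Suc i)))). g (d (Suc i) x) = \<zero>\<^sub>N"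
  have "cob N (Suc i) (ev (Suc i) g) = \<zero>\<^bsub>mpow (l (Suc (Suc i))) N\<^esub>"
   unfolding cob_ev[OF N g] by (subst ev_zero_iff[OF N lhom_compose[OF Y d g]]) (use z in \<open>auto simp: compose_eq\<close>)
  then obtain y where y: "y \<in> car (mpow (l i) N)" "cob N i y = ev (Suc i) g"
   using co ev_closed[OF N g] unfolding coexact_def by blast
  let ?u = "restrict (lincomb N (l i) y) (car (fr R (l i)))"
  note u = ev_lincomb[OF N y(1)]
  have "g = compose (car (fr R (l (Suc i)))) ?u (d i)"
   by (rule ev_inj[OF N g lhom_compose[OF Y d u(1)]]) (simp only: cob_ev[OF N u(1), symmetric] u(2) y(2))
  then have "\<forall>x \<in> car (fr R (l (Suc i))). g x = ?u (d i x)" by (metis compose_eq)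
  then show "\<exists>u \<in> lhom R (fr R (l i)) N. \<forall>x \<in> car (fr R (l (Suc i))). g x = u (d i x)"
   using u(1) by blast
 qed
next
 assume ac: "Ext_acyclic R (\<lambda>i. fr R (l i)) d N"
 show "coexact N"
  unfolding coexact_def
 proof (intro allI ballI impI)
  fix i x assume x: "x \<in> car (mpow (l (Suc i)) N)"
   and z: "cob N (Suc i) x = \<zero>\<^bsub>mpow (l (Suc (Suc i))) N\<^esub>"
  let ?g = "restrict (lincomb N (l (Suc i)) x) (car (fr R (l (Suc i))))"
  note g = ev_lincomb[OF N x]
  have "ev (Suc (Suc i)) (compose (car (fr R (l (Suc (Suc i))))) ?g (d (Suc i))) =
    \<zero>\<^bsub>mpow (l (Suc (Suc i))) N\<^esub>"
   using z cob_ev[OF N g(1)] unfolding g(2) by simp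
  then have "\<forall>y \<in> car (fr R (l (Suc (Suc i)))).
    compose (car (fr R (l (Suc (Suc i))))) ?g (d (Suc i)) y = \<zero>\<^sub>N"
   unfolding ev_zero_iff[OF N lhom_compose[OF Y d g(1)]] .
  then have "\<forall>y \<in> car (fr R (l (Suc (Suc i)))). ?g (d (Suc i) y) = \<zero>\<^sub>N" by (metis compose_eq)
  then obtain u where u: "u \<in> lhom R (fr R (l i)) N"
   "\<And>x. x \<in> car (fr R (l (Suc i))) \<Longrightarrow> ?g x = u (d i x)"
   using ac g(1) unfolding Ext_acyclic_def by blast
  have "?g = compose (car (fr R (l (Suc i)))) u (d i)"
   by (rule lhom_eqI[OF g(1) lhom_compose[OF Y d u(1)]]) (simp only: u(2) compose_eq)
  then have "cob N i (ev i u) = x" using cob_ev[OF N u(1)] g(2) by simp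
  then show "\<exists>y \<in> car (mpow (l i) N). cob N i y = x" using ev_closed[OF N u(1)] by blast
 qed
qed

text \<open>The resolution behind \<open>Ext\<close> is an arbitrary choice; comparing it with the
  free one in both directions removes it, and what is left is a condition on explicit
  matrices.\<close>

lemma Ext_trivial_iff:
 assumes "degreewise_fg R A" and N: "left_module R N"
 shows "(\<forall>i \<ge> 1. trivial_group (Ext R i A N)) \<longleftrightarrow> coexact N"
proof -
 obtain X e where X: "chosen_resolution R A = (X, e)" by fastforce
 obtain I :: "nat \<Rightarrow> 'a set" where I: "aug_res R A (\<lambda>i. X (Suc i)) (e 0) (\<lambda>i. e (Suc i)) I"
  using proj_resolution_aug_res[of R A X e] chosen_resolution[OF assms(1)] X by auto
 show ?thesis
  unfolding trivial_Ext_iff[OF assms X] coexact_iff[OF N]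
  using Ext_acyclic_transfer[OF I aug N] Ext_acyclic_transfer[OF aug I N] by blast
qed

lemma lhom_gens_eqI:
 assumes N: "left_module R N" and "g \<in> lhom R A N" "g' \<in> lhom R A N"
  and eq: "\<And>k. k < l 0 \<Longrightarrow> g (cvec k) = g' (cvec k)"
 shows "g = g'"
proof (rule lhom_eqI[OF assms(2,3)])
 fix a assume "a \<in> car A"
 then obtain r where r: "r \<in> car (fr R (l 0))" "a = p r" using p_onto by auto
 have "compose (car (fr R (l 0))) g p = compose (car (fr R (l 0))) g' p"
  by (rule free_lhom_eqI[OF N lhom_compose[OF Y p assms(2)] lhom_compose[OF Y p assms(3)]])
   (use eq in \<open>auto simp: compose_eq uvec_closed[OF M.ring] cvec_def\<close>)
 then show "g a = g' a" using r by (metis compose_eq)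
qed

text \<open>Together with \<open>cob_hom_zero\<close> and \<open>lhom_gens_eqI\<close> this
  identifies \<open>Hom(A, N)\<close>, by values at the generators \<open>cvec\<close>, with the
  kernel of the first coboundary. The map on the free cover kills the relations, hence factors
  through \<open>A\<close>.\<close>

lemma lhom_exists:
 assumes N: "left_module R N" and x: "x \<in> car (mpow (l 0) N)" "cob N 0 x = \<zero>\<^bsub>mpow (l (Suc 0)) N\<^esub>"
 shows "\<exists>g \<in> lhom R A N. \<forall>k < l 0. g (cvec k) = x k"
proof -
 let ?h = "restrict (lincomb N (l 0) x) (car (fr R (l 0)))"
 note h = ev_lincomb[OF N x(1)]
 have "ev (Suc 0) (compose (car (fr R (l (Suc 0)))) ?h (d 0)) = \<zero>\<^bsub>mpow (l (Suc 0)) N\<^esub>"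
  using x(2) cob_ev[OF N h(1)] unfolding h(2) by simp
 then have "\<forall>y \<in> car (fr R (l (Suc 0))). compose (car (fr R (l (Suc 0)))) ?h (d 0) y = \<zero>\<^sub>N"
  unfolding ev_zero_iff[OF N lhom_compose[OF Y d h(1)]] .
 then have hd: "?h (d 0 y) = \<zero>\<^sub>N" if "y \<in> car (fr R (l (Suc 0)))" for y using that by (metis compose_eq)
 obtain g where g: "g \<in> lhom R A N" "\<And>r. r \<in> car (fr R (l 0)) \<Longrightarrow> g (p r) = ?h r"
  by (rule factor_lhom[OF Y M N p p_onto h(1)]) (use exact0 hd in blast)+
 have "g (cvec k) = x k" if "k < l 0" for k
  using that fun_cong[OF h(2), of k] g(2)[OF uvec_closed[OF M.ring]] by (simp add: cvec_def ev_def)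
 then show ?thesis using g(1) by blast
qed

lemma cob_hom_zero:
 assumes N: "left_module R N" and g: "g \<in> lhom R A N"
 shows "cob N 0 (\<lambda>k \<in> {..<l 0}. g (cvec k)) = \<zero>\<^bsub>mpow (l (Suc 0)) N\<^esub>"
proof -
 interpret g: lhm R A N g by (intro lhmI M N g)
 have gp: "compose (car (fr R (l 0))) g p \<in> lhom R (fr R (l 0)) N" by (rule lhom_compose[OF Y p g])
 have "(\<lambda>k \<in> {..<l 0}. g (cvec k)) = ev 0 (compose (car (fr R (l 0))) g p)"
  by (auto simp: ev_def cvec_def compose_eq uvec_closed[OF M.ring] intro!: restrict_ext)
 then have "cob N 0 (\<lambda>k \<in> {..<l 0}. g (cvec k)) =
   ev (Suc 0) (compose (car (fr R (l (Suc 0)))) (compose (car (fr R (l 0))) g p) (d 0))"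
  using cob_ev[OF N gp] by simp
 also have "\<dots> = \<zero>\<^bsub>mpow (l (Suc 0)) N\<^esub>"
  by (subst ev_zero_iff[OF N lhom_compose[OF Y d gp]]) (auto simp: compose_eq)
 finally show ?thesis .
qed

lemma gens: "a \<in> car A \<Longrightarrow> \<exists>r \<in> car (fr R (l 0)). a = lincomb A (l 0) cvec r"
proof -
 assume "a \<in> car A"
 then obtain r where r: "r \<in> car (fr R (l 0))" "a = p r" using p_onto by auto
 then have "a = lincomb A (l 0) cvec r"
  using M.lhom_fr_eq_lincomb[OF p r(1)] by (simp add: cvec_def[abs_def])
 then show ?thesis using r by blast
qed

end

text \<open>The resolved module is a right module, hence one over \<open>op_ring R\<close>.
  Tensoring turns the differentials into matrices over \<open>R\<close> that act on powers of left
  \<open>R\<close>-modules.\<close>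

locale tres = fres "op_ring R" A l p d
 for R :: "'r ring" and A :: "('r, 'a) module" and l :: "nat \<Rightarrow> nat" and p d
begin

lemma ring_R: "ring R"
 using M.ring by simp

definition bnd :: "('r, 'm) module \<Rightarrow> nat \<Rightarrow> (nat \<Rightarrow> 'm) \<Rightarrow> nat \<Rightarrow> 'm" where
 "bnd N i = mv N (l (Suc i)) (l i) (\<lambda>k j. mat i j k)"

lemma bnd_ahom: "left_module R N \<Longrightarrow> bnd N i \<in> ahom (mpow (l (Suc i)) N) (mpow (l i) N)"
 unfolding bnd_def using mat_closed by (intro lmod.mv_ahom) (auto simp: lmod_iff)

lemma pm_bnd:
 assumes "left_module R N" "left_module R N'" "f \<in> linear R N N'" "x \<in> car (mpow (l (Suc i)) N)"
 shows "pm (l i) f (bnd N i x) = bnd N' i (pm (l (Suc i)) f x)"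
 unfolding bnd_def by (rule pm_mv) (use assms mat_closed in auto)

lemma free_tens: "left_module R N \<Longrightarrow> free_tens R N"
 by (simp add: free_tens_def lmod_iff)

lemma sigma_bnd:
 assumes N: "left_module R N" and t: "t \<in> car (tens R (fr (op_ring R) (l (Suc i))) N)"
 shows "free_tens.sigma R N (l i) (tmapl R (fr (op_ring R) (l i)) N (d i) t)
  = bnd N i (free_tens.sigma R N (l (Suc i)) t)"
 using free_tens.sigma_map[OF free_tens[OF N] d t] by (simp add: bnd_def mat_def[abs_def])

lemma tau_bnd:
 assumes N: "left_module R N" and x: "x \<in> car (mpow (l (Suc i)) N)"
 shows "tmapl R (fr (op_ring R) (l i)) N (d i) (free_tens.tau R N (l (Suc i)) x)
  = free_tens.tau R N (l i) (bnd N i x)"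
proof -
 interpret F: free_tens R N by (rule free_tens[OF N])
 have D: "tmapl R (fr (op_ring R) (l i)) N (d i) \<in>
   ahom (tens R (fr (op_ring R) (l (Suc i))) N) (tens R (fr (op_ring R) (l i)) N)"
  by (rule tmap_ahom[OF Y Y N N lhom_linear[OF d] linear_id])
 have t: "F.tau (l (Suc i)) x \<in> car (tens R (fr (op_ring R) (l (Suc i))) N)" by (rule F.tau_closed[OF x])
 show ?thesis
  using F.tau_sigma[of "tmapl R (fr (op_ring R) (l i)) N (d i) (F.tau (l (Suc i)) x)" "l i"]
   sigma_bnd[OF N t] F.sigma_tau[OF x] D t by (simp add: ahom_def)
qed

lemma tens_dd:
 assumes N: "left_module R N" and t: "t \<in> car (tens R (fr (op_ring R) (l (Suc (Suc i)))) N)"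
 shows "tmapl R (fr (op_ring R) (l i)) N (d i)
  (tmapl R (fr (op_ring R) (l (Suc i))) N (d (Suc i)) t) = \<zero>\<^bsub>tens R (fr (op_ring R) (l i)) N\<^esub>"
proof -
 interpret T: tens_ctx R "fr (op_ring R) (l j)" N for j by (rule tens_ctxI[OF Y N])
 note D = tmap_ahom[OF Y Y N N lhom_linear[OF d] linear_id]
 show ?thesis
 proof (rule T.tens_eqI[OF T.abg_tens ahom_comp[OF D D] ahom_zero[OF T.abg_tens] _ t])
  fix x m assume x: "x \<in> car (fr (op_ring R) (l (Suc (Suc i))))" and m: "m \<in> car N"
  interpret q: ahm "fr (op_ring R) (l i)" "tens R (fr (op_ring R) (l i)) N" "\<lambda>a. pt R (fr (op_ring R) (l i)) N a m"
   by (rule T.pt_l_ahm[OF m])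
  show "tmapl R (fr (op_ring R) (l i)) N (d i)
   (tmapl R (fr (op_ring R) (l (Suc i))) N (d (Suc i))
    (pt R (fr (op_ring R) (l (Suc (Suc i)))) N x m)) = \<zero>\<^bsub>tens R (fr (op_ring R) (l i)) N\<^esub>"
   using x m by (simp add: tmap_pure[OF Y Y N N lhom_linear[OF d] linear_id])
 qed
qed

lemma bnd_bnd:
 assumes N: "left_module R N" and x: "x \<in> car (mpow (l (Suc (Suc i))) N)"
 shows "bnd N i (bnd N (Suc i) x) = \<zero>\<^bsub>mpow (l i) N\<^esub>"
proof -
 interpret N: lmod R N using N by (simp add: lmod_iff)
 interpret F: free_tens R N by (rule free_tens[OF N])
 have bx: "bnd N (Suc i) x \<in> car (mpow (l (Suc i)) N)" "bnd N i (bnd N (Suc i) x) \<in> car (mpow (l i) N)"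
  using bnd_ahom[OF N] x by (auto simp: ahom_def)
 interpret s: ahm "tens R (fr (op_ring R) (l i)) N" "mpow (l i) N" "F.sigma (l i)"
  by (rule ahmI[OF F.Ft.abg_tens abg_pow[OF N.abg_axioms] F.sigma])
 have "F.tau (l i) (bnd N i (bnd N (Suc i) x)) = \<zero>\<^bsub>tens R (fr (op_ring R) (l i)) N\<^esub>"
  using tens_dd[OF N F.tau_closed[OF x]] tau_bnd[OF N x] tau_bnd[OF N bx(1)] by simp
 then show ?thesis using F.sigma_tau[OF bx(2)] s.zero by simp
qed

definition chexact :: "('r, 'm) module \<Rightarrow> bool" where
 "chexact N \<longleftrightarrow> (\<forall>i. \<forall>x \<in> car (mpow (l (Suc i)) N). bnd N i x = \<zero>\<^bsub>mpow (l i) N\<^esub> \<longrightarrow>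
   (\<exists>y \<in> car (mpow (l (Suc (Suc i))) N). bnd N (Suc i) y = x))"

lemma chexact_iff:
 assumes N: "left_module R N"
 shows "chexact N \<longleftrightarrow> Tor_acyclic R (\<lambda>i. fr (op_ring R) (l i)) d N"
proof -
 interpret N: lmod R N using N by (simp add: lmod_iff)
 interpret F: free_tens R N by (rule free_tens[OF N])
 interpret s: ahm "tens R (fr (op_ring R) j) N" "mpow j N" "F.sigma j" for j
  by (rule ahmI[OF F.Ft.abg_tens abg_pow[OF N.abg_axioms] F.sigma])
 interpret t: ahm "mpow j N" "tens R (fr (op_ring R) j) N" "F.tau j" for j
  by (rule ahmI[OF abg_pow[OF N.abg_axioms] F.Ft.abg_tens F.tau_ahom])
 note D = tmap_ahom[OF Y Y N N lhom_linear[OF d] linear_id]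
 let ?D = "\<lambda>i. tmapl R (fr (op_ring R) (l i)) N (d i)"
 show ?thesis
 proof
  assume ch: "chexact N"
  show "Tor_acyclic R (\<lambda>i. fr (op_ring R) (l i)) d N"
   unfolding Tor_acyclic_def
  proof (intro allI ballI impI)
   fix i t assume t: "t \<in> car (tens R (fr (op_ring R) (l (Suc i))) N)"
    and z: "?D i t = \<zero>\<^bsub>tens R (fr (op_ring R) (l i)) N\<^esub>"
   have "bnd N i (F.sigma (l (Suc i)) t) = \<zero>\<^bsub>mpow (l i) N\<^esub>"
    using sigma_bnd[OF N t] z s.zero by simp
   then obtain y where y: "y \<in> car (mpow (l (Suc (Suc i))) N)" "bnd N (Suc i) y = F.sigma (l (Suc i)) t"
    using ch s.closed[OF t] unfolding chexact_def by blast
   show "\<exists>t' \<in> car (tens R (fr (op_ring R) (l (Suc (Suc i)))) N). t = ?D (Suc i) t'"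
    by (rule bexI[OF _ t.closed[OF y(1)]]) (simp only: tau_bnd[OF N y(1)] y(2) F.tau_sigma[OF t])
  qed
 next
  assume T: "Tor_acyclic R (\<lambda>i. fr (op_ring R) (l i)) d N"
  show "chexact N"
   unfolding chexact_def
  proof (intro allI ballI impI)
   fix i x assume x: "x \<in> car (mpow (l (Suc i)) N)" and z: "bnd N i x = \<zero>\<^bsub>mpow (l i) N\<^esub>"
   have "?D i (F.tau (l (Suc i)) x) = \<zero>\<^bsub>tens R (fr (op_ring R) (l i)) N\<^esub>"
    using tau_bnd[OF N x] z t.zero by simp
   then obtain t' where t': "t' \<in> car (tens R (fr (op_ring R) (l (Suc (Suc i)))) N)"
    "F.tau (l (Suc i)) x = ?D (Suc i) t'"
    using T t.closed[OF x] unfolding Tor_acyclic_def by blast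
   show "\<exists>y \<in> car (mpow (l (Suc (Suc i))) N). bnd N (Suc i) y = x"
    by (rule bexI[OF _ s.closed[OF t'(1)]])
     (simp only: sigma_bnd[OF N t'(1), symmetric] t'(2)[symmetric] F.sigma_tau[OF x])
  qed
 qed
qed

lemma Tor_trivial_iff:
 assumes "degreewise_fg (op_ring R) A" and N: "left_module R N"
 shows "(\<forall>i \<ge> 1. trivial_group (Tor R i A N)) \<longleftrightarrow> chexact N"
proof -
 obtain X e where X: "chosen_resolution (op_ring R) A = (X, e)" by fastforce
 obtain I :: "nat \<Rightarrow> 'a set" where I: "aug_res (op_ring R) A (\<lambda>i. X (Suc i)) (e 0) (\<lambda>i. e (Suc i)) I"
  using proj_resolution_aug_res[of "op_ring R" A X e] chosen_resolution[OF assms(1)] X by auto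
 show ?thesis
  unfolding trivial_Tor_iff[OF assms X] chexact_iff[OF N]
  using Tor_acyclic_transfer[OF I aug N] Tor_acyclic_transfer[OF aug I N] by blast
qed

definition gam :: "('r, 'm) module \<Rightarrow> (nat \<Rightarrow> 'm) \<Rightarrow> ('a \<times> 'm \<Rightarrow>\<^sub>0 int) set" where
 "gam N x = nsum (tens R A N) (\<lambda>k. pt R A N (cvec k) (x k)) (l 0)"

lemma
 assumes N: "left_module R N"
 shows gam_ahom: "gam N \<in> ahom (mpow (l 0) N) (tens R A N)"
  and gam_surj: "t \<in> car (tens R A N) \<Longrightarrow> \<exists>x \<in> car (mpow (l 0) N). gam N x = t"
  and gam_zero_iff: "x \<in> car (mpow (l 0) N) \<Longrightarrow> gam N x = \<zero>\<^bsub>tens R A N\<^esub> \<longleftrightarrow>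
   (\<exists>y \<in> car (mpow (l (Suc 0)) N). x = bnd N 0 y)"
proof -
 interpret P: presented_tens R N A "l 0" "l (Suc 0)" p "d 0"
  using free_tens[OF N] M.left_module p p_onto d d0
  by (auto simp: presented_tens_def presented_tens_axioms_def)
 have g: "P.gam = gam N"
  unfolding P.gam_def[abs_def] gam_def[abs_def] cvec_def[abs_def] by simp
 show "gam N \<in> ahom (mpow (l 0) N) (tens R A N)" using P.gam_ahom unfolding g .
 show "\<exists>x \<in> car (mpow (l 0) N). gam N x = t" if "t \<in> car (tens R A N)"
  using P.gam_surj[OF that] unfolding g .
 show "gam N x = \<zero>\<^bsub>tens R A N\<^esub> \<longleftrightarrow> (\<exists>y \<in> car (mpow (l (Suc 0)) N). x = bnd N 0 y)"
  if "x \<in> car (mpow (l 0) N)"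
  using P.gam_zero_iff[OF that] unfolding g by (simp add: bnd_def mat_def[abs_def])
qed

lemma tensor_map_gam:
 assumes N: "left_module R N" "left_module R N'" and f: "f \<in> linear R N N'"
  and x: "x \<in> car (mpow (l 0) N)"
 shows "tensor_map R A N' (\<lambda>c. c) f (gam N x) = gam N' (pm (l 0) f x)"
proof -
 interpret T: tens_ctx R A N by (rule tens_ctxI[OF M.left_module N(1)])
 interpret T': tens_ctx R A N' by (rule tens_ctxI[OF M.left_module N(2)])
 interpret h: ahm "tens R A N" "tens R A N'" "tensor_map R A N' (\<lambda>c. c) f"
  by (intro ahmI T.abg_tens T'.abg_tens tmap_ahom M.left_module N f linear_id)
 have "tensor_map R A N' (\<lambda>c. c) f (gam N x) =
   nsum (tens R A N') (\<lambda>k. tensor_map R A N' (\<lambda>c. c) f (pt R A N (cvec k) (x k))) (l 0)"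
  unfolding gam_def by (rule h.nsum) (use x in auto)
 also have "\<dots> = gam N' (pm (l 0) f x)"
  unfolding gam_def
  by (rule nsum_cong) (use x in \<open>simp add: tmap_pure[OF M.left_module M.left_module N linear_id f]\<close>)
 finally show ?thesis .
qed

end

section \<open>The functors given by a bimodule\<close>

lemma left_mod_simps [simp]:
 "car (left_mod C) = car C" "\<zero>\<^bsub>left_mod C\<^esub> = \<zero>\<^sub>C" "x \<oplus>\<^bsub>left_mod C\<^esub> y = x \<oplus>\<^sub>C y"
 "s \<odot>\<^bsub>left_mod C\<^esub> x = s \<odot>\<^sub>C x"
 by (simp_all add: left_mod_def module.truncate_def)

lemma right_mod_simps [simp]:
 "car (right_mod C) = car C" "\<zero>\<^bsub>right_mod C\<^esub> = \<zero>\<^sub>C" "x \<oplus>\<^bsub>right_mod C\<^esub> y = x \<oplus>\<^sub>C y"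
 "r \<odot>\<^bsub>right_mod C\<^esub> x = rsmult C x r"
 by (simp_all add: right_mod_def)

lemma tensor_mod_simps [simp]:
 "car (tensor_mod R C M) = car (tens R (right_mod C) M)"
 "\<zero>\<^bsub>tensor_mod R C M\<^esub> = \<zero>\<^bsub>tens R (right_mod C) M\<^esub>"
 "x \<oplus>\<^bsub>tensor_mod R C M\<^esub> y = x \<oplus>\<^bsub>tens R (right_mod C) M\<^esub> y"
 "s \<odot>\<^bsub>tensor_mod R C M\<^esub> x = tmapl R (right_mod C) M (\<lambda>c. s \<odot>\<^sub>C c) x"
 by (simp_all add: tensor_mod_def tens_def Let_def)

lemma hom_mod_simps [simp]:
 "car (hom_mod S C N) = lhom S (left_mod C) N"
 "\<zero>\<^bsub>hom_mod S C N\<^esub> = (\<lambda>x \<in> car C. \<zero>\<^sub>N)"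
 "f \<oplus>\<^bsub>hom_mod S C N\<^esub> g = (\<lambda>x \<in> car C. f x \<oplus>\<^sub>N g x)"
 "r \<odot>\<^bsub>hom_mod S C N\<^esub> f = (\<lambda>c \<in> car C. f (rsmult C c r))"
 by (simp_all add: hom_mod_def Let_def)

lemma nsum_tensor_mod [simp]: "nsum (tensor_mod R C M) f m = nsum (tens R (right_mod C) M) f m"
 by (induction m) auto

locale bimod =
 fixes S :: "'s ring" and R :: "'r ring" and C :: "('s, 'r, 'c) bimodule"
 assumes bimodule: "is_bimodule S R C"
begin

abbreviation "CL \<equiv> left_mod C"
abbreviation "CR \<equiv> right_mod C"

lemma CL: "left_module S CL" and CR: "left_module (op_ring R) CR"
 and commute: "s \<in> car S \<Longrightarrow> c \<in> car C \<Longrightarrow> r \<in> car R \<Longrightarrow> rsmult C (s \<odot>\<^sub>C c) r = s \<odot>\<^sub>C rsmult C c r"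
 using bimodule by (auto simp: is_bimodule_def)

sublocale CL: lmod S CL using CL by (simp add: lmod_iff)
sublocale CR: lmod "op_ring R" CR using CR by (simp add: lmod_iff)

lemma C_closed [simp]:
 "s \<in> car S \<Longrightarrow> c \<in> car C \<Longrightarrow> s \<odot>\<^sub>C c \<in> car C"
 "r \<in> car R \<Longrightarrow> c \<in> car C \<Longrightarrow> rsmult C c r \<in> car C"
 "c \<in> car C \<Longrightarrow> c' \<in> car C \<Longrightarrow> c \<oplus>\<^sub>C c' \<in> car C"
 "\<zero>\<^sub>C \<in> car C"
 using CL.smult_closed[of s c] CR.smult_closed[of r c] CL.add_closed[of c c'] CL.zero_closed by auto

lemma smult_linear: "s \<in> car S \<Longrightarrow> (\<lambda>c. s \<odot>\<^sub>C c) \<in> linear (op_ring R) CR CR"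
 using CL.smult_r_distr[of s] by (auto simp: linear_def ahom_def commute)

lemma rsmult_linear: "r \<in> car R \<Longrightarrow> (\<lambda>c. rsmult C c r) \<in> linear S CL CL"
 using CR.smult_r_distr[of r] by (auto simp: linear_def ahom_def commute)

abbreviation "tm \<equiv> tensor_mod R C"
abbreviation hm :: "('s, 'n) module \<Rightarrow> ('r, 'c \<Rightarrow> 'n) module" where "hm \<equiv> hom_mod S C"

context
 fixes M :: "('r, 'm) module"
 assumes M: "left_module R M"
begin

interpretation M: lmod R M using M by (simp add: lmod_iff)
interpretation T: tens_ctx R CR M by (rule tens_ctxI[OF CR M])
interpretation TT: abg "tens R CR M" by (rule T.abg_tens)

lemma tens_smult_ahom: "s \<in> car S \<Longrightarrow>
  tmapl R CR M (\<lambda>c. s \<odot>\<^sub>C c) \<in> ahom (tens R CR M) (tens R CR M)"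
 by (rule tmap_ahom[OF CR CR M M smult_linear linear_id])

lemma tens_smult_pure: "s \<in> car S \<Longrightarrow> c \<in> car C \<Longrightarrow> m \<in> car M \<Longrightarrow>
  tmapl R CR M (\<lambda>c. s \<odot>\<^sub>C c) (pt R CR M c m) = pt R CR M (s \<odot>\<^sub>C c) m"
 by (rule tmap_pure[OF CR CR M M smult_linear linear_id]) auto

lemma lm_tm: "left_module S (tm M)"
proof (rule left_moduleI)
 interpret S: ring S by (rule CL.ring)
 fix a b t assume a: "a \<in> car S" and b: "b \<in> car S" and "t \<in> car (tm M)"
 then have t: "t \<in> car (tens R CR M)" by simp
 note sa = tens_smult_ahom[OF a] and sb = tens_smult_ahom[OF b]
 have "tmapl R CR M (\<lambda>c. (a \<oplus>\<^sub>S b) \<odot>\<^sub>C c) t =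
   tmapl R CR M (\<lambda>c. a \<odot>\<^sub>C c) t \<oplus>\<^bsub>tens R CR M\<^esub> tmapl R CR M (\<lambda>c. b \<odot>\<^sub>C c) t"
  by (rule T.tens_eqI[OF T.abg_tens tens_smult_ahom ahom_add[OF T.abg_tens sa sb] _ t])
   (use a b CL.smult_l_distr T.pt_add_l in \<open>auto simp: tens_smult_pure\<close>)
 then show "(a \<oplus>\<^sub>S b) \<odot>\<^bsub>tm M\<^esub> t = a \<odot>\<^bsub>tm M\<^esub> t \<oplus>\<^bsub>tm M\<^esub> b \<odot>\<^bsub>tm M\<^esub> t" by simp
 have "tmapl R CR M (\<lambda>c. (a \<otimes>\<^sub>S b) \<odot>\<^sub>C c) t =
   tmapl R CR M (\<lambda>c. a \<odot>\<^sub>C c) (tmapl R CR M (\<lambda>c. b \<odot>\<^sub>C c) t)"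
  by (rule T.tens_eqI[OF T.abg_tens tens_smult_ahom ahom_comp[OF sb sa] _ t])
   (use a b CL.smult_assoc in \<open>auto simp: tens_smult_pure\<close>)
 then show "(a \<otimes>\<^sub>S b) \<odot>\<^bsub>tm M\<^esub> t = a \<odot>\<^bsub>tm M\<^esub> (b \<odot>\<^bsub>tm M\<^esub> t)" by simp
next
 interpret S: ring S by (rule CL.ring)
 fix t assume "t \<in> car (tm M)"
 then have t: "t \<in> car (tens R CR M)" by simp
 have "tmapl R CR M (\<lambda>c. \<one>\<^sub>S \<odot>\<^sub>C c) t = t"
  by (rule tensor_map_id[OF CR M t]) (use CL.smult_one in auto)
 then show "\<one>\<^sub>S \<odot>\<^bsub>tm M\<^esub> t = t" by simp
 show "\<exists>y \<in> car (tm M). y \<oplus>\<^bsub>tm M\<^esub> t = \<zero>\<^bsub>tm M\<^esub>"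
  using t by (intro bexI[of _ "\<ominus>\<^bsub>tens R CR M\<^esub> t"]) auto
qed (use tens_smult_ahom CL.ring in \<open>auto simp: TT.ac ahom_def\<close>)

end

context
 fixes N :: "('s, 'n) module"
 assumes N: "left_module S N"
begin

interpretation N: lmod S N using N by (simp add: lmod_iff)

lemma hom_closed: "f \<in> lhom S CL N \<Longrightarrow> c \<in> car C \<Longrightarrow> f c \<in> car N"
 using lhom_closed[of f S CL N c] by simp

lemma hom_lhm: "f \<in> lhom S CL N \<Longrightarrow> lhm S CL N f"
 by (intro lhmI CL N)

lemma lm_hm: "left_module R (hm N)"
proof (rule left_moduleI)
 have ring_R: "ring R" using CR.ring by simp
 then interpret R: ring R .
 show "ring R" by (rule ring_R)
 note cl = hom_closed
 show "r \<odot>\<^bsub>hm N\<^esub> f \<in> car (hm N)" if "r \<in> car R" "f \<in> car (hm N)" for r f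
 proof -
  interpret f: lhm S CL N f using that by (intro hom_lhm) simp
  have "restrict (\<lambda>c. f (rsmult C c r)) (car CL) \<in> lhom S CL N"
   by (rule restrict_lhomI[OF CL])
    (use that linearD[OF rsmult_linear[OF that(1)]] f.add f.smult f.closed in auto)
  then show ?thesis by simp
 qed
 fix f assume f: "f \<in> car (hm N)"
 interpret f: lhm S CL N f using f by (intro hom_lhm) simp
 show "\<zero>\<^bsub>hm N\<^esub> \<oplus>\<^bsub>hm N\<^esub> f = f"
  by (rule extensionalityI[of _ "car C"]) (use f.ext f.closed in auto)
 have "(\<lambda>x \<in> car CL. (\<lambda>x \<in> car CL. \<zero>\<^sub>N) x \<ominus>\<^sub>N f x) \<in> lhom S CL N"
  by (intro lhom_diff CL N lhom_zero f.lhom)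
 then show "\<exists>g \<in> car (hm N). g \<oplus>\<^bsub>hm N\<^esub> f = \<zero>\<^bsub>hm N\<^esub>"
  using f.closed by (intro bexI[of _ "\<lambda>x \<in> car CL. (\<lambda>x \<in> car CL. \<zero>\<^sub>N) x \<ominus>\<^sub>N f x"]) (auto intro!: restrict_ext)
 show "\<one>\<^sub>R \<odot>\<^bsub>hm N\<^esub> f = f"
  by (rule extensionalityI[of _ "car C"]) (use f.ext CR.smult_one in auto)
 fix a b assume a: "a \<in> car R" and b: "b \<in> car R"
 show "(a \<oplus>\<^sub>R b) \<odot>\<^bsub>hm N\<^esub> f = a \<odot>\<^bsub>hm N\<^esub> f \<oplus>\<^bsub>hm N\<^esub> b \<odot>\<^bsub>hm N\<^esub> f"
  using a b f.add CR.smult_l_distr[of a b] by (auto intro!: restrict_ext)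
 \<comment> \<open>The factors trade places because \<open>CR\<close> is a module over the opposite
   ring.\<close>
 show "(a \<otimes>\<^sub>R b) \<odot>\<^bsub>hm N\<^esub> f = a \<odot>\<^bsub>hm N\<^esub> (b \<odot>\<^bsub>hm N\<^esub> f)"
  using a b CR.smult_assoc[of b a] by (auto intro!: restrict_ext)
qed (use lhom_add[OF CL N] lhom_zero[OF CL N] hom_closed in \<open>auto simp: N.ac intro!: restrict_ext\<close>)

end

end

section \<open>Diagram chases\<close>

text \<open>Short exactness for maps that are merely additive and may be arbitrary outside the
  carriers, as entrywise maps on powers and the maps induced by the functors are.\<close>

definition gses :: "('r, 'a) module \<Rightarrow> ('r, 'b) module \<Rightarrow> ('r, 'z) module \<Rightarrow> ('a \<Rightarrow> 'b) \<Rightarrow> ('b \<Rightarrow> 'z) \<Rightarrow> bool" where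
 "gses A B Z f g \<longleftrightarrow> abg A \<and> abg B \<and> abg Z \<and> f \<in> ahom A B \<and> g \<in> ahom B Z \<and>
   (\<forall>x \<in> car A. f x = \<zero>\<^sub>B \<longrightarrow> x = \<zero>\<^sub>A) \<and> (\<forall>z \<in> car Z. \<exists>y \<in> car B. g y = z) \<and>
   (\<forall>x \<in> car A. g (f x) = \<zero>\<^sub>Z) \<and> (\<forall>y \<in> car B. g y = \<zero>\<^sub>Z \<longrightarrow> (\<exists>x \<in> car A. f x = y))"

locale gsesl = f: ahm A B f + g: ahm B Z g
 for A :: "('r, 'a) module" and B :: "('r, 'b) module" and Z :: "('r, 'z) module" and f g +
 assumes inj0: "x \<in> car A \<Longrightarrow> f x = \<zero>\<^sub>B \<Longrightarrow> x = \<zero>\<^sub>A"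
  and onto: "z \<in> car Z \<Longrightarrow> \<exists>y \<in> car B. g y = z"
  and gf [simp]: "x \<in> car A \<Longrightarrow> g (f x) = \<zero>\<^sub>Z"
  and ex: "y \<in> car B \<Longrightarrow> g y = \<zero>\<^sub>Z \<Longrightarrow> \<exists>x \<in> car A. f x = y"
begin

lemma inj: "x \<in> car A \<Longrightarrow> y \<in> car A \<Longrightarrow> f x = f y \<Longrightarrow> x = y"
 using inj0[of "x \<ominus>\<^sub>A y"] by (simp add: f.A.diff_eq_zero)

end

lemma gses_iff: "gses A B Z f g \<longleftrightarrow> gsesl A B Z f g"
 by (auto simp: gses_def gsesl_def gsesl_axioms_def ahm_def ahm_axioms_def)

lemma ses_gses: "ses R A B Z f g \<Longrightarrow> gses A B Z f g"
proof -
 assume "ses R A B Z f g"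
 then interpret sesm R A B Z f g by (simp add: ses_iff)
 show ?thesis unfolding gses_def
 proof (intro conjI ballI impI)
  show "\<exists>y \<in> car B. g y = z" if "z \<in> car Z" for z by (rule surjE[OF that]) blast
  show "\<exists>x \<in> car A. f x = y" if "y \<in> car B" "g y = \<zero>\<^sub>Z" for y by (rule exactE[OF that]) blast
 qed (use f.ahom g.ahom f.A.abg_axioms f.B.abg_axioms g.B.abg_axioms f_zero_iff in auto)
qed

lemma gses_pow:
 assumes "gses A B Z f g"
 shows "gses (mpow k A) (mpow k B) (mpow k Z) (pm k f) (pm k g)"
proof -
 interpret gsesl A B Z f g using assms by (simp add: gses_iff)
 interpret PA: abg "mpow k A" by (rule abg_pow[OF f.A.abg_axioms])
 interpret PB: abg "mpow k B" by (rule abg_pow[OF f.B.abg_axioms])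
 interpret PZ: abg "mpow k Z" by (rule abg_pow[OF g.B.abg_axioms])
 show ?thesis
  unfolding gses_def
 proof (intro conjI ballI impI)
  fix x assume x: "x \<in> car (mpow k A)" "pm k f x = \<zero>\<^bsub>mpow k B\<^esub>"
  have "f (x i) = \<zero>\<^sub>B" if "i < k" for i using fun_cong[OF x(2), of i] that by simp
  then show "x = \<zero>\<^bsub>mpow k A\<^esub>" by (intro pow_eqI[OF x(1) PA.zero_closed]) (use x inj0 in simp)
 next
  fix z assume z: "z \<in> car (mpow k Z)"
  have "\<exists>y. i < k \<longrightarrow> y \<in> car B \<and> g y = z i" for i using onto[OF pow_closed[OF z, of i]] by blast
  then obtain y where y: "\<And>i. i < k \<Longrightarrow> y i \<in> car B \<and> g (y i) = z i" by metis
  have "restrict y {..<k} \<in> car (mpow k B)" using y by simp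
  moreover have "pm k g (restrict y {..<k}) = z"
   by (rule pow_eqI[OF pm_closed[OF g.ahom calculation] z]) (use y in simp)
  ultimately show "\<exists>y \<in> car (mpow k B). pm k g y = z" by blast
 next
  fix x assume x: "x \<in> car (mpow k A)"
  show "pm k g (pm k f x) = \<zero>\<^bsub>mpow k Z\<^esub>"
   by (rule pow_eqI[OF pm_closed[OF g.ahom pm_closed[OF f.ahom x]] PZ.zero_closed]) (use x in simp)
 next
  fix y assume y: "y \<in> car (mpow k B)" "pm k g y = \<zero>\<^bsub>mpow k Z\<^esub>"
  have "g (y i) = \<zero>\<^sub>Z" if "i < k" for i using fun_cong[OF y(2), of i] that by simp
  then have "\<exists>x. i < k \<longrightarrow> x \<in> car A \<and> f x = y i" for i using ex[OF pow_closed[OF y(1), of i]] by blast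
  then obtain x where x: "\<And>i. i < k \<Longrightarrow> x i \<in> car A \<and> f (x i) = y i" by metis
  have "restrict x {..<k} \<in> car (mpow k A)" using x by simp
  moreover have "pm k f (restrict x {..<k}) = y"
   by (rule pow_eqI[OF pm_closed[OF f.ahom calculation] y(1)]) (use x in simp)
  ultimately show "\<exists>x \<in> car (mpow k A). pm k f x = y" by blast
 qed (use f.ahom g.ahom pm_ahom PA.abg_axioms PB.abg_axioms PZ.abg_axioms in auto)
qed

text \<open>A commutative ladder between two short exact rows, with vertical maps \<open>a\<close>,
  \<open>b\<close>, \<open>c\<close>.\<close>

definition sq :: "('r, 'a) module \<Rightarrow> ('r, 'b) module \<Rightarrow> ('r, 'z) module \<Rightarrow> ('a \<Rightarrow> 'b) \<Rightarrow> ('b \<Rightarrow> 'z) \<Rightarrow>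
  ('s, 'a1) module \<Rightarrow> ('s, 'b1) module \<Rightarrow> ('s, 'z1) module \<Rightarrow> ('a1 \<Rightarrow> 'b1) \<Rightarrow> ('b1 \<Rightarrow> 'z1) \<Rightarrow>
  ('a \<Rightarrow> 'a1) \<Rightarrow> ('b \<Rightarrow> 'b1) \<Rightarrow> ('z \<Rightarrow> 'z1) \<Rightarrow> bool" where
 "sq A B Z f g A' B' Z' f' g' a b c \<longleftrightarrow> gses A B Z f g \<and> gses A' B' Z' f' g' \<and> a \<in> ahom A A' \<and> b \<in> ahom B B' \<and>
   (\<forall>x \<in> car A. f' (a x) = b (f x)) \<and> (\<forall>y \<in> car B. g' (b y) = c (g y))"

locale sql = r: gsesl A B Z f g + r': gsesl A' B' Z' f' g' + a: ahm A A' a + b: ahm B B' b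
 for A B Z f g A' B' Z' f' g' a b +
 fixes c
 assumes l: "x \<in> car A \<Longrightarrow> f' (a x) = b (f x)" and r: "y \<in> car B \<Longrightarrow> g' (b y) = c (g y)"

lemma sq_iff: "sq A B Z f g A' B' Z' f' g' a b c \<longleftrightarrow> sql A B Z f g A' B' Z' f' g' a b c"
 unfolding sq_def sql_def sql_axioms_def gses_iff
 by (auto simp: gsesl_def ahm_def ahm_axioms_def)

text \<open>Only the inclusion of the kernel in the image. That consecutive maps compose to zero is
  a separate hypothesis, made for the middle complex alone.\<close>

definition ex_at :: "('r, 'a) module \<Rightarrow> ('s, 'b) module \<Rightarrow> ('t, 'z) module \<Rightarrow> ('a \<Rightarrow> 'b) \<Rightarrow> ('b \<Rightarrow> 'z) \<Rightarrow> bool" where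
 "ex_at A B Z f g \<longleftrightarrow> (\<forall>y \<in> car B. g y = \<zero>\<^sub>Z \<longrightarrow> (\<exists>x \<in> car A. f x = y))"

text \<open>The two halves of the long exact sequence: cycles of the quotient lift to cycles, and boundaries
 of the middle complex lying in the subcomplex are boundaries there.\<close>

lemma chase_lift:
 assumes "sq A1 B1 Z1 f1 g1 A2 B2 Z2 f2 g2 a1 b1 c1" and "sq A2 B2 Z2 f2 g2 A3 B3 Z3 f3 g3 a2 b2 c2"
  and bb: "\<And>y. y \<in> car B1 \<Longrightarrow> b2 (b1 y) = \<zero>\<^bsub>B3\<^esub>" and A: "ex_at A1 A2 A3 a1 a2"
  and z: "z \<in> car Z1" "c1 z = \<zero>\<^bsub>Z2\<^esub>"
 shows "\<exists>y \<in> car B1. g1 y = z \<and> b1 y = \<zero>\<^bsub>B2\<^esub>"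
proof -
 interpret p: sql A1 B1 Z1 f1 g1 A2 B2 Z2 f2 g2 a1 b1 c1 using assms(1) by (simp add: sq_iff)
 interpret q: sql A2 B2 Z2 f2 g2 A3 B3 Z3 f3 g3 a2 b2 c2 using assms(2) by (simp add: sq_iff)
 obtain y where y: "y \<in> car B1" "g1 y = z" using p.r.onto[OF z(1)] by blast
 obtain u where u: "u \<in> car A2" "f2 u = b1 y" using p.r'.ex[of "b1 y"] p.r[OF y(1)] y z by auto
 have "a2 u = \<zero>\<^bsub>A3\<^esub>" by (rule q.r'.inj0) (use u q.l[OF u(1)] bb[OF y(1)] in auto)
 then obtain u' where u': "u' \<in> car A1" "a1 u' = u" using A u(1) unfolding ex_at_def by blast
 show ?thesis by (rule bexI[of _ "y \<ominus>\<^bsub>B1\<^esub> f1 u'"]) (use y u u' p.l[OF u'(1)] z in auto)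
qed

lemma chase_drop:
 assumes "sq A0 B0 Z0 f0 g0 A1 B1 Z1 f1 g1 a0 b0 c0" and "sq A1 B1 Z1 f1 g1 A2 B2 Z2 f2 g2 a1 b1 c1"
  and bb: "\<And>y. y \<in> car B0 \<Longrightarrow> b1 (b0 y) = \<zero>\<^bsub>B2\<^esub>" and Z: "ex_at Z0 Z1 Z2 c0 c1"
  and x: "x \<in> car A2" and y: "y \<in> car B1" "f2 x = b1 y"
 shows "\<exists>x' \<in> car A1. a1 x' = x"
proof -
 interpret p: sql A0 B0 Z0 f0 g0 A1 B1 Z1 f1 g1 a0 b0 c0 using assms(1) by (simp add: sq_iff)
 interpret q: sql A1 B1 Z1 f1 g1 A2 B2 Z2 f2 g2 a1 b1 c1 using assms(2) by (simp add: sq_iff)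
 have "c1 (g1 y) = \<zero>\<^bsub>Z2\<^esub>" using q.r[OF y(1)] q.r'.gf[OF x] y(2) by simp
 then obtain z' where z': "z' \<in> car Z0" "c0 z' = g1 y" using Z p.r'.g.closed[OF y(1)] unfolding ex_at_def by blast
 obtain w where w: "w \<in> car B0" "g0 w = z'" using p.r.onto[OF z'(1)] by blast
 obtain u where u: "u \<in> car A1" "f1 u = y \<ominus>\<^bsub>B1\<^esub> b0 w"
  using p.r'.ex[of "y \<ominus>\<^bsub>B1\<^esub> b0 w"] y w z' p.r[OF w(1)] by auto
 have "f2 (a1 u) = f2 x" using q.l[OF u(1)] u y w bb[OF w(1)] q.b.closed[OF y(1)] by simp
 then show ?thesis using q.r'.inj[OF q.a.closed[OF u(1)] x] u(1) by blast
qed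

text \<open>The portion \<open>H(B) \<rightarrow> H(Z) \<rightarrow> H(A)\<close> of the long exact
  sequence; the connecting map explains why exactness of the \<open>A\<close> complex enters one
  place further on.\<close>

lemma ex_at_cok:
 assumes s0: "sq A0 B0 Z0 f0 g0 A1 B1 Z1 f1 g1 a0 b0 c0" and s: "sq A1 B1 Z1 f1 g1 A2 B2 Z2 f2 g2 a1 b1 c1"
   "sq A2 B2 Z2 f2 g2 A3 B3 Z3 f3 g3 a2 b2 c2"
  and bb: "\<And>y. y \<in> car B1 \<Longrightarrow> b2 (b1 y) = \<zero>\<^bsub>B3\<^esub>" and A: "ex_at A1 A2 A3 a1 a2" and B: "ex_at B0 B1 B2 b0 b1"
 shows "ex_at Z0 Z1 Z2 c0 c1"
 unfolding ex_at_def
proof (intro ballI impI)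
 interpret p: sql A0 B0 Z0 f0 g0 A1 B1 Z1 f1 g1 a0 b0 c0 using s0 by (simp add: sq_iff)
 fix z assume "z \<in> car Z1" "c1 z = \<zero>\<^bsub>Z2\<^esub>"
 then obtain y where "y \<in> car B1" "g1 y = z" "b1 y = \<zero>\<^bsub>B2\<^esub>" using chase_lift[OF s bb A] by blast
 then obtain x where x: "x \<in> car B0" "g1 (b0 x) = z" using B unfolding ex_at_def by blast
 show "\<exists>x \<in> car Z0. c0 x = z" by (rule bexI[of _ "g0 x"]) (use x p.r[OF x(1)] in auto)
qed

text \<open>The portion \<open>H(Z) \<rightarrow> H(A) \<rightarrow> H(B)\<close>, with exactness of
  the \<open>Z\<close> complex one place earlier.\<close>

lemma ex_at_ker:
 assumes s: "sq A0 B0 Z0 f0 g0 A1 B1 Z1 f1 g1 a0 b0 c0" "sq A1 B1 Z1 f1 g1 A2 B2 Z2 f2 g2 a1 b1 c1"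
  and s2: "sq A2 B2 Z2 f2 g2 A3 B3 Z3 f3 g3 a2 b2 c2"
  and bb: "\<And>y. y \<in> car B0 \<Longrightarrow> b1 (b0 y) = \<zero>\<^bsub>B2\<^esub>" and Z: "ex_at Z0 Z1 Z2 c0 c1" and B: "ex_at B1 B2 B3 b1 b2"
 shows "ex_at A1 A2 A3 a1 a2"
 unfolding ex_at_def
proof (intro ballI impI)
 interpret p: sql A2 B2 Z2 f2 g2 A3 B3 Z3 f3 g3 a2 b2 c2 using s2 by (simp add: sq_iff)
 fix x assume x: "x \<in> car A2" "a2 x = \<zero>\<^bsub>A3\<^esub>"
 then have "b2 (f2 x) = \<zero>\<^bsub>B3\<^esub>" using p.l[OF x(1)] by simp
 then obtain w where "w \<in> car B1" "b1 w = f2 x" using B p.r.f.closed[OF x(1)] unfolding ex_at_def by blast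
 then show "\<exists>x' \<in> car A1. a1 x' = x" using chase_drop[OF s bb Z x(1)] by simp
qed

lemma abg_zero_mod: "abg (zero_mod z)"
 by (rule abg.intro, rule abelian_groupI) auto

text \<open>Pads the complexes at their ends, where exactness turns into injectivity or
  surjectivity.\<close>

abbreviation "zm \<equiv> zero_mod () :: (unit, unit) module"

lemma gses_trivial: "gses zm zm zm (\<lambda>_. ()) (\<lambda>_. ())"
 by (simp add: gses_def ahom_def abg_zero_mod)

section \<open>Pairings\<close>

locale semid = bimod S R C + L: fres S "left_mod C" m pL dL + T: tres R "right_mod C" l pR dR
 for S :: "'s ring" and R :: "'r ring" and C :: "('s, 'r, 'c) bimodule" and m pL dL and l pR dR
begin

text \<open>A pairing of a left \<open>R\<close>-module \<open>M\<close> with a left \<open>S\<close>-module \<open>N\<close> is the same as an \<open>S\<close>-linear map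
 from \<open>C \<otimes> M\<close> to \<open>N\<close>, and as an \<open>R\<close>-linear map from \<open>M\<close> to \<open>Hom(C, N)\<close>. This makes the conditions
 defining the Auslander and the Bass class two instances of one condition.\<close>

definition pairing :: "('r, 'm) module \<Rightarrow> ('s, 'n) module \<Rightarrow> ('c \<Rightarrow> 'm \<Rightarrow> 'n) \<Rightarrow> bool" where
 "pairing M N \<beta> \<longleftrightarrow> left_module R M \<and> left_module S N \<and>
   (\<forall>x \<in> car M. (\<lambda>c. \<beta> c x) \<in> linear S CL N) \<and> (\<forall>c \<in> car C. \<beta> c \<in> ahom M N) \<and>
   (\<forall>r \<in> car R. \<forall>c \<in> car C. \<forall>x \<in> car M. \<beta> (rsmult C c r) x = \<beta> c (r \<odot>\<^sub>M x))"

text \<open>The map \<open>M \<rightarrow> Hom(C, N)\<close> followed by evaluation at the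
  generators of \<open>C\<close> as a left module.\<close>

definition bU :: "('c \<Rightarrow> 'm \<Rightarrow> 'n) \<Rightarrow> 'm \<Rightarrow> nat \<Rightarrow> 'n" where
 "bU \<beta> x = (\<lambda>j \<in> {..<m 0}. \<beta> (L.cvec j) x)"

text \<open>The map \<open>C \<otimes> M \<rightarrow> N\<close> preceded by the cover of
  \<open>C \<otimes> M\<close> by a power of \<open>M\<close>.\<close>

definition bT :: "('s, 'n) module \<Rightarrow> ('c \<Rightarrow> 'm \<Rightarrow> 'n) \<Rightarrow> (nat \<Rightarrow> 'm) \<Rightarrow> 'n" where
 "bT N \<beta> x = nsum N (\<lambda>k. \<beta> (T.cvec k) (x k)) (l 0)"

text \<open>Exactness of \<open>0 \<rightarrow> M \<rightarrow> N^(m 0) \<rightarrow> N^(m 1)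
  \<rightarrow> ...\<close>, place by place. Places 0 and 1 say that
  \<open>M \<rightarrow> Hom(C, N)\<close> is injective and surjective; place \<open>i + 2\<close>
  is the vanishing of Ext in degree \<open>i + 1\<close>.\<close>

fun uex :: "('r, 'm) module \<Rightarrow> ('s, 'n) module \<Rightarrow> ('c \<Rightarrow> 'm \<Rightarrow> 'n) \<Rightarrow> nat \<Rightarrow> bool" where
 "uex M N \<beta> 0 \<longleftrightarrow> (\<forall>x \<in> car M. bU \<beta> x = \<zero>\<^bsub>mpow (m 0) N\<^esub> \<longrightarrow> x = \<zero>\<^sub>M)"
| "uex M N \<beta> (Suc 0) \<longleftrightarrow> (\<forall>y \<in> car (mpow (m 0) N). L.cob N 0 y = \<zero>\<^bsub>mpow (m (Suc 0)) N\<^esub> \<longrightarrow>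
   (\<exists>x \<in> car M. bU \<beta> x = y))"
| "uex M N \<beta> (Suc (Suc i)) \<longleftrightarrow> (\<forall>y \<in> car (mpow (m (Suc i)) N).
   L.cob N (Suc i) y = \<zero>\<^bsub>mpow (m (Suc (Suc i))) N\<^esub> \<longrightarrow> (\<exists>x \<in> car (mpow (m i) N). L.cob N i x = y))"

text \<open>Exactness of \<open>... \<rightarrow> M^(l 1) \<rightarrow> M^(l 0) \<rightarrow> N
  \<rightarrow> 0\<close>. Places 0 and 1 say that \<open>C \<otimes> M \<rightarrow> N\<close> is
  surjective and injective; place \<open>i + 2\<close> is the vanishing of Tor in degree
  \<open>i + 1\<close>.\<close>

fun tex :: "('r, 'm) module \<Rightarrow> ('s, 'n) module \<Rightarrow> ('c \<Rightarrow> 'm \<Rightarrow> 'n) \<Rightarrow> nat \<Rightarrow> bool" where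
 "tex M N \<beta> 0 \<longleftrightarrow> (\<forall>y \<in> car N. \<exists>x \<in> car (mpow (l 0) M). bT N \<beta> x = y)"
| "tex M N \<beta> (Suc 0) \<longleftrightarrow> (\<forall>x \<in> car (mpow (l 0) M). bT N \<beta> x = \<zero>\<^sub>N \<longrightarrow>
   (\<exists>y \<in> car (mpow (l (Suc 0)) M). T.bnd M 0 y = x))"
| "tex M N \<beta> (Suc (Suc i)) \<longleftrightarrow> (\<forall>x \<in> car (mpow (l (Suc i)) M). T.bnd M i x = \<zero>\<^bsub>mpow (l i) M\<^esub> \<longrightarrow>
   (\<exists>y \<in> car (mpow (l (Suc (Suc i))) M). T.bnd M (Suc i) y = x))"

lemma coexact_uex: "L.coexact N \<longleftrightarrow> (\<forall>i. uex M N \<beta> (Suc (Suc i)))"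
 by (simp add: L.coexact_def)

lemma chexact_tex: "T.chexact M \<longleftrightarrow> (\<forall>i. tex M N \<beta> (Suc (Suc i)))"
 by (simp add: T.chexact_def)

definition good :: "('r, 'm) module \<Rightarrow> ('s, 'n) module \<Rightarrow> ('c \<Rightarrow> 'm \<Rightarrow> 'n) \<Rightarrow> bool" where
 "good M N \<beta> \<longleftrightarrow> pairing M N \<beta> \<and> (\<forall>i. uex M N \<beta> i) \<and> (\<forall>i. tex M N \<beta> i)"

context
 fixes M :: "('r, 'm) module" and N :: "('s, 'n) module" and \<beta>
 assumes pair: "pairing M N \<beta>"
begin

lemma pM: "left_module R M" and pN: "left_module S N"
 and \<beta>_linear: "x \<in> car M \<Longrightarrow> (\<lambda>c. \<beta> c x) \<in> linear S CL N"
 and \<beta>_ahom: "c \<in> car C \<Longrightarrow> \<beta> c \<in> ahom M N"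
 and \<beta>_balanced: "r \<in> car R \<Longrightarrow> c \<in> car C \<Longrightarrow> x \<in> car M \<Longrightarrow> \<beta> (rsmult C c r) x = \<beta> c (r \<odot>\<^sub>M x)"
 using pair by (auto simp: pairing_def)

interpretation M: lmod R M using pM by (simp add: lmod_iff)
interpretation N: lmod S N using pN by (simp add: lmod_iff)
interpretation PM: abg "mpow k M" for k by (rule abg_pow[OF M.abg_axioms])
interpretation PN: abg "mpow k N" for k by (rule abg_pow[OF N.abg_axioms])
interpretation TM: tens_ctx R CR M by (rule tens_ctxI[OF CR pM])

lemma \<beta>_closed: "c \<in> car C \<Longrightarrow> x \<in> car M \<Longrightarrow> \<beta> c x \<in> car N"
 using \<beta>_ahom by (simp add: ahom_def)

lemma cvec_C [simp]: "L.cvec j \<in> car C" "T.cvec k \<in> car C"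
 using L.cvec_closed[of j] T.cvec_closed[of k] by auto

lemma bU_ahom: "bU \<beta> \<in> ahom M (mpow (m 0) N)"
 using \<beta>_ahom[OF cvec_C(1)] by (auto simp: ahom_def bU_def add_pow intro!: restrict_ext)

lemma bT_ahom: "bT N \<beta> \<in> ahom (mpow (l 0) M) N"
proof -
 have "bT N \<beta> (x \<oplus>\<^bsub>mpow (l 0) M\<^esub> y) = bT N \<beta> x \<oplus>\<^sub>N bT N \<beta> y"
  if "x \<in> car (mpow (l 0) M)" "y \<in> car (mpow (l 0) M)" for x y
  unfolding bT_def using that \<beta>_ahom[OF cvec_C(2)] \<beta>_closed
  by (subst N.nsum_add[symmetric]) (auto simp: ahom_def intro!: nsum_cong)
 then show ?thesis using \<beta>_closed by (auto simp: ahom_def bT_def intro!: N.nsum_closed)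
qed

lemma pairing_lhom: "x \<in> car M \<Longrightarrow> (\<lambda>c \<in> car C. \<beta> c x) \<in> lhom S CL N"
 using restrict_lhomI[OF CL, of "\<lambda>c. \<beta> c x" N] linearD[OF \<beta>_linear, of x] by simp

lemma cob_bU: "x \<in> car M \<Longrightarrow> L.cob N 0 (bU \<beta> x) = \<zero>\<^bsub>mpow (m (Suc 0)) N\<^esub>"
proof -
 assume x: "x \<in> car M"
 have "(\<lambda>k \<in> {..<m 0}. (\<lambda>c \<in> car C. \<beta> c x) (L.cvec k)) = bU \<beta> x" by (simp add: bU_def)
 then show ?thesis using L.cob_hom_zero[OF pN pairing_lhom[OF x]] by simp
qed

lemma tens_map_pairing:
 obtains h where "h \<in> ahom (tens R CR M) N"
  "\<And>c x. c \<in> car C \<Longrightarrow> x \<in> car M \<Longrightarrow> h (pt R CR M c x) = \<beta> c x"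
  "\<And>x. x \<in> car (mpow (l 0) M) \<Longrightarrow> h (T.gam M x) = bT N \<beta> x"
proof -
 obtain h where h: "h \<in> ahom (tens R CR M) N"
  "\<And>c x. c \<in> car CR \<Longrightarrow> x \<in> car M \<Longrightarrow> h (pt R CR M c x) = \<beta> c x"
  by (rule TM.tens_universal[OF N.abg_axioms, of \<beta>])
   (use \<beta>_closed \<beta>_balanced \<beta>_ahom linearD(2)[OF \<beta>_linear] in \<open>auto simp: ahom_def\<close>)
 interpret h: ahm "tens R CR M" N h by (rule ahmI[OF TM.abg_tens N.abg_axioms h(1)])
 have "h (T.gam M x) = bT N \<beta> x" if x: "x \<in> car (mpow (l 0) M)" for x
 proof -
  have "h (T.gam M x) = nsum N (\<lambda>k. h (pt R CR M (T.cvec k) (x k))) (l 0)"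
   unfolding T.gam_def by (rule h.nsum) (use x TM.pt_closed in simp)
  also have "\<dots> = bT N \<beta> x" unfolding bT_def by (rule nsum_cong) (use x h(2) in simp)
  finally show ?thesis .
 qed
 then show thesis using that h by simp
qed

lemma bT_bnd: 
 assumes y: "y \<in> car (mpow (l (Suc 0)) M)" shows "bT N \<beta> (T.bnd M 0 y) = \<zero>\<^sub>N"
proof -
 obtain h where h: "h \<in> ahom (tens R CR M) N"
  "\<And>x. x \<in> car (mpow (l 0) M) \<Longrightarrow> h (T.gam M x) = bT N \<beta> x"
  using tens_map_pairing by metis
 interpret h: ahm "tens R CR M" N h by (rule ahmI[OF TM.abg_tens N.abg_axioms h(1)])
 have yc: "T.bnd M 0 y \<in> car (mpow (l 0) M)" using T.bnd_ahom[OF pM] y by (simp add: ahom_def)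
 have "T.gam M (T.bnd M 0 y) = \<zero>\<^bsub>tens R CR M\<^esub>" using T.gam_zero_iff[OF pM yc] y by blast
 then show ?thesis using h(2)[OF yc] h.zero by simp
qed

end

lemma bnd_closed: "left_module R M \<Longrightarrow> x \<in> car (mpow (l (Suc i)) M) \<Longrightarrow> T.bnd M i x \<in> car (mpow (l i) M)"
 using T.bnd_ahom[of M i] by (simp add: ahom_def)

definition pmor :: "('r, 'm) module \<Rightarrow> ('s, 'n) module \<Rightarrow> ('c \<Rightarrow> 'm \<Rightarrow> 'n) \<Rightarrow>
  ('r, 'm1) module \<Rightarrow> ('s, 'n1) module \<Rightarrow> ('c \<Rightarrow> 'm1 \<Rightarrow> 'n1) \<Rightarrow> ('m \<Rightarrow> 'm1) \<Rightarrow> ('n \<Rightarrow> 'n1) \<Rightarrow> bool" where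
 "pmor M N \<beta> M' N' \<beta>' f g \<longleftrightarrow> pairing M N \<beta> \<and> pairing M' N' \<beta>' \<and> f \<in> linear R M M' \<and> g \<in> linear S N N' \<and>
   (\<forall>c \<in> car C. \<forall>x \<in> car M. g (\<beta> c x) = \<beta>' c (f x))"

lemma pmor_squares:
 assumes "pmor M N \<beta> M' N' \<beta>' f g"
 shows "x \<in> car M \<Longrightarrow> pm (m 0) g (bU \<beta> x) = bU \<beta>' (f x)"
  and "y \<in> car (mpow (m i) N) \<Longrightarrow> pm (m (Suc i)) g (L.cob N i y) = L.cob N' i (pm (m i) g y)"
  and "v \<in> car (mpow (l 0) M) \<Longrightarrow> g (bT N \<beta> v) = bT N' \<beta>' (pm (l 0) f v)"
  and "w \<in> car (mpow (l (Suc i)) M) \<Longrightarrow> pm (l i) f (T.bnd M i w) = T.bnd M' i (pm (l (Suc i)) f w)"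
proof -
 have p: "pairing M N \<beta>" "pairing M' N' \<beta>'" and f: "f \<in> linear R M M'" and g: "g \<in> linear S N N'"
  and gf: "\<And>c x. c \<in> car C \<Longrightarrow> x \<in> car M \<Longrightarrow> g (\<beta> c x) = \<beta>' c (f x)"
  using assms by (auto simp: pmor_def)
 note c = cvec_C[OF p(1)]
 interpret N: lmod S N using pN[OF p(1)] by (simp add: lmod_iff)
 interpret N': lmod S N' using pN[OF p(2)] by (simp add: lmod_iff)
 interpret g: ahm N N' g using g by (intro ahmI N.abg_axioms N'.abg_axioms) (simp add: linear_def)
 show "pm (m 0) g (bU \<beta> x) = bU \<beta>' (f x)" if "x \<in> car M"
  using that by (auto simp: pm_def bU_def gf c intro!: restrict_ext)
 show "pm (m (Suc i)) g (L.cob N i y) = L.cob N' i (pm (m i) g y)" if "y \<in> car (mpow (m i) N)"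
  by (rule L.pm_cob[OF pN[OF p(1)] pN[OF p(2)] g that])
 show "g (bT N \<beta> v) = bT N' \<beta>' (pm (l 0) f v)" if v: "v \<in> car (mpow (l 0) M)"
 proof -
  have "g (bT N \<beta> v) = nsum N' (\<lambda>k. g (\<beta> (T.cvec k) (v k))) (l 0)"
   unfolding bT_def by (rule g.nsum) (use v c \<beta>_closed[OF p(1)] in simp)
  also have "\<dots> = bT N' \<beta>' (pm (l 0) f v)"
   unfolding bT_def by (rule nsum_cong) (use v c gf in simp)
  finally show ?thesis .
 qed
 show "pm (l i) f (T.bnd M i w) = T.bnd M' i (pm (l (Suc i)) f w)" if "w \<in> car (mpow (l (Suc i)) M)"
  by (rule T.pm_bnd[OF pM[OF p(1)] pM[OF p(2)] f that])
qed

text \<open>Exactness at one place of a third complex involves the ladders next to it. Near the ends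
  of the complexes these are of different kinds, and from place 3 on they are all alike.\<close>

lemma cases3: "P 0 \<Longrightarrow> P (Suc 0) \<Longrightarrow> P (Suc (Suc 0)) \<Longrightarrow> (\<And>i. P (Suc (Suc (Suc i)))) \<Longrightarrow> P i"
 by (metis not0_implies_Suc)

lemma ex_iff:
 "uex M N \<beta> 0 \<longleftrightarrow> ex_at zm M (mpow (m 0) N) (\<lambda>_. \<zero>\<^sub>M) (bU \<beta>)"
 "uex M N \<beta> (Suc 0) \<longleftrightarrow> ex_at M (mpow (m 0) N) (mpow (m (Suc 0)) N) (bU \<beta>) (L.cob N 0)"
 "uex M N \<beta> (Suc (Suc i)) \<longleftrightarrow>
  ex_at (mpow (m i) N) (mpow (m (Suc i)) N) (mpow (m (Suc (Suc i))) N) (L.cob N i) (L.cob N (Suc i))"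
 "tex M N \<beta> 0 \<longleftrightarrow> ex_at (mpow (l 0) M) N zm (bT N \<beta>) (\<lambda>_. ())"
 "tex M N \<beta> (Suc 0) \<longleftrightarrow> ex_at (mpow (l (Suc 0)) M) (mpow (l 0) M) N (T.bnd M 0) (bT N \<beta>)"
 "tex M N \<beta> (Suc (Suc i)) \<longleftrightarrow>
  ex_at (mpow (l (Suc (Suc i))) M) (mpow (l (Suc i)) M) (mpow (l i) M) (T.bnd M (Suc i)) (T.bnd M i)"
 by (auto simp: ex_at_def)

lemma sq_cob:
 assumes N: "left_module S NA" "left_module S NB" "left_module S NZ" and f: "f \<in> linear S NA NB" "g \<in> linear S NB NZ"
  and s: "gses NA NB NZ f g"
 shows "sq (mpow (m i) NA) (mpow (m i) NB) (mpow (m i) NZ) (pm (m i) f) (pm (m i) g)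
  (mpow (m (Suc i)) NA) (mpow (m (Suc i)) NB) (mpow (m (Suc i)) NZ) (pm (m (Suc i)) f) (pm (m (Suc i)) g)
  (L.cob NA i) (L.cob NB i) (L.cob NZ i)"
 using gses_pow[OF s] L.cob_ahom[OF N(1)] L.cob_ahom[OF N(2)] L.pm_cob[OF N(1,2) f(1)] L.pm_cob[OF N(2,3) f(2)]
 by (simp add: sq_def)

lemma sq_bnd:
 assumes M: "left_module R MA" "left_module R MB" "left_module R MZ" and f: "f \<in> linear R MA MB" "g \<in> linear R MB MZ"
  and s: "gses MA MB MZ f g"
 shows "sq (mpow (l (Suc i)) MA) (mpow (l (Suc i)) MB) (mpow (l (Suc i)) MZ) (pm (l (Suc i)) f) (pm (l (Suc i)) g)
  (mpow (l i) MA) (mpow (l i) MB) (mpow (l i) MZ) (pm (l i) f) (pm (l i) g)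
  (T.bnd MA i) (T.bnd MB i) (T.bnd MZ i)"
 using gses_pow[OF s] T.bnd_ahom[OF M(1)] T.bnd_ahom[OF M(2)] T.pm_bnd[OF M(1,2) f(1)] T.pm_bnd[OF M(2,3) f(2)]
 by (simp add: sq_def)

context
 fixes MA :: "('r, 'ma) module" and NA :: "('s, 'na) module" and \<beta>A
  and MB :: "('r, 'mb) module" and NB :: "('s, 'nb) module" and \<beta>B
  and MZ :: "('r, 'mz) module" and NZ :: "('s, 'nz) module" and \<beta>Z
  and fM gM fN gN
 assumes mf: "pmor MA NA \<beta>A MB NB \<beta>B fM fN" and mg: "pmor MB NB \<beta>B MZ NZ \<beta>Z gM gN"
  and rM: "gses MA MB MZ fM gM" and rN: "gses NA NB NZ fN gN"
begin

lemma pA: "pairing MA NA \<beta>A" and pB: "pairing MB NB \<beta>B" and pZ: "pairing MZ NZ \<beta>Z"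
 and lin: "fM \<in> linear R MA MB" "gM \<in> linear R MB MZ" "fN \<in> linear S NA NB" "gN \<in> linear S NB NZ"
 using mf mg by (auto simp: pmor_def)

lemmas sqf = pmor_squares[OF mf] and sqg = pmor_squares[OF mg]
lemmas cob = sq_cob[OF pN[OF pA] pN[OF pB] pN[OF pZ] lin(3,4) rN] and bnd = sq_bnd[OF pM[OF pA] pM[OF pB] pM[OF pZ] lin(1,2) rM]

lemma start: "sq zm zm zm (\<lambda>_. ()) (\<lambda>_. ()) MA MB MZ fM gM
  (\<lambda>_. \<zero>\<^sub>MA) (\<lambda>_. \<zero>\<^sub>MB) (\<lambda>_. \<zero>\<^sub>MZ)"
proof -
 interpret gsesl MA MB MZ fM gM using rM by (simp add: gses_iff)
 show ?thesis using rM by (simp add: gses_trivial sq_def ahom_def)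
qed

lemma stop: "sq NA NB NZ fN gN zm zm zm (\<lambda>_. ()) (\<lambda>_. ()) (\<lambda>_. ()) (\<lambda>_. ()) (\<lambda>_. ())"
 using rN by (simp add: gses_trivial sq_def ahom_def)

lemma trivial: "sq zm zm zm (\<lambda>_. ()) (\<lambda>_. ()) zm zm zm
  (\<lambda>_. ()) (\<lambda>_. ()) (\<lambda>_. ()) (\<lambda>_. ()) (\<lambda>_. ())"
 by (simp add: gses_trivial sq_def ahom_def)

lemma squ: "sq MA MB MZ fM gM (mpow (m 0) NA) (mpow (m 0) NB) (mpow (m 0) NZ) (pm (m 0) fN) (pm (m 0) gN)
  (bU \<beta>A) (bU \<beta>B) (bU \<beta>Z)"
 using rM gses_pow[OF rN] bU_ahom[OF pA] bU_ahom[OF pB] sqf(1) sqg(1) by (simp add: sq_def)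

lemma sqt: "sq (mpow (l 0) MA) (mpow (l 0) MB) (mpow (l 0) MZ) (pm (l 0) fM) (pm (l 0) gM) NA NB NZ fN gN
  (bT NA \<beta>A) (bT NB \<beta>B) (bT NZ \<beta>Z)"
 using rN gses_pow[OF rM] bT_ahom[OF pA] bT_ahom[OF pB] sqf(3) sqg(3) by (simp add: sq_def)

lemma bU_zero: "bU \<beta>B \<zero>\<^sub>MB = \<zero>\<^bsub>mpow (m 0) NB\<^esub>"
proof -
 interpret sql MA MB MZ fM gM "mpow (m 0) NA" "mpow (m 0) NB" "mpow (m 0) NZ" "pm (m 0) fN" "pm (m 0) gN"
   "bU \<beta>A" "bU \<beta>B" "bU \<beta>Z" using squ by (simp add: sq_iff)
 show ?thesis by (rule b.zero)
qed

text \<open>At the padded end, exactness of the \<open>A\<close> complex asks for an element of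
  \<open>NA\<close> over \<open>()\<close>.\<close>

lemma NA_nonempty: "\<exists>x. x \<in> car NA"
proof -
 interpret lmod S NA using pN[OF pA] by (simp add: lmod_iff)
 show ?thesis using zero_closed by blast
qed

lemmas cc = L.cob_cob[OF pN[OF pB]] and bb = T.bnd_bnd[OF pM[OF pB]]

text \<open>Two out of three along the long exact sequences of both complexes. \<open>cases3\<close>
  leaves a few kinds of places, served by the listed instances of \<open>ex_at_cok\<close>; the
  padded ladders supply the neighbours at the ends.\<close>

lemma good_cok:
 assumes A: "good MA NA \<beta>A" and B: "good MB NB \<beta>B"
 shows "good MZ NZ \<beta>Z"
proof -
 note [simp del] = uex.simps tex.simps
 note good = A[unfolded good_def] B[unfolded good_def]
 have "uex MZ NZ \<beta>Z i" for i
  by (rule cases3[of "uex MZ NZ \<beta>Z"]; unfold ex_iff;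
    rule ex_at_cok[OF start squ cob] ex_at_cok[OF squ cob cob] ex_at_cok[OF cob cob cob];
    use good cob_bU[OF pB] cc in \<open>simp flip: ex_iff[of MA NA \<beta>A] ex_iff[of MB NB \<beta>B]\<close>)
 moreover have "tex MZ NZ \<beta>Z i" for i
  by (rule cases3[of "tex MZ NZ \<beta>Z"]; unfold ex_iff;
    rule ex_at_cok[OF sqt stop trivial] ex_at_cok[OF bnd sqt stop] ex_at_cok[OF bnd bnd sqt] ex_at_cok[OF bnd bnd bnd];
    use good bT_bnd[OF pB] bb NA_nonempty in \<open>simp add: ex_at_def[of _ zm] flip: ex_iff[of MA NA \<beta>A] ex_iff[of MB NB \<beta>B]\<close>)
 ultimately show ?thesis using pZ by (simp add: good_def)
qed

lemma good_ker:
 assumes B: "good MB NB \<beta>B" and Z: "good MZ NZ \<beta>Z"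
 shows "good MA NA \<beta>A"
proof -
 note [simp del] = uex.simps tex.simps
 note good = B[unfolded good_def] Z[unfolded good_def]
 have "uex MA NA \<beta>A i" for i
  by (rule cases3[of "uex MA NA \<beta>A"]; unfold ex_iff;
    rule ex_at_ker[OF trivial start squ] ex_at_ker[OF start squ cob] ex_at_ker[OF squ cob cob] ex_at_ker[OF cob cob cob];
    use good cob_bU[OF pB] cc bU_zero in \<open>simp add: ex_at_def[of _ zm] flip: ex_iff[of MB NB \<beta>B] ex_iff[of MZ NZ \<beta>Z]\<close>)
 moreover have "tex MA NA \<beta>A i" for i
  by (rule cases3[of "tex MA NA \<beta>A"]; unfold ex_iff;
    rule ex_at_ker[OF bnd sqt stop] ex_at_ker[OF bnd bnd sqt] ex_at_ker[OF bnd bnd bnd];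
    use good bT_bnd[OF pB] bb in \<open>simp flip: ex_iff[of MB NB \<beta>B] ex_iff[of MZ NZ \<beta>Z]\<close>)
 ultimately show ?thesis using pA by (simp add: good_def)
qed

end

end

section \<open>The Auslander and Bass classes in terms of good pairings\<close>

lemma bij_id: "bij_betw (\<lambda>x. x) A A"
 by (simp add: bij_betw_def)

context semid
begin

lemma pairing_tm:
 assumes M: "left_module R M" shows "pairing M (tm M) (pt R CR M)"
proof -
 interpret X: tens_ctx R CR M by (rule tens_ctxI[OF CR M])
 show ?thesis
  unfolding pairing_def
  using M lm_tm[OF M] X.pt_add_l X.pt_add_r X.pt_balanced X.pt_closed tens_smult_pure[OF M]
  by (simp add: linear_def ahom_def)
qed

lemma pairing_hm:
 assumes N: "left_module S N" shows "pairing (hm N) N (\<lambda>c f. f c)"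
 unfolding pairing_def
 using N lm_hm[OF N] lhom_linear[of _ S CL N] hom_closed[OF N]
 by (simp add: ahom_def)

definition adjR :: "('r, 'm) module \<Rightarrow> ('c \<Rightarrow> 'm \<Rightarrow> 'n) \<Rightarrow> 'm \<Rightarrow> 'c \<Rightarrow> 'n" where
 "adjR M \<beta> = (\<lambda>x \<in> car M. \<lambda>c \<in> car C. \<beta> c x)"

text \<open>The description by \<open>THE\<close> copies the shape of \<open>counit_map\<close>,
  which thereby becomes the instance for the evaluation pairing.\<close>

definition adjL :: "('r, 'm) module \<Rightarrow> ('s, 'n) module \<Rightarrow> ('c \<Rightarrow> 'm \<Rightarrow> 'n) \<Rightarrow> ('c \<times> 'm \<Rightarrow>\<^sub>0 int) set \<Rightarrow> 'n" where
 "adjL M N \<beta> = (THE \<nu>. \<nu> \<in> lhom S (tm M) N \<and>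
   (\<forall>c \<in> car C. \<forall>x \<in> car M. \<nu> (pt R CR M c x) = \<beta> c x))"

lemma unit_map_adjR: "unit_map R C M = adjR M (pt R CR M)"
 by (simp add: unit_map_def adjR_def)

lemma counit_map_adjL: "counit_map S R C N = adjL (hm N) N (\<lambda>c f. f c)"
 by (simp add: counit_map_def adjL_def)

context
 fixes M :: "('r, 'm) module" and N :: "('s, 'n) module" and \<beta>
 assumes pair: "pairing M N \<beta>"
begin

interpretation M: lmod R M using pM[OF pair] by (simp add: lmod_iff)
interpretation N: lmod S N using pN[OF pair] by (simp add: lmod_iff)
interpretation X: tens_ctx R CR M by (rule tens_ctxI[OF CR pM[OF pair]])

lemma adjR_lhom: "adjR M \<beta> \<in> lhom R M (hm N)"
 unfolding adjR_def
proof (rule restrict_lhomI[OF pM[OF pair]])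
 show "(\<lambda>c \<in> car C. \<beta> c x) \<in> car (hm N)" if "x \<in> car M" for x
  using pairing_lhom[OF pair that] by simp
qed (use \<beta>_ahom[OF pair] \<beta>_balanced[OF pair] in \<open>auto simp: ahom_def intro!: restrict_ext\<close>)

text \<open>A homomorphism on \<open>C\<close> is zero as soon as it vanishes at the generators, so
  \<open>adjR\<close> and \<open>bU\<close> have the same kernel.\<close>

lemma adjR_inj_iff: "inj_on (adjR M \<beta>) (car M) \<longleftrightarrow> uex M N \<beta> 0"
proof -
 interpret H: lmod R "hm N" using lm_hm[OF pN[OF pair]] by (simp add: lmod_iff)
 interpret a: lhm R M "hm N" "adjR M \<beta>" by (intro lhmI M.left_module H.left_module adjR_lhom)
 have z: "bU \<beta> x = \<zero>\<^bsub>mpow (m 0) N\<^esub> \<longleftrightarrow> adjR M \<beta> x = \<zero>\<^bsub>hm N\<^esub>" if x: "x \<in> car M" for x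
 proof
  assume *: "bU \<beta> x = \<zero>\<^bsub>mpow (m 0) N\<^esub>"
  have "\<beta> (L.cvec j) x = \<zero>\<^sub>N" if "j < m 0" for j
   using fun_cong[OF *, of j] that by (simp add: bU_def)
  then have "(\<lambda>c \<in> car C. \<beta> c x) = (\<lambda>c \<in> car CL. \<zero>\<^sub>N)"
   using x by (intro L.lhom_gens_eqI[OF pN[OF pair] pairing_lhom[OF pair x] lhom_zero[OF CL pN[OF pair]]])
    (simp add: cvec_C[OF pair])
  then show "adjR M \<beta> x = \<zero>\<^bsub>hm N\<^esub>" using x by (simp add: adjR_def)
 next
  assume "adjR M \<beta> x = \<zero>\<^bsub>hm N\<^esub>"
  then have "(\<lambda>c \<in> car C. \<beta> c x) = (\<lambda>c \<in> car C. \<zero>\<^sub>N)" using x by (simp add: adjR_def)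
  then have "\<beta> c x = \<zero>\<^sub>N" if "c \<in> car C" for c using that by (metis restrict_apply')
  then show "bU \<beta> x = \<zero>\<^bsub>mpow (m 0) N\<^esub>" by (simp add: bU_def zero_pow cvec_C[OF pair])
 qed
 show ?thesis
 proof
  assume "inj_on (adjR M \<beta>) (car M)"
  then show "uex M N \<beta> 0" using a.inj_on_zeroD z by simp
 next
  assume "uex M N \<beta> 0"
  then show "inj_on (adjR M \<beta>) (car M)" using z by (intro a.inj_onI0) simp
 qed
qed

text \<open>The vectors killed by the first coboundary are the vectors of values of homomorphisms
  from \<open>C\<close> to \<open>N\<close>, so both sides ask that all of these come from
  \<open>M\<close>.\<close>

lemma adjR_surj_iff: "adjR M \<beta> ` car M = car (hm N) \<longleftrightarrow> uex M N \<beta> (Suc 0)"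
proof
 assume s: "adjR M \<beta> ` car M = car (hm N)"
 have "\<exists>x \<in> car M. bU \<beta> x = y"
  if y: "y \<in> car (mpow (m 0) N)" "L.cob N 0 y = \<zero>\<^bsub>mpow (m (Suc 0)) N\<^esub>" for y
 proof -
  obtain g where g: "g \<in> lhom S CL N" "\<forall>k < m 0. g (L.cvec k) = y k" using L.lhom_exists[OF pN[OF pair] y] by blast
  then have "g \<in> adjR M \<beta> ` car M" using s by simp
  then obtain x where x: "x \<in> car M" "g = adjR M \<beta> x" by auto
  have "bU \<beta> x = y"
   by (rule pow_eqI[of _ "m 0" N]) (use x g y bU_ahom[OF pair] in \<open>auto simp: ahom_def bU_def adjR_def cvec_C[OF pair]\<close>)
  then show ?thesis using x by blast
 qed
 then show "uex M N \<beta> (Suc 0)" by simp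
next
 assume u: "uex M N \<beta> (Suc 0)"
 have "g \<in> adjR M \<beta> ` car M" if g: "g \<in> lhom S CL N" for g
 proof -
  have "(\<lambda>k \<in> {..<m 0}. g (L.cvec k)) \<in> car (mpow (m 0) N)"
   using hom_closed[OF pN[OF pair] g] by (simp add: cvec_C[OF pair])
  then obtain x where x: "x \<in> car M" "bU \<beta> x = (\<lambda>k \<in> {..<m 0}. g (L.cvec k))"
   using u L.cob_hom_zero[OF pN[OF pair] g] by auto
  have "g = (\<lambda>c \<in> car C. \<beta> c x)"
   by (rule L.lhom_gens_eqI[OF pN[OF pair] g pairing_lhom[OF pair x(1)]])
    (use fun_cong[OF x(2)] in \<open>auto simp: bU_def cvec_C[OF pair] split: if_splits\<close>, metis)
  then show ?thesis using x(1) by (intro image_eqI[of _ _ x]) (simp_all add: adjR_def)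
 qed
 then show "adjR M \<beta> ` car M = car (hm N)"
  using lhom_closed[OF adjR_lhom] by auto
qed

lemma adjR_lisos_iff: "adjR M \<beta> \<in> lisos R M (hm N) \<longleftrightarrow> uex M N \<beta> 0 \<and> uex M N \<beta> (Suc 0)"
 unfolding lisos_def bij_betw_def using adjR_lhom adjR_inj_iff adjR_surj_iff by auto

lemma adjL:
 shows adjL_lhom: "adjL M N \<beta> \<in> lhom S (tm M) N"
  and adjL_pt: "c \<in> car C \<Longrightarrow> x \<in> car M \<Longrightarrow> adjL M N \<beta> (pt R CR M c x) = \<beta> c x"
  and adjL_gam: "v \<in> car (mpow (l 0) M) \<Longrightarrow> adjL M N \<beta> (T.gam M v) = bT N \<beta> v"
proof -
 obtain h where h: "h \<in> ahom (tens R CR M) N"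
  "\<And>c x. c \<in> car C \<Longrightarrow> x \<in> car M \<Longrightarrow> h (pt R CR M c x) = \<beta> c x"
  "\<And>x. x \<in> car (mpow (l 0) M) \<Longrightarrow> h (T.gam M x) = bT N \<beta> x"
  by (rule tens_map_pairing[OF pair]) blast
 interpret h: ahm "tens R CR M" N h by (rule ahmI[OF X.abg_tens N.abg_axioms h(1)])
 let ?h = "restrict h (car (tm M))"
 have sm: "h (tmapl R CR M (\<lambda>c. s \<odot>\<^sub>C c) t) = s \<odot>\<^sub>N h t"
  if s: "s \<in> car S" and t: "t \<in> car (tens R CR M)" for s t
 proof (rule X.tens_eqI[OF N.abg_axioms ahom_comp[OF tens_smult_ahom[OF pM[OF pair] s] h(1)] _ _ t])
  show "(\<lambda>t. s \<odot>\<^sub>N h t) \<in> ahom (tens R CR M) N"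
   using s by (simp add: ahom_def N.smult_r_distr)
  show "h (tmapl R CR M (\<lambda>c. s \<odot>\<^sub>C c) (pt R CR M c x)) = s \<odot>\<^sub>N h (pt R CR M c x)"
   if "c \<in> car CR" "x \<in> car M" for c x
   using that s linearD(3)[OF \<beta>_linear[OF pair, of x], of s c] by (simp add: tens_smult_pure[OF pM[OF pair]] h(2))
 qed
 have hl: "?h \<in> lhom S (tm M) N"
  by (rule restrict_lhomI[OF lm_tm[OF pM[OF pair]]]) (use sm in auto)
 have pt': "?h (pt R CR M c x) = \<beta> c x" if "c \<in> car C" "x \<in> car M" for c x
  using that X.pt_closed[of c x] h(2) by simp
 have uniq: "\<nu> = ?h" if \<nu>: "\<nu> \<in> lhom S (tm M) N \<and> (\<forall>c \<in> car C. \<forall>x \<in> car M. \<nu> (pt R CR M c x) = \<beta> c x)" for \<nu>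
 proof (rule lhom_eqI[OF conjunct1[OF \<nu>] hl])
  fix t assume "t \<in> car (tm M)"
  then have t: "t \<in> car (tens R CR M)" by simp
  have "\<nu> \<in> ahom (tens R CR M) N" "?h \<in> ahom (tens R CR M) N"
   using lhom_ahom[OF conjunct1[OF \<nu>]] lhom_ahom[OF hl] by (simp_all add: ahom_def)
  then show "\<nu> t = ?h t"
   by (rule X.tens_eqI[OF N.abg_axioms _ _ _ t]) (use \<nu> pt' in auto)
 qed
 have eq: "adjL M N \<beta> = ?h"
  unfolding adjL_def by (rule the_equality) (use hl pt' uniq in blast)+
 show "adjL M N \<beta> \<in> lhom S (tm M) N" unfolding eq by (rule hl)
 show "adjL M N \<beta> (pt R CR M c x) = \<beta> c x" if "c \<in> car C" "x \<in> car M" unfolding eq by (rule pt'[OF that])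
 show "adjL M N \<beta> (T.gam M v) = bT N \<beta> v" if "v \<in> car (mpow (l 0) M)"
  unfolding eq using that h(3)[OF that] T.gam_ahom[OF pM[OF pair]] by (simp add: ahom_def)
qed

text \<open>\<open>bT\<close> is \<open>adjL\<close> after the cover \<open>T.gam\<close>, and the
  kernel of \<open>T.gam\<close> is the image of the first boundary. Hence surjectivity and
  injectivity of \<open>adjL\<close> are exactness at the last two places.\<close>

lemma adjL_lisos_iff: "adjL M N \<beta> \<in> lisos S (tm M) N \<longleftrightarrow> tex M N \<beta> 0 \<and> tex M N \<beta> (Suc 0)"
proof -
 interpret a: lhm S "tm M" N "adjL M N \<beta>"
  by (intro lhmI lm_tm[OF pM[OF pair]] N.left_module adjL_lhom)
 note gs = T.gam_surj[OF pM[OF pair]]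
 have gc: "T.gam M v \<in> car (tens R CR M)" if "v \<in> car (mpow (l 0) M)" for v
  using T.gam_ahom[OF pM[OF pair]] that by (simp add: ahom_def)
 have s: "adjL M N \<beta> ` car (tm M) = car N \<longleftrightarrow> tex M N \<beta> 0"
 proof
  assume e: "adjL M N \<beta> ` car (tm M) = car N"
  have "\<exists>v \<in> car (mpow (l 0) M). bT N \<beta> v = y" if "y \<in> car N" for y
  proof -
   have "y \<in> adjL M N \<beta> ` car (tm M)" using that e by simp
   then obtain t where t: "t \<in> car (tens R CR M)" "y = adjL M N \<beta> t" by auto
   then obtain v where "v \<in> car (mpow (l 0) M)" "T.gam M v = t" using gs by blast
   then show ?thesis using adjL_gam t by auto
  qed
  then show "tex M N \<beta> 0" by simp
 next
  assume "tex M N \<beta> 0"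
  then have "y \<in> adjL M N \<beta> ` car (tm M)" if "y \<in> car N" for y
   using that adjL_gam gc by (force simp: image_iff)
  then show "adjL M N \<beta> ` car (tm M) = car N" using a.closed by blast
 qed
 have i: "inj_on (adjL M N \<beta>) (car (tm M)) \<longleftrightarrow> tex M N \<beta> (Suc 0)"
 proof
  assume e: "inj_on (adjL M N \<beta>) (car (tm M))"
  have "\<exists>y \<in> car (mpow (l (Suc 0)) M). T.bnd M 0 y = v"
   if v: "v \<in> car (mpow (l 0) M)" "bT N \<beta> v = \<zero>\<^sub>N" for v
  proof -
   have "T.gam M v = \<zero>\<^bsub>tens R CR M\<^esub>"
    using a.inj_on_zeroD[OF e, of "T.gam M v"] gc[OF v(1)] adjL_gam[OF v(1)] v(2) by simp
   then show ?thesis using T.gam_zero_iff[OF pM[OF pair] v(1)] by auto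
  qed
  then show "tex M N \<beta> (Suc 0)" by simp
 next
  assume e: "tex M N \<beta> (Suc 0)"
  show "inj_on (adjL M N \<beta>) (car (tm M))"
  proof (rule a.inj_onI0)
   fix t assume "t \<in> car (tm M)" and z: "adjL M N \<beta> t = \<zero>\<^sub>N"
   then obtain v where v: "v \<in> car (mpow (l 0) M)" "T.gam M v = t" using gs[of t] by auto
   then have "\<exists>y \<in> car (mpow (l (Suc 0)) M). T.bnd M 0 y = v" using e z adjL_gam[OF v(1)] by simp
   then show "t = \<zero>\<^bsub>tm M\<^esub>" using T.gam_zero_iff[OF pM[OF pair] v(1)] v(2) by auto
  qed
 qed
 show ?thesis unfolding lisos_def bij_betw_def using s i adjL_lhom by auto
qed

end

definition Aus :: "('r, 'm) module \<Rightarrow> bool" where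
 "Aus M \<longleftrightarrow> left_module R M \<and> good M (tm M) (pt R CR M)"

definition Bas :: "('s, 'n) module \<Rightarrow> bool" where
 "Bas N \<longleftrightarrow> left_module S N \<and> good (hm N) N (\<lambda>c f. f c)"

text \<open>For the universal pairing \<open>bT\<close> is the cover \<open>T.gam\<close>
  itself.\<close>

lemma tex_tm:
 assumes M: "left_module R M"
 shows "tex M (tm M) (pt R CR M) 0" "tex M (tm M) (pt R CR M) (Suc 0)"
proof -
 have bT: "bT (tm M) (pt R CR M) = T.gam M"
  by (simp add: bT_def[abs_def] T.gam_def[abs_def])
 show "tex M (tm M) (pt R CR M) 0" using T.gam_surj[OF M] by (simp add: bT)
 show "tex M (tm M) (pt R CR M) (Suc 0)" using T.gam_zero_iff[OF M] by (auto simp: bT)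
qed

text \<open>For the evaluation pairing \<open>adjR\<close> is the identity of
  \<open>hm N\<close>.\<close>

lemma uex_hm:
 assumes N: "left_module S N"
 shows "uex (hm N) N (\<lambda>c f. f c) 0" "uex (hm N) N (\<lambda>c f. f c) (Suc 0)"
proof -
 have "adjR (hm N) (\<lambda>c f. f c) f = f" if "f \<in> car (hm N)" for f
  by (rule extensionalityI[of _ "car C"]) (use that in \<open>auto simp: adjR_def lhom_def PiE_def\<close>)
 then have "inj_on (adjR (hm N) (\<lambda>c f. f c)) (car (hm N))"
  "adjR (hm N) (\<lambda>c f. f c) ` car (hm N) = car (hm N)"
  by (auto simp: inj_on_def simp del: hom_mod_simps)
 then show "uex (hm N) N (\<lambda>c f. f c) 0" "uex (hm N) N (\<lambda>c f. f c) (Suc 0)"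
  using adjR_inj_iff[OF pairing_hm[OF N]] adjR_surj_iff[OF pairing_hm[OF N]] by auto
qed

lemma all_nat_iff: "(\<forall>i. P i) \<longleftrightarrow> P 0 \<and> P (Suc 0) \<and> (\<forall>i. P (Suc (Suc i)))"
 by (metis not0_implies_Suc)

text \<open>For the pairing of \<open>M\<close> with \<open>tm M\<close>, places 0 and 1 of
  \<open>uex\<close> say that the unit is an isomorphism and the later ones that Ext vanishes;
  places 0 and 1 of \<open>tex\<close> hold by \<open>tex_tm\<close>, and the later ones say that
  Tor vanishes.\<close>

lemma Auslander_iff:
 assumes "degreewise_fg S CL" "degreewise_fg (op_ring R) CR"
 shows "M \<in> Auslander S R C \<longleftrightarrow> Aus M"
proof (cases "left_module R M")
 case True
 note p = pairing_tm[OF True]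
 show ?thesis
  unfolding Auslander_def Aus_def good_def all_nat_iff[of "uex _ _ _"] all_nat_iff[of "tex _ _ _"] unit_map_adjR mem_Collect_eq
  using True p tex_tm[OF True] adjR_lisos_iff[OF p] L.Ext_trivial_iff[OF assms(1) lm_tm[OF True]]
   T.Tor_trivial_iff[OF assms(2) True] coexact_uex[of "tm M" M "pt R CR M"] chexact_tex[of M "tm M" "pt R CR M"]
  by (metis (no_types, lifting))
qed (simp add: Auslander_def Aus_def)

text \<open>The roles are exchanged: the first two places of \<open>tex\<close> are the condition on
  the counit, and those of \<open>uex\<close> hold by \<open>uex_hm\<close>.\<close>

lemma Bass_iff:
 assumes "degreewise_fg S CL" "degreewise_fg (op_ring R) CR"
 shows "N \<in> Bass S R C \<longleftrightarrow> Bas N"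
proof (cases "left_module S N")
 case True
 note p = pairing_hm[OF True]
 show ?thesis
  unfolding Bass_def Bas_def good_def all_nat_iff[of "uex _ _ _"] all_nat_iff[of "tex _ _ _"] counit_map_adjL mem_Collect_eq
  using True p uex_hm[OF True] adjL_lisos_iff[OF p] L.Ext_trivial_iff[OF assms(1) True]
   T.Tor_trivial_iff[OF assms(2) lm_hm[OF True]] coexact_uex[of N "hm N" "\<lambda>c f. f c"]
   chexact_tex[of "hm N" N "\<lambda>c f. f c"]
  by (metis (no_types, lifting))
qed (simp add: Bass_def Bas_def)

lemma pairing_zero: "pairing (zero_mod ()) (zero_mod ()) (\<lambda>c x. ())"
 using lm_zero_mod[of R "()"] lm_zero_mod[of S "()"] CL.ring CR.ring
 by (simp add: pairing_def linear_def ahom_def)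

lemma good_zero: "good (zero_mod ()) (zero_mod ()) (\<lambda>c x. ())"
proof -
 have eq: "x = y" for x y :: "nat \<Rightarrow> unit" by (rule ext) simp
 have c: "(\<lambda>_ \<in> {..<k}. ()) \<in> car (mpow k (zero_mod ()))" for k by simp
 have "uex (zero_mod ()) (zero_mod ()) (\<lambda>c x. ()) i" for i
  by (rule cases3[of "uex (zero_mod ()) (zero_mod ()) (\<lambda>c x. ())"]) (auto intro: eq bexI[OF eq c])
 moreover have "tex (zero_mod ()) (zero_mod ()) (\<lambda>c x. ()) i" for i
  by (rule cases3[of "tex (zero_mod ()) (zero_mod ()) (\<lambda>c x. ())"]) (auto intro: c bexI[OF eq c])
 ultimately show ?thesis using pairing_zero by (simp add: good_def)
qed

lemma gses_zero:
 assumes "abg A" "abg B" "g \<in> ahom A B" "bij_betw g (car A) (car B)"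
 shows "gses (zero_mod ()) A B (\<lambda>x. \<zero>\<^sub>A) g" "gses A B (zero_mod ()) g (\<lambda>x. ())"
proof -
 interpret g: ahm A B g by (rule ahmI) fact+
 have "\<exists>y \<in> car A. g y = b" if "b \<in> car B" for b
  using that assms(4) unfolding bij_betw_def by (metis imageE)
 then show "gses (zero_mod ()) A B (\<lambda>x. \<zero>\<^sub>A) g" "gses A B (zero_mod ()) g (\<lambda>x. ())"
  unfolding gses_def using assms abg_zero_mod g.inj_on_zeroD[OF bij_betw_imp_inj_on[OF assms(4)]]
   exI[of "\<lambda>y. y \<in> car B", OF g.B.zero_closed]
  by (auto simp: ahom_def)
qed

lemma pmor_zero:
 assumes "pairing M N \<beta>"
 shows "pmor (zero_mod ()) (zero_mod ()) (\<lambda>c x. ()) M N \<beta> (\<lambda>x. \<zero>\<^sub>M) (\<lambda>x. \<zero>\<^sub>N)"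
  and "pmor M N \<beta> (zero_mod ()) (zero_mod ()) (\<lambda>c x. ()) (\<lambda>x. ()) (\<lambda>x. ())"
proof -
 interpret M: lmod R M using pM[OF assms] by (simp add: lmod_iff)
 interpret N: lmod S N using pN[OF assms] by (simp add: lmod_iff)
 have "\<beta> c \<zero>\<^sub>M = \<zero>\<^sub>N" if "c \<in> car C" for c
  by (rule ahm.zero[OF ahmI[OF M.abg_axioms N.abg_axioms \<beta>_ahom[OF assms that]]])
 then show "pmor (zero_mod ()) (zero_mod ()) (\<lambda>c x. ()) M N \<beta> (\<lambda>x. \<zero>\<^sub>M) (\<lambda>x. \<zero>\<^sub>N)"
  and "pmor M N \<beta> (zero_mod ()) (zero_mod ()) (\<lambda>c x. ()) (\<lambda>x. ()) (\<lambda>x. ())"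
  unfolding pmor_def using assms pairing_zero by (simp_all add: linear_def ahom_def)
qed

text \<open>An isomorphism is a short exact sequence with a zero module at one end, so invariance is
  a special case of \<open>good_cok\<close> and \<open>good_ker\<close>.\<close>

lemma good_iso:
 assumes mor: "pmor M N \<beta> M' N' \<beta>' f g"
  and bij: "bij_betw f (car M) (car M')" "bij_betw g (car N) (car N')"
 shows "good M N \<beta> \<longleftrightarrow> good M' N' \<beta>'"
proof -
 have p: "pairing M N \<beta>" "pairing M' N' \<beta>'" and fg: "f \<in> ahom M M'" "g \<in> ahom N N'"
  using mor by (auto simp: pmor_def linear_def)
 interpret M: lmod R M using pM[OF p(1)] by (simp add: lmod_iff)
 interpret N: lmod S N using pN[OF p(1)] by (simp add: lmod_iff)
 interpret M': lmod R M' using pM[OF p(2)] by (simp add: lmod_iff)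
 interpret N': lmod S N' using pN[OF p(2)] by (simp add: lmod_iff)
 note a = M.abg_axioms M'.abg_axioms N.abg_axioms N'.abg_axioms
 show ?thesis
  using good_cok[OF pmor_zero(1)[OF p(1)] mor gses_zero(1)[OF a(1,2) fg(1) bij(1)] gses_zero(1)[OF a(3,4) fg(2) bij(2)] good_zero]
   good_ker[OF mor pmor_zero(2)[OF p(2)] gses_zero(2)[OF a(1,2) fg(1) bij(1)] gses_zero(2)[OF a(3,4) fg(2) bij(2)] _ good_zero]
  by blast
qed

lemma pmor_post:
 assumes p: "pairing M N \<beta>" and N': "left_module S N'" and e: "e \<in> linear S N N'"
 shows "pmor M N \<beta> M N' (\<lambda>c x. e (\<beta> c x)) (\<lambda>x. x) e"
proof -
 have "(\<lambda>c. e (\<beta> c x)) \<in> linear S CL N'" if "x \<in> car M" for x by (rule linear_comp[OF \<beta>_linear[OF p that] e])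
 moreover have "(\<lambda>x. e (\<beta> c x)) \<in> ahom M N'" if "c \<in> car C" for c
  by (rule ahom_comp[OF \<beta>_ahom[OF p that]]) (use e in \<open>simp add: linear_def\<close>)
 ultimately show ?thesis using p N' e linear_id by (simp add: pmor_def pairing_def)
qed

lemma pmor_pre:
 assumes p: "pairing M' N \<beta>" and M: "left_module R M" and f: "f \<in> linear R M M'"
 shows "pmor M N (\<lambda>c x. \<beta> c (f x)) M' N \<beta> f (\<lambda>x. x)"
proof -
 have "(\<lambda>x. \<beta> c (f x)) \<in> ahom M N" if "c \<in> car C" for c
  by (rule ahom_comp[OF _ \<beta>_ahom[OF p that]]) (use f in \<open>simp add: linear_def\<close>)
 then show ?thesis using p M f linear_id linearD[OF f] by (simp add: pmor_def pairing_def)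
qed

lemma good_post:
 assumes g: "good M N \<beta>" and N': "left_module S N'" and e: "e \<in> lisos S N N'"
 shows "good M N' (\<lambda>c x. e (\<beta> c x))"
proof -
 have p: "pairing M N \<beta>" and el: "e \<in> lhom S N N'" and b: "bij_betw e (car N) (car N')"
  using g e by (simp_all add: good_def lisos_def)
 show ?thesis using good_iso[OF pmor_post[OF p N' lhom_linear[OF el]] bij_id b] g by (rule iffD1)
qed

lemma good_pre:
 assumes g: "good M' N \<beta>" and M: "left_module R M" and f: "f \<in> lisos R M M'"
 shows "good M N (\<lambda>c x. \<beta> c (f x))"
proof -
 have p: "pairing M' N \<beta>" and fl: "f \<in> lhom R M M'" and b: "bij_betw f (car M) (car M')"
  using g f by (simp_all add: good_def lisos_def)
 show ?thesis using good_iso[OF pmor_pre[OF p M lhom_linear[OF fl]] b bij_id] g by (rule iffD2)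
qed

text \<open>In a good pairing \<open>adjR\<close> is an isomorphism of \<open>M\<close> with
  \<open>hm N\<close>, and it carries the pairing to evaluation.\<close>

lemma good_Bas:
 assumes g: "good M N \<beta>" shows "Bas N"
proof -
 have p: "pairing M N \<beta>" using g by (simp add: good_def)
 note N = pN[OF p]
 have iso: "adjR M \<beta> \<in> lisos R M (hm N)" using g adjR_lisos_iff[OF p] unfolding good_def by blast
 have mor: "pmor M N \<beta> (hm N) N (\<lambda>c f. f c) (adjR M \<beta>) (\<lambda>x. x)"
  unfolding pmor_def using p pairing_hm[OF N] lhom_linear[OF adjR_lhom[OF p]] linear_id by (auto simp: adjR_def)
 have "good (hm N) N (\<lambda>c f. f c)"
  using iffD1[OF good_iso[OF mor _ bij_id] g] iso by (simp add: lisos_def)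
 then show ?thesis using N by (simp add: Bas_def)
qed

text \<open>Likewise \<open>adjL\<close> identifies \<open>tm M\<close> with \<open>N\<close> and
  the universal pairing with the given one.\<close>

lemma good_Aus:
 assumes g: "good M N \<beta>" shows "Aus M"
proof -
 have p: "pairing M N \<beta>" using g by (simp add: good_def)
 note M = pM[OF p]
 have iso: "adjL M N \<beta> \<in> lisos S (tm M) N" using g adjL_lisos_iff[OF p] unfolding good_def by blast
 have mor: "pmor M (tm M) (pt R CR M) M N \<beta> (\<lambda>x. x) (adjL M N \<beta>)"
  unfolding pmor_def using p pairing_tm[OF M] lhom_linear[OF adjL_lhom[OF p]] linear_id adjL_pt[OF p] by auto
 have "good M (tm M) (pt R CR M)"
  using iffD2[OF good_iso[OF mor bij_id] g] iso by (simp add: lisos_def)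
 then show ?thesis using M by (simp add: Aus_def)
qed

text \<open>A good pairing puts its first module into the Auslander class and its second into the
  Bass class at the same time.\<close>

lemma Aus_tm: "Aus M \<Longrightarrow> Bas (tm M)"
 unfolding Aus_def using good_Bas by blast

lemma Bas_hm: "Bas N \<Longrightarrow> Aus (hm N)"
 unfolding Bas_def using good_Aus by blast

lemma Aus_iso:
 assumes A: "Aus M" and M': "left_module R M'" and iso: "isomorphic R M M'"
 shows "Aus M'"
proof -
 have M: "left_module R M" and g: "good M (tm M) (pt R CR M)" using A by (simp_all add: Aus_def)
 obtain f where f: "f \<in> lisos R M' M" using isomorphic_sym[OF M M' iso] by (auto simp: isomorphic_def)
 show ?thesis by (rule good_Aus[OF good_pre[OF g M' f]])
qed

lemma Bas_iso:
 assumes B: "Bas N" and N': "left_module S N'" and iso: "isomorphic S N N'"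
 shows "Bas N'"
proof -
 have g: "good (hm N) N (\<lambda>c f. f c)" using B by (simp add: Bas_def)
 obtain f where f: "f \<in> lisos S N N'" using iso by (auto simp: isomorphic_def)
 show ?thesis by (rule good_Bas[OF good_post[OF g N' f]])
qed

end

section \<open>Exactness of the two functors on the two classes\<close>

context semid
begin

definition hmap :: "('n \<Rightarrow> 'n1) \<Rightarrow> ('c \<Rightarrow> 'n) \<Rightarrow> 'c \<Rightarrow> 'n1" where
 "hmap f = (\<lambda>h. compose (car C) f h)"

definition tmap :: "('r, 'm1) module \<Rightarrow> ('m \<Rightarrow> 'm1) \<Rightarrow> ('c \<times> 'm \<Rightarrow>\<^sub>0 int) set \<Rightarrow> ('c \<times> 'm1 \<Rightarrow>\<^sub>0 int) set" where
 "tmap M' f = tensor_map R CR M' (\<lambda>c. c) f"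

lemma hmap_linear:
 assumes N: "left_module S N" "left_module S N'" and f: "f \<in> lhom S N N'"
 shows "hmap f \<in> linear R (hm N) (hm N')"
proof -
 have cl: "hmap f h \<in> lhom S CL N'" if "h \<in> lhom S CL N" for h
  using lhom_compose[OF CL that f] by (simp add: hmap_def)
 show ?thesis
  using cl hom_closed[OF N(1)] linearD[OF lhom_linear[OF f]]
  by (auto simp: linear_def ahom_def hmap_def compose_def intro!: restrict_ext)
qed

lemma hmap_eq [simp]: "c \<in> car C \<Longrightarrow> hmap f h c = f (h c)"
 by (simp add: hmap_def compose_eq)

lemma tmap_linear:
 assumes M: "left_module R M" "left_module R M'" and f: "f \<in> linear R M M'"
 shows "tmap M' f \<in> linear S (tm M) (tm M')"
proof -
 interpret X: tens_ctx R CR M by (rule tens_ctxI[OF CR M(1)])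
 interpret X': tens_ctx R CR M' by (rule tens_ctxI[OF CR M(2)])
 have a: "tmap M' f \<in> ahom (tens R CR M) (tens R CR M')"
  unfolding tmap_def by (rule tmap_ahom[OF CR CR M linear_id f])
 note p = tmap_pure[OF CR CR M linear_id f]
 have "tmap M' f (tmapl R CR M (\<lambda>c. s \<odot>\<^sub>C c) t) =
   tmapl R CR M' (\<lambda>c. s \<odot>\<^sub>C c) (tmap M' f t)"
  if s: "s \<in> car S" and t: "t \<in> car (tens R CR M)" for s t
  by (rule X.tens_eqI[OF X'.abg_tens ahom_comp[OF tens_smult_ahom[OF M(1) s] a]
     ahom_comp[OF a tens_smult_ahom[OF M(2) s]] _ t])
   (use s p linearD(1)[OF f] in \<open>simp add: tmap_def tens_smult_pure[OF M(1)] tens_smult_pure[OF M(2)]\<close>)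
 then show ?thesis using a by (simp add: linear_def ahom_def)
qed

lemma tmap_pt:
 assumes "left_module R M" "left_module R M'" "f \<in> linear R M M'" "c \<in> car C" "x \<in> car M"
 shows "tmap M' f (pt R CR M c x) = pt R CR M' c (f x)"
 unfolding tmap_def by (rule tmap_pure[OF CR CR assms(1,2) linear_id assms(3)]) (use assms in auto)

lemma tmap_gam:
 assumes "left_module R M" "left_module R M'" "f \<in> linear R M M'" "v \<in> car (mpow (l 0) M)"
 shows "tmap M' f (T.gam M v) = T.gam M' (pm (l 0) f v)"
 unfolding tmap_def by (rule T.tensor_map_gam[OF assms])

lemma pmor_hm:
 assumes "left_module S N" "left_module S N'" "f \<in> lhom S N N'"
 shows "pmor (hm N) N (\<lambda>c f. f c) (hm N') N' (\<lambda>c f. f c) (hmap f) f"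
 unfolding pmor_def
 using pairing_hm[OF assms(1)] pairing_hm[OF assms(2)] hmap_linear[OF assms] lhom_linear[OF assms(3)] by simp

lemma pmor_tm:
 assumes "left_module R M" "left_module R M'" "f \<in> lhom R M M'"
 shows "pmor M (tm M) (pt R CR M) M' (tm M') (pt R CR M') f (tmap M' f)"
 unfolding pmor_def
 using pairing_tm[OF assms(1)] pairing_tm[OF assms(2)] tmap_linear[OF assms(1,2) lhom_linear[OF assms(3)]]
  tmap_pt[OF assms(1,2) lhom_linear[OF assms(3)]] lhom_linear[OF assms(3)] by simp

text \<open>Left exactness of \<open>Hom(C, -)\<close>. Surjectivity stays a hypothesis, to be met
  either from the vanishing of Ext or from faithfulness.\<close>

lemma hom_gses:
 assumes ses: "ses S A B Z f g"
  and lift: "\<And>h. h \<in> lhom S CL Z \<Longrightarrow> \<exists>h' \<in> lhom S CL B. hmap g h' = h"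
 shows "gses (hm A) (hm B) (hm Z) (hmap f) (hmap g)"
proof -
 interpret E: sesm S A B Z f g using ses by (simp add: ses_iff)
 note A = E.f.A.left_module and B = E.f.B.left_module and Z = E.g.B.left_module
 interpret HA: lmod R "hm A" using lm_hm[OF A] by (simp add: lmod_iff)
 interpret HB: lmod R "hm B" using lm_hm[OF B] by (simp add: lmod_iff)
 interpret HZ: lmod R "hm Z" using lm_hm[OF Z] by (simp add: lmod_iff)
 show ?thesis
  unfolding gses_def
 proof (intro conjI ballI impI)
  show "hmap f \<in> ahom (hm A) (hm B)" "hmap g \<in> ahom (hm B) (hm Z)"
   using hmap_linear[OF A B E.f.lhom] hmap_linear[OF B Z E.g.lhom] by (auto simp: linear_def)
  show "h = \<zero>\<^bsub>hm A\<^esub>" if h: "h \<in> car (hm A)" "hmap f h = \<zero>\<^bsub>hm B\<^esub>" for h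
  proof -
   have hz: "h c = \<zero>\<^sub>A" if c: "c \<in> car C" for c
   proof -
    have "f (h c) = \<zero>\<^sub>B" using fun_cong[OF h(2), of c] c by simp
    then show ?thesis using E.f_zero_iff[of "h c"] hom_closed[OF A] h(1) c by auto
   qed
   show ?thesis
    by (rule extensionalityI[of _ "car C"]) (use h(1) hz in \<open>auto simp: lhom_def PiE_def\<close>)
  qed
  show "\<exists>h' \<in> car (hm B). hmap g h' = h" if "h \<in> car (hm Z)" for h
   using lift[of h] that by simp
  show "hmap g (hmap f h) = \<zero>\<^bsub>hm Z\<^esub>" if "h \<in> car (hm A)" for h
   using that hom_closed[OF A, of h] by (auto simp: hmap_def compose_def intro!: restrict_ext)
  show "\<exists>h' \<in> car (hm A). hmap f h' = h" if h: "h \<in> car (hm B)" "hmap g h = \<zero>\<^bsub>hm Z\<^esub>" for h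
  proof -
   have hl: "h \<in> lhom S CL B" using h by simp
   have "h c \<in> f ` car A" if c: "c \<in> car CL" for c
   proof -
    have "g (h c) = \<zero>\<^sub>Z" using fun_cong[OF h(2), of c] c by simp
    then show ?thesis using E.exact lhom_closed[OF hl c] by (simp add: lker_def)
   qed
   then obtain h' where h': "h' \<in> lhom S CL A" "\<And>c. c \<in> car CL \<Longrightarrow> f (h' c) = h c"
    using lhom_lift_inj[OF CL A B E.f.lhom E.inj hl] by blast
   have "hmap f h' = h"
    by (rule extensionalityI[of _ "car C"]) (use h'(2) hl in \<open>auto simp: lhom_def PiE_def hmap_def compose_def\<close>)
   then show ?thesis using h'(1) by auto
  qed
 qed (rule HA.abg_axioms HB.abg_axioms HZ.abg_axioms)+
qed

text \<open>Right exactness of \<open>C \<otimes> -\<close>, chased through representatives of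
  tensors in powers of the modules. Injectivity stays a hypothesis, to be met either from the
  vanishing of Tor or from faithfulness.\<close>

lemma tens_gses:
 assumes ses: "ses R A B Z f g"
  and inj: "\<And>t. t \<in> car (tm A) \<Longrightarrow> tmap B f t = \<zero>\<^bsub>tm B\<^esub> \<Longrightarrow> t = \<zero>\<^bsub>tm A\<^esub>"
 shows "gses (tm A) (tm B) (tm Z) (tmap B f) (tmap Z g)"
proof -
 interpret E: sesm R A B Z f g using ses by (simp add: ses_iff)
 note A = E.f.A.left_module and B = E.f.B.left_module and Z = E.g.B.left_module
 interpret HA: lmod S "tm A" using lm_tm[OF A] by (simp add: lmod_iff)
 interpret HB: lmod S "tm B" using lm_tm[OF B] by (simp add: lmod_iff)
 interpret HZ: lmod S "tm Z" using lm_tm[OF Z] by (simp add: lmod_iff)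
 note fl = lhom_linear[OF E.f.lhom] and gl = lhom_linear[OF E.g.lhom]
 have fa: "tmap B f \<in> ahom (tm A) (tm B)" and ga: "tmap Z g \<in> ahom (tm B) (tm Z)"
  using tmap_linear[OF A B fl] tmap_linear[OF B Z gl] by (auto simp: linear_def)
 have gam: "T.gam M \<in> ahom (mpow (l 0) M) (tm M)" if "left_module R M" for M :: "('r, 'x) module"
  using T.gam_ahom[OF that] by (simp add: ahom_def)
 interpret P: gsesl "mpow k A" "mpow k B" "mpow k Z" "pm k f" "pm k g" for k
  using gses_pow[OF ses_gses[OF ses]] by (simp add: gses_iff)
 interpret gB: ahm "mpow (l 0) B" "tm B" "T.gam B"
  by (rule ahmI[OF P.f.B.abg_axioms HB.abg_axioms gam[OF B]])
 interpret gZ: ahm "mpow (l 0) Z" "tm Z" "T.gam Z"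
  by (rule ahmI[OF P.g.B.abg_axioms HZ.abg_axioms gam[OF Z]])
 show ?thesis
  unfolding gses_def
 proof (intro conjI ballI impI)
  fix t assume "t \<in> car (tm Z)"
  then obtain v where v: "v \<in> car (mpow (l 0) Z)" "T.gam Z v = t" using T.gam_surj[OF Z] by auto
  obtain w where w: "w \<in> car (mpow (l 0) B)" "pm (l 0) g w = v" using P.onto[OF v(1)] by blast
  show "\<exists>y \<in> car (tm B). tmap Z g y = t"
   by (rule bexI[OF _ gB.closed[OF w(1)]]) (simp add: tmap_gam[OF B Z gl w(1)] w v)
 next
  fix t assume "t \<in> car (tm A)"
  then obtain v where v: "v \<in> car (mpow (l 0) A)" "T.gam A v = t" using T.gam_surj[OF A] by auto
  have "tmap Z g (tmap B f t) = T.gam Z (pm (l 0) g (pm (l 0) f v))"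
   using tmap_gam[OF A B fl v(1)] tmap_gam[OF B Z gl P.f.closed[OF v(1)]] v(2) by simp
  then show "tmap Z g (tmap B f t) = \<zero>\<^bsub>tm Z\<^esub>" using P.gf[OF v(1)] gZ.zero by simp
 next
  fix t assume "t \<in> car (tm B)" and z: "tmap Z g t = \<zero>\<^bsub>tm Z\<^esub>"
  then obtain v where v: "v \<in> car (mpow (l 0) B)" "T.gam B v = t" using T.gam_surj[OF B] by auto
  have "T.gam Z (pm (l 0) g v) = \<zero>\<^bsub>tens R CR Z\<^esub>" using z tmap_gam[OF B Z gl v(1)] v(2) by simp
  then obtain y where y: "y \<in> car (mpow (l (Suc 0)) Z)" "pm (l 0) g v = T.bnd Z 0 y"
   using T.gam_zero_iff[OF Z P.g.closed[OF v(1)]] by blast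
  \<comment> \<open>The boundary that explains why the tensor dies over \<open>Z\<close> is lifted
    to \<open>B\<close>. Subtracting it from \<open>v\<close> leaves the tensor unchanged and moves
    the representative into the image of the power of \<open>A\<close>.\<close>
  obtain w where w: "w \<in> car (mpow (l (Suc 0)) B)" "pm (l (Suc 0)) g w = y" using P.onto[OF y(1)] by blast
  have bw: "T.bnd B 0 w \<in> car (mpow (l 0) B)" by (rule bnd_closed[OF B w(1)])
  have vw: "v \<ominus>\<^bsub>mpow (l 0) B\<^esub> T.bnd B 0 w \<in> car (mpow (l 0) B)" using v bw by simp
  have "pm (l 0) g (v \<ominus>\<^bsub>mpow (l 0) B\<^esub> T.bnd B 0 w) = \<zero>\<^bsub>mpow (l 0) Z\<^esub>"
   using v w y bw T.pm_bnd[OF B Z gl w(1)] bnd_closed[OF Z y(1)] by simp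
  then obtain u where u: "u \<in> car (mpow (l 0) A)" "pm (l 0) f u = v \<ominus>\<^bsub>mpow (l 0) B\<^esub> T.bnd B 0 w"
   using P.ex[OF vw] by blast
  have "T.gam B (T.bnd B 0 w) = \<zero>\<^bsub>tm B\<^esub>" using T.gam_zero_iff[OF B bw] w(1) by auto
  then have "tmap B f (T.gam A u) = t"
   using tmap_gam[OF A B fl u(1)] u(2) gB.diff[OF v(1) bw] v gB.closed[OF v(1)] HB.diff_zero by simp
  moreover have "T.gam A u \<in> car (tm A)" using gam[OF A] u(1) by (simp add: ahom_def)
  ultimately show "\<exists>x \<in> car (tm A). tmap B f x = t" by blast
 qed (use inj fa ga HA.abg_axioms HB.abg_axioms HZ.abg_axioms in blast)+
qed

text \<open>A homomorphism from \<open>C\<close> to \<open>Z\<close> is a vector over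
  \<open>Z\<close> killed by the first coboundary. As Ext^1(C, A) vanishes,
  \<open>chase_lift\<close> lifts it to a vector over \<open>B\<close> with the same property, that
  is, to a homomorphism into \<open>B\<close>.\<close>

lemma Bas_hom_gses:
 assumes ses: "ses S A B Z f g" and A: "Bas A"
 shows "gses (hm A) (hm B) (hm Z) (hmap f) (hmap g)"
proof -
 interpret E: sesm S A B Z f g using ses by (simp add: ses_iff)
 note mA = E.f.A.left_module and mB = E.f.B.left_module and mZ = E.g.B.left_module
 note fl = lhom_linear[OF E.f.lhom] and gl = lhom_linear[OF E.g.lhom]
 note cob = sq_cob[OF mA mB mZ fl gl ses_gses[OF ses]]
 have A2: "uex (hm A) A (\<lambda>c f. f c) (Suc (Suc 0))" using A unfolding Bas_def good_def by blast
 have "\<exists>h' \<in> lhom S CL B. hmap g h' = h" if h: "h \<in> lhom S CL Z" for h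
 proof -
  let ?z = "\<lambda>k \<in> {..<m 0}. h (L.cvec k)"
  have z: "?z \<in> car (mpow (m 0) Z)" using lhom_closed[OF h] L.cvec_closed by auto
  have "\<exists>y \<in> car (mpow (m 0) B). pm (m 0) g y = ?z \<and> L.cob B 0 y = \<zero>\<^bsub>mpow (m (Suc 0)) B\<^esub>"
   by (rule chase_lift[OF cob cob, OF _ A2[unfolded ex_iff] z L.cob_hom_zero[OF mZ h]]) (rule L.cob_cob[OF mB])
  then obtain y where y: "y \<in> car (mpow (m 0) B)" "pm (m 0) g y = ?z"
   "L.cob B 0 y = \<zero>\<^bsub>mpow (m (Suc 0)) B\<^esub>" by blast
  obtain h' where h': "h' \<in> lhom S CL B" "\<forall>k < m 0. h' (L.cvec k) = y k"
   using L.lhom_exists[OF mB y(1,3)] by blast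
  have "compose (car CL) g h' = h"
  proof (rule L.lhom_gens_eqI[OF mZ lhom_compose[OF CL h'(1) E.g.lhom] h])
   show "compose (car CL) g h' (L.cvec k) = h (L.cvec k)" if "k < m 0" for k
    using fun_cong[OF y(2), of k] that h'(2) L.cvec_closed[of k] by (simp add: compose_eq)
  qed
  then show ?thesis using h'(1) by (auto simp: hmap_def)
 qed
 then show ?thesis by (rule hom_gses[OF ses])
qed

lemma Bas_cok:
 assumes ses: "ses S A B Z f g" and A: "Bas A" and B: "Bas B"
 shows "Bas Z"
proof -
 interpret E: sesm S A B Z f g using ses by (simp add: ses_iff)
 note mA = E.f.A.left_module and mB = E.f.B.left_module and mZ = E.g.B.left_module
 have "good (hm Z) Z (\<lambda>c f. f c)"
  by (rule good_cok[OF pmor_hm[OF mA mB E.f.lhom] pmor_hm[OF mB mZ E.g.lhom] Bas_hom_gses[OF ses A] ses_gses[OF ses]])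
   (use A B in \<open>auto simp: Bas_def\<close>)
 then show ?thesis by (rule good_Bas)
qed

text \<open>If \<open>t\<close> dies over \<open>B\<close>, a representative of it becomes a
  boundary there. As Tor_1(C, Z) vanishes, \<open>chase_drop\<close> shows that it is a boundary
  over \<open>A\<close> already, so \<open>t\<close> is zero.\<close>

lemma Aus_tmap_inj:
 assumes ses: "ses R A B Z f g" and Z: "Aus Z" and t: "t \<in> car (tm A)" "tmap B f t = \<zero>\<^bsub>tm B\<^esub>"
 shows "t = \<zero>\<^bsub>tm A\<^esub>"
proof -
 interpret E: sesm R A B Z f g using ses by (simp add: ses_iff)
 note mA = E.f.A.left_module and mB = E.f.B.left_module and mZ = E.g.B.left_module
 note fl = lhom_linear[OF E.f.lhom] and gl = lhom_linear[OF E.g.lhom]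
 note bnd = sq_bnd[OF mA mB mZ fl gl ses_gses[OF ses]]
 interpret P: gsesl "mpow (l 0) A" "mpow (l 0) B" "mpow (l 0) Z" "pm (l 0) f" "pm (l 0) g"
  using gses_pow[OF ses_gses[OF ses]] by (simp add: gses_iff)
 have Z2: "tex Z (tm Z) (pt R CR Z) (Suc (Suc 0))" using Z unfolding Aus_def good_def by blast
 obtain v where v: "v \<in> car (mpow (l 0) A)" "T.gam A v = t" using T.gam_surj[OF mA] t(1) by auto
 have "T.gam B (pm (l 0) f v) = \<zero>\<^bsub>tens R CR B\<^esub>" using t(2) tmap_gam[OF mA mB fl v(1)] v(2) by simp
 then obtain w where w: "w \<in> car (mpow (l (Suc 0)) B)" "pm (l 0) f v = T.bnd B 0 w"
  using T.gam_zero_iff[OF mB P.f.closed[OF v(1)]] by blast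
 have "\<exists>u \<in> car (mpow (l (Suc 0)) A). T.bnd A 0 u = v"
  by (rule chase_drop[OF bnd bnd, OF _ Z2[unfolded ex_iff] v(1) w]) (rule T.bnd_bnd[OF mB])
 then show ?thesis using T.gam_zero_iff[OF mA v(1)] v(2) by auto
qed

lemma Aus_ker:
 assumes ses: "ses R A B Z f g" and B: "Aus B" and Z: "Aus Z"
 shows "Aus A"
proof -
 interpret E: sesm R A B Z f g using ses by (simp add: ses_iff)
 note mA = E.f.A.left_module and mB = E.f.B.left_module and mZ = E.g.B.left_module
 have H: "gses (tm A) (tm B) (tm Z) (tmap B f) (tmap Z g)" by (rule tens_gses[OF ses Aus_tmap_inj[OF ses Z]])
 have "good A (tm A) (pt R CR A)"
  by (rule good_ker[OF pmor_tm[OF mA mB E.f.lhom] pmor_tm[OF mB mZ E.g.lhom] ses_gses[OF ses] H])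
   (use B Z in \<open>auto simp: Aus_def\<close>)
 then show ?thesis by (rule good_Aus)
qed

end

section \<open>Consequences of faithfulness\<close>

locale faithful_semid = semid S R C m pL dL l pR dR
 for S :: "'s ring" and R :: "'r ring" and C :: "('s, 'r, 'c) bimodule" and m pL dL and l pR dR +
 assumes inf: "infinite (UNIV :: 'c set)" and R_small: "car R \<lesssim> (UNIV :: 'c set)"
  and S_small: "car S \<lesssim> (UNIV :: 'c set)"
  and faithful_L: "\<And>N :: ('s, 'c) module. left_module S N \<Longrightarrow> trivial_group (hom_group S CL N) \<Longrightarrow> car N = {\<zero>\<^sub>N}"
  and faithful_R: "\<And>M :: ('r, 'c) module. left_module (op_ring R) M \<Longrightarrow> trivial_group (hom_group (op_ring R) CR M) \<Longrightarrow>
   car M = {\<zero>\<^sub>M}"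
begin

text \<open>Faithfulness is a statement about modules over the type of \<open>C\<close>. A module
  over another type, small enough to be copied there, is tested through its copy.\<close>

lemma hom_copy_trivial:
 fixes Q :: "'q ring" and P :: "('q, 'c) module" and N :: "('q, 'n) module"
 assumes P: "left_module Q P" and N: "left_module Q N" "car N \<lesssim> (UNIV :: 'c set)"
  and z: "\<And>h. h \<in> lhom Q P N \<Longrightarrow> h = (\<lambda>x \<in> car P. \<zero>\<^sub>N)"
 shows "trivial_group (hom_group Q P (copy N :: ('q, 'c) module))"
proof -
 let ?N = "copy N :: ('q, 'c) module"
 have cN: "left_module Q ?N" by (rule lm_copy[OF N])
 obtain e where e: "e \<in> lisos Q ?N N"
  using isomorphic_sym[OF N(1) cN isomorphic_copy[OF N]] by (auto simp: isomorphic_def)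
 interpret e: lhm Q ?N N e using e by (intro lhmI cN N) (simp add: lisos_def)
 have inj: "inj_on e (car ?N)" using e by (simp add: lisos_def bij_betw_def)
 have "h = (\<lambda>x \<in> car P. \<zero>\<^sub>?N)" if h: "h \<in> lhom Q P ?N" for h
 proof (rule lhom_eqI[OF h lhom_zero[OF P cN]])
  fix x assume x: "x \<in> car P"
  have "compose (car P) e h = (\<lambda>x \<in> car P. \<zero>\<^sub>N)"
   by (rule z[OF lhom_compose[OF P h e.lhom]])
  then have "e (h x) = \<zero>\<^sub>N" using x by (metis compose_eq restrict_apply')
  then show "h x = (\<lambda>x \<in> car P. \<zero>\<^sub>?N) x"
   using e.inj_on_zeroD[OF inj lhom_closed[OF h x]] x by simp
 qed
 then have "car (hom_group Q P ?N) = {\<one>\<^bsub>hom_group Q P ?N\<^esub>}"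
  using lhom_zero[OF P cN] unfolding hom_group_simps(1,2) by blast
 then show ?thesis using comm_group_hom_group[OF P cN] by (simp add: trivial_group_def comm_group_def)
qed

lemma copy_trivial:
 fixes Q :: "'q ring" and N :: "('q, 'n) module"
 assumes "left_module Q N" "car N \<lesssim> (UNIV :: 'c set)"
  and "car (copy N :: ('q, 'c) module) = {\<zero>\<^bsub>(copy N :: ('q, 'c) module)\<^esub>}"
 shows "car N = {\<zero>\<^sub>N}"
proof -
 interpret N: lmod Q N using assms(1) by (simp add: lmod_iff)
 have "code N x = (code N \<zero>\<^sub>N :: 'c)" if "x \<in> car N" for x using assms(3) that by auto
 then have "x = \<zero>\<^sub>N" if "x \<in> car N" for x
  using inj_onD[OF inj_code[OF assms(2)] _ that N.zero_closed] that by blast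
 then show ?thesis using N.zero_closed by blast
qed

lemma hom_zero_imp_zero_L:
 assumes N: "left_module S N" "car N \<lesssim> (UNIV :: 'c set)"
  and z: "\<And>h. h \<in> lhom S CL N \<Longrightarrow> h = (\<lambda>x \<in> car CL. \<zero>\<^sub>N)"
 shows "car N = {\<zero>\<^sub>N}"
 by (rule copy_trivial[OF N faithful_L[OF lm_copy[OF N] hom_copy_trivial[OF CL N z]]])

lemma hom_zero_imp_zero_R:
 assumes N: "left_module (op_ring R) N" "car N \<lesssim> (UNIV :: 'c set)"
  and z: "\<And>h. h \<in> lhom (op_ring R) CR N \<Longrightarrow> h = (\<lambda>x \<in> car CR. \<zero>\<^sub>N)"
 shows "car N = {\<zero>\<^sub>N}"
 by (rule copy_trivial[OF N faithful_R[OF lm_copy[OF N] hom_copy_trivial[OF CR N z]]])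

text \<open>\<open>C\<close> has finitely many generators as a right module, so
  \<open>C \<otimes> M\<close> is an image of a finite power of \<open>M\<close>.\<close>

lemma tm_small:
 assumes M: "left_module R M" "car M \<lesssim> (UNIV :: 'c set)"
 shows "car (tm M) \<lesssim> (UNIV :: 'c set)"
proof -
 have "car (tm M) \<subseteq> T.gam M ` car (mpow (l 0) M)"
  using T.gam_surj[OF M(1)] by (auto simp: image_iff)
 then have "car (tm M) \<lesssim> car (mpow (l 0) M)" by (rule subset_image_lepoll)
 then show ?thesis
  using PiE_lessThan_lepoll[OF inf M(2)] unfolding carrier_pow by (rule lepoll_trans)
qed

text \<open>A homomorphism on \<open>C\<close> is determined by its values at finitely many
  generators.\<close>

lemma hm_small:
 assumes N: "left_module S N" "car N \<lesssim> (UNIV :: 'c set)"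
 shows "car (hm N) \<lesssim> (UNIV :: 'c set)"
proof -
 let ?e = "\<lambda>h. \<lambda>k \<in> {..<m 0}. h (L.cvec k)"
 have "inj_on ?e (car (hm N))"
 proof (rule inj_onI)
  fix h h' assume "h \<in> car (hm N)" "h' \<in> car (hm N)" and eq: "?e h = ?e h'"
  then have "h \<in> lhom S CL N" "h' \<in> lhom S CL N" by auto
  then show "h = h'"
   by (rule L.lhom_gens_eqI[OF N(1)]) (use fun_cong[OF eq] in \<open>metis lessThan_iff restrict_apply'\<close>)
 qed
 moreover have "?e ` car (hm N) \<subseteq> car (mpow (m 0) N)"
  using lhom_closed[of _ S CL N] L.cvec_closed by auto
 ultimately have "car (hm N) \<lesssim> car (mpow (m 0) N)" unfolding lepoll_def by blast
 then show ?thesis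
  using PiE_lessThan_lepoll[OF inf N(2)] unfolding carrier_pow by (rule lepoll_trans)
qed

text \<open>Let \<open>K\<close> be the kernel of
  \<open>C \<otimes> A \<rightarrow> C \<otimes> B\<close>. A homomorphism from \<open>C\<close> to
  \<open>K\<close> has the form \<open>c \<mapsto> c \<otimes> x\<close> with \<open>x\<close> in
  \<open>A\<close>, since the unit of \<open>A\<close> is onto; then the unit of \<open>B\<close>
  kills \<open>f x\<close>, so \<open>x = 0\<close>. Thus \<open>Hom(C, K) = 0\<close>, and
  faithfulness gives \<open>K = 0\<close>: tensoring keeps the sequence exact.\<close>

lemma Aus_cok:
 assumes ses: "ses R A B Z f g" and A: "Aus A" and B: "Aus B" and small: "car A \<lesssim> (UNIV :: 'c set)"
 shows "Aus Z"
proof -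
 interpret E: sesm R A B Z f g using ses by (simp add: ses_iff)
 note mA = E.f.A.left_module and mB = E.f.B.left_module and mZ = E.g.B.left_module
 note fl = lhom_linear[OF E.f.lhom]
 have tf: "tmap B f \<in> linear S (tm A) (tm B)" by (rule tmap_linear[OF mA mB fl])
 let ?f = "restrict (tmap B f) (car (tm A))"
 have tfl: "?f \<in> lhom S (tm A) (tm B)"
  by (rule restrict_lhomI[OF lm_tm[OF mA]]) (use linearD[OF tf] in auto)
 interpret tf: lhm S "tm A" "tm B" ?f by (intro lhmI lm_tm mA mB tfl)
 let ?K = "ker_mod (tm A) (tm B) ?f"
 have gA: "uex A (tm A) (pt R CR A) (Suc 0)" and gB: "uex B (tm B) (pt R CR B) 0"
  using A B by (auto simp: Aus_def good_def simp del: uex.simps)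
 have "car ?K = {\<zero>\<^sub>?K}"
 proof (rule hom_zero_imp_zero_L[OF tf.lm_ker])
  have "car ?K \<subseteq> car (tm A)" by (auto simp: lker_def)
  then show "car ?K \<lesssim> (UNIV :: 'c set)" using tm_small[OF mA small] lepoll_trans subset_imp_lepoll by blast
  fix h assume h: "h \<in> lhom S CL ?K"
  have hA: "h \<in> lhom S CL (tm A)" by (rule lhom_submodule_mono[OF h]) (auto simp: lker_def)
  then have "h \<in> adjR A (pt R CR A) ` car A"
   using adjR_surj_iff[OF pairing_tm[OF mA]] gA by simp
  then obtain x where x: "x \<in> car A" "h = adjR A (pt R CR A) x" by auto
  have hx: "h c = pt R CR A c x" if "c \<in> car C" for c using that x by (simp add: adjR_def)
  interpret X: tens_ctx R CR A by (rule tens_ctxI[OF CR mA])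
  have z: "pt R CR B c (f x) = \<zero>\<^bsub>tm B\<^esub>" if c: "c \<in> car C" for c
  proof -
   have "h c \<in> car ?K" using lhom_closed[OF h] c by simp
   then show ?thesis using hx[OF c] tmap_pt[OF mA mB fl c x(1)] X.pt_closed[of c x] c x(1) by (simp add: lker_def)
  qed
  have "bU (pt R CR B) (f x) = \<zero>\<^bsub>mpow (m 0) (tm B)\<^esub>"
   using z cvec_C[OF pairing_tm[OF mB]] by (auto simp: bU_def zero_pow intro!: restrict_ext)
  then have "f x = \<zero>\<^sub>B" using gB E.f.closed[OF x(1)] by simp
  then have x0: "x = \<zero>\<^sub>A" using E.f_zero_iff[OF x(1)] by simp
  have "h c = \<zero>\<^bsub>tens R CR A\<^esub>" if "c \<in> car C" for c
   using hx[OF that] ahm.zero[OF X.pt_r_ahm, of c] that x0 by simp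
  then show "h = (\<lambda>x \<in> car CL. \<zero>\<^sub>?K)"
   by (intro lhom_eqI[OF h lhom_zero[OF CL tf.lm_ker]]) simp
 qed
 then have inj: "t = \<zero>\<^bsub>tm A\<^esub>" if "t \<in> car (tm A)" "tmap B f t = \<zero>\<^bsub>tm B\<^esub>" for t
  using that by (auto simp: lker_def)
 have H: "gses (tm A) (tm B) (tm Z) (tmap B f) (tmap Z g)" by (rule tens_gses[OF ses inj])
 have "good Z (tm Z) (pt R CR Z)"
  by (rule good_cok[OF pmor_tm[OF mA mB E.f.lhom] pmor_tm[OF mB mZ E.g.lhom] ses_gses[OF ses] H])
   (use A B in \<open>auto simp: Aus_def\<close>)
 then show ?thesis by (rule good_Aus)
qed

text \<open>The image \<open>I\<close> of \<open>g\<close> is all of \<open>P\<close> because \<open>R/J\<close> vanishes, where \<open>J\<close> is the ideal of all \<open>r\<close> with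
 \<open>r P \<subseteq> I\<close>: an \<open>R\<close>-linear map from \<open>C\<close> to the right module \<open>R/J\<close> induces a map from \<open>C \<otimes> P\<close> to \<open>P/I\<close>
 that vanishes on the image of \<open>C \<otimes> Q\<close>. Here \<open>R/J\<close> is realised as a set of maps from \<open>P\<close> to \<open>P/I\<close>.\<close>

lemma tmap_surj_imp_surj:
 assumes Q: "left_module R Q" and P: "left_module R P" and g: "g \<in> linear R Q P"
  and surj: "\<And>t. t \<in> car (tm P) \<Longrightarrow> \<exists>t' \<in> car (tm Q). tmap P g t' = t" and x: "x \<in> car P"
 shows "\<exists>y \<in> car Q. g y = x"
proof -
 interpret Q: lmod R Q using Q by (simp add: lmod_iff)
 interpret P: lmod R P using P by (simp add: lmod_iff)
 interpret R: ring R by (rule P.ring)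
 interpret RR: abg R by (rule abg.intro) (rule R.is_abelian_group)
 interpret g: ahm Q P g using g by (intro ahmI Q.abg_axioms P.abg_axioms) (simp add: linear_def)
 let ?G = "quot P (g ` car Q)"
 obtain \<pi> where G: "abg ?G" and \<pi>: "\<pi> \<in> ahom P ?G"
  and \<pi>0: "\<And>x. x \<in> car P \<Longrightarrow> \<pi> x = \<zero>\<^sub>?G \<longleftrightarrow> x \<in> g ` car Q"
  using quot_projection[OF P.abg_axioms Q.abg_axioms g.ahom] by blast
 interpret G: abg ?G by (rule G)
 interpret \<pi>: ahm P ?G \<pi> by (rule ahmI[OF P.abg_axioms G \<pi>])
 define \<phi> where "\<phi> r = (\<lambda>p \<in> car P. \<pi> (r \<odot>\<^sub>P p))" for r
 define E :: "('r, 'b \<Rightarrow> 'b set) module" where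
  "E = \<lparr>carrier = \<phi> ` car R, monoid.mult = undefined, one = undefined, ring.zero = \<phi> \<zero>\<^sub>R,
   add = (\<lambda>u v. \<lambda>p \<in> car P. u p \<oplus>\<^sub>?G v p), smult = (\<lambda>s u. \<lambda>p \<in> car P. u (s \<odot>\<^sub>P p))\<rparr>"
 have E: "car E = \<phi> ` car R" "\<zero>\<^sub>E = \<phi> \<zero>\<^sub>R"
  "u \<oplus>\<^sub>E v = (\<lambda>p \<in> car P. u p \<oplus>\<^sub>?G v p)" "s \<odot>\<^sub>E u = (\<lambda>p \<in> car P. u (s \<odot>\<^sub>P p))" for u v s
  by (simp_all add: E_def)
 have add: "\<phi> r \<oplus>\<^sub>E \<phi> r' = \<phi> (r \<oplus>\<^sub>R r')" if "r \<in> car R" "r' \<in> car R" for r r'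
  using that by (auto simp: E \<phi>_def P.smult_l_distr intro!: restrict_ext)
 have smult: "s \<odot>\<^sub>E \<phi> r = \<phi> (r \<otimes>\<^sub>R s)" if "r \<in> car R" "s \<in> car R" for r s
  using that by (auto simp: E \<phi>_def P.smult_assoc intro!: restrict_ext)
 have Emod: "left_module (op_ring R) E"
 proof (rule left_moduleI)
  show "ring (op_ring R)" using P.ring by simp
  show "\<exists>v \<in> car E. v \<oplus>\<^sub>E u = \<zero>\<^sub>E" if u: "u \<in> car E" for u
  proof -
   obtain r where r: "r \<in> car R" "u = \<phi> r" using u unfolding E(1) by (elim imageE) blast
   show ?thesis by (rule bexI[of _ "\<phi> (\<ominus>\<^sub>R r)"]) (use r in \<open>auto simp: add E(1,2) R.l_neg\<close>)
  qed
 qed (auto simp: E(1,2) add smult R.a_ac R.l_distr R.r_distr R.m_assoc)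
 have "car E \<lesssim> (UNIV :: 'c set)" unfolding E(1) using image_lepoll R_small by (rule lepoll_trans)
 moreover have "h = (\<lambda>c \<in> car CR. \<zero>\<^sub>E)" if h: "h \<in> lhom (op_ring R) CR E" for h
 proof (rule lhom_eqI[OF h lhom_zero[OF CR Emod]])
  interpret h: lhm "op_ring R" CR E h by (intro lhmI CR Emod h)
  interpret X: tens_ctx R CR P by (rule tens_ctxI[OF CR P])
  interpret XQ: tens_ctx R CR Q by (rule tens_ctxI[OF CR Q])
  have hc: "\<exists>r \<in> car R. h c = \<phi> r" if "c \<in> car C" for c using h.closed[of c] that by (auto simp: E)
  obtain H where H: "H \<in> ahom (tens R CR P) ?G"
   "\<And>c p. c \<in> car CR \<Longrightarrow> p \<in> car P \<Longrightarrow> H (pt R CR P c p) = h c p"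
  proof (rule X.tens_universal[OF G, of h])
   show "h c p \<in> car ?G" if "c \<in> car CR" "p \<in> car P" for c p
    using hc[of c] that by (auto simp: \<phi>_def)
   show "h (c \<oplus>\<^sub>CR c') p = h c p \<oplus>\<^sub>?G h c' p" if "c \<in> car CR" "c' \<in> car CR" "p \<in> car P" for c c' p
    using h.add[OF that(1,2)] that(3) by (simp add: E)
   show "h c (p \<oplus>\<^sub>P p') = h c p \<oplus>\<^sub>?G h c p'" if "c \<in> car CR" "p \<in> car P" "p' \<in> car P" for c p p'
    using hc[of c] that by (auto simp: \<phi>_def P.smult_r_distr)
   show "h (r \<odot>\<^sub>CR c) p = h c (r \<odot>\<^sub>P p)" if "r \<in> car R" "c \<in> car CR" "p \<in> car P" for r c p
    using h.smult[of r c] that by (simp add: E)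
  qed blast
  have tg: "tmap P g \<in> ahom (tens R CR Q) (tens R CR P)"
   using tmap_linear[OF Q P g] by (simp add: linear_def ahom_def)
  have H0: "H (tmap P g t) = \<zero>\<^sub>?G" if t: "t \<in> car (tens R CR Q)" for t
  proof (rule XQ.tens_eqI[OF G ahom_comp[OF tg H(1)] ahom_zero[OF G] _ t])
   fix c q assume c: "c \<in> car CR" and q: "q \<in> car Q"
   obtain r where r: "r \<in> car R" "h c = \<phi> r" using hc[of c] c by auto
   have "r \<odot>\<^sub>P g q = g (r \<odot>\<^sub>Q q)" using linearD(3)[OF g r(1) q] by simp
   then have "\<pi> (r \<odot>\<^sub>P g q) = \<zero>\<^sub>?G" using r q by (subst \<pi>0) auto
   then show "H (tmap P g (pt R CR Q c q)) = \<zero>\<^sub>?G"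
    using c q r tmap_pt[OF Q P g, of c q] H(2)[of c "g q"] by (simp add: \<phi>_def)
  qed
  fix c assume c: "c \<in> car CR"
  obtain r where r: "r \<in> car R" "h c = \<phi> r" using hc[of c] c by auto
  have "h c p = \<phi> \<zero>\<^sub>R p" if p: "p \<in> car P" for p
  proof -
   obtain t where "t \<in> car (tens R CR Q)" "tmap P g t = pt R CR P c p"
    using surj[of "pt R CR P c p"] X.pt_closed[OF c p] by auto
   then have "h c p = \<zero>\<^sub>?G" using H0 H(2)[OF c p] by metis
   then show ?thesis using p by (simp add: \<phi>_def)
  qed
  then have "h c = \<phi> \<zero>\<^sub>R"
   unfolding r(2) by (intro extensionalityI[of _ "car P"]) (auto simp: \<phi>_def)
  then show "h c = (\<lambda>c \<in> car CR. \<zero>\<^sub>E) c" using c by (simp add: E(2))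
 qed
 ultimately have "car E = {\<zero>\<^sub>E}" by (rule hom_zero_imp_zero_R[OF Emod])
 \<comment> \<open>The class of \<open>\<one>\<close> in \<open>R/J\<close> is zero, so
   \<open>\<one>\<close> itself multiplies \<open>P\<close> into the image of
   \<open>g\<close>.\<close>
 then have "\<phi> \<one>\<^sub>R = \<phi> \<zero>\<^sub>R" unfolding E(1,2) by auto
 then have "\<phi> \<one>\<^sub>R x = \<phi> \<zero>\<^sub>R x" by (rule fun_cong)
 then have "\<pi> x = \<zero>\<^sub>?G" using x P.smult_one P.smult_zero_l \<pi>.zero by (simp add: \<phi>_def)
 then show ?thesis using \<pi>0[OF x] by auto
qed

text \<open>The counits of \<open>B\<close> and \<open>Z\<close> are isomorphisms and natural, so
  \<open>C \<otimes> Hom(C, g)\<close> is onto because \<open>g\<close> is. By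
  \<open>tmap_surj_imp_surj\<close> already \<open>Hom(C, g)\<close> is onto, and
  \<open>Hom(C, -)\<close> keeps the sequence exact.\<close>

lemma Bas_ker:
 assumes ses: "ses S A B Z f g" and B: "Bas B" and Z: "Bas Z"
 shows "Bas A"
proof -
 interpret E: sesm S A B Z f g using ses by (simp add: ses_iff)
 note mA = E.f.A.left_module and mB = E.f.B.left_module and mZ = E.g.B.left_module
 have isoB: "adjL (hm B) B (\<lambda>c f. f c) \<in> lisos S (tm (hm B)) B"
  and isoZ: "adjL (hm Z) Z (\<lambda>c f. f c) \<in> lisos S (tm (hm Z)) Z"
  using B Z adjL_lisos_iff[OF pairing_hm[OF mB]] adjL_lisos_iff[OF pairing_hm[OF mZ]]
  unfolding Bas_def good_def by blast+
 let ?\<nu>B = "adjL (hm B) B (\<lambda>c f. f c)" and ?\<nu>Z = "adjL (hm Z) Z (\<lambda>c f. f c)"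
 note hB = lm_hm[OF mB] and hZ = lm_hm[OF mZ]
 note gl = hmap_linear[OF mB mZ E.g.lhom]
 have nat: "?\<nu>Z (tmap (hm Z) (hmap g) t) = g (?\<nu>B t)" if t: "t \<in> car (tm (hm B))" for t
 proof -
  interpret X: tens_ctx R CR "hm B" by (rule tens_ctxI[OF CR hB])
  have t': "t \<in> car (tens R CR (hm B))" using t by simp
  have a: "tmap (hm Z) (hmap g) \<in> ahom (tens R CR (hm B)) (tens R CR (hm Z))"
   "?\<nu>Z \<in> ahom (tens R CR (hm Z)) Z" "?\<nu>B \<in> ahom (tens R CR (hm B)) B" "g \<in> ahom B Z"
   using tmap_linear[OF hB hZ gl] lhom_ahom[OF adjL_lhom[OF pairing_hm[OF mZ]]]
    lhom_ahom[OF adjL_lhom[OF pairing_hm[OF mB]]] lhom_ahom[OF E.g.lhom]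
   by (auto simp: linear_def ahom_def)
  show ?thesis
  proof (rule X.tens_eqI[OF E.g.B.abg_axioms ahom_comp[OF a(1,2)] ahom_comp[OF a(3,4)] _ t'])
   fix c h assume c: "c \<in> car CR" and h: "h \<in> car (hm B)"
   have "hmap g h \<in> car (hm Z)" using linearD(1)[OF gl h] .
   then show "?\<nu>Z (tmap (hm Z) (hmap g) (pt R CR (hm B) c h)) = g (?\<nu>B (pt R CR (hm B) c h))"
    using c h tmap_pt[OF hB hZ gl, of c h] adjL_pt[OF pairing_hm[OF mB], of c h]
     adjL_pt[OF pairing_hm[OF mZ], of c "hmap g h"] by simp
  qed
 qed
 have surj: "\<exists>t' \<in> car (tm (hm B)). tmap (hm Z) (hmap g) t' = t" if t: "t \<in> car (tm (hm Z))" for t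
 proof -
  have "?\<nu>Z t \<in> car Z" using lhom_closed[OF adjL_lhom[OF pairing_hm[OF mZ]] t] .
  then obtain b where b: "b \<in> car B" "g b = ?\<nu>Z t" by (rule E.surjE)
  moreover have "?\<nu>B ` car (tm (hm B)) = car B" using isoB by (simp add: lisos_def bij_betw_def)
  ultimately have "b \<in> ?\<nu>B ` car (tm (hm B))" by simp
  then obtain t' where t': "t' \<in> car (tm (hm B))" and "b = ?\<nu>B t'" by (rule imageE)
  then have t'b: "?\<nu>B t' = b" by simp
  have inj: "inj_on ?\<nu>Z (car (tm (hm Z)))" using isoZ by (simp add: lisos_def bij_betw_def)
  have "?\<nu>Z (tmap (hm Z) (hmap g) t') = ?\<nu>Z t" using nat[OF t'] t'b b by simp
  then have "tmap (hm Z) (hmap g) t' = t"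
   by (rule inj_onD[OF inj _ linearD(1)[OF tmap_linear[OF hB hZ gl] t'] t])
  then show ?thesis using t' by blast
 qed
 have "\<exists>h' \<in> lhom S CL B. hmap g h' = h" if "h \<in> lhom S CL Z" for h
  using tmap_surj_imp_surj[OF hB hZ gl surj, of h] that by simp
 then have H: "gses (hm A) (hm B) (hm Z) (hmap f) (hmap g)" by (rule hom_gses[OF ses])
 have "good (hm A) A (\<lambda>c f. f c)"
  by (rule good_ker[OF pmor_hm[OF mA mB E.f.lhom] pmor_hm[OF mB mZ E.g.lhom] H ses_gses[OF ses]])
   (use B Z in \<open>auto simp: Bas_def\<close>)
 then show ?thesis by (rule good_Bas)
qed

end

section \<open>Finite presentation of syzygies and of powers\<close>

lemma (in fres) ker_d_eq_im:
 "ker_mod (fr R (l (Suc i))) (im_mod (fr R (l (Suc i))) (fr R (l i)) (d i)) (d i)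
  = im_mod (fr R (l (Suc (Suc i)))) (fr R (l (Suc i))) (d (Suc i))"
 "ker_mod (fr R (l 0)) A p = im_mod (fr R (l (Suc 0))) (fr R (l 0)) (d 0)"
 using dS[of i] d0 by (simp_all add: lker_def)

text \<open>Each syzygy is covered by a free module of finite rank whose kernel is the next syzygy;
  this is why \<open>i\<close> varies in the induction.\<close>

lemma (in fres) FP_im: "FP n R (im_mod (fr R (l (Suc i))) (fr R (l i)) (d i))"
proof (induction n arbitrary: i)
 case 0
 show ?case by (rule FP_0I[OF d.lm_im lhom_im_mod[OF d]]) simp
next
 case (Suc n)
 show ?case by (rule FP_SucI[OF d.lm_im lhom_im_mod[OF d]]) (simp_all add: ker_d_eq_im Suc)
qed

lemma (in fres) FP_resolved: "FP n R A"
proof (cases n)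
 case 0
 then show ?thesis using FP_0I[OF M p p_onto] by simp
next
 case (Suc n')
 then show ?thesis using FP_SucI[OF M p p_onto, of n'] FP_im by (simp only: ker_d_eq_im)
qed

definition inj_at :: "('r, 'm) module \<Rightarrow> nat \<Rightarrow> nat \<Rightarrow> 'm \<Rightarrow> nat \<Rightarrow> 'm" where
 "inj_at M k j x = (\<lambda>i \<in> {..<k}. if i = j then x else \<zero>\<^sub>M)"

lemma inj_at_nth [simp]: "i < k \<Longrightarrow> inj_at M k j x i = (if i = j then x else \<zero>\<^sub>M)"
 by (simp add: inj_at_def)

lemma (in lmod) inj_at_closed [simp]: "x \<in> car M \<Longrightarrow> inj_at M k j x \<in> car (mpow k M)"
 by (simp add: inj_at_def)

lemma (in lmod) inj_at_linear: "inj_at M k j \<in> linear R M (mpow k M)"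
 unfolding linear_def ahom_def by (auto simp: add_pow smult_pow inj_at_def intro!: restrict_ext)

lemma nth_linear: "j < k \<Longrightarrow> (\<lambda>x. x j) \<in> linear R (mpow k M) M"
 by (simp add: linear_def ahom_def)

lemma (in lmod) nsum_inj_at:
 assumes x: "x \<in> car (mpow k M)"
 shows "nsum (mpow k M) (\<lambda>j. inj_at M k j (x j)) k = x"
proof -
 interpret P: lmod R "mpow k M" using lm_pow[OF left_module] by (simp add: lmod_iff)
 show ?thesis
 proof (rule pow_eqI[OF P.nsum_closed x])
  fix i assume i: "i < k"
  have "nsum (mpow k M) (\<lambda>j. inj_at M k j (x j)) k i = nsum M (\<lambda>j. if j = i then x j else \<zero>\<^sub>M) k"
   unfolding nsum_pow[OF i] by (rule nsum_cong) (use i in auto)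
  then show "nsum (mpow k M) (\<lambda>j. inj_at M k j (x j)) k i = x i" using nsum_delta[of i k x] i x by simp
 qed (use x in simp)
qed

text \<open>Splitting off the last coordinate makes the power an extension of a smaller power by
  \<open>M\<close>.\<close>

lemma FP_pow:
 assumes "FP n R M" shows "FP n R (mpow k M)"
proof (induction k)
 case 0
 have "left_module R (mpow 0 M)" by (intro lm_pow FP_left_module[OF assms])
 then show ?case by (rule FP_zero) (simp add: pow_defs restrict_def)
next
 case (Suc k)
 interpret M: lmod R M using FP_left_module[OF assms] by (simp add: lmod_iff)
 interpret P: lmod R "mpow j M" for j using lm_pow[OF M.left_module] by (simp add: lmod_iff)
 let ?f = "restrict (inj_at M (Suc k) k) (car M)"
 let ?g = "\<lambda>x \<in> car (mpow (Suc k) M). \<lambda>i \<in> {..<k}. x i"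
 have "ses R M (mpow (Suc k) M) (mpow k M) ?f ?g"
 proof (rule sesI[OF M.left_module P.left_module P.left_module])
  show "?f \<in> lhom R M (mpow (Suc k) M)"
   by (rule restrict_lhomI[OF M.left_module]) (use linearD[OF M.inj_at_linear] in auto)
  show g: "?g \<in> lhom R (mpow (Suc k) M) (mpow k M)"
   by (rule restrict_lhomI[OF P.left_module]) (auto simp: add_pow smult_pow intro!: restrict_ext)
  show "inj_on ?f (car M)"
  proof (rule inj_onI)
   fix x y assume "x \<in> car M" "y \<in> car M" "?f x = ?f y"
   then have "inj_at M (Suc k) k x = inj_at M (Suc k) k y" by simp
   from fun_cong[OF this, of k] show "x = y" by simp
  qed
  show "\<exists>y \<in> car (mpow (Suc k) M). ?g y = z" if z: "z \<in> car (mpow k M)" for z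
  proof (rule bexI)
   show c: "(\<lambda>i \<in> {..<Suc k}. if i < k then z i else \<zero>\<^sub>M) \<in> car (mpow (Suc k) M)" using z by auto
   show "?g (\<lambda>i \<in> {..<Suc k}. if i < k then z i else \<zero>\<^sub>M) = z"
    by (rule pow_eqI[OF lhom_closed[OF g c] z]) (use c in simp)
  qed
  show "?g (?f x) = \<zero>\<^bsub>mpow k M\<^esub>" if "x \<in> car M" for x
   by (rule pow_eqI[of _ k M]) (use that in auto)
  show "\<exists>x \<in> car M. ?f x = y" if y: "y \<in> car (mpow (Suc k) M)" and z: "?g y = \<zero>\<^bsub>mpow k M\<^esub>" for y
  proof (rule bexI)
   show "y k \<in> car M" using y by simp
   then show "?f (y k) = y"
   proof (simp, intro pow_eqI[of _ "Suc k" M])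
    fix i assume i: "i < Suc k"
    have "y i = \<zero>\<^sub>M" if "i < k" using fun_cong[OF z, of i] y that by simp
    then show "inj_at M (Suc k) k (y k) i = y i" using i by (cases "i = k") auto
   qed (use y in auto)
  qed
 qed
 then show ?case using FP_ext assms Suc by blast
qed

section \<open>Exactness tests with fp_n-injective and fp_n-flat modules\<close>

lemma FP_embed:
 fixes Q :: "'q ring" and V :: "('q, 'v) module" and W :: "('q, 'w) module"
 assumes inf: "infinite (UNIV :: 'u set)" and Q: "car Q \<lesssim> (UNIV :: 'u set)" and W_small: "car W \<lesssim> (UNIV :: 'u set)"
  and V: "left_module Q V" and W: "FP n Q W" and w: "w \<in> lhom Q V W" and im: "FP n Q (im_mod V W w)"
 obtains W' :: "('q, 'u) module" and e where "left_module Q W'" "e \<in> lhom Q W W'" "inj_on e (car W)" "fin_presented Q n W'"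
  "fin_presented Q n (im_mod V W' (compose (car V) e w))"
proof -
 note mW = FP_left_module[OF W]
 \<comment> \<open>Copying the target is enough: the image of \<open>V\<close> in the copy is a
   module over \<open>'u\<close> whatever the type of \<open>V\<close> is, and its inclusion is one
   of the monomorphisms tested by \<open>fpI\<close> and \<open>fpF\<close>.\<close>
 let ?W = "copy W :: ('q, 'u) module" and ?e = "restrict (code W) (car W) :: 'w \<Rightarrow> 'u"
 have W': "left_module Q ?W" by (rule lm_copy[OF mW W_small])
 have iso: "?e \<in> lisos Q W ?W" by (rule code_lisos[OF mW W_small])
 then have e: "?e \<in> lhom Q W ?W" and inj: "inj_on ?e (car W)" by (auto simp: lisos_def bij_betw_def)
 interpret w: lhm Q V W w by (intro lhmI V mW w)
 interpret ew: lhm Q V ?W "compose (car V) ?e w" by (rule lhmI[OF V W' lhom_compose[OF V w e]])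
 let ?I = "im_mod V W w" and ?I' = "im_mod V ?W (compose (car V) ?e w)"
 have FW: "FP n Q ?W" by (rule FP_iso[OF W W' isomorphic_copy[OF mW W_small]])
 have "restrict ?e (car ?I) \<in> lhom Q ?I ?I'"
 proof (rule restrict_lhomI[OF w.lm_im])
  interpret e: lhm Q W ?W ?e by (intro lhmI mW W' e)
  fix x y assume "x \<in> car ?I" "y \<in> car ?I"
  then have "x \<in> car W" "y \<in> car W" by auto
  then show "?e (x \<oplus>\<^sub>?I y) = ?e x \<oplus>\<^sub>?I' ?e y" using e.add[of x y] by simp
 next
  interpret e: lhm Q W ?W ?e by (intro lhmI mW W' e)
  fix a x assume "a \<in> car Q" "x \<in> car ?I"
  then have "a \<in> car Q" "x \<in> car W" by auto
  then show "?e (a \<odot>\<^sub>?I x) = a \<odot>\<^sub>?I' ?e x" using e.smult[of a x] by simp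
 qed (auto simp: compose_def)
 moreover have "bij_betw ?e (car ?I) (car ?I')"
  by (rule bij_betw_imageI) (auto intro!: inj_on_subset[OF inj] simp: compose_def image_image)
 then have "bij_betw (restrict ?e (car ?I)) (car ?I) (car ?I')"
  by (rule bij_betw_cong[THEN iffD2, rotated]) (rule restrict_apply')
 ultimately have "isomorphic Q ?I ?I'" by (auto simp: isomorphic_def lisos_def)
 then have "FP n Q ?I'" by (rule FP_iso[OF im ew.lm_im])
 then show ?thesis using that[OF W' e inj] FP_fin_presented[OF inf Q] FW by blast
qed

text \<open>A map \<open>g\<close> that vanishes on the kernel of \<open>w\<close> factors through
  the image of \<open>w\<close>. Both this image and \<open>W\<close> are finitely n-presented, so
  injectivity of \<open>N\<close> extends the factor to \<open>W\<close>.\<close>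

lemma inj_exact:
 fixes Q :: "'q ring" and N :: "('q, 'u) module"
 assumes inf: "infinite (UNIV :: 'u set)" and Q: "car Q \<lesssim> (UNIV :: 'u set)" and W_small: "car W \<lesssim> (UNIV :: 'u set)"
  and V: "left_module Q V" and W: "FP n Q W" and w: "w \<in> lhom Q V W" and im: "FP n Q (im_mod V W w)"
  and N: "N \<in> fpI Q n" and g: "g \<in> lhom Q V N"
  and ker: "\<And>v. v \<in> car V \<Longrightarrow> w v = \<zero>\<^sub>W \<Longrightarrow> g v = \<zero>\<^sub>N"
 shows "\<exists>h \<in> lhom Q W N. \<forall>v \<in> car V. g v = h (w v)"
proof -
 obtain W' :: "('q, 'u) module" and e where W': "left_module Q W'" and e: "e \<in> lhom Q W W'" "inj_on e (car W)"
  and fp: "fin_presented Q n W'" "fin_presented Q n (im_mod V W' (compose (car V) e w))"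
  by (rule FP_embed[OF inf Q W_small V W w im])
 note mW = FP_left_module[OF W]
 have mN: "left_module Q N" using N by (simp add: fpI_def)
 interpret e: lhm Q W W' e by (intro lhmI mW W' e)
 let ?w = "compose (car V) e w"
 let ?I = "im_mod V W' ?w"
 interpret ew: lhm Q V W' ?w by (rule lhmI[OF V W' lhom_compose[OF V w e(1)]])
 obtain g1 where g1: "g1 \<in> lhom Q ?I N" "\<And>x. x \<in> car V \<Longrightarrow> g1 (?w x) = g x"
 proof (rule factor_lhom[OF V ew.lm_im mN lhom_im_mod[OF ew.lhom] _ g])
  fix x assume x: "x \<in> car V" "?w x = \<zero>\<^sub>?I"
  then have "w x = \<zero>\<^sub>W" using e.inj_on_zeroD[OF e(2) lhom_closed[OF w x(1)]] by (simp add: compose_eq)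
  then show "g x = \<zero>\<^sub>N" using ker x by simp
 qed auto
 let ?j = "\<lambda>x \<in> car ?I. x"
 have "?j \<in> lhom Q ?I W'" using lhom_id[OF ew.lm_im] by (rule lhom_submodule_mono) auto
 moreover have "inj_on ?j (car ?I)" by (simp add: inj_on_def)
 ultimately have "(\<lambda>h. compose (car ?I) h ?j) ` lhom Q W' N = lhom Q ?I N"
  using N fp unfolding fpI_def by blast
 then have "g1 \<in> (\<lambda>h. compose (car ?I) h ?j) ` lhom Q W' N" using g1(1) by simp
 then obtain h where h: "g1 = compose (car ?I) h ?j" "h \<in> lhom Q W' N" by (rule imageE)
 show ?thesis
 proof (rule bexI[OF _ lhom_compose[OF mW e(1) h(2)]], rule ballI)
  fix v assume v: "v \<in> car V"
  then have "?w v \<in> car ?I" by simp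
  then have "g1 (?w v) = h (?w v)" unfolding h(1) by (simp add: compose_eq)
  then show "g v = compose (car W) h e (w v)" using v g1(2)[OF v] lhom_closed[OF w v] by (simp add: compose_eq)
 qed
qed

text \<open>\<open>w\<close> factors through its image \<open>I\<close>. Flatness makes
  \<open>I \<otimes> M \<rightarrow> W \<otimes> M\<close> injective, and the surjection of
  \<open>V\<close> onto \<open>I\<close> is handled by right exactness.\<close>

lemma flat_exact:
 fixes R :: "'q ring" and M :: "('q, 'u) module"
 assumes inf: "infinite (UNIV :: 'u set)" and R: "car R \<lesssim> (UNIV :: 'u set)" and W_small: "car W \<lesssim> (UNIV :: 'u set)"
  and U: "left_module (op_ring R) U" and V: "left_module (op_ring R) V" and W: "FP n (op_ring R) W"
  and u: "u \<in> linear (op_ring R) U V" and w: "w \<in> lhom (op_ring R) V W" and im: "FP n (op_ring R) (im_mod V W w)"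
  and M: "M \<in> fpF R n" and ex: "\<And>v. v \<in> car V \<Longrightarrow> w v = \<zero>\<^sub>W \<Longrightarrow> v \<in> u ` car U"
  and t: "t \<in> car (tens R V M)" "tmapl R W M w t = \<zero>\<^bsub>tens R W M\<^esub>"
 shows "t \<in> tmapl R V M u ` car (tens R U M)"
proof -
 have Q: "car (op_ring R) \<lesssim> (UNIV :: 'u set)" using R by simp
 obtain W' :: "('q, 'u) module" and e where W': "left_module (op_ring R) W'" and e: "e \<in> lhom (op_ring R) W W'"
   "inj_on e (car W)"
  and fp: "fin_presented (op_ring R) n W'" "fin_presented (op_ring R) n (im_mod V W' (compose (car V) e w))"
  by (rule FP_embed[OF inf Q W_small V W w im])
 note mW = FP_left_module[OF W]
 have mM: "left_module R M" using M by (simp add: fpF_def)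
 interpret e: lhm "op_ring R" W W' e by (intro lhmI mW W' e)
 let ?w = "compose (car V) e w"
 let ?I = "im_mod V W' ?w"
 interpret ew: lhm "op_ring R" V W' ?w by (rule lhmI[OF V W' lhom_compose[OF V w e(1)]])
 note mI = ew.lm_im
 have wI: "?w \<in> linear (op_ring R) V ?I" by (rule lhom_linear[OF lhom_im_mod[OF ew.lhom]])
 let ?j = "\<lambda>x \<in> car ?I. x"
 have j: "?j \<in> lhom (op_ring R) ?I W'" using lhom_id[OF ew.lm_im] by (rule lhom_submodule_mono) auto
 have "inj_on ?j (car ?I)" by (simp add: inj_on_def)
 then have "inj_on (tmapl R W' M ?j) (car (tensor_group R ?I M))"
  using M fp j unfolding fpF_def by blast
 then have inj: "inj_on (tmapl R W' M ?j) (car (tens R ?I M))" by (simp add: tens_def)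
 interpret tV: tens_ctx R V M by (rule tens_ctxI[OF V mM])
 interpret tI: tens_ctx R ?I M by (rule tens_ctxI[OF mI mM])
 interpret tW: tens_ctx R W M by (rule tens_ctxI[OF mW mM])
 interpret tW': tens_ctx R W' M by (rule tens_ctxI[OF W' mM])
 have wt: "tmapl R ?I M ?w \<in> ahom (tens R V M) (tens R ?I M)"
  by (rule tmap_ahom[OF V mI mM mM wI linear_id])
 interpret jm: ahm "tens R ?I M" "tens R W' M" "tmapl R W' M ?j"
  by (intro ahmI tI.abg_tens tW'.abg_tens tmap_ahom mI W' mM lhom_linear[OF j] linear_id)
 interpret em: ahm "tens R W M" "tens R W' M" "tmapl R W' M e"
  by (intro ahmI tW.abg_tens tW'.abg_tens tmap_ahom mW W' mM lhom_linear[OF e(1)] linear_id)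
 have eq: "tmapl R W' M ?j (tmapl R ?I M ?w t)
   = tmapl R W' M e (tmapl R W M w t)"
 proof (rule tV.tens_eqI[OF tW'.abg_tens ahom_comp[OF wt jm.ahom] ahom_comp[OF _ em.ahom] _ t(1)])
  show "tmapl R W M w \<in> ahom (tens R V M) (tens R W M)"
   by (rule tmap_ahom[OF V mW mM mM lhom_linear[OF w] linear_id])
  fix v x assume v: "v \<in> car V" and x: "x \<in> car M"
  have "?w v \<in> car ?I" using v by simp
  then show "tmapl R W' M ?j (tmapl R ?I M ?w (pt R V M v x)) =
    tmapl R W' M e (tmapl R W M w (pt R V M v x))"
   unfolding tmap_pure[OF V mI mM mM wI linear_id v x] tmap_pure[OF V mW mM mM lhom_linear[OF w] linear_id v x]
    tmap_pure[OF mW W' mM mM lhom_linear[OF e(1)] linear_id lhom_closed[OF w v] x]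
   using tmap_pure[OF mI W' mM mM lhom_linear[OF j] linear_id _ x, of "?w v"] v by (simp add: compose_eq)
 qed
 have ct: "tmapl R ?I M ?w t \<in> car (tens R ?I M)" using wt t(1) by (simp add: ahom_def)
 have "tmapl R W' M ?j (tmapl R ?I M ?w t) = \<zero>\<^bsub>tens R W' M\<^esub>"
  unfolding eq t(2) by (rule em.zero)
 then have 0: "tmapl R ?I M ?w t = \<zero>\<^bsub>tens R ?I M\<^esub>" by (rule jm.inj_on_zeroD[OF inj ct])
 show ?thesis
 proof (rule tens_right_exact[OF U V mI mM u wI _ _ t(1) 0])
  fix v assume v: "v \<in> car V" "?w v = \<zero>\<^sub>?I"
  then have "w v = \<zero>\<^sub>W" using e.inj_on_zeroD[OF e(2) lhom_closed[OF w v(1)]] by (simp add: compose_eq)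
  then show "v \<in> u ` car U" by (rule ex[OF v(1)])
 qed simp
qed

text \<open>When \<open>A\<close> has a second, commuting module structure \<open>A'\<close> over \<open>R'\<close> and \<open>R' \<cong> End\<^sub>R(A)\<close>, applying
 \<open>Hom(-, A)\<close> to the resolution gives an exact sequence \<open>0 \<rightarrow> R' \<rightarrow> A'\<^bsup>l 0\<^esup> \<rightarrow> A'\<^bsup>l 1\<^esup> \<rightarrow> \<dots>\<close> of \<open>R'\<close>-modules
 all of whose kernels are finitely \<open>n\<close>-presented.\<close>

locale dualres = fres R A l p d
 for R :: "'r ring" and A :: "('r, 'a) module" and l p d +
 fixes R' :: "'q ring" and A' :: "('q, 'a) module"
 assumes A': "left_module R' A'" and FP_A': "FP n R' A'"
  and same: "car A' = car A" "\<zero>\<^sub>A' = \<zero>\<^sub>A" "x \<oplus>\<^sub>A' y = x \<oplus>\<^sub>A y"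
  and commutes: "\<lbrakk>r \<in> car R; r' \<in> car R'; x \<in> car A\<rbrakk> \<Longrightarrow> r' \<odot>\<^sub>A' (r \<odot>\<^sub>A x) = r \<odot>\<^sub>A (r' \<odot>\<^sub>A' x)"
  and coexact: "coexact A"
  and homothety: "bij_betw (\<lambda>r'. \<lambda>x \<in> car A. r' \<odot>\<^sub>A' x) (car R') (lhom R A A)"
begin

interpretation A': lmod R' A' using A' by (simp add: lmod_iff)

lemma pow_same: "car (mpow k A') = car (mpow k A)" "\<zero>\<^bsub>mpow k A'\<^esub> = \<zero>\<^bsub>mpow k A\<^esub>"
 "x \<oplus>\<^bsub>mpow k A'\<^esub> y = x \<oplus>\<^bsub>mpow k A\<^esub> y"
 by (simp_all add: pow_defs same)

lemma nsum_same: "nsum A' f k = nsum A f k"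
 by (induction k) (simp_all add: same)

lemma pow': "left_module R' (mpow k A')"
 by (rule lm_pow[OF A'])

definition D :: "nat \<Rightarrow> (nat \<Rightarrow> 'a) \<Rightarrow> nat \<Rightarrow> 'a" where
 "D i = restrict (cob A i) (car (mpow (l i) A'))"

text \<open>The initial map of the dual complex. \<open>R'\<close> appears as the free module of
  rank one, with \<open>r 0\<close> as the scalar that \<open>r\<close> stands for; it goes to the
  values at the generators of multiplication by that scalar.\<close>

definition E :: "(nat \<Rightarrow> 'q) \<Rightarrow> nat \<Rightarrow> 'a" where
 "E = (\<lambda>r \<in> car (fr R' 1). \<lambda>k \<in> {..<l 0}. r 0 \<odot>\<^sub>A' cvec k)"

lemma cob_closed_A: "x \<in> car (mpow (l i) A) \<Longrightarrow> cob A i x \<in> car (mpow (l (Suc i)) A)"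
 using cob_ahom[OF M, of i] by (simp add: ahom_def)

text \<open>The matrix entries lie in \<open>R\<close>, whose action commutes with that of
  \<open>R'\<close>.\<close>

lemma D_lhom: "D i \<in> lhom R' (mpow (l i) A') (mpow (l (Suc i)) A')"
 unfolding D_def
proof (rule restrict_lhomI[OF pow'])
 fix r x assume r: "r \<in> car R'" and x: "x \<in> car (mpow (l i) A')"
 have x': "x k \<in> car A" if "k < l i" for k using pow_closed[OF x that] same by simp
 show "cob A i (r \<odot>\<^bsub>mpow (l i) A'\<^esub> x) = r \<odot>\<^bsub>mpow (l (Suc i)) A'\<^esub> cob A i x"
  unfolding cob_def mv_def smult_pow
 proof (rule restrict_ext)
  fix j assume j: "j \<in> {..<l (Suc i)}"
  have "nsum A (\<lambda>k. mat i j k \<odot>\<^sub>A (\<lambda>i \<in> {..<l i}. r \<odot>\<^sub>A' x i) k) (l i) = nsum A' (\<lambda>k. r \<odot>\<^sub>A' (mat i j k \<odot>\<^sub>A x k)) (l i)"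
   unfolding nsum_same by (rule nsum_cong) (use r x' commutes in simp)
  also have "\<dots> = r \<odot>\<^sub>A' nsum A' (\<lambda>k. mat i j k \<odot>\<^sub>A x k) (l i)"
   by (rule A'.smult_nsum[OF r, symmetric]) (use x' same in simp)
  finally show "nsum A (\<lambda>k. mat i j k \<odot>\<^sub>A (\<lambda>i \<in> {..<l i}. r \<odot>\<^sub>A' x i) k) (l i) =
    r \<odot>\<^sub>A' (\<lambda>j \<in> {..<l (Suc i)}. nsum A (\<lambda>k. mat i j k \<odot>\<^sub>A x k) (l i)) j"
   using j by (simp add: nsum_same)
 qed
qed (use cob_ahom[OF M, of i] in \<open>simp_all add: ahom_def pow_same\<close>)

lemma E_lhom: "E \<in> lhom R' (fr R' 1) (mpow (l 0) A')"
proof -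
 have [simp]: "a \<odot>\<^sub>A' cvec k \<in> car A" if "a \<in> car R'" for a k
  using A'.smult_closed[OF that, of "cvec k"] by (simp add: same)
 have E: "E = restrict (\<lambda>r. \<lambda>k \<in> {..<l 0}. r 0 \<odot>\<^sub>A' cvec k) (car (fr R' 1))" by (simp add: E_def)
 show ?thesis unfolding E
  by (rule restrict_lhomI[OF lm_free[OF A'.ring]])
   (auto simp: add_pow smult_pow A'.smult_l_distr A'.smult_assoc same intro!: restrict_ext)
qed

lemma E_inj:
 assumes r: "r \<in> car (fr R' 1)" "E r = \<zero>\<^bsub>mpow (l 0) A'\<^esub>" shows "r = \<zero>\<^bsub>fr R' 1\<^esub>"
proof -
 interpret R': ring R' by (rule A'.ring)
 have r0: "r 0 \<in> car R'" using r(1) by simp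
 let ?h = "\<lambda>r'. \<lambda>x \<in> car A. r' \<odot>\<^sub>A' x"
 have h: "?h s \<in> lhom R A A" if "s \<in> car R'" for s using homothety that by (auto simp: bij_betw_def)
 have "?h (r 0) = ?h \<zero>\<^sub>R'"
 proof (rule lhom_gens_eqI[OF M h[OF r0] h[OF R'.zero_closed]])
  fix k assume k: "k < l 0"
  have "r 0 \<odot>\<^sub>A' cvec k = \<zero>\<^sub>A'" using fun_cong[OF r(2), of k] k r(1) by (simp add: E_def)
  then show "?h (r 0) (cvec k) = ?h \<zero>\<^sub>R' (cvec k)" using A'.smult_zero_l[of "cvec k"] by (simp add: same)
 qed
 then have r0': "r 0 = \<zero>\<^sub>R'" using inj_onD[OF bij_betw_imp_inj_on[OF homothety]] r0 R'.zero_closed by metis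
 interpret F: lmod R' "fr R' 1" using lm_free[OF A'.ring] by (simp add: lmod_iff)
 show ?thesis by (rule free_eqI[OF r(1) F.zero_closed]) (use r0' in simp)
qed

text \<open>A vector killed by the first coboundary lists the values of an endomorphism of
  \<open>A\<close>, and every endomorphism is multiplication by an element of
  \<open>R'\<close>.\<close>

lemma E_exact:
 assumes x: "x \<in> car (mpow (l 0) A')" "D 0 x = \<zero>\<^bsub>mpow (l (Suc 0)) A'\<^esub>" shows "x \<in> E ` car (fr R' 1)"
proof -
 have x': "x \<in> car (mpow (l 0) A)" "cob A 0 x = \<zero>\<^bsub>mpow (l (Suc 0)) A\<^esub>"
  using x by (simp_all add: D_def pow_same)
 obtain g where g: "g \<in> lhom R A A" "\<forall>k < l 0. g (cvec k) = x k" using lhom_exists[OF M x'] by blast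
 then obtain r where r: "r \<in> car R'" "g = (\<lambda>x \<in> car A. r \<odot>\<^sub>A' x)" using homothety by (auto simp: bij_betw_def)
 have c: "(\<lambda>i \<in> {..<1}. r) \<in> car (fr R' 1)" using r by simp
 have "E (\<lambda>i \<in> {..<1}. r) = x"
  by (rule pow_eqI[OF lhom_closed[OF E_lhom c] x(1)]) (use g r c in \<open>simp add: E_def\<close>)
 then show ?thesis using c by blast
qed

lemma D_exact:
 assumes "x \<in> car (mpow (l (Suc i)) A')" "D (Suc i) x = \<zero>\<^bsub>mpow (l (Suc (Suc i))) A'\<^esub>"
 shows "x \<in> D i ` car (mpow (l i) A')"
 using assms coexact unfolding coexact_def by (fastforce simp: D_def pow_same)

lemma D_D: "x \<in> car (mpow (l i) A') \<Longrightarrow> D (Suc i) (D i x) = \<zero>\<^bsub>mpow (l (Suc (Suc i))) A'\<^esub>"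
 using cob_cob[OF M] cob_closed_A by (simp add: D_def pow_same)

lemma D_E:
 assumes r: "r \<in> car (fr R' 1)" shows "D 0 (E r) = \<zero>\<^bsub>mpow (l (Suc 0)) A'\<^esub>"
proof -
 have r0: "r 0 \<in> car R'" using r by simp
 let ?h = "\<lambda>x \<in> car A. r 0 \<odot>\<^sub>A' x"
 have "?h \<in> lhom R A A" using homothety r0 by (auto simp: bij_betw_def)
 then have "cob A 0 (\<lambda>k \<in> {..<l 0}. ?h (cvec k)) = \<zero>\<^bsub>mpow (l (Suc 0)) A\<^esub>" by (rule cob_hom_zero[OF M])
 moreover have "(\<lambda>k \<in> {..<l 0}. ?h (cvec k)) = E r" using r by (auto simp: E_def intro!: restrict_ext)
 ultimately show ?thesis using lhom_closed[OF E_lhom r] by (simp add: D_def pow_same)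
qed

lemma FP_pow': "FP n R' (mpow k A')"
 by (rule FP_pow[OF FP_A'])

lemma FP_im_E: "FP n R' (im_mod (fr R' 1) (mpow (l 0) A') E)"
proof -
 interpret E: lhm R' "fr R' 1" "mpow (l 0) A'" E by (intro lhmI lm_free A'.ring pow' E_lhom)
 have "bij_betw E (car (fr R' 1)) (E ` car (fr R' 1))"
  by (rule bij_betw_imageI[OF E.inj_onI0]) (use E_inj in auto)
 then have "isomorphic R' (fr R' 1) (im_mod (fr R' 1) (mpow (l 0) A') E)"
  using lhom_im_mod[OF E_lhom] by (auto simp: isomorphic_def lisos_def)
 then show ?thesis by (rule FP_iso[OF FP_fr[OF A'.ring] E.lm_im])
qed

text \<open>Exactness at \<open>V\<close> makes the image of \<open>g\<close> the quotient of
  \<open>V\<close> by the image of \<open>f\<close>, so finite presentation moves on along the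
  complex.\<close>

lemma FP_im_step:
 assumes V: "left_module R' V" and f: "f \<in> lhom R' U V" and g: "g \<in> lhom R' V W" and U: "left_module R' U" and W: "left_module R' W"
  and gf: "\<And>x. x \<in> car U \<Longrightarrow> g (f x) = \<zero>\<^sub>W" and ex: "\<And>y. y \<in> car V \<Longrightarrow> g y = \<zero>\<^sub>W \<Longrightarrow> y \<in> f ` car U"
  and FU: "FP n R' (im_mod U V f)" and FV: "FP n R' V"
 shows "FP n R' (im_mod V W g)"
proof -
 interpret f: lhm R' U V f by (intro lhmI U V f)
 interpret g: lhm R' V W g by (intro lhmI W V g)
 have "ses R' (im_mod U V f) V (im_mod V W g) (\<lambda>x \<in> car (im_mod U V f). x) g"
 proof (rule sesI[OF f.lm_im V g.lm_im _ lhom_im_mod[OF g]])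
  show "(\<lambda>x \<in> car (im_mod U V f). x) \<in> lhom R' (im_mod U V f) V"
   using lhom_id[OF f.lm_im] by (rule lhom_submodule_mono) auto
 qed (use gf ex in \<open>auto simp: inj_on_def\<close>)
 then show ?thesis using FU FV by (rule FP_quot)
qed

lemma FP_im_D: "FP n R' (im_mod (mpow (l i) A') (mpow (l (Suc i)) A') (D i))"
proof (induction i)
 case 0
 show ?case
  by (rule FP_im_step[OF pow' E_lhom D_lhom lm_free[OF A'.ring] pow' D_E E_exact FP_im_E FP_pow'])
next
 case (Suc i)
 show ?case by (rule FP_im_step[OF pow' D_lhom D_lhom pow' pow' D_D D_exact Suc FP_pow'])
qed

end

section \<open>The tensored dual complex: fp_n-flat modules are in the Auslander class\<close>

locale fsd = faithful_semid S R C m pL dL l pR dR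
 for S :: "'s ring" and R :: "'r ring" and C :: "('s, 'r, 'c) bimodule" and m pL dL and l pR dR +
 assumes coL: "L.coexact CL" and coR: "T.coexact CR"
  and homS: "bij_betw (\<lambda>s. \<lambda>c \<in> car C. s \<odot>\<^sub>C c) (car S) (lhom (op_ring R) CR CR)"
  and homR: "bij_betw (\<lambda>r. \<lambda>c \<in> car C. rsmult C c r) (car R) (lhom S CL CL)"
begin

text \<open>The left resolution of \<open>C\<close> dualises to a complex of right
  \<open>R\<close>-modules, which is tensored with \<open>M\<close>; the right resolution dualises
  to a complex of left \<open>S\<close>-modules, to which \<open>Hom(-, N)\<close> is
  applied.\<close>

sublocale DL: dualres S CL m pL dL "op_ring R" CR
 by (intro dualres.intro dualres_axioms.intro L.fres_axioms) (use CR T.FP_resolved coL homR commute in auto)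

sublocale DR: dualres "op_ring R" CR l pR dR S CL
 by (intro dualres.intro dualres_axioms.intro T.fres_axioms) (use CL L.FP_resolved coR homS commute in auto)

lemma C_pow_small: "car (mpow k CR) \<lesssim> (UNIV :: 'c set)" "car (mpow k CL) \<lesssim> (UNIV :: 'c set)"
 using PiE_lessThan_lepoll[OF inf subset_imp_lepoll[OF subset_UNIV]] unfolding carrier_pow by blast+

lemma fr_small: "car (fr R k) \<lesssim> (UNIV :: 'c set)" "car (fr S k) \<lesssim> (UNIV :: 'c set)"
 using PiE_lessThan_lepoll[OF inf R_small] PiE_lessThan_lepoll[OF inf S_small] unfolding carrier_fr by blast+

end

lemma tensor_map_zero:
 assumes U: "left_module (op_ring R) U" and V: "left_module (op_ring R) V" and M: "left_module R M"
  and t: "t \<in> car (tens R U M)"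
 shows "tmapl R V M (\<lambda>x. \<zero>\<^sub>V) t = \<zero>\<^bsub>tens R V M\<^esub>"
proof -
 interpret V: lmod "op_ring R" V using V by (simp add: lmod_iff)
 interpret tU: tens_ctx R U M by (rule tens_ctxI[OF U M])
 interpret tV: tens_ctx R V M by (rule tens_ctxI[OF V M])
 interpret U: lmod "op_ring R" U using U by (simp add: lmod_iff)
 have z: "(\<lambda>x. \<zero>\<^sub>V) \<in> linear (op_ring R) U V" by (simp add: linear_def ahom_def)
 show ?thesis
 proof (rule tU.tens_eqI[OF tV.abg_tens tmap_ahom[OF U V M M z linear_id] ahom_zero[OF tV.abg_tens] _ t])
  fix a x assume a: "a \<in> car U" and x: "x \<in> car M"
  show "tmapl R V M (\<lambda>x. \<zero>\<^sub>V) (pt R U M a x) = \<zero>\<^bsub>tens R V M\<^esub>"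
   unfolding tmap_pure[OF U V M M z linear_id a x] by (rule ahm.zero[OF tV.pt_l_ahm[OF x]])
 qed
qed

context bimod
begin

lemma powCR: "left_module (op_ring R) (mpow k CR)"
 by (rule lm_pow[OF CR])

context
 fixes M :: "('r, 'm) module"
 assumes M: "left_module R M"
begin

text \<open>\<open>psig\<close> and \<open>ptau\<close> are the two directions of the isomorphism
  between \<open>C^k \<otimes> M\<close> and \<open>(C \<otimes> M)^k\<close>, made from coordinate
  maps and coordinate injections.\<close>

definition psig :: "nat \<Rightarrow> ((nat \<Rightarrow> 'c) \<times> 'm \<Rightarrow>\<^sub>0 int) set \<Rightarrow> nat \<Rightarrow> ('c \<times> 'm \<Rightarrow>\<^sub>0 int) set" where
 "psig k t = (\<lambda>j \<in> {..<k}. tmapl R CR M (\<lambda>y. y j) t)"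

definition ptau :: "nat \<Rightarrow> (nat \<Rightarrow> ('c \<times> 'm \<Rightarrow>\<^sub>0 int) set) \<Rightarrow> ((nat \<Rightarrow> 'c) \<times> 'm \<Rightarrow>\<^sub>0 int) set" where
 "ptau k s = nsum (tens R (mpow k CR) M) (\<lambda>j. tmapl R (mpow k CR) M (inj_at CR k j) (s j)) k"

interpretation tP: tens_ctx R "mpow k CR" M for k by (rule tens_ctxI[OF powCR M])
interpretation tC: tens_ctx R CR M by (rule tens_ctxI[OF CR M])
interpretation TP: abg "tens R (mpow k CR) M" for k by (rule tP.abg_tens)
interpretation TC: abg "tens R CR M" by (rule tC.abg_tens)

lemma nth_map: "j < k \<Longrightarrow> tmapl R CR M (\<lambda>y. y j) \<in> ahom (tens R (mpow k CR) M) (tens R CR M)"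
 by (rule tmap_ahom[OF powCR CR M M nth_linear linear_id])

lemma inj_at_map: "tmapl R (mpow k CR) M (inj_at CR k j) \<in> ahom (tens R CR M) (tens R (mpow k CR) M)"
 by (rule tmap_ahom[OF CR powCR M M CR.inj_at_linear linear_id])

lemma psig_ahom: "psig k \<in> ahom (tens R (mpow k CR) M) (mpow k (tm M))"
 using nth_map by (auto simp: psig_def ahom_def add_pow intro!: restrict_ext)

lemma psig_pure: "y \<in> car (mpow k CR) \<Longrightarrow> x \<in> car M \<Longrightarrow>
  psig k (pt R (mpow k CR) M y x) = (\<lambda>j \<in> {..<k}. pt R CR M (y j) x)"
 using tmap_pure[OF powCR CR M M nth_linear linear_id] by (auto simp: psig_def intro!: restrict_ext)

lemma ptau_ahom: "ptau k \<in> ahom (mpow k (tm M)) (tens R (mpow k CR) M)"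
proof -
 have "(\<lambda>s. nsum (tens R (mpow k CR) M) (\<lambda>j. tmapl R (mpow k CR) M (inj_at CR k j) (s j)) k)
   \<in> ahom (mpow k (tm M)) (tens R (mpow k CR) M)"
 proof (rule ahom_nsum[OF tP.abg_tens])
  fix j assume "j < k"
  then have "(\<lambda>s. s j) \<in> ahom (mpow k (tm M)) (tens R CR M)" by (auto simp: ahom_def dest: pow_closed)
  then show "(\<lambda>s. tmapl R (mpow k CR) M (inj_at CR k j) (s j)) \<in> ahom (mpow k (tm M)) (tens R (mpow k CR) M)"
   by (rule ahom_comp[OF _ inj_at_map])
 qed
 then show ?thesis by (simp add: ptau_def[abs_def])
qed

lemma ptau_psig:
 assumes t: "t \<in> car (tens R (mpow k CR) M)" shows "ptau k (psig k t) = t"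
proof (rule tP.tens_eqI[OF tP.abg_tens ahom_comp[OF psig_ahom ptau_ahom] _ _ t])
 show "(\<lambda>t. t) \<in> ahom (tens R (mpow k CR) M) (tens R (mpow k CR) M)" by (simp add: ahom_def)
 fix y x assume y: "y \<in> car (mpow k CR)" and x: "x \<in> car M"
 interpret px: ahm "mpow k CR" "tens R (mpow k CR) M" "\<lambda>a. pt R (mpow k CR) M a x" by (rule tP.pt_l_ahm[OF x])
 have "ptau k (psig k (pt R (mpow k CR) M y x)) =
   nsum (tens R (mpow k CR) M) (\<lambda>j. pt R (mpow k CR) M (inj_at CR k j (y j)) x) k"
  unfolding psig_pure[OF y x] ptau_def
  by (rule nsum_cong) (use tmap_pure[OF CR powCR M M CR.inj_at_linear linear_id _ x] pow_closed[OF y] in simp)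
 also have "\<dots> = pt R (mpow k CR) M (nsum (mpow k CR) (\<lambda>j. inj_at CR k j (y j)) k) x"
  by (rule px.nsum[symmetric]) (use CR.inj_at_closed pow_closed[OF y] in blast)
 finally show "ptau k (psig k (pt R (mpow k CR) M y x)) = pt R (mpow k CR) M y x"
  unfolding CR.nsum_inj_at[OF y] .
qed

lemma psig_ptau:
 assumes s: "s \<in> car (mpow k (tm M))" shows "psig k (ptau k s) = s"
proof (rule pow_eqI[OF _ s])
 have "ptau k s \<in> car (tens R (mpow k CR) M)" using ptau_ahom s by (simp add: ahom_def)
 then show "psig k (ptau k s) \<in> car (mpow k (tm M))" using psig_ahom by (simp add: ahom_def)
 have sc: "s j \<in> car (tens R CR M)" if "j < k" for j using pow_closed[OF s that] by simp
 fix i assume i: "i < k"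
 interpret n: ahm "tens R (mpow k CR) M" "tens R CR M" "tmapl R CR M (\<lambda>y. y i)"
  by (rule ahmI[OF tP.abg_tens tC.abg_tens nth_map[OF i]])
 have comp: "tmapl R CR M (\<lambda>y. y i) (tmapl R (mpow k CR) M (inj_at CR k j) u)
   = (if j = i then u else \<zero>\<^bsub>tens R CR M\<^esub>)" if u: "u \<in> car (tens R CR M)" for j u
 proof -
  have "tmapl R CR M (\<lambda>y. y i) (tmapl R (mpow k CR) M (inj_at CR k j) u)
   = tmapl R CR M (\<lambda>x. inj_at CR k j x i) u"
   by (rule tensor_map_comp[OF CR powCR CR M M M CR.inj_at_linear nth_linear[OF i] linear_id linear_id u])
  also have "\<dots> = (if j = i then u else \<zero>\<^bsub>tens R CR M\<^esub>)"
   using tensor_map_id[OF CR M u, of "\<lambda>x. x" "\<lambda>m. m"] tensor_map_zero[OF CR CR M u] i by simp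
  finally show ?thesis .
 qed
 have "psig k (ptau k s) i = nsum (tens R CR M) (\<lambda>j. if j = i then s j else \<zero>\<^bsub>tens R CR M\<^esub>) k"
  unfolding psig_def ptau_def using i
  by (simp, subst n.nsum) (use inj_at_map sc comp in \<open>auto simp: ahom_def intro!: nsum_cong\<close>)
 also have "\<dots> = s i" using TC.nsum_delta[of i k s] i sc by simp
 finally show "psig k (ptau k s) i = s i" .
qed

end

end

context fsd
begin

text \<open>Both sides use the same matrices of the left resolution, and scalars of \<open>S\<close>
  act on tensors through \<open>C\<close>. So \<open>psig\<close> turns the dual complex tensored
  with \<open>M\<close> into the complex of \<open>L.cob\<close> on powers of
  \<open>tm M\<close>.\<close>

lemma psig_cob:
 fixes M :: "('r, 'm) module"
 assumes M: "left_module R M" and t: "t \<in> car (tens R (mpow (m i) CR) M)"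
 shows "psig M (m (Suc i)) (tmapl R (mpow (m (Suc i)) CR) M (DL.D i) t)
  = L.cob (tm M) i (psig M (m i) t)"
proof -
 note D = lhom_linear[OF DL.D_lhom]
 interpret tP: tens_ctx R "mpow k CR" M for k by (rule tens_ctxI[OF powCR M])
 interpret tC: tens_ctx R CR M by (rule tens_ctxI[OF CR M])
 note mt = lm_tm[OF M]
 have abg: "abg (mpow k (tm M))" for k
 proof -
  interpret lmod S "mpow k (tm M)" using lm_pow[OF mt] by (simp add: lmod_iff)
  show ?thesis by unfold_locales
 qed
 show ?thesis
 proof (rule tP.tens_eqI[OF abg ahom_comp[OF tmap_ahom[OF powCR powCR M M D linear_id] psig_ahom[OF M]]
    ahom_comp[OF psig_ahom[OF M] L.cob_ahom[OF mt]] _ t])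
  fix y x assume y: "y \<in> car (mpow (m i) CR)" and x: "x \<in> car M"
  interpret px: ahm CR "tens R CR M" "\<lambda>a. pt R CR M a x" by (rule tC.pt_l_ahm[OF x])
  have yc: "y k \<in> car C" if "k < m i" for k using pow_closed[OF y that] by simp
  have Dy: "DL.D i y \<in> car (mpow (m (Suc i)) CR)" by (rule lhom_closed[OF DL.D_lhom y])
  show "psig M (m (Suc i)) (tmapl R (mpow (m (Suc i)) CR) M (DL.D i) (pt R (mpow (m i) CR) M y x))
    = L.cob (tm M) i (psig M (m i) (pt R (mpow (m i) CR) M y x))"
   unfolding tmap_pure[OF powCR powCR M M D linear_id y x] psig_pure[OF M Dy x] psig_pure[OF M y x] L.cob_def mv_def
  proof (rule restrict_ext)
   fix j assume j: "j \<in> {..<m (Suc i)}"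
   have "DL.D i y j = nsum CR (\<lambda>k. L.mat i j k \<odot>\<^sub>C y k) (m i)"
    using y j by (simp add: DL.D_def L.cob_def DL.nsum_same)
   then have "pt R CR M (DL.D i y j) x = nsum (tens R CR M) (\<lambda>k. pt R CR M (L.mat i j k \<odot>\<^sub>C y k) x) (m i)"
    using px.nsum[of "m i" "\<lambda>k. L.mat i j k \<odot>\<^sub>C y k"] yc by simp
   also have "\<dots> = nsum (tm M) (\<lambda>k. L.mat i j k \<odot>\<^bsub>tm M\<^esub> (\<lambda>j \<in> {..<m i}. pt R CR M (y j) x) k) (m i)"
    unfolding nsum_tensor_mod by (rule nsum_cong) (use tens_smult_pure[OF M _ yc x] in simp)
   finally show "pt R CR M (DL.D i y j) x
     = nsum (tm M) (\<lambda>k. L.mat i j k \<odot>\<^bsub>tm M\<^esub> (\<lambda>j \<in> {..<m i}. pt R CR M (y j) x) k) (m i)" .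
  qed
 qed
qed

text \<open>Flatness on the dual complex of the left resolution yields all places of
  \<open>uex\<close>, that is, the unit and Ext. Flatness on the free resolution of the right module
  \<open>C\<close> yields Tor.\<close>

lemma fpF_Aus:
 fixes M :: "('r, 'c) module"
 assumes M: "M \<in> fpF R n"
 shows "Aus M"
proof -
 have mM: "left_module R M" using M by (simp add: fpF_def)
 interpret M: lmod R M using mM by (simp add: lmod_iff)
 interpret FT: free_tens R M by unfold_locales
 note mt = lm_tm[OF mM]
 interpret tP: tens_ctx R "mpow k CR" M for k by (rule tens_ctxI[OF powCR mM])
 interpret ps: ahm "tens R (mpow k CR) M" "mpow k (tm M)" "psig M k" for k
 proof -
  interpret lmod S "mpow k (tm M)" using lm_pow[OF mt] by (simp add: lmod_iff)
  show "ahm (tens R (mpow k CR) M) (mpow k (tm M)) (psig M k)"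
   by (intro ahmI tP.abg_tens psig_ahom mM) unfold_locales
 qed
 have psig_zero: "t = \<zero>\<^bsub>tens R (mpow k CR) M\<^esub>" if "t \<in> car (tens R (mpow k CR) M)"
   "psig M k t = \<zero>\<^bsub>mpow k (tm M)\<^esub>" for t k
 proof -
  interpret pt: ahm "mpow k (tm M)" "tens R (mpow k CR) M" "ptau M k"
   by (intro ahmI tP.abg_tens ptau_ahom mM) unfold_locales
  show ?thesis using ptau_psig[OF mM that(1)] that(2) pt.zero by simp
 qed
 have psig_onto: "\<exists>t \<in> car (tens R (mpow k CR) M). psig M k t = s" if "s \<in> car (mpow k (tm M))" for s k
  using psig_ptau[OF mM that] ptau_ahom[OF mM, of k] that by (auto simp: ahom_def simp del: tensor_mod_simps)
 \<comment> \<open>\<open>F\<close> is the isomorphism from \<open>M\<close> to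
   \<open>R \<otimes> M\<close>, with \<open>R\<close> in the form of a free module of rank
   one.\<close>
 define u where "u = uv R 1 0"
 have u: "u \<in> car (fr (op_ring R) 1)" unfolding u_def by simp
 define F where "F x = pt R (fr (op_ring R) 1) M u x" for x
 have F: "F x \<in> car (tens R (fr (op_ring R) 1) M)" if "x \<in> car M" for x
  unfolding F_def using u that by (rule FT.Ft.pt_closed)
 have F_onto: "\<exists>x \<in> car M. F x = t" if t: "t \<in> car (tens R (fr (op_ring R) 1) M)" for t
 proof -
  interpret TF: abg "tens R (fr (op_ring R) 1) M" by (rule FT.Ft.abg_tens)
  let ?x = "FT.sigma 1 t 0"
  have s: "FT.sigma 1 t \<in> car (mpow 1 M)" using FT.sigma t by (simp add: ahom_def)
  then have x: "?x \<in> car M" by (rule pow_closed) simp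
  have "t = F ?x" using FT.tau_sigma[OF t] TF.zero_add[OF F[OF x]] by (simp add: FT.tau_def F_def u_def)
  then show ?thesis using x by metis
 qed
 have F_zero: "x = \<zero>\<^sub>M" if x: "x \<in> car M" "F x = \<zero>\<^bsub>tens R (fr (op_ring R) 1) M\<^esub>" for x
 proof -
  interpret sg: ahm "tens R (fr (op_ring R) 1) M" "mpow 1 M" "FT.sigma 1"
   by (intro ahmI FT.Ft.abg_tens FT.sigma abg_pow) unfold_locales
  have "FT.sigma 1 (F x) 0 = x" using FT.sigma_pure[OF u x(1)] x by (simp add: F_def u_def)
  then show ?thesis using x sg.zero by simp
 qed
 \<comment> \<open>Under \<open>F\<close> and \<open>psig\<close> the initial map of the tensored
   dual complex is \<open>bU\<close>.\<close>
 have E: "psig M (m 0) (tmapl R (mpow (m 0) CR) M DL.E (F x)) = bU (pt R CR M) x" if x: "x \<in> car M" for x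
 proof -
  have Eu: "DL.E u k = L.cvec k" if "k < m 0" for k
   using that u CR.smult_one[of "L.cvec k"] L.cvec_closed[of k] by (simp add: DL.E_def u_def)
  show ?thesis
   unfolding F_def tmap_pure[OF lm_free[OF CR.ring] powCR mM mM lhom_linear[OF DL.E_lhom] linear_id u x]
    psig_pure[OF mM lhom_closed[OF DL.E_lhom u] x] bU_def
   by (rule restrict_ext) (simp add: Eu)
 qed
 note frR = lm_free[OF CR.ring]
 note flat = flat_exact[OF inf R_small _ _ _ _ _ _ _ M]
 \<comment> \<open>Cocycles for \<open>L.cob\<close> correspond to elements killed by the tensored
   dual map, where flatness applies.\<close>
 have lift: "\<exists>t \<in> car (tens R (mpow (m i) CR) M). psig M (m i) t = y \<and>
   tmapl R (mpow (m (Suc i)) CR) M (DL.D i) t = \<zero>\<^bsub>tens R (mpow (m (Suc i)) CR) M\<^esub>"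
  if y: "y \<in> car (mpow (m i) (tm M))" and z: "L.cob (tm M) i y = \<zero>\<^bsub>mpow (m (Suc i)) (tm M)\<^esub>" for y i
 proof -
  obtain t where t: "t \<in> car (tens R (mpow (m i) CR) M)" "psig M (m i) t = y" using psig_onto[OF y] by blast
  have "tmapl R (mpow (m (Suc i)) CR) M (DL.D i) t = \<zero>\<^bsub>tens R (mpow (m (Suc i)) CR) M\<^esub>"
   using tmap_ahom[OF powCR powCR mM mM lhom_linear[OF DL.D_lhom] linear_id] t z
   by (intro psig_zero) (simp_all add: ahom_def psig_cob[OF mM t(1)])
  then show ?thesis using t by blast
 qed
 have "uex M (tm M) (pt R CR M) i" for i
 proof -
  consider "i = 0" | "i = Suc 0" | i' where "i = Suc (Suc i')" by (metis not0_implies_Suc)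
  then show ?thesis
  proof cases
  case 1
  show ?thesis unfolding 1 uex.simps
  proof (intro ballI impI)
   fix x assume x: "x \<in> car M" and z: "bU (pt R CR M) x = \<zero>\<^bsub>mpow (m 0) (tm M)\<^esub>"
   have tz: "tmapl R (mpow (m 0) CR) M DL.E (F x) = \<zero>\<^bsub>tens R (mpow (m 0) CR) M\<^esub>"
    using psig_zero[of "tmapl R (mpow (m 0) CR) M DL.E (F x)" "m 0"] E[OF x] z
     tmap_ahom[OF frR powCR mM mM lhom_linear[OF DL.E_lhom] linear_id] F[OF x] by (simp add: ahom_def)
   \<comment> \<open>Injectivity of the initial map is exactness at \<open>R \<otimes> M\<close>
     with a zero map coming in.\<close>
   have "F x \<in> tmapl R (fr (op_ring R) 1) M (\<lambda>r. \<zero>\<^bsub>fr (op_ring R) 1\<^esub>) ` car (tens R (fr (op_ring R) 1) M)"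
   proof (rule flat[OF C_pow_small(1) frR frR DL.FP_pow' _ DL.E_lhom DL.FP_im_E _ F[OF x] tz])
    show "(\<lambda>r. \<zero>\<^bsub>fr (op_ring R) 1\<^esub>) \<in> linear (op_ring R) (fr (op_ring R) 1) (fr (op_ring R) 1)"
     unfolding linear_def ahom_def using FT.Ft.A.zero_closed FT.Ft.A.smult_zero_r FT.Ft.A.zero_add by simp
    fix v assume v: "v \<in> car (fr (op_ring R) 1)" "DL.E v = \<zero>\<^bsub>mpow (m 0) CR\<^esub>"
    show "v \<in> (\<lambda>r. \<zero>\<^bsub>fr (op_ring R) 1\<^esub>) ` car (fr (op_ring R) 1)"
     using DL.E_inj[OF v] v by blast
   qed
   then have "F x = \<zero>\<^bsub>tens R (fr (op_ring R) 1) M\<^esub>" using tensor_map_zero[OF frR frR mM] by (elim imageE) simp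
   then show "x = \<zero>\<^sub>M" by (rule F_zero[OF x])
  qed
 next
  case 2
  show ?thesis unfolding 2 uex.simps
  proof (intro ballI impI)
   fix y assume y: "y \<in> car (mpow (m 0) (tm M))" and z: "L.cob (tm M) 0 y = \<zero>\<^bsub>mpow (m (Suc 0)) (tm M)\<^esub>"
   obtain t where t: "t \<in> car (tens R (mpow (m 0) CR) M)" "psig M (m 0) t = y"
    and tz: "tmapl R (mpow (m (Suc 0)) CR) M (DL.D 0) t = \<zero>\<^bsub>tens R (mpow (m (Suc 0)) CR) M\<^esub>"
    using lift[OF y z] by blast
   have "t \<in> tmapl R (mpow (m 0) CR) M DL.E ` car (tens R (fr (op_ring R) 1) M)"
    by (rule flat[OF C_pow_small(1) frR powCR DL.FP_pow' lhom_linear[OF DL.E_lhom] DL.D_lhom DL.FP_im_D _ t(1) tz]) (rule DL.E_exact)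
   then obtain t' where t': "t = tmapl R (mpow (m 0) CR) M DL.E t'" "t' \<in> car (tens R (fr (op_ring R) 1) M)"
    by (rule imageE)
   obtain x where x: "x \<in> car M" "F x = t'" using F_onto[OF t'(2)] by blast
   show "\<exists>x \<in> car M. bU (pt R CR M) x = y"
    by (rule bexI[OF _ x(1)]) (use E[OF x(1)] x(2) t'(1) t(2) in simp)
  qed
 next
  case (3 i')
  show ?thesis unfolding 3 uex.simps
  proof (intro ballI impI)
   fix y assume y: "y \<in> car (mpow (m (Suc i')) (tm M))"
    and z: "L.cob (tm M) (Suc i') y = \<zero>\<^bsub>mpow (m (Suc (Suc i'))) (tm M)\<^esub>"
   obtain t where t: "t \<in> car (tens R (mpow (m (Suc i')) CR) M)" "psig M (m (Suc i')) t = y"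
    and tz: "tmapl R (mpow (m (Suc (Suc i'))) CR) M (DL.D (Suc i')) t = \<zero>\<^bsub>tens R (mpow (m (Suc (Suc i'))) CR) M\<^esub>"
    using lift[OF y z] by blast
   have "t \<in> tmapl R (mpow (m (Suc i')) CR) M (DL.D i') ` car (tens R (mpow (m i') CR) M)"
    by (rule flat[OF C_pow_small(1) powCR powCR DL.FP_pow' lhom_linear[OF DL.D_lhom] DL.D_lhom DL.FP_im_D _ t(1) tz]) (rule DL.D_exact)
   then obtain t' where t': "t = tmapl R (mpow (m (Suc i')) CR) M (DL.D i') t'"
    "t' \<in> car (tens R (mpow (m i') CR) M)" by (rule imageE)
   show "\<exists>x \<in> car (mpow (m i') (tm M)). L.cob (tm M) i' x = y"
    by (rule bexI[OF _ ps.closed[OF t'(2)]]) (use psig_cob[OF mM t'(2)] t'(1) t(2) in simp)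
  qed
 qed
 qed
 \<comment> \<open>The syzygies of the right resolution are finitely presented too, so flatness
   keeps this resolution exact.\<close>
 moreover have "Tor_acyclic R (\<lambda>i. fr (op_ring R) (l i)) dR M"
  unfolding Tor_acyclic_def
 proof (intro allI ballI impI)
  fix i t assume t: "t \<in> car (tens R (fr (op_ring R) (l (Suc i))) M)"
   "tmapl R (fr (op_ring R) (l i)) M (dR i) t = \<zero>\<^bsub>tens R (fr (op_ring R) (l i)) M\<^esub>"
  have "t \<in> tmapl R (fr (op_ring R) (l (Suc i))) M (dR (Suc i)) `
    car (tens R (fr (op_ring R) (l (Suc (Suc i)))) M)"
   by (rule flat[OF _ frR frR FP_fr[OF CR.ring] lhom_linear[OF T.d] T.d T.FP_im _ t])
    (use fr_small(1) T.exactS in \<open>simp_all add: carrier_fr\<close>)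
  then show "\<exists>t' \<in> car (tens R (fr (op_ring R) (l (Suc (Suc i)))) M).
    t = tmapl R (fr (op_ring R) (l (Suc i))) M (dR (Suc i)) t'" by (elim imageE) blast
 qed
 then have "\<forall>i. tex M (tm M) (pt R CR M) (Suc (Suc i))" using T.chexact_iff[OF mM] chexact_tex by blast
 then have "\<forall>i. tex M (tm M) (pt R CR M) i"
  using tex_tm[OF mM] all_nat_iff[of "tex M (tm M) (pt R CR M)"] by (simp del: tex.simps)
 ultimately show ?thesis using pairing_tm[OF mM] mM by (simp add: Aus_def good_def del: uex.simps tex.simps)
qed

end

section \<open>Homomorphisms out of the dual complex: fp_n-injective modules are in the Bass
  class\<close>

context bimod
begin

lemma powCL: "left_module S (mpow k CL)"
 by (rule lm_pow[OF CL])

text \<open>\<open>Phi\<close> and \<open>Psi\<close> are the two directions of the isomorphism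
  between \<open>Hom(C, N)^k\<close> and \<open>Hom(C^k, N)\<close>.\<close>

definition Phi :: "('s, 'n) module \<Rightarrow> nat \<Rightarrow> (nat \<Rightarrow> 'c \<Rightarrow> 'n) \<Rightarrow> (nat \<Rightarrow> 'c) \<Rightarrow> 'n" where
 "Phi N k f = (\<lambda>y \<in> car (mpow k CL). nsum N (\<lambda>j. f j (y j)) k)"

definition Psi :: "nat \<Rightarrow> ((nat \<Rightarrow> 'c) \<Rightarrow> 'n) \<Rightarrow> nat \<Rightarrow> 'c \<Rightarrow> 'n" where
 "Psi k h = (\<lambda>j \<in> {..<k}. \<lambda>c \<in> car C. h (inj_at CL k j c))"

context
 fixes N :: "('s, 'n) module"
 assumes N: "left_module S N"
begin

interpretation N: lmod S N using N by (simp add: lmod_iff)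

lemma hm_nth: "f \<in> car (mpow k (hm N)) \<Longrightarrow> j < k \<Longrightarrow> f j \<in> lhom S CL N"
 using pow_closed[of f k "hm N" j] by simp

lemma hm_nth_ahm: "f \<in> car (mpow k (hm N)) \<Longrightarrow> j < k \<Longrightarrow> ahm CL N (f j)"
 by (rule ahmI[OF CL.abg_axioms N.abg_axioms lhom_ahom[OF hm_nth]])

lemma hm_nth_smult: "f \<in> car (mpow k (hm N)) \<Longrightarrow> j < k \<Longrightarrow> s \<in> car S \<Longrightarrow> c \<in> car CL \<Longrightarrow>
  f j (s \<odot>\<^sub>CL c) = s \<odot>\<^sub>N f j c"
 using hm_nth by (simp add: lhom_def)

lemma Phi_lhom:
 assumes f: "f \<in> car (mpow k (hm N))"
 shows "Phi N k f \<in> lhom S (mpow k CL) N"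
 unfolding Phi_def
proof (rule restrict_lhomI[OF powCL])
 note f_closed = ahm.closed[OF hm_nth_ahm[OF f]] and f_add = ahm.add[OF hm_nth_ahm[OF f]]
 show "nsum N (\<lambda>j. f j (x j)) k \<in> car N" if "x \<in> car (mpow k CL)" for x
  using f_closed pow_closed[OF that] by simp
 show "nsum N (\<lambda>j. f j ((x \<oplus>\<^bsub>mpow k CL\<^esub> y) j)) k = nsum N (\<lambda>j. f j (x j)) k \<oplus>\<^sub>N nsum N (\<lambda>j. f j (y j)) k"
  if x: "x \<in> car (mpow k CL)" and y: "y \<in> car (mpow k CL)" for x y
 proof -
  have "nsum N (\<lambda>j. f j ((x \<oplus>\<^bsub>mpow k CL\<^esub> y) j)) k = nsum N (\<lambda>j. f j (x j) \<oplus>\<^sub>N f j (y j)) k"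
   by (rule nsum_cong) (use f_add pow_closed[OF x] pow_closed[OF y] in simp)
  then show ?thesis using N.nsum_add f_closed pow_closed[OF x] pow_closed[OF y] by simp
 qed
 show "nsum N (\<lambda>j. f j ((a \<odot>\<^bsub>mpow k CL\<^esub> x) j)) k = a \<odot>\<^sub>N nsum N (\<lambda>j. f j (x j)) k"
  if a: "a \<in> car S" and x: "x \<in> car (mpow k CL)" for a x
 proof -
  have "nsum N (\<lambda>j. f j ((a \<odot>\<^bsub>mpow k CL\<^esub> x) j)) k = nsum N (\<lambda>j. a \<odot>\<^sub>N f j (x j)) k"
   by (rule nsum_cong) (use hm_nth_smult[OF f _ a] pow_closed[OF x] in simp)
  then show ?thesis using N.smult_nsum[OF a] f_closed pow_closed[OF x] by simp
 qed
qed

lemma Psi_closed: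
 assumes h: "h \<in> lhom S (mpow k CL) N" shows "Psi k h \<in> car (mpow k (hm N))"
proof -
 interpret h: lhm S "mpow k CL" N h by (intro lhmI powCL N h)
 have "(\<lambda>c \<in> car CL. h (inj_at CL k j c)) \<in> lhom S CL N" for j
  by (rule restrict_lhomI[OF CL]) (use linearD[OF CL.inj_at_linear[of k j]] in auto)
 then show ?thesis by (simp add: Psi_def)
qed

lemma Phi_Psi:
 assumes h: "h \<in> lhom S (mpow k CL) N" shows "Phi N k (Psi k h) = h"
proof (rule lhom_eqI[OF Phi_lhom[OF Psi_closed[OF h]] h])
 interpret h: lhm S "mpow k CL" N h by (intro lhmI powCL N h)
 fix y assume y: "y \<in> car (mpow k CL)"
 have yc: "y j \<in> car CL" if "j < k" for j using pow_closed[OF y that] .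
 have "Phi N k (Psi k h) y = nsum N (\<lambda>j. h (inj_at CL k j (y j))) k"
  using y unfolding Phi_def Psi_def by (simp, intro nsum_cong) (use yc in simp)
 also have "\<dots> = h (nsum (mpow k CL) (\<lambda>j. inj_at CL k j (y j)) k)"
  by (rule h.nsum[symmetric]) (use CL.inj_at_closed yc in blast)
 finally show "Phi N k (Psi k h) y = h y" unfolding CL.nsum_inj_at[OF y] .
qed

lemma Phi_inj:
 assumes f: "f \<in> car (mpow k (hm N))" and g: "g \<in> car (mpow k (hm N))"
  and eq: "\<And>y. y \<in> car (mpow k CL) \<Longrightarrow> Phi N k f y = Phi N k g y"
 shows "f = g"
proof (rule pow_eqI[OF f g])
 fix j assume j: "j < k"
 have P: "Phi N k f (inj_at CL k j c) = f j c" if f: "f \<in> car (mpow k (hm N))" and c: "c \<in> car CL" for f c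
 proof -
  note f_zero = ahm.zero[OF hm_nth_ahm[OF f]] and f_closed = ahm.closed[OF hm_nth_ahm[OF f]]
  have "Phi N k f (inj_at CL k j c) = nsum N (\<lambda>i. if i = j then f i c else \<zero>\<^sub>N) k"
   using CL.inj_at_closed[OF c] unfolding Phi_def by (simp, intro nsum_cong) (use f_zero in simp)
  then show ?thesis using N.nsum_delta[of j k "\<lambda>i. f i c"] j f_closed[OF j c] by simp
 qed
 show "f j = g j"
  by (rule lhom_eqI[OF hm_nth[OF f j] hm_nth[OF g j]]) (use P f g eq[OF CL.inj_at_closed] in metis)
qed

lemma nsum_hm: "c \<in> car C \<Longrightarrow> nsum (hm N) F k c = nsum N (\<lambda>j. F j c) k"
 by (induction k) simp_all

end

end

context fsd
begin

text \<open>Precomposition with the dual map becomes the boundary on powers of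
  \<open>Hom(C, N)\<close>, because a scalar \<open>r\<close> acts there by
  \<open>c \<mapsto> c r\<close>; the two sums over the matrix are interchanged.\<close>

lemma Phi_bnd:
 fixes N :: "('s, 'n) module"
 assumes N: "left_module S N" and f: "f \<in> car (mpow (l (Suc i)) (hm N))" and y: "y \<in> car (mpow (l i) CL)"
 shows "Phi N (l (Suc i)) f (DR.D i y) = Phi N (l i) (T.bnd (hm N) i f) y"
proof -
 interpret N: lmod S N using N by (simp add: lmod_iff)
 note f_closed = ahm.closed[OF hm_nth_ahm[OF N f]] and f_nsum = ahm.nsum[OF hm_nth_ahm[OF N f]]
 have yc: "y k \<in> car C" if "k < l i" for k using pow_closed[OF y that] by simp
 have rc: "rsmult C (y k) (T.mat i j k) \<in> car C" if "k < l i" for j k using that yc T.mat_closed by simp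
 have "Phi N (l (Suc i)) f (DR.D i y) = nsum N (\<lambda>j. f j (nsum CL (\<lambda>k. rsmult C (y k) (T.mat i j k)) (l i))) (l (Suc i))"
  using lhom_closed[OF DR.D_lhom y] y unfolding Phi_def
  by (simp, intro nsum_cong) (simp add: DR.D_def T.cob_def DR.nsum_same)
 also have "\<dots> = nsum N (\<lambda>j. nsum N (\<lambda>k. f j (rsmult C (y k) (T.mat i j k))) (l i)) (l (Suc i))"
  by (rule nsum_cong) (use f_nsum rc in simp)
 also have "\<dots> = nsum N (\<lambda>k. nsum N (\<lambda>j. f j (rsmult C (y k) (T.mat i j k))) (l (Suc i))) (l i)"
  by (rule N.nsum_swap) (use f_closed rc in simp)
 also have "\<dots> = nsum N (\<lambda>k. T.bnd (hm N) i f k (y k)) (l i)"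
  by (rule nsum_cong) (use yc in \<open>simp add: T.bnd_def nsum_hm[OF N]\<close>)
 finally show ?thesis using y by (simp add: Phi_def)
qed

text \<open>Injectivity on the dual complex of the right resolution yields all places of
  \<open>tex\<close>, that is, the counit and Tor. Injectivity on the free resolution of the left
  module \<open>C\<close> yields Ext.\<close>

lemma fpI_Bas:
 fixes N :: "('s, 'c) module"
 assumes N: "N \<in> fpI S n"
 shows "Bas N"
proof -
 have mN: "left_module S N" using N by (simp add: fpI_def)
 interpret N: lmod S N using mN by (simp add: lmod_iff)
 note frS = lm_free[OF CL.ring]
 note inj = inj_exact[OF inf S_small _ _ _ _ _ N]
 define u where "u = uv S 1 0"
 have u: "u \<in> car (fr S 1)" unfolding u_def using CL.ring by simp
 \<comment> \<open>Precomposition with the initial map \<open>DR.E\<close> is \<open>bT\<close>,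
   once \<open>Hom(S, N)\<close> is identified with \<open>N\<close>.\<close>
 have Phi_E: "Phi N (l 0) f (DR.E s) = s 0 \<odot>\<^sub>N bT N (\<lambda>c f. f c) f" if f: "f \<in> car (mpow (l 0) (hm N))" and s: "s \<in> car (fr S 1)" for f s
 proof -
  note f_closed = ahm.closed[OF hm_nth_ahm[OF mN f]]
  have s0: "s 0 \<in> car S" using s by simp
  have tc: "T.cvec k \<in> car CL" for k using T.cvec_closed[of k] by simp
  have "Phi N (l 0) f (DR.E s) = nsum N (\<lambda>k. s 0 \<odot>\<^sub>N f k (T.cvec k)) (l 0)"
   using lhom_closed[OF DR.E_lhom s] s unfolding Phi_def
   by (simp, intro nsum_cong) (use hm_nth_smult[OF mN f _ s0 tc] in \<open>simp add: DR.E_def\<close>)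
  then show ?thesis using N.smult_nsum[OF s0, of "l 0" "\<lambda>k. f k (T.cvec k)"] f_closed[OF _ tc] by (simp add: bT_def)
 qed
 have mh: "left_module R (hm N)" by (rule lm_hm[OF mN])
 \<comment> \<open>Injectivity extends \<open>Phi N (l i) f\<close> along \<open>DR.D i\<close>, and
   the extension is \<open>Phi\<close> of a vector whose boundary is \<open>f\<close>.\<close>
 have step: "\<exists>y \<in> car (mpow (l (Suc i)) (hm N)). T.bnd (hm N) i y = f" if f: "f \<in> car (mpow (l i) (hm N))"
  and z: "\<And>v. v \<in> car (mpow (l i) CL) \<Longrightarrow> DR.D i v = \<zero>\<^bsub>mpow (l (Suc i)) CL\<^esub> \<Longrightarrow> Phi N (l i) f v = \<zero>\<^sub>N" for f i
 proof -
  obtain h where h: "h \<in> lhom S (mpow (l (Suc i)) CL) N" "\<forall>v \<in> car (mpow (l i) CL). Phi N (l i) f v = h (DR.D i v)"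
   using inj[OF C_pow_small(2) powCL DR.FP_pow' DR.D_lhom DR.FP_im_D Phi_lhom[OF mN f] z] by blast
  note P = Psi_closed[OF mN h(1)]
  have "T.bnd (hm N) i (Psi (l (Suc i)) h) = f"
   by (rule Phi_inj[OF mN bnd_closed[OF mh P] f]) (use Phi_bnd[OF mN P] Phi_Psi[OF mN h(1)] h(2) in simp)
  then show ?thesis using P by blast
 qed
 have "tex (hm N) N (\<lambda>c f. f c) i" for i
 proof -
  consider "i = 0" | "i = Suc 0" | i' where "i = Suc (Suc i')" by (metis not0_implies_Suc)
  then show ?thesis
  proof cases
   case 1
   show ?thesis unfolding 1 tex.simps
   proof
    fix y assume y: "y \<in> car N"
    \<comment> \<open>An element of \<open>N\<close> is a homomorphism on the free module of rank
      one; it is extended along \<open>DR.E\<close>.\<close>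
    obtain g where g: "g \<in> lhom S (fr S 1) N" "g u = y"
     using free_lhom_exists[OF mN, of "{..<1}" "\<lambda>_. y"] y unfolding u_def by blast
    interpret g: lhm S "fr S 1" N g by (intro lhmI frS mN g(1))
    have "\<exists>h \<in> lhom S (mpow (l 0) CL) N. \<forall>v \<in> car (fr S 1). g v = h (DR.E v)"
    proof (rule inj[OF C_pow_small(2) frS DR.FP_pow' DR.E_lhom DR.FP_im_E g(1)])
     fix v assume v: "v \<in> car (fr S 1)" "DR.E v = \<zero>\<^bsub>mpow (l 0) CL\<^esub>"
     show "g v = \<zero>\<^sub>N" unfolding DR.E_inj[OF v] by (rule g.zero)
    qed
    then obtain h where h: "h \<in> lhom S (mpow (l 0) CL) N" "\<forall>v \<in> car (fr S 1). g v = h (DR.E v)" by blast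
    have "y = Phi N (l 0) (Psi (l 0) h) (DR.E u)" using h g(2) u Phi_Psi[OF mN h(1)] by simp
    then have "y = u 0 \<odot>\<^sub>N bT N (\<lambda>c f. f c) (Psi (l 0) h)" using Phi_E[OF Psi_closed[OF mN h(1)] u] by simp
    moreover have "bT N (\<lambda>c f. f c) (Psi (l 0) h) \<in> car N"
     using bT_ahom[OF pairing_hm[OF mN]] Psi_closed[OF mN h(1)] by (simp add: ahom_def)
    ultimately have "bT N (\<lambda>c f. f c) (Psi (l 0) h) = y" by (simp add: u_def)
    then show "\<exists>x \<in> car (mpow (l 0) (hm N)). bT N (\<lambda>c f. f c) x = y" using Psi_closed[OF mN h(1)] by blast
   qed
  next
   case 2
   show ?thesis unfolding 2 tex.simps
   proof (intro ballI impI)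
    fix f assume f: "f \<in> car (mpow (l 0) (hm N))" and z: "bT N (\<lambda>c f. f c) f = \<zero>\<^sub>N"
    show "\<exists>y \<in> car (mpow (l (Suc 0)) (hm N)). T.bnd (hm N) 0 y = f"
    proof (rule step[OF f])
     fix v assume v: "v \<in> car (mpow (l 0) CL)" "DR.D 0 v = \<zero>\<^bsub>mpow (l (Suc 0)) CL\<^esub>"
     obtain s where "v = DR.E s" "s \<in> car (fr S 1)" using DR.E_exact[OF v] by (rule imageE)
     then show "Phi N (l 0) f v = \<zero>\<^sub>N" using Phi_E[OF f] z by simp
    qed
   qed
  next
   case (3 i')
   show ?thesis unfolding 3 tex.simps
   proof (intro ballI impI)
    fix f assume f: "f \<in> car (mpow (l (Suc i')) (hm N))" and z: "T.bnd (hm N) i' f = \<zero>\<^bsub>mpow (l i') (hm N)\<^esub>"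
    show "\<exists>y \<in> car (mpow (l (Suc (Suc i'))) (hm N)). T.bnd (hm N) (Suc i') y = f"
    proof (rule step[OF f])
     fix v assume v: "v \<in> car (mpow (l (Suc i')) CL)" "DR.D (Suc i') v = \<zero>\<^bsub>mpow (l (Suc (Suc i'))) CL\<^esub>"
     obtain y where y: "v = DR.D i' y" "y \<in> car (mpow (l i') CL)" using DR.D_exact[OF v] by (rule imageE)
     have "nsum N (\<lambda>j. \<zero>\<^bsub>mpow (l i') (hm N)\<^esub> j (y j)) (l i') = nsum N (\<lambda>j. \<zero>\<^sub>N) (l i')"
      by (rule nsum_cong) (use pow_closed[OF y(2)] in simp)
     then show "Phi N (l (Suc i')) f v = \<zero>\<^sub>N"
      unfolding y(1) Phi_bnd[OF mN f y(2)] z using y(2) by (simp add: Phi_def)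
    qed
   qed
  qed
 qed
 moreover have "Ext_acyclic S (\<lambda>i. fr S (m i)) dL N"
  unfolding Ext_acyclic_def
 proof (intro allI ballI impI)
  fix i g assume g: "g \<in> lhom S (fr S (m (Suc i))) N" "\<forall>x \<in> car (fr S (m (Suc (Suc i)))). g (dL (Suc i) x) = \<zero>\<^sub>N"
  have "\<exists>h \<in> lhom S (fr S (m i)) N. \<forall>v \<in> car (fr S (m (Suc i))). g v = h (dL i v)"
  proof (rule inj[OF fr_small(2) frS FP_fr[OF CL.ring] L.d L.FP_im g(1)])
   fix v assume "v \<in> car (fr S (m (Suc i)))" "dL i v = \<zero>\<^bsub>fr S (m i)\<^esub>"
   from L.exactS[OF this] show "g v = \<zero>\<^sub>N" using g(2) by (elim imageE) simp
  qed
  then show "\<exists>h \<in> lhom S (fr S (m i)) N. \<forall>v \<in> car (fr S (m (Suc i))). g v = h (dL i v)" .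
 qed
 then have "\<forall>i. uex (hm N) N (\<lambda>c f. f c) (Suc (Suc i))" using L.coexact_iff[OF mN] coexact_uex by blast
 then have "\<forall>i. uex (hm N) N (\<lambda>c f. f c) i"
  using uex_hm[OF mN] all_nat_iff[of "uex (hm N) N (\<lambda>c f. f c)"] by (simp del: uex.simps)
 ultimately show ?thesis using pairing_hm[OF mN] mN by (simp add: Bas_def good_def del: uex.simps tex.simps)
qed

end

section \<open>Finite resolutions and coresolutions as iterated short exact sequences\<close>

lemma resolved_le_0:
 assumes mod: "\<And>M. M \<in> \<F> \<Longrightarrow> left_module R M"
  and iso: "\<And>M M'. M \<in> \<F> \<Longrightarrow> left_module R M' \<Longrightarrow> isomorphic R M M' \<Longrightarrow> M' \<in> \<F>"
 shows "resolved_le R \<F> 0 = \<F>"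
proof (intro Set.set_eqI iffI)
 fix N assume "N \<in> resolved_le R \<F> 0"
 then obtain X d where X: "X 0 = N" "exact_onto R (Suc 0) X d" "inj_on (d 0) (car (X (Suc 0)))" "X (Suc 0) \<in> \<F>"
  by (auto simp: resolved_le_def)
 then have "d 0 \<in> lisos R (X (Suc 0)) N" by (auto simp: exact_onto_def lisos_def bij_betw_def)
 moreover have "left_module R N" using X by (auto simp: exact_onto_def)
 ultimately show "N \<in> \<F>" using iso[OF X(4)] by (auto simp: isomorphic_def)
next
 fix N assume N: "N \<in> \<F>"
 show "N \<in> resolved_le R \<F> 0"
  unfolding resolved_le_def exact_onto_def using N mod[OF N] lhom_id[OF mod[OF N]]
  by (auto intro!: exI[of _ "\<lambda>_. N"] exI[of _ "\<lambda>_. \<lambda>x \<in> car N. x"] simp: inj_on_def)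
qed

text \<open>The sequence is cut at its first kernel, or spliced there. All statements about length
  \<open>k\<close> thereby become inductions over short exact sequences.\<close>

lemma resolved_le_Suc:
 "N \<in> resolved_le R \<F> (Suc k) \<longleftrightarrow> (\<exists>K F f g. ses R K F N f g \<and> F \<in> \<F> \<and> K \<in> resolved_le R \<F> k)"
proof
 assume "N \<in> resolved_le R \<F> (Suc k)"
 then obtain X d where X: "X 0 = N" "exact_onto R (Suc (Suc k)) X d" "inj_on (d (Suc k)) (car (X (Suc (Suc k))))"
  "\<forall>i \<le> Suc k. X (Suc i) \<in> \<F>" by (auto simp: resolved_le_def)
 let ?K = "ker_mod (X 1) (X 0) (d 0)"
 let ?X = "\<lambda>i. if i = 0 then ?K else X (Suc i)" and ?d = "\<lambda>i. d (Suc i)"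
 have "exact_onto R (Suc k) ?X ?d" by (rule exact_onto_tail(2)[OF X(2)]) simp
 then have "?K \<in> resolved_le R \<F> k"
  unfolding resolved_le_def using X(3,4) by (intro CollectI exI[of _ ?X] exI[of _ ?d]) auto
 moreover have "ses R ?K (X 1) N (\<lambda>x \<in> lker (X 1) (X 0) (d 0). x) (d 0)"
  using exact_onto_tail(1)[OF X(2)] X(1) by simp
 ultimately show "\<exists>K F f g. ses R K F N f g \<and> F \<in> \<F> \<and> K \<in> resolved_le R \<F> k" using X(4) by fastforce
next
 assume "\<exists>K F f g. ses R K F N f g \<and> F \<in> \<F> \<and> K \<in> resolved_le R \<F> k"
 then obtain K F f g where s: "ses R K F N f g" and F: "F \<in> \<F>" and K: "K \<in> resolved_le R \<F> k" by blast
 interpret s: sesm R K F N f g using s by (simp add: ses_iff)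
 obtain X d where X: "X 0 = K" "exact_onto R (Suc k) X d" "inj_on (d k) (car (X (Suc k)))"
  "\<forall>i \<le> k. X (Suc i) \<in> \<F>" using K by (auto simp: resolved_le_def)
 have Xm: "left_module R (X i)" if "i \<le> Suc k" for i using X(2) that by (simp add: exact_onto_def)
 have dl: "d i \<in> lhom R (X (Suc i)) (X i)" if "i \<le> k" for i using X(2) that by (simp add: exact_onto_def)
 have d0: "d 0 ` car (X (Suc 0)) = car K" using X(1,2) by (simp add: exact_onto_def)
 have d0c: "d 0 x \<in> car K" if "x \<in> car (X (Suc 0))" for x using d0 that by blast
 \<comment> \<open>Splicing: the map in position 1 is the given cover of \<open>K\<close> followed
   by \<open>f\<close>.\<close>
 let ?X = "\<lambda>i. case i of 0 \<Rightarrow> N | Suc 0 \<Rightarrow> F | Suc (Suc j) \<Rightarrow> X (Suc j)"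
 let ?d = "\<lambda>i. case i of 0 \<Rightarrow> g | Suc 0 \<Rightarrow> compose (car (X 1)) f (d 0) | Suc (Suc j) \<Rightarrow> d (Suc j)"
 have ex: "exact_onto R (Suc (Suc k)) ?X ?d"
  unfolding exact_onto_def
 proof (intro conjI allI impI)
  show "left_module R (?X i)" if "i \<le> Suc (Suc k)" for i
   using that s.f.B.left_module s.g.B.left_module Xm by (auto split: nat.split)
  show "?d i \<in> lhom R (?X (Suc i)) (?X i)" if "i < Suc (Suc k)" for i
   using that s.g.lhom lhom_compose[OF Xm[of 1] _ s.f.lhom, of "d 0"] dl[of 0] dl X(1) by (auto split: nat.split)
  show "?d 0 ` car (?X 1) = car (?X 0)" using s.surj by simp
  show "?d (Suc i) ` car (?X (Suc (Suc i))) = lker (?X (Suc i)) (?X i) (?d i)" if i: "Suc i < Suc (Suc k)" for i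
  proof (cases i)
   case 0
   have "compose (car (X 1)) f (d 0) ` car (X 1) = f ` d 0 ` car (X (Suc 0))"
    by (simp add: image_image compose_eq cong: image_cong)
   then show ?thesis using 0 d0 s.exact by simp
  next
   case (Suc j)
   have e: "d (Suc j) ` car (X (Suc (Suc j))) = lker (X (Suc j)) (X j) (d j)"
    using X(2) i Suc by (simp add: exact_onto_def)
   show ?thesis
   proof (cases j)
    case 0
    have "lker (X (Suc 0)) F (compose (car (X 1)) f (d 0)) = lker (X (Suc 0)) K (d 0)"
     using s.f_zero_iff d0c by (auto simp: lker_def compose_eq)
    then show ?thesis using Suc 0 e X(1) by simp
   qed (use Suc e in simp)
  qed
 qed
 have "inj_on (?d (Suc k)) (car (?X (Suc (Suc k))))"
 proof (cases k)
  case 0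
  have "inj_on f (d 0 ` car (X 1))" using s.inj d0 by simp
  then have "inj_on (compose (car (X 1)) f (d 0)) (car (X 1))"
   using X(3) 0 comp_inj_on[of "d 0" "car (X 1)" f] by (simp add: compose_def inj_on_def)
  then show ?thesis using 0 by simp
 qed (use X(3) in simp)
 then show "N \<in> resolved_le R \<F> (Suc k)"
  unfolding resolved_le_def using ex F X(4)
  by (intro CollectI exI[of _ ?X] exI[of _ ?d]) (auto split: nat.split)
qed

lemma coresolved_le_0:
 assumes mod: "\<And>M. M \<in> \<I> \<Longrightarrow> left_module R M"
  and iso: "\<And>M M'. M \<in> \<I> \<Longrightarrow> left_module R M' \<Longrightarrow> isomorphic R M M' \<Longrightarrow> M' \<in> \<I>"
 shows "coresolved_le R \<I> 0 = \<I>"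
proof (intro Set.set_eqI iffI)
 fix N assume "N \<in> coresolved_le R \<I> 0"
 then obtain X d where X: "X 0 = N" "d 0 \<in> lhom R (X 0) (X (Suc 0))" "inj_on (d 0) (car (X 0))"
  "d 0 ` car (X 0) = car (X (Suc 0))" "X (Suc 0) \<in> \<I>" "left_module R (X 0)"
  by (auto simp: coresolved_le_def)
 then have "isomorphic R N (X (Suc 0))" by (auto simp: lisos_def bij_betw_def isomorphic_def)
 then show "N \<in> \<I>" using iso[OF X(5)] isomorphic_sym mod X by blast
next
 fix N assume N: "N \<in> \<I>"
 show "N \<in> coresolved_le R \<I> 0"
  unfolding coresolved_le_def using N mod[OF N] lhom_id[OF mod[OF N]]
  by (auto intro!: exI[of _ "\<lambda>_. N"] exI[of _ "\<lambda>_. \<lambda>x \<in> car N. x"] simp: inj_on_def)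
qed

text \<open>The cut is made at the image of \<open>d 1\<close> inside \<open>X 2\<close>; its
  coresolution starts with the inclusion of that image.\<close>

lemma coresolved_le_Suc:
 "N \<in> coresolved_le R \<I> (Suc k) \<longleftrightarrow> (\<exists>I Z f g. ses R N I Z f g \<and> I \<in> \<I> \<and> Z \<in> coresolved_le R \<I> k)"
proof
 assume "N \<in> coresolved_le R \<I> (Suc k)"
 then obtain X d where X: "X 0 = N" "\<And>i. i \<le> Suc (Suc k) \<Longrightarrow> left_module R (X i)"
  "\<And>i. i \<le> Suc k \<Longrightarrow> d i \<in> lhom R (X i) (X (Suc i))" "inj_on (d 0) (car (X 0))"
  "\<And>i. i < Suc k \<Longrightarrow> d i ` car (X i) = lker (X (Suc i)) (X (Suc (Suc i))) (d (Suc i))"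
  "d (Suc k) ` car (X (Suc k)) = car (X (Suc (Suc k)))" "\<forall>i \<le> Suc k. X (Suc i) \<in> \<I>"
  unfolding coresolved_le_def mem_Collect_eq by (elim exE conjE, intro that) simp_all
 interpret d0: lhm R "X 0" "X 1" "d 0" by (intro lhmI X(2)) (use X(3)[of 0] in auto)
 interpret d1: lhm R "X 1" "X 2" "d 1" by (intro lhmI X(2)) (use X(3)[of 1] in \<open>auto simp: numeral_2_eq_2\<close>)
 let ?Z = "im_mod (X 1) (X 2) (d 1)"
 note mZ = d1.lm_im
 have "ses R N (X 1) ?Z (d 0) (d 1)"
  unfolding ses_def using X(1,4) X(5)[of 0] d0.lhom d0.A.left_module d0.B.left_module mZ lhom_im_mod[OF d1.lhom]
  by (simp add: lker_def numeral_2_eq_2)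
 moreover have "?Z \<in> coresolved_le R \<I> k"
 proof -
  let ?X = "\<lambda>i. if i = 0 then ?Z else X (Suc i)" and ?d = "\<lambda>i. if i = 0 then (\<lambda>x \<in> car ?Z. x) else d (Suc i)"
  have "(\<lambda>x \<in> car ?Z. x) \<in> lhom R ?Z (X 2)"
   using lhom_id[OF mZ] by (rule lhom_submodule_mono) (use d1.closed in auto)
  then have "?d i \<in> lhom R (?X i) (?X (Suc i))" if "i \<le> k" for i
   using X(3)[of "Suc i"] that by (cases i) (simp_all add: numeral_2_eq_2)
  moreover have "?d i ` car (?X i) = lker (?X (Suc i)) (?X (Suc (Suc i))) (?d (Suc i))" if "i < k" for i
   using X(5)[of "Suc i"] that by (cases i) (simp_all add: numeral_2_eq_2)
  moreover have "?d k ` car (?X k) = car (?X (Suc k))" using X(6) by (cases k) (simp_all add: numeral_2_eq_2)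
  moreover have "left_module R (?X i)" if "i \<le> Suc k" for i using X(2)[of "Suc i"] mZ that by simp
  ultimately show ?thesis
   unfolding coresolved_le_def using X(7)
   by (intro CollectI exI[of _ ?X] exI[of _ ?d]) (auto simp: inj_on_def)
 qed
 ultimately show "\<exists>I Z f g. ses R N I Z f g \<and> I \<in> \<I> \<and> Z \<in> coresolved_le R \<I> k" using X(7) by fastforce
next
 assume "\<exists>I Z f g. ses R N I Z f g \<and> I \<in> \<I> \<and> Z \<in> coresolved_le R \<I> k"
 then obtain I Z f g where s: "ses R N I Z f g" and I: "I \<in> \<I>" and Z: "Z \<in> coresolved_le R \<I> k" by blast
 interpret s: sesm R N I Z f g using s by (simp add: ses_iff)
 obtain X d where X: "X 0 = Z" "\<And>i. i \<le> Suc k \<Longrightarrow> left_module R (X i)"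
  "\<And>i. i \<le> k \<Longrightarrow> d i \<in> lhom R (X i) (X (Suc i))" "inj_on (d 0) (car (X 0))"
  "\<And>i. i < k \<Longrightarrow> d i ` car (X i) = lker (X (Suc i)) (X (Suc (Suc i))) (d (Suc i))"
  "d k ` car (X k) = car (X (Suc k))" "\<forall>i \<le> k. X (Suc i) \<in> \<I>"
  using Z unfolding coresolved_le_def mem_Collect_eq by (elim exE conjE, intro that) simp_all
 interpret d0: lhm R Z "X 1" "d 0" by (intro lhmI) (use X(1) X(2)[of 0] X(2)[of 1] X(3)[of 0] in auto)
 let ?X = "\<lambda>i. case i of 0 \<Rightarrow> N | Suc 0 \<Rightarrow> I | Suc (Suc j) \<Rightarrow> X (Suc j)"
 let ?d = "\<lambda>i. case i of 0 \<Rightarrow> f | Suc 0 \<Rightarrow> compose (car I) (d 0) g | Suc (Suc j) \<Rightarrow> d (Suc j)"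
 have dg: "compose (car I) (d 0) g \<in> lhom R I (X 1)" by (rule lhom_compose[OF s.f.B.left_module s.g.lhom d0.lhom])
 have im: "compose (car I) (d 0) g ` car I = d 0 ` car Z"
 proof -
  have "compose (car I) (d 0) g ` car I = d 0 ` g ` car I"
   by (simp add: image_image compose_eq cong: image_cong)
  then show ?thesis using s.surj by simp
 qed
 have "left_module R (?X i)" if "i \<le> Suc (Suc k)" for i
  using that s.f.A.left_module s.f.B.left_module X(2) by (auto split: nat.split)
 moreover have "?d i \<in> lhom R (?X i) (?X (Suc i))" if "i \<le> Suc k" for i
  using that s.f.lhom dg X(3) by (auto split: nat.split)
 moreover have "?d i ` car (?X i) = lker (?X (Suc i)) (?X (Suc (Suc i))) (?d (Suc i))" if i: "i < Suc k" for i
 proof (cases i)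
  case 0
  have inj: "inj_on (d 0) (car Z)" using X(1,4) by simp
  have "d 0 (g x) = \<zero>\<^bsub>X (Suc 0)\<^esub> \<longleftrightarrow> g x = \<zero>\<^sub>Z" if "x \<in> car I" for x
   using d0.inj_on_zeroD[OF inj s.g.closed[OF that]] d0.zero by auto
  then have "lker I (X (Suc 0)) (compose (car I) (d 0) g) = lker I Z g"
   by (auto simp: lker_def compose_eq)
  then show ?thesis using 0 s.exact by simp
 next
  case (Suc j)
  show ?thesis using im X(1) X(5)[of j] i Suc by (cases j) simp_all
 qed
 moreover have "?d (Suc k) ` car (?X (Suc k)) = car (?X (Suc (Suc k)))"
  using im X(1,6) by (cases k) simp_all
 ultimately show "N \<in> coresolved_le R \<I> (Suc k)"
  unfolding coresolved_le_def using s.inj I X(7)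
  by (intro CollectI exI[of _ ?X] exI[of _ ?d]) (auto split: nat.split)
qed

section \<open>Closure of the classes under isomorphism, and zero modules\<close>

lemma fin_presented_left_module: "fin_presented R n M \<Longrightarrow> left_module R M"
 unfolding fin_presented_def exact_onto_def by force

lemma isomorphicE:
 assumes "left_module R A" "left_module R B" "isomorphic R A B"
 obtains e e' where "e \<in> lisos R A B" "e' \<in> lisos R B A"
  "\<And>x. x \<in> car A \<Longrightarrow> e' (e x) = x" "\<And>y. y \<in> car B \<Longrightarrow> e (e' y) = y"
proof -
 obtain e where e: "e \<in> lisos R A B" using assms(3) by (auto simp: isomorphic_def)
 then have b: "bij_betw e (car A) (car B)" by (simp add: lisos_def)
 show ?thesis
  by (rule that[OF e lhom_inv[OF assms(1,2) e]])
   (use bij_betwE[OF b] bij_betw_inv_into_left[OF b] bij_betw_inv_into_right[OF b] in auto)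
qed

lemma fpI_iso:
 fixes M M' :: "('r, 'u) module"
 assumes M: "M \<in> fpI R n" and M': "left_module R M'" and iso: "isomorphic R M M'"
 shows "M' \<in> fpI R n"
proof -
 have mM: "left_module R M" using M by (simp add: fpI_def)
 obtain e e' where "e \<in> lisos R M M'" "e' \<in> lisos R M' M"
  and "\<And>x. x \<in> car M \<Longrightarrow> e' (e x) = x" and e'e: "\<And>y. y \<in> car M' \<Longrightarrow> e (e' y) = y" by (rule isomorphicE[OF mM M' iso], rule that)
 then have e: "e \<in> lhom R M M'" "e' \<in> lhom R M' M" by (auto simp: lisos_def)
 have "(\<lambda>h. compose (car K) h f) ` lhom R L M' = lhom R K M'"
  if K: "fin_presented R n K" and L: "fin_presented R n L" and f: "f \<in> lhom R K L" "inj_on f (car K)"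
  for K L :: "('r, 'u) module" and f
 proof (intro equalityI subsetI)
  note mK = fin_presented_left_module[OF K] and mL = fin_presented_left_module[OF L]
  fix h assume "h \<in> (\<lambda>h. compose (car K) h f) ` lhom R L M'"
  then show "h \<in> lhom R K M'" using lhom_compose[OF mK f(1)] by (elim imageE) simp
 next
  note mK = fin_presented_left_module[OF K] and mL = fin_presented_left_module[OF L]
  fix h assume h: "h \<in> lhom R K M'"
  have "compose (car K) e' h \<in> lhom R K M" by (rule lhom_compose[OF mK h e(2)])
  moreover have "(\<lambda>h. compose (car K) h f) ` lhom R L M = lhom R K M"
   using M K L f unfolding fpI_def by blast
  ultimately have "compose (car K) e' h \<in> (\<lambda>h. compose (car K) h f) ` lhom R L M" by simp
  then obtain g where g: "compose (car K) e' h = compose (car K) g f" "g \<in> lhom R L M" by (rule imageE)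
  note eg = lhom_compose[OF mL g(2) e(1)]
  show "h \<in> (\<lambda>h. compose (car K) h f) ` lhom R L M'"
  proof (rule image_eqI[OF _ eg], rule lhom_eqI[OF h lhom_compose[OF mK f(1) eg]])
   fix x assume x: "x \<in> car K"
   have "e' (h x) = g (f x)" using fun_cong[OF g(1), of x] x by (simp add: compose_eq)
   then show "h x = compose (car K) (compose (car L) e g) f x"
    using e'e[OF lhom_closed[OF h x]] x lhom_closed[OF f(1) x] by (simp add: compose_eq)
  qed
 qed
 then show ?thesis using M' unfolding fpI_def by blast
qed

lemma fpF_iso:
 fixes M M' :: "('r, 'u) module"
 assumes M: "M \<in> fpF R n" and M': "left_module R M'" and iso: "isomorphic R M M'"
 shows "M' \<in> fpF R n"
proof -
 have mM: "left_module R M" using M by (simp add: fpF_def)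
 obtain e e' where "e \<in> lisos R M M'" "e' \<in> lisos R M' M"
  and "\<And>x. x \<in> car M \<Longrightarrow> e' (e x) = x" and e'e: "\<And>y. y \<in> car M' \<Longrightarrow> e (e' y) = y" by (rule isomorphicE[OF mM M' iso], rule that)
 then have e: "e \<in> linear R M M'" "e' \<in> linear R M' M" by (auto simp: lisos_def intro: lhom_linear)
 have "inj_on (tmapl R L M' f) (car (tensor_group R K M'))"
  if K: "fin_presented (op_ring R) n K" and L: "fin_presented (op_ring R) n L"
   and f: "f \<in> lhom (op_ring R) K L" "inj_on f (car K)"
  for K L :: "('r, 'u) module" and f
 proof -
  note mK = fin_presented_left_module[OF K] and mL = fin_presented_left_module[OF L] and fl = lhom_linear[OF f(1)]
  have i: "inj_on (tmapl R L M f) (car (tensor_group R K M))"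
   using M K L f unfolding fpF_def by blast
  show ?thesis
  proof (rule inj_onI)
   let ?g = "tensor_map R K M (\<lambda>a. a) e'" and ?F' = "tmapl R L M' f" and ?F = "tmapl R L M f"
   fix s t assume "s \<in> car (tensor_group R K M')" "t \<in> car (tensor_group R K M')" and eq: "?F' s = ?F' t"
   then have st: "s \<in> car (tens R K M')" "t \<in> car (tens R K M')" by (auto simp: tens_def)
   have sq: "?F (?g u) = tensor_map R L M (\<lambda>a. a) e' (?F' u)" if u: "u \<in> car (tens R K M')" for u
    using tensor_map_comp[OF mK mK mL M' mM mM linear_id fl e(2) linear_id u]
     tensor_map_comp[OF mK mL mL M' M' mM fl linear_id linear_id e(2) u] by simp
   have inv: "tensor_map R K M' (\<lambda>a. a) e (?g u) = u" if u: "u \<in> car (tens R K M')" for u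
    using tensor_map_comp[OF mK mK mK M' mM M' linear_id linear_id e(2,1) u]
     tensor_map_id[OF mK M' u, of "\<lambda>a. a" "\<lambda>m. e (e' m)"] e'e by simp
   have g: "?g u \<in> car (tensor_group R K M)" if u: "u \<in> car (tens R K M')" for u
    using tmap_ahom[OF mK mK M' mM linear_id e(2)] u by (simp add: ahom_def tens_def)
   have "?F (?g s) = ?F (?g t)" unfolding sq[OF st(1)] sq[OF st(2)] eq ..
   then have "?g s = ?g t" by (rule inj_onD[OF i _ g[OF st(1)] g[OF st(2)]])
   then have "tensor_map R K M' (\<lambda>a. a) e (?g s) = tensor_map R K M' (\<lambda>a. a) e (?g t)" by (rule arg_cong)
   then show "s = t" unfolding inv[OF st(1)] inv[OF st(2)] .
  qed
 qed
 then show ?thesis using M' unfolding fpF_def by blast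
qed

lemma zero_tens:
 assumes A: "left_module (op_ring R) A" and M: "left_module R M" "car M = {\<zero>\<^sub>M}"
 shows "car (tens R A M) = {\<zero>\<^bsub>tens R A M\<^esub>}"
proof -
 interpret t: tens_ctx R A M by (rule tens_ctxI[OF A M(1)])
 interpret T: abg "tens R A M" by (rule t.abg_tens)
 have "t = \<zero>\<^bsub>tens R A M\<^esub>" if t: "t \<in> car (tens R A M)" for t
 proof (rule t.tens_eqI[OF t.abg_tens _ ahom_zero[OF t.abg_tens] _ t])
  show "(\<lambda>t. t) \<in> ahom (tens R A M) (tens R A M)" by (simp add: ahom_def)
  show "pt R A M a x = \<zero>\<^bsub>tens R A M\<^esub>" if "a \<in> car A" "x \<in> car M" for a x
   using that M(2) ahm.zero[OF t.pt_r_ahm[OF that(1)]] by simp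
 qed
 then show ?thesis using T.zero_closed by (intro equalityI subsetI) simp_all
qed

lemma zero_lhom:
 assumes A: "left_module R A" and M: "left_module R M" "car M = {\<zero>\<^sub>M}"
 shows "lhom R A M = {\<lambda>x \<in> car A. \<zero>\<^sub>M}"
proof -
 have "h = (\<lambda>x \<in> car A. \<zero>\<^sub>M)" if h: "h \<in> lhom R A M" for h
  by (rule lhom_eqI[OF h lhom_zero[OF A M(1)]]) (use lhom_closed[OF h] M(2) in auto)
 then show ?thesis using lhom_zero[OF A M(1)] by blast
qed

lemma zero_fpI:
 fixes M :: "('r, 'u) module"
 assumes M: "left_module R M" "car M = {\<zero>\<^sub>M}"
 shows "M \<in> fpI R n"
proof -
 have "(\<lambda>h. compose (car K) h f) ` lhom R L M = lhom R K M"
  if "fin_presented R n K" "fin_presented R n L" "f \<in> lhom R K L" for K L :: "('r, 'u) module" and f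
  unfolding zero_lhom[OF fin_presented_left_module[OF that(1)] M] zero_lhom[OF fin_presented_left_module[OF that(2)] M]
  using lhom_closed[OF that(3)] by (auto simp: compose_def intro!: restrict_ext)
 then show ?thesis using M(1) by (simp add: fpI_def)
qed

lemma zero_fpF:
 fixes M :: "('r, 'u) module"
 assumes M: "left_module R M" "car M = {\<zero>\<^sub>M}"
 shows "M \<in> fpF R n"
proof -
 have "inj_on h (car (tensor_group R K M))" if "fin_presented (op_ring R) n K"
  for K :: "('r, 'u) module" and h :: "('u \<times> 'u \<Rightarrow>\<^sub>0 int) set \<Rightarrow> ('u \<times> 'u \<Rightarrow>\<^sub>0 int) set"
  using zero_tens[OF fin_presented_left_module[OF that] M] by (simp add: tens_def)
 then show ?thesis using M(1) by (simp add: fpF_def)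
qed

lemma ses_zero_left:
 assumes "left_module R M" "left_module R Z" "car Z = {\<zero>\<^sub>Z}"
 shows "ses R Z M M (\<lambda>x \<in> car Z. \<zero>\<^sub>M) (\<lambda>x \<in> car M. x)"
proof -
 interpret M: lmod R M using assms(1) by (simp add: lmod_iff)
 show ?thesis
  using assms lhom_zero[OF assms(2,1)] lhom_id[OF assms(1)] by (intro sesI) (auto simp: inj_on_def)
qed

lemma ses_zero_right:
 assumes "left_module R M" "left_module R Z" "car Z = {\<zero>\<^sub>Z}"
 shows "ses R M M Z (\<lambda>x \<in> car M. x) (\<lambda>x \<in> car M. \<zero>\<^sub>Z)"
proof -
 interpret M: lmod R M using assms(1) by (simp add: lmod_iff)
 show ?thesis
  using assms lhom_zero[OF assms(1,2)] lhom_id[OF assms(1)] by (intro sesI) (auto simp: inj_on_def intro: M.zero_closed)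
qed

text \<open>What is used of the four classes in question: they consist of modules, are closed under
 isomorphism and contain the zero modules.\<close>

locale mod_class =
 fixes R :: "'r ring" and \<F> :: "('r, 'u) module set"
 assumes ring: "ring R" and mod: "M \<in> \<F> \<Longrightarrow> left_module R M"
  and iso: "M \<in> \<F> \<Longrightarrow> left_module R M' \<Longrightarrow> isomorphic R M M' \<Longrightarrow> M' \<in> \<F>"
  and zero: "left_module R Z \<Longrightarrow> car Z = {\<zero>\<^sub>Z} \<Longrightarrow> Z \<in> \<F>"
begin

lemma zm: "left_module R (zero_mod z)" by (rule lm_zero_mod[OF ring])

text \<open>The first term is \<open>M\<close> itself with zero kernel, and the zero module is a
  member of the class, hence resolved to any length by induction.\<close>

lemma sub_resolved: "M \<in> \<F> \<Longrightarrow> M \<in> resolved_le R \<F> k"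
proof (induction k arbitrary: M)
 case 0
 then show ?case using resolved_le_0[of \<F> R] mod iso by blast
next
 case (Suc k)
 let ?Z = "zero_mod undefined :: ('r, 'u) module"
 have "ses R ?Z M M (\<lambda>x \<in> car ?Z. \<zero>\<^sub>M) (\<lambda>x \<in> car M. x)"
  by (rule ses_zero_left[OF mod[OF Suc.prems] zm]) simp
 moreover have "?Z \<in> \<F>" by (rule zero[OF zm]) simp
 ultimately show ?case unfolding resolved_le_Suc using Suc by blast
qed

lemma sub_coresolved: "M \<in> \<F> \<Longrightarrow> M \<in> coresolved_le R \<F> k"
proof (induction k arbitrary: M)
 case 0
 then show ?case using coresolved_le_0[of \<F> R] mod iso by blast
next
 case (Suc k)
 let ?Z = "zero_mod undefined :: ('r, 'u) module"
 have "ses R M M ?Z (\<lambda>x \<in> car M. x) (\<lambda>x \<in> car M. \<zero>\<^sub>?Z)"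
  by (rule ses_zero_right[OF mod[OF Suc.prems] zm]) simp
 moreover have "?Z \<in> \<F>" by (rule zero[OF zm]) simp
 ultimately show ?case unfolding coresolved_le_Suc using Suc by blast
qed

lemma resolved_induct:
 assumes "M \<in> resolved_le R \<F> k" and base: "\<And>M. M \<in> \<F> \<Longrightarrow> P 0 M"
  and step: "\<And>k K F M f g. ses R K F M f g \<Longrightarrow> F \<in> \<F> \<Longrightarrow> K \<in> resolved_le R \<F> k \<Longrightarrow> P k K \<Longrightarrow> P (Suc k) M"
 shows "P k M"
 using assms(1)
proof (induction k arbitrary: M)
 case 0
 then show ?case using resolved_le_0[of \<F> R] mod iso base by blast
next
 case (Suc k)
 then show ?case using step unfolding resolved_le_Suc by blast
qed

lemma coresolved_induct:
 assumes "M \<in> coresolved_le R \<F> k" and base: "\<And>M. M \<in> \<F> \<Longrightarrow> P 0 M"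
  and step: "\<And>k M I Z f g. ses R M I Z f g \<Longrightarrow> I \<in> \<F> \<Longrightarrow> Z \<in> coresolved_le R \<F> k \<Longrightarrow> P k Z \<Longrightarrow> P (Suc k) M"
 shows "P k M"
 using assms(1)
proof (induction k arbitrary: M)
 case 0
 then show ?case using coresolved_le_0[of \<F> R] mod iso base by blast
next
 case (Suc k)
 then show ?case using step unfolding coresolved_le_Suc by blast
qed

end

section \<open>Functors and exact sequences on copies of modules\<close>

lemma carrier_small [simp]: "car M \<lesssim> (UNIV :: 'u set)" for M :: "('r, 'u) module"
 by (simp add: subset_imp_lepoll)

lemma copy_map_code:
 fixes M :: "('r, 'm) module"
 assumes "car M \<lesssim> (UNIV :: 'u set)" "x \<in> car M"
 shows "copy_map M N f (code M x :: 'u) = code N (f x)"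
 using assms by (simp add: copy_map_def)

lemma copy_map_lhom:
 fixes M :: "('r, 'm) module" and N :: "('r, 'n) module"
 assumes M: "left_module R M" "car M \<lesssim> (UNIV :: 'u set)" and N: "left_module R N" "car N \<lesssim> (UNIV :: 'u set)"
  and f: "f \<in> linear R M N"
 shows "(copy_map M N f :: 'u \<Rightarrow> 'u) \<in> lhom R (copy M) (copy N)"
proof -
 interpret M: lmod R M using M by (simp add: lmod_iff)
 note [simp] = linearD[OF f] decode_code[OF M(2)] decode_code[OF N(2)]
 show ?thesis unfolding copy_map_def copy_simps(1)[symmetric]
  by (rule restrict_lhomI[OF lm_copy[OF M]]) auto
qed

lemma copy_ses:
 fixes A :: "('r, 'a) module" and B :: "('r, 'b) module" and Z :: "('r, 'z) module"
 assumes A: "left_module R A" "car A \<lesssim> (UNIV :: 'u set)" and B: "left_module R B" "car B \<lesssim> (UNIV :: 'u set)"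
  and Z: "left_module R Z" "car Z \<lesssim> (UNIV :: 'u set)"
  and f: "f \<in> linear R A B" and g: "g \<in> linear R B Z" and s: "gses A B Z f g"
 shows "ses R (copy A :: ('r, 'u) module) (copy B :: ('r, 'u) module) (copy Z :: ('r, 'u) module) (copy_map A B f) (copy_map B Z g)"
proof -
 interpret s: gsesl A B Z f g using s by (simp add: gses_iff)
 note F = copy_map_code[OF A(2), of _ B f] and G = copy_map_code[OF B(2), of _ Z g]
 note iA = inj_onD[OF inj_code[OF A(2)]] and iB = inj_onD[OF inj_code[OF B(2)]] and iZ = inj_onD[OF inj_code[OF Z(2)]]
 have "inj_on (copy_map A B f :: 'u \<Rightarrow> 'u) (car (copy A))"
 proof (rule inj_onI)
  fix x y assume "x \<in> car (copy A)" "y \<in> car (copy A)" and eq: "copy_map A B f x = (copy_map A B f y :: 'u)"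
  then obtain a b where ab: "a \<in> car A" "b \<in> car A" "x = code A a" "y = code A b" by auto
  have "f a = f b" by (rule iB) (use eq F ab in simp_all)
  then show "x = y" using s.inj[OF ab(1,2)] ab by simp
 qed
 moreover have "\<exists>y \<in> car (copy B :: ('r, 'u) module). copy_map B Z g y = z" if z: "z \<in> car (copy Z)" for z :: 'u
 proof -
  obtain w where w: "w \<in> car Z" "z = code Z w" using z by auto
  obtain b where b: "b \<in> car B" "g b = w" using s.onto[OF w(1)] by blast
  show ?thesis by (rule bexI[of _ "code B b"]) (use b w G in auto)
 qed
 moreover have "copy_map B Z g (copy_map A B f x) = (\<zero>\<^bsub>copy Z\<^esub> :: 'u)" if x: "x \<in> car (copy A)" for x :: 'u
 proof -
  obtain a where "a \<in> car A" "x = code A a" using x by auto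
  then show ?thesis using F G by simp
 qed
 moreover have "\<exists>x \<in> car (copy A :: ('r, 'u) module). copy_map A B f x = y"
  if y: "y \<in> car (copy B)" and z: "copy_map B Z g y = (\<zero>\<^bsub>copy Z\<^esub> :: 'u)" for y :: 'u
 proof -
  obtain b where b: "b \<in> car B" "y = code B b" using y by auto
  have "g b = \<zero>\<^sub>Z" by (rule iZ) (use z b G in simp_all)
  then obtain a where a: "a \<in> car A" "f a = b" using s.ex[OF b(1)] by blast
  show ?thesis by (rule bexI[of _ "code A a"]) (use a b F in auto)
 qed
 ultimately show ?thesis
  using copy_map_lhom[OF A B f] copy_map_lhom[OF B Z g] lm_copy[OF A] lm_copy[OF B] lm_copy[OF Z]
  by (intro sesI) blast+
qed

lemma full_subcat_simps [simp]:
 "Obj (full_subcat R \<M>) = \<M>" "Arr (full_subcat R \<M>) = lhom R"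
 "Comp (full_subcat R \<M>) = (\<lambda>X g f. compose (car X) g f)" "Ident (full_subcat R \<M>) = (\<lambda>X. \<lambda>x \<in> car X. x)"
 by (simp_all add: full_subcat_def)

text \<open>Both functors in one statement: \<open>T\<close> gives the concrete objects and
  \<open>F\<close> the concrete action on maps, known only on carriers. Copying makes the arrows
  extensional, which turns the functor laws into equalities of functions.\<close>

lemma copy_is_functor:
 fixes T :: "('r, 'm) module \<Rightarrow> ('s, 'n) module" and \<N> :: "('s, 'u) module set"
 assumes T: "\<And>X. X \<in> \<M> \<Longrightarrow> left_module S (T X) \<and> car (T X) \<lesssim> (UNIV :: 'u set)"
  and id: "\<And>X t. X \<in> \<M> \<Longrightarrow> t \<in> car (T X) \<Longrightarrow> F X X (\<lambda>x \<in> car X. x) t = t"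
  and lin: "\<And>X Y f. X \<in> \<M> \<Longrightarrow> Y \<in> \<M> \<Longrightarrow> f \<in> lhom R X Y \<Longrightarrow> F X Y f \<in> linear S (T X) (T Y)"
  and comp: "\<And>X Y f Z g t. X \<in> \<M> \<Longrightarrow> Y \<in> \<M> \<Longrightarrow> f \<in> lhom R X Y \<Longrightarrow> Z \<in> \<M> \<Longrightarrow> g \<in> lhom R Y Z \<Longrightarrow>
   t \<in> car (T X) \<Longrightarrow> F X Z (compose (car X) g f) t = F Y Z g (F X Y f t)"
  and \<M>: "\<And>X. X \<in> \<M> \<Longrightarrow> left_module R X" and \<N>: "\<And>X. X \<in> \<M> \<Longrightarrow> copy (T X) \<in> \<N>"
  and \<Phi>: "\<And>X. fst \<Phi> X = copy (T X)" "\<And>X Y f. snd \<Phi> X Y f = copy_map (T X) (T Y) (F X Y f)"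
 shows "is_functor (full_subcat R \<M>) (full_subcat S \<N>) \<Phi>"
proof -
 have hom: "copy_map (T X) (T Y) (F X Y f) \<in> lhom S (copy (T X) :: ('s, 'u) module) (copy (T Y) :: ('s, 'u) module)"
  if "X \<in> \<M>" "Y \<in> \<M>" "f \<in> lhom R X Y" for X Y f
  using T that by (intro copy_map_lhom lin) auto
 have cm: "left_module S (copy (T X) :: ('s, 'u) module)" if "X \<in> \<M>" for X
  using T[OF that] lm_copy by blast
 have c: "copy_map (T X) (T Y) f (code (T X) t :: 'u) = code (T Y) (f t)" if "X \<in> \<M>" "t \<in> car (T X)" for X Y f t
  using T that by (intro copy_map_code) auto
 show ?thesis
  unfolding is_functor_def full_subcat_simps \<Phi>
 proof (intro conjI ballI)
  fix X assume X: "X \<in> \<M>"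
  show "copy_map (T X) (T X) (F X X (\<lambda>x \<in> car X. x)) = (\<lambda>x \<in> car (copy (T X) :: ('s, 'u) module). x)"
   by (rule lhom_eqI[OF hom[OF X X lhom_id[OF \<M>[OF X]]] lhom_id[OF cm[OF X]]]) (auto simp: c X id)
  fix Y Z f g assume *: "Y \<in> \<M>" "Z \<in> \<M>" "f \<in> lhom R X Y" "g \<in> lhom R Y Z"
  show "copy_map (T X) (T Z) (F X Z (compose (car X) g f)) = compose (car (copy (T X) :: ('s, 'u) module))
    (copy_map (T Y) (T Z) (F Y Z g)) (copy_map (T X) (T Y) (F X Y f))"
   by (rule lhom_eqI[OF hom[OF X *(2) lhom_compose[OF \<M>[OF X] *(3,4)]]
      lhom_compose[OF cm[OF X] hom[OF X *(1,3)] hom[OF *(1,2,4)]]])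
    (auto simp: c X * compose_eq comp[OF X *(1,3,2,4)] linearD(1)[OF lin[OF X *(1,3)]])
 qed (use hom \<N> in auto)
qed

lemma lisos_cat_isos:
 assumes X: "left_module R X" and Y: "left_module R Y" and f: "f \<in> lisos R X Y"
 shows "f \<in> cat_isos (full_subcat R \<M>) X Y"
proof -
 have b: "bij_betw f (car X) (car Y)" and fl: "f \<in> lhom R X Y" using f by (auto simp: lisos_def)
 let ?g = "restrict (inv_into (car X) f) (car Y)"
 have "?g \<in> lhom R Y X" using lhom_inv[OF X Y f] by (simp add: lisos_def)
 moreover have "compose (car X) ?g f = (\<lambda>x \<in> car X. x)" "compose (car Y) f ?g = (\<lambda>y \<in> car Y. y)"
  using bij_betw_inv_into_left[OF b] bij_betw_inv_into_right[OF b] lhom_closed[OF fl]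
  by (auto simp: compose_def intro!: restrict_ext)
 ultimately show ?thesis using fl by (auto simp: cat_isos_def)
qed

context semid
begin

lemma good_lisos:
 assumes "good M N \<beta>"
 shows "adjR M \<beta> \<in> lisos R M (hm N)" "adjL M N \<beta> \<in> lisos S (tm M) N"
 using assms adjR_lisos_iff adjL_lisos_iff unfolding good_def by blast+

text \<open>Composing the pairing of \<open>Y\<close> with \<open>tm Y\<close> with an isomorphism
  onto \<open>N\<close> gives a good pairing of \<open>Y\<close> with \<open>N\<close>, whose
  \<open>adjR\<close> is the required isomorphism.\<close>

lemma isomorphic_hm_of_tm:
 assumes Y: "Aus Y" and N: "left_module S N" and iso: "isomorphic S N (tm Y)"
 shows "isomorphic R Y (hm N)"
proof -
 have mY: "left_module R Y" and g: "good Y (tm Y) (pt R CR Y)" using Y by (simp_all add: Aus_def)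
 obtain e where e: "e \<in> lisos S (tm Y) N"
  using isomorphic_sym[OF N lm_tm[OF mY] iso] by (auto simp: isomorphic_def)
 from good_lisos(1)[OF good_post[OF g N e]] show ?thesis by (auto simp: isomorphic_def)
qed

lemma isomorphic_tm_of_hm:
 assumes X: "Bas X" and M: "left_module R M" and iso: "isomorphic R M (hm X)"
 shows "isomorphic S (tm M) X"
proof -
 have g: "good (hm X) X (\<lambda>c f. f c)" using X by (simp add: Bas_def)
 obtain f where f: "f \<in> lisos R M (hm X)" using iso by (auto simp: isomorphic_def)
 from good_lisos(2)[OF good_pre[OF g M f]] show ?thesis by (auto simp: isomorphic_def)
qed

end

context faithful_semid
begin

abbreviation tcopy :: "('r, 'c) module \<Rightarrow> ('s, 'c) module" where "tcopy M \<equiv> copy (tm M)"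
abbreviation hcopy :: "('s, 'c) module \<Rightarrow> ('r, 'c) module" where "hcopy N \<equiv> copy (hm N)"

lemma tm_props: "left_module R M \<Longrightarrow> left_module S (tm M)" "left_module R M \<Longrightarrow> car (tm M) \<lesssim> (UNIV :: 'c set)"
 "left_module R M \<Longrightarrow> left_module S (tcopy M)" for M :: "('r, 'c) module"
 using lm_tm[of M] tm_small[of M] lm_copy[of S "tm M"] by (simp_all del: tensor_mod_simps)

lemma hm_props: "left_module S N \<Longrightarrow> left_module R (hm N)" "left_module S N \<Longrightarrow> car (hm N) \<lesssim> (UNIV :: 'c set)"
 "left_module S N \<Longrightarrow> left_module R (hcopy N)" for N :: "('s, 'c) module"
 using lm_hm[of N] hm_small[of N] lm_copy[of R "hm N"] by (simp_all del: hom_mod_simps)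

lemma tcopy_ses:
 assumes ses: "ses R A B Z f g" and Z: "Aus Z"
 shows "\<exists>f' g'. ses S (tcopy A) (tcopy B) (tcopy Z) f' g'"
proof -
 have m: "left_module R A" "left_module R B" "left_module R Z" "f \<in> linear R A B" "g \<in> linear R B Z"
  using ses lhom_linear by (auto simp: ses_def)
 have "gses (tm A) (tm B) (tm Z) (tmap B f) (tmap Z g)" by (rule tens_gses[OF ses Aus_tmap_inj[OF ses Z]])
 then show ?thesis using copy_ses[OF tm_props(1,2)[OF m(1)] tm_props(1,2)[OF m(2)] tm_props(1,2)[OF m(3)]
   tmap_linear[OF m(1,2,4)] tmap_linear[OF m(2,3,5)]] by blast
qed

lemma hcopy_ses:
 assumes ses: "ses S A B Z f g" and A: "Bas A"
 shows "\<exists>f' g'. ses R (hcopy A) (hcopy B) (hcopy Z) f' g'"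
proof -
 have m: "left_module S A" "left_module S B" "left_module S Z" "f \<in> lhom S A B" "g \<in> lhom S B Z"
  using ses by (auto simp: ses_def)
 show ?thesis using copy_ses[OF hm_props(1,2)[OF m(1)] hm_props(1,2)[OF m(2)] hm_props(1,2)[OF m(3)]
   hmap_linear[OF m(1,2,4)] hmap_linear[OF m(2,3,5)] Bas_hom_gses[OF ses A]] by blast
qed

lemma tensor_functor_simps:
 "fst (tensor_functor R C) M = tcopy M" "snd (tensor_functor R C) M M' f = copy_map (tm M) (tm M') (tmap M' f)"
 by (simp_all add: tensor_functor_def tmap_def)

lemma hom_functor_simps:
 "fst (hom_functor S C) N = hcopy N" "snd (hom_functor S C) N N' f = copy_map (hm N :: ('r, _) module) (hm N') (hmap f)"
 by (simp_all add: hom_functor_def hmap_def)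

lemma tensor_is_functor:
 assumes \<M>: "\<And>M. M \<in> \<M> \<Longrightarrow> left_module R M" and "\<And>M. M \<in> \<M> \<Longrightarrow> tcopy M \<in> \<N>"
 shows "is_functor (full_subcat R \<M>) (full_subcat S \<N>) (tensor_functor R C)"
proof (rule copy_is_functor[where T = tm and F = "\<lambda>X. tmap"])
 fix X assume "X \<in> \<M>"
 then have X: "left_module R X" by (rule \<M>)
 show "left_module S (tm X) \<and> car (tm X) \<lesssim> (UNIV :: 'c set)" using tm_props[OF X] by blast
 show "tmap X (\<lambda>x \<in> car X. x) t = t" if "t \<in> car (tm X)" for t
  unfolding tmap_def by (rule tensor_map_id[OF CR X]) (use that in simp_all)
 fix Y f assume "Y \<in> \<M>" and f: "f \<in> lhom R X Y"
 then have Y: "left_module R Y" by (intro \<M>)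
 show tf: "tmap Y f \<in> linear S (tm X) (tm Y)" by (rule tmap_linear[OF X Y lhom_linear[OF f]])
 fix Z g t assume "Z \<in> \<M>" and g: "g \<in> lhom R Y Z" and t: "t \<in> car (tm X)"
 then have Z: "left_module R Z" by (intro \<M>)
 note tg = tmap_linear[OF Y Z lhom_linear[OF g]] and gf = lhom_linear[OF lhom_compose[OF X f g]]
 interpret tX: tens_ctx R CR X by (rule tens_ctxI[OF CR X])
 interpret tZ: tens_ctx R CR Z by (rule tens_ctxI[OF CR Z])
 have t': "t \<in> car (tens R CR X)" using t by simp
 have a: "tmap Z (compose (car X) g f) \<in> ahom (tens R CR X) (tens R CR Z)"
  "tmap Y f \<in> ahom (tens R CR X) (tens R CR Y)" "tmap Z g \<in> ahom (tens R CR Y) (tens R CR Z)"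
  using tmap_linear[OF X Z gf] tf tg by (auto simp: linear_def ahom_def)
 show "tmap Z (compose (car X) g f) t = tmap Z g (tmap Y f t)"
 proof (rule tX.tens_eqI[OF tZ.abg_tens a(1) ahom_comp[OF a(2,3)] _ t'])
  fix c x assume "c \<in> car CR" "x \<in> car X"
  then show "tmap Z (compose (car X) g f) (pt R CR X c x) = tmap Z g (tmap Y f (pt R CR X c x))"
   using tmap_pt[OF X Z gf, of c x] tmap_pt[OF X Y lhom_linear[OF f], of c x]
    tmap_pt[OF Y Z lhom_linear[OF g], of c "f x"] lhom_closed[OF f] by (simp add: compose_eq)
 qed
qed (use assms in \<open>simp_all add: tensor_functor_simps\<close>)

lemma hom_is_functor:
 assumes \<N>: "\<And>N. N \<in> \<N> \<Longrightarrow> left_module S N" and "\<And>N. N \<in> \<N> \<Longrightarrow> hcopy N \<in> \<M>"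
 shows "is_functor (full_subcat S \<N>) (full_subcat R \<M>) (hom_functor S C)"
proof (rule copy_is_functor[where T = hm and F = "\<lambda>X Y. hmap"])
 fix X assume "X \<in> \<N>"
 then have X: "left_module S X" by (rule \<N>)
 show "left_module R (hm X) \<and> car (hm X) \<lesssim> (UNIV :: 'c set)" using hm_props[OF X] by blast
 show "hmap (\<lambda>x \<in> car X. x) h = h" if h: "h \<in> car (hm X)" for h
 proof -
  have hl: "h \<in> lhom S CL X" using h by simp
  show ?thesis
   by (rule lhom_eqI[OF _ hl, of _ X]) (use linearD(1)[OF hmap_linear[OF X X lhom_id[OF X]] h] lhom_closed[OF hl] in auto)
 qed
 fix Y f assume "Y \<in> \<N>" and f: "f \<in> lhom S X Y"
 then show "hmap f \<in> linear R (hm X) (hm Y)" by (intro hmap_linear X \<N>)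
 show "hmap (compose (car X) g f) h = hmap g (hmap f h)" if "h \<in> car (hm X)" for g h
  using that lhom_closed[of h S CL X] by (auto simp: hmap_def compose_def intro!: restrict_ext)
qed (use assms in \<open>simp_all add: hom_functor_simps\<close>)

end

section \<open>Unit and counit of the copied functors, and the criterion for an equivalence\<close>

context faithful_semid
begin

text \<open>The universal pairing with values in the copy of \<open>tm M\<close>. It is good since
  coding is an isomorphism, so the unit for the copies is its \<open>adjR\<close> followed by one
  more coding.\<close>

definition unit_pairing :: "('r, 'c) module \<Rightarrow> 'c \<Rightarrow> 'c \<Rightarrow> 'c" where
 "unit_pairing M = (\<lambda>c x. restrict (code (tm M)) (car (tm M)) (pt R CR M c x))"

definition unit_iso :: "('r, 'c) module \<Rightarrow> 'c \<Rightarrow> 'c" where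
 "unit_iso M = compose (car M) (restrict (code (hm (tcopy M))) (car (hm (tcopy M)))) (adjR M (unit_pairing M))"

text \<open>Evaluation, where the homomorphism is given by its code in the copy of
  \<open>hm N\<close>.\<close>

definition counit_pairing :: "('s, 'c) module \<Rightarrow> 'c \<Rightarrow> 'c \<Rightarrow> 'c" where
 "counit_pairing N = (\<lambda>c y. restrict (decode (hm N)) (car (hcopy N)) y c)"

definition counit_iso :: "('s, 'c) module \<Rightarrow> 'c \<Rightarrow> 'c" where
 "counit_iso N = compose (car (tcopy (hcopy N))) (adjL (hcopy N) N (counit_pairing N))
  (restrict (decode (tm (hcopy N))) (car (tcopy (hcopy N))))"

lemma unit_pairing_eq: 
 fixes M :: "('r, 'c) module"
 assumes M: "left_module R M" and c: "c \<in> car C" "x \<in> car M"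
 shows "unit_pairing M c x = code (tm M) (pt R CR M c x)"
proof -
 interpret t: tens_ctx R CR M by (rule tens_ctxI[OF CR M])
 show ?thesis using c by (simp add: unit_pairing_def)
qed

lemma unit_iso:
 fixes M :: "('r, 'c) module"
 assumes A: "Aus M"
 shows "unit_iso M \<in> lisos R M (hcopy (tcopy M))" and "adjR M (unit_pairing M) \<in> lhom R M (hm (tcopy M))"
proof -
 have M: "left_module R M" and g: "good M (tm M) (pt R CR M)" using A by (simp_all add: Aus_def)
 note T = tm_props(3)[OF M]
 have "good M (tcopy M) (unit_pairing M)"
  unfolding unit_pairing_def by (rule good_post[OF g T code_lisos[OF tm_props(1,2)[OF M]]])
 then have a: "adjR M (unit_pairing M) \<in> lisos R M (hm (tcopy M))" by (rule good_lisos)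
 then show "adjR M (unit_pairing M) \<in> lhom R M (hm (tcopy M))" by (simp add: lisos_def)
 show "unit_iso M \<in> lisos R M (hcopy (tcopy M))"
  unfolding unit_iso_def by (rule lisos_compose[OF M a code_lisos[OF hm_props(1,2)[OF T]]])
qed

lemma unit_iso_natural:
 fixes M M' :: "('r, 'c) module"
 assumes A: "Aus M" "Aus M'" and f: "f \<in> lhom R M M'"
 shows "compose (car M) (unit_iso M') f =
  compose (car M) (copy_map (hm (tcopy M)) (hm (tcopy M')) (hmap (copy_map (tm M) (tm M') (tmap M' f)))) (unit_iso M)"
proof (rule extensionalityI[of _ "car M"])
 fix x assume x: "x \<in> car M"
 have M: "left_module R M" "left_module R M'" using A by (auto simp: Aus_def)
 note T = tm_props(3)[OF M(1)] tm_props(3)[OF M(2)]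
 have fx: "f x \<in> car M'" by (rule lhom_closed[OF f x])
 interpret t: tens_ctx R CR M by (rule tens_ctxI[OF CR M(1)])
 let ?a = "adjR M (unit_pairing M) x" and ?F = "copy_map (tm M) (tm M') (tmap M' f) :: 'c \<Rightarrow> 'c"
 have a: "?a \<in> car (hm (tcopy M))" "adjR M' (unit_pairing M') (f x) \<in> car (hm (tcopy M'))"
  by (rule lhom_closed[OF unit_iso(2)[OF A(1)] x]) (rule lhom_closed[OF unit_iso(2)[OF A(2)] fx])
 have "hmap ?F ?a = adjR M' (unit_pairing M') (f x)"
 proof -
  have "?F (unit_pairing M c x) = unit_pairing M' c (f x)" if c: "c \<in> car C" for c
  proof -
   have p: "pt R CR M c x \<in> car (tm M)" using t.pt_closed[of c x] c x by simp
   show ?thesis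
    unfolding unit_pairing_eq[OF M(1) c x] unit_pairing_eq[OF M(2) c fx] copy_map_code[OF tm_props(2)[OF M(1)] p]
     tmap_pt[OF M lhom_linear[OF f] c x] ..
  qed
  then show ?thesis using x fx by (auto simp: hmap_def adjR_def compose_def intro!: restrict_ext)
 qed
 then show "compose (car M) (unit_iso M') f x =
   compose (car M) (copy_map (hm (tcopy M)) (hm (tcopy M')) (hmap ?F)) (unit_iso M) x"
  using x fx a by (simp add: compose_eq unit_iso_def copy_map_code[OF hm_props(2)[OF T(1)] a(1)] del: hom_mod_simps)
qed (simp_all add: compose_def)

lemma counit_iso:
 fixes N :: "('s, 'c) module"
 assumes B: "Bas N"
 shows "counit_iso N \<in> lisos S (tcopy (hcopy N)) N" and "pairing (hcopy N) N (counit_pairing N)"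
proof -
 have N: "left_module S N" and g: "good (hm N) N (\<lambda>c f. f c)" using B by (simp_all add: Bas_def)
 note H = hm_props(3)[OF N]
 have g': "good (hcopy N) N (counit_pairing N)"
  unfolding counit_pairing_def by (rule good_pre[OF g H decode_lisos[OF hm_props(1,2)[OF N]]])
 then show "pairing (hcopy N) N (counit_pairing N)" by (simp add: good_def)
 show "counit_iso N \<in> lisos S (tcopy (hcopy N)) N"
  unfolding counit_iso_def
  by (rule lisos_compose[OF tm_props(3)[OF H] decode_lisos[OF tm_props(1,2)[OF H]] good_lisos(2)[OF g']])
qed

lemma counit_iso_natural:
 fixes N N' :: "('s, 'c) module"
 assumes B: "Bas N" "Bas N'" and f: "f \<in> lhom S N N'"
 shows "compose (car (tcopy (hcopy N))) (counit_iso N')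
   (copy_map (tm (hcopy N)) (tm (hcopy N')) (tmap (hcopy N') (copy_map (hm N) (hm N') (hmap f)))) =
  compose (car (tcopy (hcopy N))) f (counit_iso N)"
proof (rule extensionalityI[of _ "car (tcopy (hcopy N))"])
 have N: "left_module S N" "left_module S N'" using B by (auto simp: Bas_def)
 note H = hm_props(3)[OF N(1)] hm_props(3)[OF N(2)]
 note p = counit_iso(2)[OF B(1)] counit_iso(2)[OF B(2)]
 let ?F = "copy_map (hm N) (hm N') (hmap f) :: 'c \<Rightarrow> 'c"
 have F: "?F \<in> lhom R (hcopy N) (hcopy N')"
  by (rule copy_map_lhom[OF hm_props(1,2)[OF N(1)] hm_props(1,2)[OF N(2)] hmap_linear[OF N f]])
 note tF = tmap_linear[OF H lhom_linear[OF F]]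
 interpret t: tens_ctx R CR "hcopy N" by (rule tens_ctxI[OF CR H(1)])
 interpret N': lmod S N' using N(2) by (simp add: lmod_iff)
 fix y assume y: "y \<in> car (tcopy (hcopy N))"
 then obtain t where t: "t \<in> car (tm (hcopy N))" "y = code (tm (hcopy N)) t" by (auto simp del: tensor_mod_simps)
 have Ft: "tmap (hcopy N') ?F t \<in> car (tm (hcopy N'))" by (rule linearD(1)[OF tF t(1)])
 have t': "t \<in> car (tens R CR (hcopy N))" using t by simp
 have a: "tmap (hcopy N') ?F \<in> ahom (tens R CR (hcopy N)) (tens R CR (hcopy N'))"
  "adjL (hcopy N') N' (counit_pairing N') \<in> ahom (tens R CR (hcopy N')) N'"
  "adjL (hcopy N) N (counit_pairing N) \<in> ahom (tens R CR (hcopy N)) N" "f \<in> ahom N N'"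
  using tF lhom_ahom[OF adjL_lhom[OF p(1)]] lhom_ahom[OF adjL_lhom[OF p(2)]] lhom_ahom[OF f]
  by (auto simp: linear_def ahom_def)
 have "adjL (hcopy N') N' (counit_pairing N') (tmap (hcopy N') ?F t) = f (adjL (hcopy N) N (counit_pairing N) t)"
 proof (rule t.tens_eqI[OF N'.abg_axioms ahom_comp[OF a(1,2)] ahom_comp[OF a(3,4)] _ t'])
  fix c y assume c: "c \<in> car CR" and y: "y \<in> car (hcopy N)"
  have c': "c \<in> car C" using c by simp
  obtain h where h: "h \<in> car (hm N)" "y = code (hm N) h" using y by (auto simp del: hom_mod_simps)
  have Fy: "?F y \<in> car (hcopy N')" by (rule lhom_closed[OF F y])
  have Fh: "?F y = code (hm N') (hmap f h)" unfolding h(2) by (rule copy_map_code[OF hm_props(2)[OF N(1)] h(1)])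
  have hf: "hmap f h \<in> car (hm N')" by (rule linearD(1)[OF hmap_linear[OF N f] h(1)])
  have "counit_pairing N' c (?F y) = hmap f h c"
   using Fy decode_code[OF hm_props(2)[OF N(2)] hf] by (simp add: counit_pairing_def Fh del: hom_mod_simps)
  moreover have "counit_pairing N c y = h c"
   using y decode_code[OF hm_props(2)[OF N(1)] h(1)] by (simp add: counit_pairing_def h(2) del: hom_mod_simps)
  ultimately show "adjL (hcopy N') N' (counit_pairing N') (tmap (hcopy N') ?F (pt R CR (hcopy N) c y)) =
    f (adjL (hcopy N) N (counit_pairing N) (pt R CR (hcopy N) c y))"
   unfolding tmap_pt[OF H lhom_linear[OF F] c' y] adjL_pt[OF p(1) c' y] adjL_pt[OF p(2) c' Fy] using c' by simp
 qed
 then show "compose (car (tcopy (hcopy N))) (counit_iso N') (copy_map (tm (hcopy N)) (tm (hcopy N')) (tmap (hcopy N') ?F)) y =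
   compose (car (tcopy (hcopy N))) f (counit_iso N) y"
  using y t(1) Ft unfolding compose_eq[OF y] unfolding t(2) copy_map_code[OF tm_props(2)[OF H(1)] t(1)]
  by (simp add: counit_iso_def compose_eq decode_code[OF tm_props(2)[OF H(1)] t(1)] decode_code[OF tm_props(2)[OF H(2)] Ft]
    del: tensor_mod_simps)
qed (simp_all add: compose_def)

text \<open>The unit is an isomorphism at every module in the Auslander class and the counit at
  every one in the Bass class. For a pair of subclasses it only remains that each functor maps one
  into the other.\<close>

lemma equivalence:
 fixes \<M> :: "('r, 'c) module set" and \<N> :: "('s, 'c) module set"
 assumes A: "\<And>M. M \<in> \<M> \<Longrightarrow> Aus M" and B: "\<And>N. N \<in> \<N> \<Longrightarrow> Bas N"
  and T: "\<And>M. M \<in> \<M> \<Longrightarrow> tcopy M \<in> \<N>" and H: "\<And>N. N \<in> \<N> \<Longrightarrow> hcopy N \<in> \<M>"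
 shows "restrict_to_equivalence S R C \<M> \<N>"
proof -
 have A': "\<And>M. M \<in> \<M> \<Longrightarrow> left_module R M" and B': "\<And>N. N \<in> \<N> \<Longrightarrow> left_module S N"
  using A B by (auto simp: Aus_def Bas_def)
 have "naturally_isomorphic (full_subcat R \<M>) (full_subcat R \<M>) id_functor (comp_functor (hom_functor S C) (tensor_functor R C))"
  unfolding naturally_isomorphic_def
 proof (intro exI[of _ unit_iso] conjI ballI)
  fix M assume "M \<in> Obj (full_subcat R \<M>)"
  then have M: "M \<in> \<M>" by simp
  show "unit_iso M \<in> cat_isos (full_subcat R \<M>) (fst id_functor M) (fst (comp_functor (hom_functor S C) (tensor_functor R C)) M)"
   using lisos_cat_isos[OF A'[OF M] A'[OF H[OF T[OF M]]] unit_iso(1)[OF A[OF M]], of \<M>]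
   by (simp add: id_functor_def comp_functor_def hom_functor_simps tensor_functor_simps)
  fix M' f assume "M' \<in> Obj (full_subcat R \<M>)" "f \<in> Arr (full_subcat R \<M>) M M'"
  then have M': "M' \<in> \<M>" and f: "f \<in> lhom R M M'" by simp_all
  show "Comp (full_subcat R \<M>) (fst id_functor M) (unit_iso M') (snd id_functor M M' f) =
    Comp (full_subcat R \<M>) (fst id_functor M) (snd (comp_functor (hom_functor S C) (tensor_functor R C)) M M' f) (unit_iso M)"
   using unit_iso_natural[OF A[OF M] A[OF M'] f]
   by (simp add: id_functor_def comp_functor_def hom_functor_simps tensor_functor_simps)
 qed
 moreover have "naturally_isomorphic (full_subcat S \<N>) (full_subcat S \<N>) (comp_functor (tensor_functor R C) (hom_functor S C)) id_functor"
  unfolding naturally_isomorphic_def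
 proof (intro exI[of _ counit_iso] conjI ballI)
  fix N assume "N \<in> Obj (full_subcat S \<N>)"
  then have N: "N \<in> \<N>" by simp
  show "counit_iso N \<in> cat_isos (full_subcat S \<N>) (fst (comp_functor (tensor_functor R C) (hom_functor S C)) N) (fst id_functor N)"
   using lisos_cat_isos[OF B'[OF T[OF H[OF N]]] B'[OF N] counit_iso(1)[OF B[OF N]], of \<N>]
   by (simp add: id_functor_def comp_functor_def hom_functor_simps tensor_functor_simps)
  fix N' f assume "N' \<in> Obj (full_subcat S \<N>)" "f \<in> Arr (full_subcat S \<N>) N N'"
  then have N': "N' \<in> \<N>" and f: "f \<in> lhom S N N'" by simp_all
  show "Comp (full_subcat S \<N>) (fst (comp_functor (tensor_functor R C) (hom_functor S C)) N) (counit_iso N')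
    (snd (comp_functor (tensor_functor R C) (hom_functor S C)) N N' f) =
    Comp (full_subcat S \<N>) (fst (comp_functor (tensor_functor R C) (hom_functor S C)) N) (snd id_functor N N' f) (counit_iso N)"
   using counit_iso_natural[OF B[OF N] B[OF N'] f]
   by (simp add: id_functor_def comp_functor_def hom_functor_simps tensor_functor_simps)
 qed
 ultimately show ?thesis
  unfolding restrict_to_equivalence_def quasi_inverse_equivalences_def
  using tensor_is_functor[OF A' T] hom_is_functor[OF B' H] by blast
qed

end

section \<open>The inclusions and the five pairs of classes\<close>

context fsd
begin

lemma ring_S: "ring S" and ring_R: "ring R"
 using CL.ring T.ring_R by auto

lemma CfpF_iff: "N \<in> CfpF S R C n \<longleftrightarrow> left_module S N \<and> (\<exists>Y :: ('r, 'c) module. Y \<in> fpF R n \<and> isomorphic S N (tm Y))"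
 by (auto simp: CfpF_def)

lemma CfpI_iff: "M \<in> CfpI S R C n \<longleftrightarrow> left_module R M \<and> (\<exists>X :: ('s, 'c) module. X \<in> fpI S n \<and> isomorphic R M (hm X))"
 by (auto simp: CfpI_def)

lemma fpF_module: "M \<in> fpF R n \<Longrightarrow> left_module R M" and fpI_module: "N \<in> fpI S n \<Longrightarrow> left_module S N"
 by (simp_all add: fpF_def fpI_def)

sublocale fpF: mod_class R "fpF R n :: ('r, 'c) module set" for n
 by (rule mod_class.intro[OF ring_R fpF_module fpF_iso zero_fpF])

sublocale fpI: mod_class S "fpI S n :: ('s, 'c) module set" for n
 by (rule mod_class.intro[OF ring_S fpI_module fpI_iso zero_fpI])

sublocale CfpF: mod_class S "CfpF S R C n" for n
proof (rule mod_class.intro)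
 show "M' \<in> CfpF S R C n" if "M \<in> CfpF S R C n" "left_module S M'" "isomorphic S M M'" for M M'
  using that isomorphic_trans[OF that(2) isomorphic_sym[OF _ that(2,3)]] unfolding CfpF_iff by blast
 fix Z :: "('s, 'c) module" assume Z: "left_module S Z" "car Z = {\<zero>\<^sub>Z}"
 let ?Y = "zero_mod undefined :: ('r, 'c) module"
 have Y: "left_module R ?Y" by (rule lm_zero_mod[OF ring_R])
 have "car (tm ?Y) = {\<zero>\<^bsub>tm ?Y\<^esub>}" using zero_tens[OF CR Y] by simp
 then have "isomorphic S Z (tm ?Y)" by (rule isomorphic_zero[OF Z tm_props(1)[OF Y]])
 then show "Z \<in> CfpF S R C n" unfolding CfpF_iff using Z zero_fpF[OF Y] by auto
qed (auto simp: CfpF_iff ring_S)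

sublocale CfpI: mod_class R "CfpI S R C n" for n
proof (rule mod_class.intro)
 show "M' \<in> CfpI S R C n" if "M \<in> CfpI S R C n" "left_module R M'" "isomorphic R M M'" for M M'
  using that isomorphic_trans[OF that(2) isomorphic_sym[OF _ that(2,3)]] unfolding CfpI_iff by blast
 fix Z :: "('r, 'c) module" assume Z: "left_module R Z" "car Z = {\<zero>\<^sub>Z}"
 let ?X = "zero_mod undefined :: ('s, 'c) module"
 have X: "left_module S ?X" by (rule lm_zero_mod[OF ring_S])
 have "car (hm ?X) = {\<zero>\<^bsub>hm ?X\<^esub>}" using zero_lhom[OF CL X] by simp
 then have "isomorphic R Z (hm ?X)" by (rule isomorphic_zero[OF Z hm_props(1)[OF X]])
 then show "Z \<in> CfpI S R C n" unfolding CfpI_iff using Z zero_fpI[OF X] by auto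
qed (auto simp: CfpI_iff ring_R)

lemma CfpF_Bas: "N \<in> CfpF S R C n \<Longrightarrow> Bas N"
 unfolding CfpF_iff using Bas_iso[OF Aus_tm[OF fpF_Aus]] isomorphic_sym tm_props(1) fpF_module by blast

lemma CfpI_Aus: "M \<in> CfpI S R C n \<Longrightarrow> Aus M"
 unfolding CfpI_iff using Aus_iso[OF Bas_hm[OF fpI_Bas]] isomorphic_sym hm_props(1) fpI_module by blast

text \<open>Resolutions are built by passing to cokernels of monomorphisms, coresolutions by passing
  to kernels of epimorphisms; here and in the next three lemmas the matching closure property is
  applied once per step.\<close>

lemma fpF_le_Aus: "M \<in> resolved_le R (fpF R n) k \<Longrightarrow> Aus M" for M :: "('r, 'c) module"
 by (erule fpF.resolved_induct) (auto intro: fpF_Aus Aus_cok)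

lemma CfpF_le_Bas: "N \<in> resolved_le S (CfpF S R C n) k \<Longrightarrow> Bas N"
 by (erule CfpF.resolved_induct) (auto intro: CfpF_Bas Bas_cok)

lemma CfpI_le_Aus: "M \<in> coresolved_le R (CfpI S R C n) k \<Longrightarrow> Aus M"
 by (erule CfpI.coresolved_induct) (auto intro: CfpI_Aus Aus_ker)

lemma fpI_le_Bas: "N \<in> coresolved_le S (fpI S n) k \<Longrightarrow> Bas N" for N :: "('s, 'c) module"
 by (erule fpI.coresolved_induct) (auto intro: fpI_Bas Bas_ker)

lemma isomorphic_tcopy: "left_module R M \<Longrightarrow> isomorphic S (tm M) (tcopy M)"
 by (rule isomorphic_copy[OF tm_props(1,2)])

lemma isomorphic_hcopy: "left_module S N \<Longrightarrow> isomorphic R (hm N) (hcopy N)"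
 by (rule isomorphic_copy[OF hm_props(1,2)])

lemma tcopy_fpF: 
 assumes M: "M \<in> fpF R n" shows "tcopy M \<in> CfpF S R C n"
 using M tm_props[OF fpF_module[OF M]] isomorphic_sym[OF _ _ isomorphic_tcopy[OF fpF_module[OF M]]]
 unfolding CfpF_iff by blast

lemma hcopy_fpI:
 assumes N: "N \<in> fpI S n" shows "hcopy N \<in> CfpI S R C n"
 using N hm_props[OF fpI_module[OF N]] isomorphic_sym[OF _ _ isomorphic_hcopy[OF fpI_module[OF N]]]
 unfolding CfpI_iff by blast

text \<open>For \<open>Y\<close> in the Auslander class \<open>Hom(C, C \<otimes> Y)\<close> is
  isomorphic to \<open>Y\<close>, and \<open>fpF\<close> is closed under isomorphism.\<close>

lemma hcopy_CfpF:
 assumes N: "N \<in> CfpF S R C n" shows "hcopy N \<in> fpF R n"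
proof -
 obtain Y :: "('r, 'c) module" where Y: "Y \<in> fpF R n" "isomorphic S N (tm Y)" and mN: "left_module S N" using N unfolding CfpF_iff by blast
 have "isomorphic R Y (hcopy N)"
  by (rule isomorphic_trans[OF fpF_module[OF Y(1)] isomorphic_hm_of_tm[OF fpF_Aus[OF Y(1)] mN Y(2)] isomorphic_hcopy[OF mN]])
 then show ?thesis by (rule fpF_iso[OF Y(1) hm_props(3)[OF mN]])
qed

lemma tcopy_CfpI:
 assumes M: "M \<in> CfpI S R C n" shows "tcopy M \<in> fpI S n"
proof -
 obtain X :: "('s, 'c) module" where X: "X \<in> fpI S n" "isomorphic R M (hm X)" and mM: "left_module R M" using M unfolding CfpI_iff by blast
 have "isomorphic S X (tcopy M)"
  using isomorphic_trans[OF fpI_module[OF X(1)] isomorphic_sym[OF tm_props(1)[OF mM] fpI_module[OF X(1)]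
    isomorphic_tm_of_hm[OF fpI_Bas[OF X(1)] mM X(2)]] isomorphic_tcopy[OF mM]] .
 then show ?thesis by (rule fpI_iso[OF X(1) tm_props(3)[OF mM]])
qed

text \<open>Tensoring keeps each short exact sequence of the resolution exact because its last term
  again has a finite resolution, hence lies in the Auslander class and has vanishing Tor_1.\<close>

lemma tcopy_fpF_le: "M \<in> resolved_le R (fpF R n) k \<Longrightarrow> tcopy M \<in> resolved_le S (CfpF S R C n) k"
proof (erule fpF.resolved_induct)
 show "tcopy M \<in> resolved_le S (CfpF S R C n) 0" if "M \<in> fpF R n" for M :: "('r, 'c) module"
  by (rule CfpF.sub_resolved[OF tcopy_fpF[OF that]])
 fix k f g and K F M :: "('r, 'c) module"
 assume s: "ses R K F M f g" "F \<in> fpF R n" "K \<in> resolved_le R (fpF R n) k" "tcopy K \<in> resolved_le S (CfpF S R C n) k"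
 then have "M \<in> resolved_le R (fpF R n) (Suc k)" unfolding resolved_le_Suc by blast
 then show "tcopy M \<in> resolved_le S (CfpF S R C n) (Suc k)"
  unfolding resolved_le_Suc[where R = S] using tcopy_ses[OF s(1) fpF_le_Aus] tcopy_fpF[OF s(2)] s(4) by blast
qed

text \<open>Here the kernel \<open>K\<close> has a finite resolution, hence lies in the Bass class,
  and the vanishing of Ext^1(C, K) keeps the sequence exact.\<close>

lemma hcopy_CfpF_le: "N \<in> resolved_le S (CfpF S R C n) k \<Longrightarrow> hcopy N \<in> resolved_le R (fpF R n) k"
proof (erule CfpF.resolved_induct)
 show "hcopy N \<in> resolved_le R (fpF R n) 0" if "N \<in> CfpF S R C n" for N :: "('s, 'c) module"
  by (rule fpF.sub_resolved[OF hcopy_CfpF[OF that]])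
 fix k f g and K F N :: "('s, 'c) module"
 assume s: "ses S K F N f g" "F \<in> CfpF S R C n" "K \<in> resolved_le S (CfpF S R C n) k" "hcopy K \<in> resolved_le R (fpF R n) k"
 then show "hcopy N \<in> resolved_le R (fpF R n) (Suc k)"
  unfolding resolved_le_Suc using hcopy_ses[OF s(1) CfpF_le_Bas[OF s(3)]] hcopy_CfpF[OF s(2)] by blast
qed

lemma tcopy_CfpI_le: "M \<in> coresolved_le R (CfpI S R C n) k \<Longrightarrow> tcopy M \<in> coresolved_le S (fpI S n) k"
proof (erule CfpI.coresolved_induct)
 show "tcopy M \<in> coresolved_le S (fpI S n) 0" if "M \<in> CfpI S R C n" for M :: "('r, 'c) module"
  by (rule fpI.sub_coresolved[OF tcopy_CfpI[OF that]])
 fix k f g and M I Z :: "('r, 'c) module"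
 assume s: "ses R M I Z f g" "I \<in> CfpI S R C n" "Z \<in> coresolved_le R (CfpI S R C n) k" "tcopy Z \<in> coresolved_le S (fpI S n) k"
 then show "tcopy M \<in> coresolved_le S (fpI S n) (Suc k)"
  unfolding coresolved_le_Suc using tcopy_ses[OF s(1) CfpI_le_Aus[OF s(3)]] tcopy_CfpI[OF s(2)] by blast
qed

lemma hcopy_fpI_le: "N \<in> coresolved_le S (fpI S n) k \<Longrightarrow> hcopy N \<in> coresolved_le R (CfpI S R C n) k"
proof (erule fpI.coresolved_induct)
 show "hcopy N \<in> coresolved_le R (CfpI S R C n) 0" if "N \<in> fpI S n" for N :: "('s, 'c) module"
  by (rule CfpI.sub_coresolved[OF hcopy_fpI[OF that]])
 fix k f g and N I Z :: "('s, 'c) module"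
 assume s: "ses S N I Z f g" "I \<in> fpI S n" "Z \<in> coresolved_le S (fpI S n) k" "hcopy Z \<in> coresolved_le R (CfpI S R C n) k"
 then have "N \<in> coresolved_le S (fpI S n) (Suc k)" unfolding coresolved_le_Suc by blast
 then show "hcopy N \<in> coresolved_le R (CfpI S R C n) (Suc k)"
  unfolding coresolved_le_Suc[where R = R] using hcopy_ses[OF s(1) fpI_le_Bas] hcopy_fpI[OF s(2)] s(4) by blast
qed

lemma tcopy_Aus: "Aus M \<Longrightarrow> Bas (tcopy M)"
 using Bas_iso[OF Aus_tm _ isomorphic_tcopy] tm_props(3) by (auto simp: Aus_def)

lemma hcopy_Bas: "Bas N \<Longrightarrow> Aus (hcopy N)"
 using Aus_iso[OF Bas_hm _ isomorphic_hcopy] hm_props(3) by (auto simp: Bas_def)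

end

text \<open>Free resolutions of \<open>C\<close> on both sides are fixed once and for all; the
  vanishing of Ext^i(C, C) becomes exactness of the coboundaries on powers of
  \<open>C\<close>.\<close>

lemma faithfully_semidualizing_fsd:
 fixes R :: "'r ring" and S :: "'s ring" and C :: "('s, 'r, 'u) bimodule"
 assumes inf: "infinite (UNIV :: 'u set)" and R: "car R \<lesssim> (UNIV :: 'u set)" and S: "car S \<lesssim> (UNIV :: 'u set)"
  and C: "faithfully_semidualizing S R C"
 shows "\<exists>m pL dL l pR dR. fsd S R C m pL dL l pR dR"
proof -
 have semi: "semidualizing S R C" using C by (simp add: faithfully_semidualizing_def)
 have bi: "is_bimodule S R C" and dL: "degreewise_fg S (left_mod C)" and dR: "degreewise_fg (op_ring R) (right_mod C)"
  using semi by (simp_all add: semidualizing_def)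
 have mL: "left_module S (left_mod C)" and mR: "left_module (op_ring R) (right_mod C)"
  using bi by (simp_all add: is_bimodule_def)
 obtain m pL dLL where L: "free_res S (left_mod C) m pL dLL" using FP_free_res[OF degreewise_fg_FP[OF dL]] by blast
 obtain l pR dRR where T: "free_res (op_ring R) (right_mod C) l pR dRR" using FP_free_res[OF degreewise_fg_FP[OF dR]] by blast
 have "fres.coexact S m dLL (left_mod C)" "fres.coexact (op_ring R) l dRR (right_mod C)"
  using fres.Ext_trivial_iff[OF fres.intro[OF L] dL mL] fres.Ext_trivial_iff[OF fres.intro[OF T] dR mR] semi
  by (simp_all add: semidualizing_def)
 then have "fsd S R C m pL dLL l pR dRR"
  using inf R S C semi bi L T
  by (intro fsd.intro faithful_semid.intro semid.intro bimod.intro fres.intro tres.intro fsd_axioms.intro faithful_semid_axioms.intro)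
   (simp_all add: faithfully_semidualizing_def semidualizing_def)
 then show ?thesis by blast
qed

theorem theorem3p8:
  fixes R :: "'r ring" and S :: "'s ring" and C :: "('s, 'r, 'u) bimodule" and n k :: nat
  assumes "infinite (UNIV :: 'u set)"
    and "carrier R \<lesssim> (UNIV :: 'u set)" and "carrier S \<lesssim> (UNIV :: 'u set)"
    and "ring R" and "ring S"
    and "faithfully_semidualizing S R C"
    and "n \<ge> 1"
  shows
    "(fpF R n :: ('r, 'u) module set) \<subseteq> resolved_le R (fpF R n) k \<and>
     (resolved_le R (fpF R n) k :: ('r, 'u) module set) \<subseteq> Auslander S R C \<and>

     CfpF S R C n \<subseteq> resolved_le S (CfpF S R C n) k \<and>
     resolved_le S (CfpF S R C n) k \<subseteq> Bass S R C \<and>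

     CfpI S R C n \<subseteq> coresolved_le R (CfpI S R C n) k \<and>
     coresolved_le R (CfpI S R C n) k \<subseteq> Auslander S R C \<and>

     (fpI S n :: ('s, 'u) module set) \<subseteq> coresolved_le S (fpI S n) k \<and>
     (coresolved_le S (fpI S n) k :: ('s, 'u) module set) \<subseteq> Bass S R C \<and>

     restrict_to_equivalence S R C (fpF R n) (CfpF S R C n) \<and>
     restrict_to_equivalence S R C (resolved_le R (fpF R n) k) (resolved_le S (CfpF S R C n) k) \<and>
     restrict_to_equivalence S R C (Auslander S R C) (Bass S R C) \<and>
     restrict_to_equivalence S R C (coresolved_le R (CfpI S R C n) k) (coresolved_le S (fpI S n) k) \<and>
     restrict_to_equivalence S R C (CfpI S R C n) (fpI S n)"
proof -
 obtain m pL dL l pR dR where "fsd S R C m pL dL l pR dR"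
  using faithfully_semidualizing_fsd[OF assms(1,2,3,6)] by blast
 then interpret fsd S R C m pL dL l pR dR .
 have fg: "degreewise_fg S CL" "degreewise_fg (op_ring R) CR"
  using assms(6) by (simp_all add: faithfully_semidualizing_def semidualizing_def)
 note Aus = Auslander_iff[OF fg] and Bas = Bass_iff[OF fg]
 note eqv = equivalence
 show ?thesis
 proof (intro conjI subsetI)
  show "restrict_to_equivalence S R C (fpF R n) (CfpF S R C n)"
   by (rule eqv[OF fpF_Aus CfpF_Bas tcopy_fpF hcopy_CfpF])
  show "restrict_to_equivalence S R C (resolved_le R (fpF R n) k) (resolved_le S (CfpF S R C n) k)"
   by (rule eqv[OF fpF_le_Aus CfpF_le_Bas tcopy_fpF_le hcopy_CfpF_le])
  show "restrict_to_equivalence S R C (Auslander S R C) (Bass S R C)"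
   by (rule eqv) (simp_all only: Aus Bas tcopy_Aus hcopy_Bas)
  show "restrict_to_equivalence S R C (coresolved_le R (CfpI S R C n) k) (coresolved_le S (fpI S n) k)"
   by (rule eqv[OF CfpI_le_Aus fpI_le_Bas tcopy_CfpI_le hcopy_fpI_le])
  show "restrict_to_equivalence S R C (CfpI S R C n) (fpI S n)"
   by (rule eqv[OF CfpI_Aus fpI_Bas tcopy_CfpI hcopy_fpI])
 qed (simp_all only: Aus Bas fpF_le_Aus CfpF_le_Bas CfpI_le_Aus fpI_le_Bas fpF.sub_resolved CfpF.sub_resolved
   CfpI.sub_coresolved fpI.sub_coresolved)
qed

end
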